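(* Let $p$ be an admissible symbol and $\Lambda_0$ an admissible IR-manifold such that $p_0=p|_{\Lambda_0}$ is real-valued, $dp_0\ne0$ on $p_0^{-1}(0)$, and $p_0^{-1}(0)\ne\emptyset$. Let $f=f_0\in C_b^\infty(\Lambda_0;\mathbf{R})$ be such that for every $\rho\in M:=p_0^{-1}(0)$ with $(H_{p_0}f)(\rho)=0$, the differential at $\rho$ of the restriction $(H_{p_0}f)|_M$ is $\ne0$. Put $\widetilde p_0=p_0-iH_{p_0}f$ and $\Sigma_0=\{\rho\in\Lambda_0;\ p_0(\rho)=0,\ H_{p_0}f(\rho)=0\}$. Assume that there is a point $\rho_0\in\Sigma_0$ where $\frac i2\{\widetilde p_0,\overline{\widetilde p_0}\}=-H_{p_0}^2f\ne0$. Then $$2\pi\int_{\Sigma_0}f_0\,\frac i2\{\widetilde p_0,\overline{\widetilde p_0}\}\,\lambda_{\widetilde p_0=0}(d\rho)>0.$$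
   Context: Admissible symbols and manifolds. $\sigma=\sum_1^n d\xi_j\wedge dx_j$ on $\mathbf{C}^{2n}$. An IR-manifold is a smooth submanifold of $\mathbf{C}^{2n}$ of real dimension $2n$ on which $\sigma$ is real and non-degenerate. Let $\Phi_0$ be a strictly plurisubharmonic real quadratic form on $\mathbf{C}^n$; for real $\Psi$ put $\Lambda_\Psi=\{(x,\frac2i\partial_x\Psi(x));x\in\mathbf{C}^n\}$ ($\partial_x$, $\partial_{\overline x}$ denote holomorphic and antiholomorphic derivatives). Let $\widetilde W\subset\subset W$ be bounded open neighborhoods of $0$ in $\Lambda_{\Phi_0}$. An admissible symbol is a function $p$ holomorphic in $\Lambda_{\Phi_0}+iW$ with $p(x,\xi)-1=\mathcal{O}(\langle(x,\xi)\rangle^m)$ for some $m<-2n$. An admissible IR-manifold is an IR-manifold $\Lambda\subset\Lambda_{\Phi_0}+i\widetilde W$ that is closed, diffeomorphic to $\mathbf{R}^{2n}$, and such that outside a bounded set $\Lambda=\Lambda_\Psi$ with $\Psi-\Phi_0\in C_b^\infty$ (bounded with all derivatives) and $(\partial_{\overline x}\partial_x\Psi)^{-1}=\mathcal{O}(1)$. Near infinity $\Lambda$ is identified with a neighborhood of infinity in $\mathbf{C}^n$ via $x\mapsto(x,\frac2i\partial_x\Psi(x))$; this defines $C_b^\infty(\Lambda)$. Hamilton fields and Poisson brackets on $\Lambda_0$ are with respect to $\sigma|_{\Lambda_0}$: $\sigma(H_f,t)=-\langle df,t\rangle$, i.e. $H_f=\sum\partial_{\xi_j}f\,\partial_{x_j}-\partial_{x_j}f\,\partial_{\xi_j}$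 in symplectic coordinates, and $\{f,g\}=H_f(g)$. The set $\Sigma_0=\widetilde p_0^{-1}(0)$ is a compact smooth submanifold of codimension $2$ of $\Lambda_0$, and $\lambda_{\widetilde p_0=0}$ is its Liouville measure: the positive density given by the $(2n-2)$-form $\lambda$ on $\Sigma_0$ with $\lambda\wedge\frac i2d\widetilde p_0\wedge d\overline{\widetilde p_0}=\sigma^n/n!$ ($\Sigma_0$ being oriented so that $\lambda>0$). *)

theory Defs
  imports "HOL-Analysis.Analysis" "HOL-Combinatorics.Permutations"
begin

section \<open>Smooth functions on open sets\<close>

primrec iter_deriv ::
  "'a::real_normed_vector list \<Rightarrow> ('a \<Rightarrow> 'b::real_normed_vector) \<Rightarrow> 'a \<Rightarrow> 'b" where
  "iter_deriv [] f = f"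
| "iter_deriv (v # vs) f = (\<lambda>x. frechet_derivative (iter_deriv vs f) (at x) v)"

text \<open>Both notions below are meant for open sets \<open>U\<close>. Differentiability of all iterated
  directional derivatives also gives their continuity, so \<open>smooth_on\<close> is \<open>C\<^sup>\<infinity>\<close>.\<close>

definition smooth_on :: "'a::real_normed_vector set \<Rightarrow> ('a \<Rightarrow> 'b::real_normed_vector) \<Rightarrow> bool" where
  "smooth_on U f \<longleftrightarrow> (\<forall>vs. \<forall>x\<in>U. iter_deriv vs f differentiable (at x))"

definition Cb_infinity_on :: "'a::real_normed_vector set \<Rightarrow> ('a \<Rightarrow> 'b::real_normed_vector) \<Rightarrow> bool" where
  "Cb_infinity_on U f \<longleftrightarrow> smooth_on U f \<and> (\<forall>vs. \<exists>C. \<forall>x\<in>U. norm (iter_deriv vs f x) \<le> C)"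


section \<open>Embedded submanifolds of a Euclidean space\<close>

text \<open>A slice chart: \<open>\<psi>\<close> is a diffeomorphism of an open set \<open>W\<close> of the ambient space onto an open
  set, carrying the part of the \<open>k\<close>-plane spanned by \<open>e 0, \<dots>, e (k-1)\<close> in \<open>W\<close> onto the part of
  \<open>S\<close> in the image. Working in the ambient space allows \<open>k\<close> to be a natural number
  (possibly 0) rather than a type.\<close>

definition slice_chart ::
  "nat \<Rightarrow> 'a::euclidean_space set \<Rightarrow> (nat \<Rightarrow> 'a) \<Rightarrow> 'a set \<Rightarrow> ('a \<Rightarrow> 'a) \<Rightarrow> bool" where
  "slice_chart k S e W \<psi> \<longleftrightarrow>
     inj_on e {..<k} \<and> independent (e ` {..<k}) \<and>
     open W \<and> open (\<psi> ` W) \<and> inj_on \<psi> W \<and>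
     smooth_on W \<psi> \<and> smooth_on (\<psi> ` W) (inv_into W \<psi>) \<and>
     \<psi> ` (W \<inter> span (e ` {..<k})) = S \<inter> \<psi> ` W"

definition smooth_submanifold :: "nat \<Rightarrow> 'a::euclidean_space set \<Rightarrow> bool" where
  "smooth_submanifold k S \<longleftrightarrow> (\<forall>\<rho>\<in>S. \<exists>e W \<psi>. slice_chart k S e W \<psi> \<and> \<rho> \<in> \<psi> ` W)"

definition smooth_function_on_subset ::
  "'a::euclidean_space set \<Rightarrow> ('a \<Rightarrow> 'b::real_normed_vector) \<Rightarrow> bool" where
  "smooth_function_on_subset S f \<longleftrightarrow>
     (\<forall>\<rho>\<in>S. \<exists>U F. open U \<and> \<rho> \<in> U \<and> smooth_on U F \<and> (\<forall>z\<in>S \<inter> U. F z = f z))"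

definition curve_through :: "'a::euclidean_space set \<Rightarrow> 'a \<Rightarrow> 'a \<Rightarrow> (real \<Rightarrow> 'a) \<Rightarrow> bool" where
  "curve_through S \<rho> v \<gamma> \<longleftrightarrow>
     (\<exists>\<epsilon>>0. smooth_on {-\<epsilon><..<\<epsilon>} \<gamma> \<and> \<gamma> ` {-\<epsilon><..<\<epsilon>} \<subseteq> S) \<and>
     \<gamma> 0 = \<rho> \<and> (\<gamma> has_vector_derivative v) (at 0)"

definition tangent_space :: "'a::euclidean_space set \<Rightarrow> 'a \<Rightarrow> 'a set" where
  "tangent_space S \<rho> = {v. \<exists>\<gamma>. curve_through S \<rho> v \<gamma>}"

text \<open>The differential of \<open>f|S\<close> at \<open>\<rho>\<close>, applied to a tangent vector \<open>v\<close>. It depends only on the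
  values of \<open>f\<close> on \<open>S\<close>.\<close>

definition differential_on ::
  "'a::euclidean_space set \<Rightarrow> ('a \<Rightarrow> 'b::real_normed_vector) \<Rightarrow> 'a \<Rightarrow> 'a \<Rightarrow> 'b" where
  "differential_on S f \<rho> v =
     (THE w. \<forall>\<gamma>. curve_through S \<rho> v \<gamma> \<longrightarrow> ((\<lambda>t. f (\<gamma> t)) has_vector_derivative w) (at 0))"

text \<open>A density \<open>\<delta>\<close> on the \<open>k\<close>-dimensional submanifold \<open>S\<close> assigns to a point and \<open>k\<close> tangent
  vectors (indices \<open>0, \<dots>, k-1\<close>) a nonnegative number. The associated measure, regarded as a Borel
  measure on the ambient space concentrated on \<open>S\<close>, is the one given in every local
  parametrization \<open>y \<mapsto> \<psi> (\<Sum>i<k. y i *\<^sub>R e i)\<close> by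
  \<open>\<delta> (\<partial>\<psi>/\<partial>y\<^sub>0, \<dots>, \<partial>\<psi>/\<partial>y\<^sub>k\<^sub>-\<^sub>1) dy\<close>. For \<open>k = 0\<close> the parameter space is a point of
  mass 1.\<close>

definition is_density_measure ::
  "nat \<Rightarrow> 'a::euclidean_space set \<Rightarrow> ('a \<Rightarrow> (nat \<Rightarrow> 'a) \<Rightarrow> real) \<Rightarrow> 'a measure \<Rightarrow> bool" where
  "is_density_measure k S \<delta> \<mu> \<longleftrightarrow>
     sets \<mu> = sets borel \<and>
     (UNIV - S) \<in> null_sets \<mu> \<and>
     (\<forall>e W \<psi>. slice_chart k S e W \<psi> \<longrightarrow>
       (\<forall>A\<in>sets borel. A \<subseteq> S \<inter> \<psi> ` W \<longrightarrow>
         emeasure \<mu> A =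
           (\<integral>\<^sup>+y. (let x = (\<Sum>i<k. y i *\<^sub>R e i) in
                  ennreal (\<delta> (\<psi> x) (\<lambda>i. frechet_derivative \<psi> (at x) (e i)))
                    * indicator {x \<in> W. \<psi> x \<in> A} x)
              \<partial>(PiM {..<k} (\<lambda>_. lborel)))))"

definition density_measure ::
  "nat \<Rightarrow> 'a::euclidean_space set \<Rightarrow> ('a \<Rightarrow> (nat \<Rightarrow> 'a) \<Rightarrow> real) \<Rightarrow> 'a measure" where
  "density_measure k S \<delta> = (THE \<mu>. is_density_measure k S \<delta> \<mu>)"


section \<open>Alternating forms\<close>

text \<open>A \<open>k\<close>-form on a real subspace \<open>T\<close> takes a sequence of vectors, of which only the entries
  \<open>0, \<dots>, k-1\<close> matter. Wedge products are normalised by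
  \<open>(\<alpha> \<and> \<beta>)(u, v) = \<alpha> u * \<beta> v - \<alpha> v * \<beta> u\<close> for 1-forms.\<close>

definition alternating_form ::
  "nat \<Rightarrow> 'a::real_vector set \<Rightarrow> ((nat \<Rightarrow> 'a) \<Rightarrow> complex) \<Rightarrow> bool" where
  "alternating_form k T \<alpha> \<longleftrightarrow>
     (\<forall>v w. (\<forall>i<k. v i = w i) \<longrightarrow> \<alpha> v = \<alpha> w) \<and>
     (\<forall>v i x y a b. (\<forall>j<k. v j \<in> T) \<and> i < k \<and> x \<in> T \<and> y \<in> T \<longrightarrow>
        \<alpha> (v(i := a *\<^sub>R x + b *\<^sub>R y)) =
          complex_of_real a * \<alpha> (v(i := x)) + complex_of_real b * \<alpha> (v(i := y))) \<and>
     (\<forall>v i j. (\<forall>l<k. v l \<in> T) \<and> i < k \<and> j < k \<and> i \<noteq> j \<and> v i = v j \<longrightarrow> \<alpha> v = 0)"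

definition wedge ::
  "nat \<Rightarrow> nat \<Rightarrow> ((nat \<Rightarrow> 'a) \<Rightarrow> complex) \<Rightarrow> ((nat \<Rightarrow> 'a) \<Rightarrow> complex) \<Rightarrow> (nat \<Rightarrow> 'a) \<Rightarrow> complex" where
  "wedge k l \<alpha> \<beta> v =
     (\<Sum>\<pi> | \<pi> permutes {..<k + l}.
        of_int (sign \<pi>) * \<alpha> (\<lambda>i. v (\<pi> i)) * \<beta> (\<lambda>i. v (\<pi> (k + i)))) / (fact k * fact l)"


section \<open>Complex phase space\<close>

text \<open>Points of \<open>\<complex>\<^sup>2\<^sup>n\<close> are pairs \<open>(x, \<xi>)\<close>, where \<open>n = CARD('n)\<close>.\<close>

type_synonym 'n phase = "(complex^'n) \<times> (complex^'n)"

definition cscale :: "complex \<Rightarrow> 'n::finite phase \<Rightarrow> 'n phase" where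
  "cscale c \<rho> = (c *s fst \<rho>, c *s snd \<rho>)"

text \<open>\<open>\<sigma> = \<Sum> d\<xi>\<^sub>j \<and> dx\<^sub>j\<close>, complex bilinear.\<close>

definition sigma :: "'n::finite phase \<Rightarrow> 'n phase \<Rightarrow> complex" where
  "sigma s t = (\<Sum>j\<in>UNIV. snd s $ j * fst t $ j - snd t $ j * fst s $ j)"

text \<open>\<open>\<sigma>\<^sup>m\<close> (a \<open>2m\<close>-form).\<close>

primrec sigma_power :: "nat \<Rightarrow> (nat \<Rightarrow> 'n::finite phase) \<Rightarrow> complex" where
  "sigma_power 0 = (\<lambda>v. 1)"
| "sigma_power (Suc m) = wedge (2 * m) 2 (sigma_power m) (\<lambda>v. sigma (v 0) (v 1))"

definition IR_manifold :: "'n::finite phase set \<Rightarrow> bool" where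
  "IR_manifold \<Lambda> \<longleftrightarrow>
     smooth_submanifold (2 * CARD('n)) \<Lambda> \<and>
     (\<forall>\<rho>\<in>\<Lambda>. \<forall>s\<in>tangent_space \<Lambda> \<rho>. \<forall>t\<in>tangent_space \<Lambda> \<rho>. sigma s t \<in> \<real>) \<and>
     (\<forall>\<rho>\<in>\<Lambda>. \<forall>s\<in>tangent_space \<Lambda> \<rho>. (\<forall>t\<in>tangent_space \<Lambda> \<rho>. sigma s t = 0) \<longrightarrow> s = 0)"

text \<open>Holomorphic functions of several variables on an open set: differentiable with complex linear
  differential.\<close>

definition phase_holomorphic_on :: "('n::finite phase \<Rightarrow> complex) \<Rightarrow> 'n phase set \<Rightarrow> bool" where
  "phase_holomorphic_on p \<Omega> \<longleftrightarrow>
     (\<forall>\<rho>\<in>\<Omega>. \<exists>D. (p has_derivative D) (at \<rho>) \<and> (\<forall>c v. D (cscale c v) = c * D v))"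


section \<open>Weights and the associated manifolds\<close>

text \<open>Wirtinger derivatives, in terms of the real differential.\<close>

definition d_hol :: "'n::finite \<Rightarrow> (complex^'n \<Rightarrow> complex) \<Rightarrow> complex^'n \<Rightarrow> complex" where
  "d_hol j F x = (frechet_derivative F (at x) (axis j 1)
                  - \<i> * frechet_derivative F (at x) (axis j \<i>)) / 2"

definition d_antihol :: "'n::finite \<Rightarrow> (complex^'n \<Rightarrow> complex) \<Rightarrow> complex^'n \<Rightarrow> complex" where
  "d_antihol j F x = (frechet_derivative F (at x) (axis j 1)
                      + \<i> * frechet_derivative F (at x) (axis j \<i>)) / 2"

definition levi_matrix :: "(complex^'n::finite \<Rightarrow> real) \<Rightarrow> complex^'n \<Rightarrow> complex^'n^'n" where
  "levi_matrix \<Psi> x = (\<chi> j k. d_antihol j (d_hol k (\<lambda>y. complex_of_real (\<Psi> y))) x)"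

definition real_quadratic_form :: "(complex^'n::finite \<Rightarrow> real) \<Rightarrow> bool" where
  "real_quadratic_form \<Phi> \<longleftrightarrow> (\<exists>B. bilinear B \<and> (\<forall>x. \<Phi> x = B x x))"

text \<open>The Levi form of a real \<open>C\<^sup>2\<close> function is real valued.\<close>

definition strictly_psh :: "(complex^'n::finite \<Rightarrow> real) \<Rightarrow> bool" where
  "strictly_psh \<Phi> \<longleftrightarrow>
     (\<forall>x z. z \<noteq> 0 \<longrightarrow> Re (\<Sum>j\<in>UNIV. \<Sum>k\<in>UNIV. levi_matrix \<Phi> x $ j $ k * cnj (z $ j) * z $ k) > 0)"

definition weight_graph :: "(complex^'n::finite \<Rightarrow> real) \<Rightarrow> complex^'n \<Rightarrow> 'n phase" where
  "weight_graph \<Psi> x = (x, \<chi> j. 2 / \<i> * d_hol j (\<lambda>y. complex_of_real (\<Psi> y)) x)"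

definition Lambda :: "(complex^'n::finite \<Rightarrow> real) \<Rightarrow> 'n phase set" where
  "Lambda \<Psi> = range (weight_graph \<Psi>)"

definition tube :: "(complex^'n::finite \<Rightarrow> real) \<Rightarrow> 'n phase set \<Rightarrow> 'n phase set" where
  "tube \<Phi>\<^sub>0 W = {\<rho> + cscale \<i> w |\<rho> w. \<rho> \<in> Lambda \<Phi>\<^sub>0 \<and> w \<in> W}"

definition bounded_open_nbhd :: "(complex^'n::finite \<Rightarrow> real) \<Rightarrow> 'n phase set \<Rightarrow> bool" where
  "bounded_open_nbhd \<Phi>\<^sub>0 W \<longleftrightarrow>
     openin (top_of_set (Lambda \<Phi>\<^sub>0)) W \<and> bounded W \<and> 0 \<in> W"

definition admissible_symbol ::
  "(complex^'n::finite \<Rightarrow> real) \<Rightarrow> 'n phase set \<Rightarrow> ('n phase \<Rightarrow> complex) \<Rightarrow> bool" where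
  "admissible_symbol \<Phi>\<^sub>0 W p \<longleftrightarrow>
     phase_holomorphic_on p (tube \<Phi>\<^sub>0 W) \<and>
     (\<exists>m::real. m < - 2 * real CARD('n) \<and>
       (\<exists>C. \<forall>\<rho>\<in>tube \<Phi>\<^sub>0 W. norm (p \<rho> - 1) \<le> C * sqrt (1 + (norm \<rho>)\<^sup>2) powr m))"

text \<open>\<open>\<Psi>\<close> is a weight describing \<open>\<Lambda>\<close> near infinity; it carries no information over bounded sets, so
  the Levi matrix is only controlled near infinity.\<close>

definition weight_at_infinity ::
  "(complex^'n::finite \<Rightarrow> real) \<Rightarrow> 'n phase set \<Rightarrow> (complex^'n \<Rightarrow> real) \<Rightarrow> bool" where
  "weight_at_infinity \<Phi>\<^sub>0 \<Lambda> \<Psi> \<longleftrightarrow>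
     Cb_infinity_on UNIV (\<lambda>x. \<Psi> x - \<Phi>\<^sub>0 x) \<and>
     (\<exists>B. bounded B \<and> \<Lambda> - B = Lambda \<Psi> - B) \<and>
     (\<exists>R C. \<forall>x. norm x > R \<longrightarrow>
        invertible (levi_matrix \<Psi> x) \<and> norm (matrix_inv (levi_matrix \<Psi> x)) \<le> C)"

text \<open>\<open>(real^'n) \<times> (real^'n)\<close> is \<open>\<real>\<^sup>2\<^sup>n\<close>.\<close>

definition diffeomorphic_to_R2n :: "'n::finite phase set \<Rightarrow> bool" where
  "diffeomorphic_to_R2n \<Lambda> \<longleftrightarrow>
     (\<exists>g :: (real^'n) \<times> (real^'n) \<Rightarrow> 'n phase.
        smooth_on UNIV g \<and> inj g \<and> range g = \<Lambda> \<and> smooth_function_on_subset \<Lambda> (inv g))"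

definition admissible_IR_manifold ::
  "(complex^'n::finite \<Rightarrow> real) \<Rightarrow> 'n phase set \<Rightarrow> 'n phase set \<Rightarrow> bool" where
  "admissible_IR_manifold \<Phi>\<^sub>0 Wt \<Lambda> \<longleftrightarrow>
     IR_manifold \<Lambda> \<and> \<Lambda> \<subseteq> tube \<Phi>\<^sub>0 Wt \<and> closed \<Lambda> \<and> diffeomorphic_to_R2n \<Lambda> \<and>
     (\<exists>\<Psi>. weight_at_infinity \<Phi>\<^sub>0 \<Lambda> \<Psi>)"

text \<open>\<open>C\<^sub>b\<^sup>\<infinity>(\<Lambda>)\<close>: smooth on \<open>\<Lambda>\<close>, with bounded derivatives in the coordinate \<open>x\<close> near infinity.\<close>

definition Cb_infinity_IR ::
  "(complex^'n::finite \<Rightarrow> real) \<Rightarrow> 'n phase set \<Rightarrow> ('n phase \<Rightarrow> real) \<Rightarrow> bool" where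
  "Cb_infinity_IR \<Phi>\<^sub>0 \<Lambda> f \<longleftrightarrow>
     smooth_function_on_subset \<Lambda> f \<and>
     (\<exists>\<Psi>. weight_at_infinity \<Phi>\<^sub>0 \<Lambda> \<Psi> \<and>
        (\<exists>R. Cb_infinity_on {x. norm x > R} (\<lambda>x. f (weight_graph \<Psi> x))))"


section \<open>Hamilton fields, Poisson brackets and the Liouville measure on an IR-manifold\<close>

definition hamilton_field ::
  "'n::finite phase set \<Rightarrow> ('n phase \<Rightarrow> real) \<Rightarrow> 'n phase \<Rightarrow> 'n phase" where
  "hamilton_field \<Lambda> g \<rho> =
     (THE v. v \<in> tangent_space \<Lambda> \<rho> \<and>
        (\<forall>t\<in>tangent_space \<Lambda> \<rho>. sigma v t = - complex_of_real (differential_on \<Lambda> g \<rho> t)))"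

definition hamilton_derivative ::
  "'n::finite phase set \<Rightarrow> ('n phase \<Rightarrow> real) \<Rightarrow> ('n phase \<Rightarrow> 'b::real_normed_vector) \<Rightarrow> 'n phase \<Rightarrow> 'b" where
  "hamilton_derivative \<Lambda> g h \<rho> = differential_on \<Lambda> h \<rho> (hamilton_field \<Lambda> g \<rho>)"

text \<open>The Poisson bracket of complex valued functions: \<open>H\<^sub>g\<close> depends complex linearly on \<open>g\<close>.\<close>

definition poisson_bracket ::
  "'n::finite phase set \<Rightarrow> ('n phase \<Rightarrow> complex) \<Rightarrow> ('n phase \<Rightarrow> complex) \<Rightarrow> 'n phase \<Rightarrow> complex" where
  "poisson_bracket \<Lambda> g h \<rho> =
     hamilton_derivative \<Lambda> (\<lambda>z. Re (g z)) h \<rho> + \<i> * hamilton_derivative \<Lambda> (\<lambda>z. Im (g z)) h \<rho>"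

text \<open>For \<open>\<rho>\<close> in the zero set of \<open>q\<close> and vectors \<open>v 0, \<dots>, v (2n-3)\<close> tangent to the zero set, this is
  \<open>|L v|\<close> for any \<open>(2n-2)\<close>-form \<open>L\<close> on the tangent space of \<open>\<Lambda>\<close> with
  \<open>L \<and> (\<i>/2) dq \<and> d(cnj q) = \<sigma>\<^sup>n/n!\<close>. Such \<open>L\<close> all have the same restriction to the tangent space of
  the zero set; the absolute value is \<open>L\<close> itself for the orientation making \<open>L\<close> positive.\<close>

definition liouville_density ::
  "'n::finite phase set \<Rightarrow> ('n phase \<Rightarrow> complex) \<Rightarrow> 'n phase \<Rightarrow> (nat \<Rightarrow> 'n phase) \<Rightarrow> real" where
  "liouville_density \<Lambda> q \<rho> v =
     (THE c. \<exists>L. alternating_form (2 * CARD('n) - 2) (tangent_space \<Lambda> \<rho>) L \<and>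
        (\<forall>w. (\<forall>i<2 * CARD('n). w i \<in> tangent_space \<Lambda> \<rho>) \<longrightarrow>
           wedge (2 * CARD('n) - 2) 2 L
             (\<lambda>u. \<i> / 2 * wedge 1 1 (\<lambda>s. differential_on \<Lambda> q \<rho> (s 0))
                                    (\<lambda>s. differential_on \<Lambda> (\<lambda>z. cnj (q z)) \<rho> (s 0)) u) w
           = sigma_power (CARD('n)) w / fact (CARD('n))) \<and>
        c = norm (L v))"

definition liouville_measure ::
  "'n::finite phase set \<Rightarrow> ('n phase \<Rightarrow> complex) \<Rightarrow> 'n phase measure" where
  "liouville_measure \<Lambda> q =
     density_measure (2 * CARD('n) - 2) {\<rho> \<in> \<Lambda>. q \<rho> = 0} (liouville_density \<Lambda> q)"

end

theory Submission
  imports Defs "HOL-Complex_Analysis.Complex_Analysis"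
begin

text \<open>Choose a global parametrization \<open>g\<close> of \<open>\<Lambda>\<^sub>0\<close> and put \<open>P = p\<^sub>0 \<circ> g\<close>, \<open>Q = (H\<^bsub>p\<^sub>0\<^esub> f) \<circ> g\<close>.
  If \<open>\<chi>\<^sub>m\<close> is an approximate identity on the line, the Liouville measure of \<open>P = Q = 0\<close> is the limit of the
  densities \<open>\<chi>\<^sub>m(P) \<chi>\<^sub>m(Q) |\<sigma>\<^sup>n/n!|\<close>. Let \<open>X\<^sub>m\<close> be the odd primitive of \<open>\<chi>\<^sub>m\<close>. The field \<open>H\<^bsub>p\<^sub>0\<^esub>\<close> is
  divergence free (Liouville) and annihilates \<open>P\<close>, so an integration by parts turns
  \<open>\<integral> \<chi>\<^sub>m(P) \<chi>\<^sub>m(Q) f (- H\<^bsub>p\<^sub>0\<^esub> Q)\<close> into \<open>\<integral> \<chi>\<^sub>m(P) X\<^sub>m(Q) H\<^bsub>p\<^sub>0\<^esub> f = \<integral> \<chi>\<^sub>m(P) X\<^sub>m(Q) Q\<close>. Here \<open>X\<^sub>m(Q) Q \<ge> 0\<close> tends to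
  \<open>|Q|/2\<close>, and \<open>Q\<close> does not vanish identically on \<open>M\<close>, because its differential along \<open>M\<close> is non-zero at its
  zeros.\<close>

section \<open>Finite differentiability classes\<close>

text \<open>\<open>liouville_measure\<close> is a definite description, so before it can be
  integrated against there must be one measure, and only one, with the prescribed values in every
  slice chart. The tube integrals settle this too. They do not mention charts, so measures computed
  in different charts agree because they are limits of the same integrals. Compactness comes from p
  tending to 1 at infinity: \<bar>P\<bar> \<le> 1/2 confines the point to a bounded closed part of
  the manifold, and there all integrands live once the kernels are narrow. A limit of nonnegative
  numbers might still be 0. It is kept away from 0 by the mass that \<chi>_m(P) retains near one
  point of M with Q \<noteq> 0. The kernel has only finitely many derivatives, while the manifold
  data have all of them; hence regularity is counted by classes \<open>Ck\<close>, and
  \<open>smooth_on\<close> is reserved for the places where the definitions demand it.\<close>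

primrec Ck :: "nat \<Rightarrow> 'a::real_normed_vector set \<Rightarrow> ('a \<Rightarrow> 'b::real_normed_vector) \<Rightarrow> bool" where
  "Ck 0 U f \<longleftrightarrow> continuous_on U f"
| "Ck (Suc k) U f \<longleftrightarrow> (\<forall>x\<in>U. f differentiable at x) \<and>
     (\<forall>v. Ck k U (\<lambda>x. frechet_derivative f (at x) v))"

abbreviation Cinf :: "'a::real_normed_vector set \<Rightarrow> ('a \<Rightarrow> 'b::real_normed_vector) \<Rightarrow> bool" where
  "Cinf U f \<equiv> \<forall>k. Ck k U f"

text \<open>U has to be open because a Frechet derivative at x depends on the values of f in a whole
  neighbourhood of x.\<close>

lemma Ck_cong:
  assumes "open U" "Ck k U f" "\<And>x. x \<in> U \<Longrightarrow> f x = g x"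
  shows "Ck k U g"
  using assms(2,3)
proof (induction k arbitrary: f g)
  case 0
  then show ?case using continuous_on_cong by force
next
  case (Suc k)
  have d: "f differentiable at x" if "x \<in> U" for x using Suc.prems that by auto
  have "g differentiable at x" if "x \<in> U" for x
    using d[OF that] Suc.prems(2) assms(1) that unfolding differentiable_def
    by (meson has_derivative_transform_within_open)
  moreover have "Ck k U (\<lambda>x. frechet_derivative g (at x) v)" for v
  proof (rule Suc.IH[of "\<lambda>x. frechet_derivative f (at x) v"])
    show "Ck k U (\<lambda>x. frechet_derivative f (at x) v)" using Suc.prems by auto
    show "frechet_derivative f (at x) v = frechet_derivative g (at x) v" if "x \<in> U" for x
      using frechet_derivative_transform_within_open[OF d[OF that] assms(1) that] Suc.prems(2) by metis
  qed
  ultimately show ?case by auto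
qed

text \<open>The derivative may be given by any formula instead of the chosen
  \<open>frechet_derivative\<close>. The closure rules below all follow this pattern: name the
  derivative, evaluate it in a fixed direction v, and apply the induction hypothesis. Fixing v keeps
  the values in the same space, so the induction never meets operator-valued maps.\<close>

lemma Ck_SucI:
  assumes "open U" "\<And>x. x \<in> U \<Longrightarrow> (f has_derivative f' x) (at x)" "\<And>v. Ck k U (\<lambda>x. f' x v)"
  shows "Ck (Suc k) U f"
proof -
  have "Ck k U (\<lambda>x. frechet_derivative f (at x) v)" for v
    by (rule Ck_cong[OF assms(1) assms(3)[of v]]) (metis assms(2) frechet_derivative_at)
  then show ?thesis using assms(2) by (auto simp: differentiable_def)
qed

lemma Ck_subset:
  assumes "Ck k U f" "V \<subseteq> U" shows "Ck k V f"
  using assms(1)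
proof (induction k arbitrary: f)
  case 0
  then show ?case using assms(2) continuous_on_subset by auto
next
  case (Suc k)
  then show ?case using assms(2) by auto
qed

lemma Ck_continuous_on: "Ck k U f \<Longrightarrow> continuous_on U f"
  by (cases k) (auto intro!: continuous_at_imp_continuous_on differentiable_imp_continuous_within)

lemma Ck_Suc_imp: "Ck (Suc k) U f \<Longrightarrow> Ck k U f"
proof (induction k arbitrary: f)
  case 0
  then show ?case using Ck_continuous_on[of "Suc 0"] by auto
next
  case (Suc k)
  show ?case using Suc.prems Suc.IH by auto
qed

lemma Ck_has_derivative:
  "Ck (Suc k) U f \<Longrightarrow> x \<in> U \<Longrightarrow> (f has_derivative frechet_derivative f (at x)) (at x)"
  by (auto simp: frechet_derivative_works[symmetric])

lemma Ck_frechet: "Ck (Suc k) U f \<Longrightarrow> Ck k U (\<lambda>x. frechet_derivative f (at x) v)"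
  by auto

lemma Ck_local:
  assumes "\<And>x. x \<in> U \<Longrightarrow> \<exists>V. open V \<and> x \<in> V \<and> Ck k V f"
  shows "Ck k U f"
  using assms
proof (induction k arbitrary: f)
  case 0
  then show ?case
    by (metis Ck.simps(1) continuous_at_imp_continuous_on continuous_on_eq_continuous_at)
next
  case (Suc k)
  have "Ck k U (\<lambda>x. frechet_derivative f (at x) v)" for v
    by (rule Suc.IH) (metis Ck.simps(2) Suc.prems)
  moreover have "f differentiable at x" if "x \<in> U" for x
    using Suc.prems[OF that] by auto
  ultimately show ?case by auto
qed

lemma Ck_const [simp, intro]: "Ck k U (\<lambda>x. c)"
  by (induction k arbitrary: c) auto

lemma Ck_bounded_linear:
  assumes "open U" "bounded_linear L" "Ck k U f"
  shows "Ck k U (\<lambda>x. L (f x))"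
  using assms(3)
proof (induction k arbitrary: f)
  case 0
  then show ?case
    using assms(2) bounded_linear.continuous_on by auto
next
  case (Suc k)
  show ?case
  proof (rule Ck_SucI[OF assms(1)])
    show "((\<lambda>x. L (f x)) has_derivative (\<lambda>v. L (frechet_derivative f (at x) v))) (at x)" if "x \<in> U" for x
      by (rule bounded_linear.has_derivative[OF assms(2) Ck_has_derivative[OF Suc.prems that]])
    show "Ck k U (\<lambda>x. L (frechet_derivative f (at x) v))" for v
      using Suc by auto
  qed
qed

lemma Ck_add:
  assumes "open U" "Ck k U f" "Ck k U g"
  shows "Ck k U (\<lambda>x. f x + g x)"
  using assms(2,3)
proof (induction k arbitrary: f g)
  case 0
  then show ?case by (auto intro: continuous_intros)
next
  case (Suc k)
  show ?case
  proof (rule Ck_SucI[OF assms(1)])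
    show "((\<lambda>x. f x + g x) has_derivative
      (\<lambda>v. frechet_derivative f (at x) v + frechet_derivative g (at x) v)) (at x)" if "x \<in> U" for x
      by (intro has_derivative_add Ck_has_derivative[OF Suc.prems(1) that] Ck_has_derivative[OF Suc.prems(2) that])
    show "Ck k U (\<lambda>x. frechet_derivative f (at x) v + frechet_derivative g (at x) v)" for v
      using Suc by auto
  qed
qed

lemma Ck_sum:
  assumes "open U" "\<And>i. i \<in> I \<Longrightarrow> Ck k U (f i)"
  shows "Ck k U (\<lambda>x. \<Sum>i\<in>I. f i x)"
  using assms(2) by (induction I rule: infinite_finite_induct) (auto intro!: Ck_add[OF assms(1)])

lemma Ck_bilinear:
  assumes "open U" "bounded_bilinear B" "Ck k U f" "Ck k U g"
  shows "Ck k U (\<lambda>x. B (f x) (g x))"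
  using assms(3,4)
proof (induction k arbitrary: f g)
  case 0
  then show ?case using bounded_bilinear.continuous_on[OF assms(2)] by auto
next
  case (Suc k)
  show ?case
  proof (rule Ck_SucI[OF assms(1)])
    show "((\<lambda>x. B (f x) (g x)) has_derivative
      (\<lambda>v. B (f x) (frechet_derivative g (at x) v) + B (frechet_derivative f (at x) v) (g x))) (at x)"
      if "x \<in> U" for x
      by (intro bounded_bilinear.FDERIV[OF assms(2)] Ck_has_derivative[OF Suc.prems(1) that]
          Ck_has_derivative[OF Suc.prems(2) that])
    show "Ck k U (\<lambda>x. B (f x) (frechet_derivative g (at x) v) + B (frechet_derivative f (at x) v) (g x))" for v
      by (intro Ck_add[OF assms(1)] Suc.IH Ck_frechet Suc.prems Ck_Suc_imp[OF Suc.prems(1)] Ck_Suc_imp[OF Suc.prems(2)])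
  qed
qed

lemmas Ck_mult = Ck_bilinear[OF _ bounded_bilinear_mult]
lemmas Ck_scaleR = Ck_bilinear[OF _ bounded_bilinear_scaleR]

lemma Ck_prod:
  fixes f :: "'i \<Rightarrow> 'a::real_normed_vector \<Rightarrow> 'b::{real_normed_algebra_1,comm_monoid_mult}"
  assumes "open U" "\<And>i. i \<in> I \<Longrightarrow> Ck k U (f i)"
  shows "Ck k U (\<lambda>x. \<Prod>i\<in>I. f i x)"
  using assms(2) by (induction I rule: infinite_finite_induct) (auto intro!: Ck_mult[OF assms(1)])

lemma Ck_uminus: "open U \<Longrightarrow> Ck k U f \<Longrightarrow> Ck k U (\<lambda>x. - f x)"
  using Ck_bounded_linear[OF _ bounded_linear_minus[OF bounded_linear_ident]] by blast

lemma Ck_diff: "open U \<Longrightarrow> Ck k U f \<Longrightarrow> Ck k U g \<Longrightarrow> Ck k U (\<lambda>x. f x - g x)"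
  using Ck_add[OF _ _ Ck_uminus, of U k f g] by simp

lemma Ck_inverse:
  fixes f :: "'a::real_normed_vector \<Rightarrow> real"
  assumes "open U" "Ck k U f" "\<And>x. x \<in> U \<Longrightarrow> f x \<noteq> 0"
  shows "Ck k U (\<lambda>x. inverse (f x))"
  using assms(2,3)
proof (induction k)
  case 0
  then show ?case by (auto intro: continuous_intros)
next
  case (Suc k)
  show ?case
  proof (rule Ck_SucI[OF assms(1)])
    show "((\<lambda>x. inverse (f x)) has_derivative
      (\<lambda>v. - (inverse (f x) * frechet_derivative f (at x) v * inverse (f x)))) (at x)" if "x \<in> U" for x
      by (rule Deriv.has_derivative_inverse[OF Suc.prems(2)[OF that] Ck_has_derivative[OF Suc.prems(1) that]])
    show "Ck k U (\<lambda>x. - (inverse (f x) * frechet_derivative f (at x) v * inverse (f x)))" for v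
      by (intro Ck_uminus assms(1) Ck_mult Suc.IH Ck_Suc_imp[OF Suc.prems(1)] Ck_frechet[OF Suc.prems(1)] Suc.prems(2))
  qed
qed

lemma Ck_compose:
  fixes g :: "'a::real_normed_vector \<Rightarrow> 'b::euclidean_space"
  assumes "open U" "open V" "Ck k V F" "Ck k U g" "\<And>x. x \<in> U \<Longrightarrow> g x \<in> V"
  shows "Ck k U (\<lambda>x. F (g x))"
  using assms(3,4)
proof (induction k arbitrary: F)
  case 0
  then show ?case using assms(5) by (auto intro: continuous_on_compose2)
next
  case (Suc k)
  show ?case
  proof (rule Ck_SucI[OF assms(1)])
    fix x assume x: "x \<in> U"
    let ?F' = "frechet_derivative F (at (g x))" and ?g' = "frechet_derivative g (at x)"
    have F': "(F has_derivative ?F') (at (g x))"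
      using Ck_has_derivative[OF Suc.prems(1) assms(5)[OF x]] .
    have "((\<lambda>x. F (g x)) has_derivative (\<lambda>v. ?F' (?g' v))) (at x)"
      using diff_chain_at[OF Ck_has_derivative[OF Suc.prems(2) x] F'] by (simp add: o_def)
    \<comment> \<open>The direction in which F is differentiated varies with x. Expanding it in the
      basis leaves derivatives of F in constant directions b, to which the induction hypothesis
      applies.\<close>
    moreover have "?F' (?g' v) = (\<Sum>b\<in>Basis. (?g' v \<bullet> b) *\<^sub>R ?F' b)" for v
    proof -
      have "?F' (?g' v) = ?F' (\<Sum>b\<in>Basis. (?g' v \<bullet> b) *\<^sub>R b)" by (simp only: euclidean_representation)
      also have "\<dots> = (\<Sum>b\<in>Basis. (?g' v \<bullet> b) *\<^sub>R ?F' b)"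
        using has_derivative_linear[OF F'] by (simp add: linear_sum linear_cmul)
      finally show ?thesis .
    qed
    ultimately show "((\<lambda>x. F (g x)) has_derivative
      (\<lambda>v. \<Sum>b\<in>Basis. (?g' v \<bullet> b) *\<^sub>R ?F' b)) (at x)" by simp
  next
    show "Ck k U (\<lambda>x. \<Sum>b\<in>Basis. (frechet_derivative g (at x) v \<bullet> b) *\<^sub>R frechet_derivative F (at (g x)) b)" for v
      by (intro Ck_sum Ck_scaleR assms(1) Suc.IH Ck_frechet[OF Suc.prems(1)] Ck_Suc_imp[OF Suc.prems(2)]
        Ck_bounded_linear[OF assms(1) bounded_linear_inner_left] Ck_frechet[OF Suc.prems(2)])
  qed
qed

lemma Ck_linear:
  fixes L :: "'a::euclidean_space \<Rightarrow> 'b::real_normed_vector"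
  assumes "linear L"
  shows "Ck k U L"
proof -
  have L: "bounded_linear L" using assms by (simp add: linear_conv_bounded_linear)
  have "Ck k UNIV L"
  proof (cases k)
    case 0
    then show ?thesis using linear_continuous_on[OF L] by simp
  next
    case (Suc l)
    then show ?thesis using Ck_SucI[of UNIV L "\<lambda>x. L" l] bounded_linear_imp_has_derivative[OF L] by simp
  qed
  then show ?thesis using Ck_subset by blast
qed

text \<open>\<open>iter_deriv\<close> has the last derivative at the head of the list, whereas
  \<open>Ck\<close> peels off the first one. Appending at the end reconciles the two
  recursions.\<close>

lemma iter_deriv_frechet:
  "iter_deriv vs (\<lambda>x. frechet_derivative f (at x) v) = iter_deriv (vs @ [v]) f"
  by (induction vs) auto

lemma smooth_on_imp_Ck: "smooth_on U f \<Longrightarrow> Ck k U f"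
proof (induction k arbitrary: f)
  case 0
  then have "\<forall>x\<in>U. iter_deriv [] f differentiable at x" unfolding smooth_on_def by blast
  then show ?case
    by (auto intro!: continuous_at_imp_continuous_on differentiable_imp_continuous_within)
next
  case (Suc k)
  have "\<forall>x\<in>U. iter_deriv [] f differentiable at x" using Suc.prems unfolding smooth_on_def by blast
  moreover have "smooth_on U (\<lambda>x. frechet_derivative f (at x) v)" for v
    using Suc.prems unfolding smooth_on_def iter_deriv_frechet by blast
  ultimately show ?case using Suc.IH by auto
qed

text \<open>Schwarz's theorem for continuous second derivatives. The difference f(x + s v + t w) -
  f(x + t w) is the integral of the v-derivative over [0, s]. Differentiating it at t = 0 under the
  integral sign, and the result at s = 0, gives both mixed derivatives.\<close>

lemma frechet_derivative_symmetric:
  fixes f :: "'a::real_normed_vector \<Rightarrow> 'b::banach"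
  assumes "open U" "Ck (Suc (Suc 0)) U f" "x \<in> U"
  shows "frechet_derivative (\<lambda>y. frechet_derivative f (at y) v) (at x) w =
         frechet_derivative (\<lambda>y. frechet_derivative f (at y) w) (at x) v"
proof -
  define D where "D u y = frechet_derivative f (at y) u" for u y
  define E where "E u u' y = frechet_derivative (D u) (at y) u'" for u u' y
  have f': "(f has_derivative (\<lambda>u. D u y)) (at y)" if "y \<in> U" for y
    using Ck_has_derivative[OF assms(2) that] by (simp add: D_def[abs_def])
  have D': "(D u has_derivative (\<lambda>u'. E u u' y)) (at y)" if "y \<in> U" for y u
    using Ck_has_derivative[OF Ck_frechet[OF assms(2)] that] by (simp add: D_def[abs_def] E_def[abs_def])
  have contE: "continuous_on U (E u u')" for u u'
    using assms(2) by (auto simp: D_def[abs_def] E_def[abs_def])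
  have contD: "continuous_on U (D u)" for u
    using D' by (meson continuous_at_imp_continuous_on has_derivative_continuous)
  obtain r where r: "r > 0" "ball x r \<subseteq> U" using assms(1,3) open_contains_ball by blast
  \<comment> \<open>With this d the parallelogram \<bar>s\<bar>, \<bar>t\<bar> \<le> d stays in the
    ball of radius r; the summand 1 keeps the denominator positive when v = w = 0.\<close>
  define d where "d = r / (norm v + norm w + 1)"
  have np: "norm v + norm w + 1 > 0" using norm_ge_zero[of v] norm_ge_zero[of w] by linarith
  have d: "d > 0" using r np by (simp add: d_def)
  have inU: "x + s *\<^sub>R v + t *\<^sub>R w \<in> U" if "\<bar>s\<bar> \<le> d" "\<bar>t\<bar> \<le> d" for s t
  proof -
    have "norm (s *\<^sub>R v + t *\<^sub>R w) \<le> \<bar>s\<bar> * norm v + \<bar>t\<bar> * norm w" 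
      using norm_triangle_ineq[of "s *\<^sub>R v" "t *\<^sub>R w"] by simp
    also have "\<dots> \<le> d * norm v + d * norm w"
      by (intro add_mono mult_right_mono that) auto
    also have "\<dots> < d * (norm v + norm w + 1)" using d by (simp add: algebra_simps)
    also have "\<dots> = r" using np by (simp add: d_def)
    finally have "dist x (x + s *\<^sub>R v + t *\<^sub>R w) < r"
      by (metis add.assoc add_diff_cancel_left' dist_commute dist_norm)
    then show ?thesis using r by auto
  qed
  have line_s: "((\<lambda>s. F (x + s *\<^sub>R v + t *\<^sub>R w)) has_vector_derivative F' v) (at s within S)"
    if "(F has_derivative F') (at (x + s *\<^sub>R v + t *\<^sub>R w))" for F :: "'a \<Rightarrow> 'b" and F' s t S
  proof -
    have "((\<lambda>s. x + s *\<^sub>R v + t *\<^sub>R w) has_derivative (\<lambda>h. h *\<^sub>R v)) (at s within S)"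
      by (auto intro!: derivative_eq_intros)
    from has_derivative_in_compose2[OF _ _ _ this, of UNIV "F" "\<lambda>_. F'"] 
    have "((\<lambda>s. F (x + s *\<^sub>R v + t *\<^sub>R w)) has_derivative (\<lambda>h. F' (h *\<^sub>R v))) (at s within S)"
      using that \<open>((\<lambda>s. x + s *\<^sub>R v + t *\<^sub>R w) has_derivative (\<lambda>h. h *\<^sub>R v)) (at s within S)\<close>
        has_derivative_compose[of "\<lambda>s. x + s *\<^sub>R v + t *\<^sub>R w"] by blast
    then show ?thesis unfolding has_vector_derivative_def
      using linear_cmul[OF has_derivative_linear[OF that]] by simp
  qed
  have line_t: "((\<lambda>t. F (x + s *\<^sub>R v + t *\<^sub>R w)) has_vector_derivative F' w) (at t within S)"
    if "(F has_derivative F') (at (x + s *\<^sub>R v + t *\<^sub>R w))" for F :: "'a \<Rightarrow> 'b" and F' s t S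
  proof -
    have "((\<lambda>t. x + s *\<^sub>R v + t *\<^sub>R w) has_derivative (\<lambda>h. h *\<^sub>R w)) (at t within S)"
      by (auto intro!: derivative_eq_intros)
    then have "((\<lambda>t. F (x + s *\<^sub>R v + t *\<^sub>R w)) has_derivative (\<lambda>h. F' (h *\<^sub>R w))) (at t within S)"
      using that has_derivative_compose[of "\<lambda>t. x + s *\<^sub>R v + t *\<^sub>R w"] by blast
    then show ?thesis unfolding has_vector_derivative_def
      using linear_cmul[OF has_derivative_linear[OF that]] by simp
  qed
  have f_s: "((\<lambda>s. f (x + s *\<^sub>R v + t *\<^sub>R w)) has_vector_derivative D v (x + s *\<^sub>R v + t *\<^sub>R w)) (at s within S)"
    if "x + s *\<^sub>R v + t *\<^sub>R w \<in> U" for s t S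
    using line_s[OF f'[OF that]] .
  have f_t: "((\<lambda>t. f (x + s *\<^sub>R v + t *\<^sub>R w)) has_vector_derivative D w (x + s *\<^sub>R v + t *\<^sub>R w)) (at t within S)"
    if "x + s *\<^sub>R v + t *\<^sub>R w \<in> U" for s t S
    using line_t[OF f'[OF that]] .
  have bot: "at 0 within {0..d} \<noteq> bot" if "d > 0" for d :: real
    using that by (simp add: trivial_limit_within)
  have bot': "at 0 within {-d..d} \<noteq> bot" if "d > 0" for d :: real
    using that by (simp add: trivial_limit_within)
  let ?I = "{-d..d}"
  have key: "D w (x + s *\<^sub>R v) - D w x = integral {0..s} (\<lambda>r. E v w (x + r *\<^sub>R v))"
    if s: "0 \<le> s" "s \<le> d" for s
  proof -
    have ftc: "integral {0..s} (\<lambda>r. D v (x + r *\<^sub>R v + t *\<^sub>R w)) = f (x + s *\<^sub>R v + t *\<^sub>R w) - f (x + t *\<^sub>R w)"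
      if t: "t \<in> ?I" for t
    proof -
      have "((\<lambda>r. D v (x + r *\<^sub>R v + t *\<^sub>R w)) has_integral
          (f (x + s *\<^sub>R v + t *\<^sub>R w) - f (x + 0 *\<^sub>R v + t *\<^sub>R w))) {0..s}"
        by (rule fundamental_theorem_of_calculus)
          (use s t d in \<open>auto intro!: f_s inU\<close>)
      then show ?thesis by (simp add: integral_unique)
    qed
    have cont: "continuous_on (?I \<times> cbox 0 s) (\<lambda>(t, r). E v w (x + r *\<^sub>R v + t *\<^sub>R w))"
      unfolding split_beta
      by (rule continuous_on_compose2[OF contE]) (use s in \<open>auto intro!: continuous_intros inU\<close>)
    have "((\<lambda>t. integral (cbox 0 s) (\<lambda>r. D v (x + r *\<^sub>R v + t *\<^sub>R w))) has_vector_derivative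
        integral (cbox 0 s) (\<lambda>r. E v w (x + r *\<^sub>R v + 0 *\<^sub>R w))) (at 0 within ?I)"
    proof (rule leibniz_rule_vector_derivative[OF _ _ cont])
      show "((\<lambda>t. D v (x + r *\<^sub>R v + t *\<^sub>R w)) has_vector_derivative E v w (x + r *\<^sub>R v + t *\<^sub>R w)) (at t within ?I)"
        if "t \<in> ?I" "r \<in> cbox 0 s" for t r
        by (rule line_t[OF D']) (use that s in \<open>auto intro!: inU\<close>)
      show "(\<lambda>r. D v (x + r *\<^sub>R v + t *\<^sub>R w)) integrable_on cbox 0 s" if "t \<in> ?I" for t
        by (rule integrable_continuous, rule continuous_on_compose2[OF contD])
          (use s that in \<open>auto intro!: continuous_intros inU\<close>)
    qed (use d in auto)
    then have der: "((\<lambda>t. integral {0..s} (\<lambda>r. D v (x + r *\<^sub>R v + t *\<^sub>R w))) has_vector_derivative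
        integral {0..s} (\<lambda>r. E v w (x + r *\<^sub>R v))) (at 0 within ?I)"
      by simp
    have "((\<lambda>t. f (x + s *\<^sub>R v + t *\<^sub>R w) - f (x + t *\<^sub>R w)) has_vector_derivative
        integral {0..s} (\<lambda>r. E v w (x + r *\<^sub>R v))) (at 0 within ?I)"
      by (rule has_vector_derivative_transform[OF _ _ der]) (use ftc d in simp_all)
    moreover have "((\<lambda>t. f (x + s *\<^sub>R v + t *\<^sub>R w) - f (x + 0 *\<^sub>R v + t *\<^sub>R w)) has_vector_derivative
        (D w (x + s *\<^sub>R v + 0 *\<^sub>R w) - D w (x + 0 *\<^sub>R v + 0 *\<^sub>R w))) (at 0 within ?I)"
      by (intro has_vector_derivative_diff f_t) (use d s inU[of s 0] assms(3) in simp_all)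
    ultimately show ?thesis
      using vector_derivative_unique_within[OF bot'[of d]] d by simp
  qed
  have cE: "continuous_on {0..d} (\<lambda>r. E v w (x + r *\<^sub>R v))"
  proof (rule continuous_on_compose2[OF contE])
    show "continuous_on {0..d} (\<lambda>r. x + r *\<^sub>R v)" by (intro continuous_intros)
    show "(\<lambda>r. x + r *\<^sub>R v) ` {0..d} \<subseteq> U" using inU[where t=0] by (force intro: imageE)
  qed
  \<comment> \<open>The identity \<open>key\<close> is only available for s \<ge> 0, so the
    derivatives at s = 0 are compared within {0..d}.\<close>
  have "((\<lambda>s. integral {0..s} (\<lambda>r. E v w (x + r *\<^sub>R v))) has_vector_derivative E v w (x + 0 *\<^sub>R v)) (at 0 within {0..d})"
    using integral_has_vector_derivative[OF cE, of 0] d by simp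
  then have "((\<lambda>s. D w (x + s *\<^sub>R v) - D w x) has_vector_derivative E v w (x + 0 *\<^sub>R v)) (at 0 within {0..d})"
    by (rule has_vector_derivative_transform[rotated 2]) (use key d in simp_all)
  moreover have "((\<lambda>s. D w (x + s *\<^sub>R v + 0 *\<^sub>R w) - D w x) has_vector_derivative (E w v (x + 0 *\<^sub>R v + 0 *\<^sub>R w) - 0)) (at 0 within {0..d})"
    by (intro has_vector_derivative_diff line_s[OF D'] has_vector_derivative_const) (use assms(3) in simp)
  ultimately have "E v w x = E w v x"
    using vector_derivative_unique_within[OF bot[of d], of _ "E v w x" "E w v x"] d by simp
  then show ?thesis by (simp add: E_def D_def[abs_def])
qed

section \<open>Alternating forms\<close>

lemma alternating_form_cong:
  "alternating_form k T \<alpha> \<Longrightarrow> (\<And>i. i < k \<Longrightarrow> v i = w i) \<Longrightarrow> \<alpha> v = \<alpha> w"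
  unfolding alternating_form_def by blast

lemma alternating_form_linear:
  assumes "alternating_form k T \<alpha>" "\<And>j. j < k \<Longrightarrow> v j \<in> T" "i < k" "x \<in> T" "y \<in> T"
  shows "\<alpha> (v(i := a *\<^sub>R x + b *\<^sub>R y)) =
    complex_of_real a * \<alpha> (v(i := x)) + complex_of_real b * \<alpha> (v(i := y))"
  using assms unfolding alternating_form_def by blast

lemma alternating_form_eq_0:
  assumes "alternating_form k T \<alpha>" "\<And>j. j < k \<Longrightarrow> v j \<in> T" "i < k" "j < k" "i \<noteq> j" "v i = v j"
  shows "\<alpha> v = 0"
  using assms unfolding alternating_form_def by blast

lemma alternating_formI:
  assumes "\<And>v w. (\<And>i. i < k \<Longrightarrow> v i = w i) \<Longrightarrow> \<alpha> v = \<alpha> w"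
    and "\<And>v i x y a b. (\<And>j. j < k \<Longrightarrow> v j \<in> T) \<Longrightarrow> i < k \<Longrightarrow> x \<in> T \<Longrightarrow> y \<in> T \<Longrightarrow>
        \<alpha> (v(i := a *\<^sub>R x + b *\<^sub>R y)) =
          complex_of_real a * \<alpha> (v(i := x)) + complex_of_real b * \<alpha> (v(i := y))"
    and "\<And>v i j. (\<And>l. l < k \<Longrightarrow> v l \<in> T) \<Longrightarrow> i < k \<Longrightarrow> j < k \<Longrightarrow> i \<noteq> j \<Longrightarrow> v i = v j \<Longrightarrow> \<alpha> v = 0"
  shows "alternating_form k T \<alpha>"
  using assms unfolding alternating_form_def by blast

lemma alternating_form_subset:
  assumes "alternating_form k T \<alpha>" "S \<subseteq> T"
  shows "alternating_form k S \<alpha>"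
proof (rule alternating_formI)
  show "\<alpha> v = \<alpha> w" if "\<And>i. i < k \<Longrightarrow> v i = w i" for v w
    using alternating_form_cong[OF assms(1) that] .
  show "\<alpha> (v(i := a *\<^sub>R x + b *\<^sub>R y)) =
          complex_of_real a * \<alpha> (v(i := x)) + complex_of_real b * \<alpha> (v(i := y))"
    if "\<And>j. j < k \<Longrightarrow> v j \<in> S" "i < k" "x \<in> S" "y \<in> S" for v i x y a b
    using alternating_form_linear[OF assms(1), of v i x y] that assms(2) by blast
  show "\<alpha> v = 0" if "\<And>l. l < k \<Longrightarrow> v l \<in> S" "i < k" "j < k" "i \<noteq> j" "v i = v j" for v i j
    using alternating_form_eq_0[OF assms(1), of v i j] that assms(2) by blast
qed

lemma alternating_form_scale:
  assumes "alternating_form k T \<alpha>"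
  shows "alternating_form k T (\<lambda>v. c * \<alpha> v)"
proof (rule alternating_formI)
  show "c * \<alpha> v = c * \<alpha> w" if "\<And>i. i < k \<Longrightarrow> v i = w i" for v w
    using alternating_form_cong[OF assms, of v w] that by simp
  show "c * \<alpha> (v(i := a *\<^sub>R x + b *\<^sub>R y)) =
          complex_of_real a * (c * \<alpha> (v(i := x))) + complex_of_real b * (c * \<alpha> (v(i := y)))"
    if "\<And>j. j < k \<Longrightarrow> v j \<in> T" "i < k" "x \<in> T" "y \<in> T" for v i x y a b
    using alternating_form_linear[OF assms that] by (simp add: algebra_simps)
  show "c * \<alpha> v = 0" if "\<And>l. l < k \<Longrightarrow> v l \<in> T" "i < k" "j < k" "i \<noteq> j" "v i = v j" for v i j
    using alternating_form_eq_0[OF assms that] by simp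
qed

lemma alternating_form_1I:
  assumes "\<And>x y a b. x \<in> T \<Longrightarrow> y \<in> T \<Longrightarrow>
    D (a *\<^sub>R x + b *\<^sub>R y) = complex_of_real a * D x + complex_of_real b * D y"
  shows "alternating_form 1 T (\<lambda>s. D (s 0))"
  by (rule alternating_formI) (use assms in auto)

text \<open>Expand the zero that results from putting \<open>v a + v b\<close> into both slots; the
  two terms with a repeated vector vanish.\<close>

lemma alternating_form_transpose:
  assumes "alternating_form N T \<alpha>" "subspace T" "\<And>i. i < N \<Longrightarrow> v i \<in> T" "a < N" "b < N" "a \<noteq> b"
  shows "\<alpha> (\<lambda>i. v (Transposition.transpose a b i)) = - \<alpha> v"
proof -
  let ?s = "v a + v b"
  have s: "?s \<in> T" using assms by (simp add: subspace_add)
  have 1: "\<alpha> (v(a := ?s, b := ?s)) = 0"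
    using assms s by (intro alternating_form_eq_0[OF assms(1), of _ a b]) auto
  have 2: "\<alpha> ((v(b := ?s))(a := 1 *\<^sub>R v a + 1 *\<^sub>R v b)) =
     complex_of_real 1 * \<alpha> ((v(b := ?s))(a := v a)) + complex_of_real 1 * \<alpha> ((v(b := ?s))(a := v b))"
    by (rule alternating_form_linear[OF assms(1)]) (use assms s in auto)
  have 3: "\<alpha> ((v(a := x))(b := 1 *\<^sub>R v a + 1 *\<^sub>R v b)) =
     complex_of_real 1 * \<alpha> ((v(a := x))(b := v a)) + complex_of_real 1 * \<alpha> ((v(a := x))(b := v b))" if "x \<in> T" for x
    by (rule alternating_form_linear[OF assms(1)]) (use assms s that in auto)
  have 4: "\<alpha> (v(a := x, b := x)) = 0" if "x \<in> T" for x
    using assms s that by (intro alternating_form_eq_0[OF assms(1), of _ a b]) auto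
  have 5: "(\<lambda>i. v (Transposition.transpose a b i)) = v(a := v b, b := v a)"
    by (auto simp: fun_eq_iff Transposition.transpose_def)
  have "0 = \<alpha> (v(a := v a, b := v a)) + \<alpha> v + (\<alpha> (v(a := v b, b := v a)) + \<alpha> (v(a := v b, b := v b)))"
    using 1 2 3[of "v a"] 3[of "v b"] assms by (simp add: fun_upd_twist[of b a])
  then show ?thesis
    using 4[of "v a"] 4[of "v b"] assms unfolding 5 by (simp add: eq_neg_iff_add_eq_0 add.commute)
qed

lemma alternating_form_permute:
  assumes "alternating_form N T \<alpha>" "subspace T" "\<And>i. i < N \<Longrightarrow> v i \<in> T" "\<pi> permutes {..<N}"
  shows "\<alpha> (\<lambda>i. v (\<pi> i)) = of_int (sign \<pi>) * \<alpha> v"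
proof -
  have "finite {..<N}" by simp
  from this assms(4) show ?thesis
  proof (induction rule: permutes_rev_induct)
    case id
    then show ?case by simp
  next
    case (swap a b p)
    have pT: "v (p i) \<in> T" if "i < N" for i
      using permutes_in_image[OF \<open>p permutes {..<N}\<close>] assms(3) that by (metis lessThan_iff)
    have "\<alpha> (\<lambda>i. v ((p \<circ> Transposition.transpose a b) i)) = - \<alpha> (\<lambda>i. v (p i))"
      using alternating_form_transpose[OF assms(1,2), of "\<lambda>i. v (p i)" a b] swap pT by simp
    also have "\<dots> = of_int (sign (p \<circ> Transposition.transpose a b)) * \<alpha> v"
    proof -
      have "permutation p" using \<open>p permutes {..<N}\<close> permutes_imp_permutation by blast
      then have "sign (p \<circ> Transposition.transpose a b) = - sign p"
        using sign_compose[OF _ permutation_swap_id[of a b], of p] \<open>a \<noteq> b\<close> sign_swap_id[of a b] by simp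
      then show ?thesis using swap by simp
    qed
    finally show ?case .
  qed
qed

lemma alternating_form_sum:
  assumes "alternating_form N T \<alpha>" "subspace T" "\<And>i. i < N \<Longrightarrow> u i \<in> T" "i < N"
    "\<And>j. j \<in> J \<Longrightarrow> x j \<in> T"
  shows "\<alpha> (u(i := \<Sum>j\<in>J. c j *\<^sub>R x j)) = (\<Sum>j\<in>J. complex_of_real (c j) * \<alpha> (u(i := x j)))"
proof -
  have z: "\<alpha> (u(i := 0)) = 0"
    using alternating_form_linear[OF assms(1,3,4) subspace_0[OF assms(2)] subspace_0[OF assms(2)], where a=0 and b=0] by simp
  define h where "h x = \<alpha> (u(i := x))" for x
  show ?thesis using assms(5) z unfolding h_def[symmetric]
  proof (induction J rule: infinite_finite_induct)
    case (infinite A)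
    then show ?case using z by simp
  next
    case empty
    then show ?case using z by simp
  next
    case (insert j J)
    have "(\<Sum>j\<in>J. c j *\<^sub>R x j) \<in> T" 
      using insert.prems by (intro subspace_sum[OF assms(2)] subspace_scale[OF assms(2)]) auto
    then have "h (c j *\<^sub>R x j + 1 *\<^sub>R (\<Sum>j\<in>J. c j *\<^sub>R x j)) =
      complex_of_real (c j) * h (x j) + complex_of_real 1 * h (\<Sum>j\<in>J. c j *\<^sub>R x j)"
      unfolding h_def using insert.prems by (intro alternating_form_linear[OF assms(1,3,4)]) blast+
    then show ?case using insert.IH insert.hyps insert.prems by simp
  qed
qed

text \<open>The slots are expanded one after another, and s counts those already done. At s = N the
  sum runs over all maps of the index set into itself.\<close>

lemma alternating_form_expand:
  assumes "alternating_form N T \<alpha>" "subspace T" "\<And>i. i < N \<Longrightarrow> v i \<in> T"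
    and "s \<le> N"
    and w: "\<And>i. i < s \<Longrightarrow> w i = (\<Sum>j<N. B i j *\<^sub>R v j)" and wT: "\<And>i. i < N \<Longrightarrow> w i \<in> T"
  shows "\<alpha> w = (\<Sum>\<phi>\<in>PiE {..<s} (\<lambda>_. {..<N}). complex_of_real (\<Prod>i<s. B i (\<phi> i)) *
     \<alpha> (\<lambda>i. if i < s then v (\<phi> i) else w i))"
  using assms(4) w
proof (induction s)
  case 0
  then show ?case by simp
next
  case (Suc s)
  let ?u = "\<lambda>\<phi> i. if i < s then v (\<phi> i) else w i"
  let ?P = "PiE {..<s} (\<lambda>_. {..<N})"
  have "\<alpha> w = (\<Sum>\<phi>\<in>?P. complex_of_real (\<Prod>i<s. B i (\<phi> i)) * \<alpha> (?u \<phi>))"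
    by (rule Suc.IH) (use Suc.prems(1) Suc.prems(2)[OF less_SucI] in simp_all)
  also have "\<dots> = (\<Sum>\<phi>\<in>?P. complex_of_real (\<Prod>i<s. B i (\<phi> i)) *
      (\<Sum>j<N. complex_of_real (B s j) * \<alpha> ((?u \<phi>)(s := v j))))"
  proof (rule sum.cong[OF refl])
    fix \<phi> assume \<phi>: "\<phi> \<in> ?P"
    have "\<alpha> ((?u \<phi>)(s := \<Sum>j<N. B s j *\<^sub>R v j)) =
        (\<Sum>j<N. complex_of_real (B s j) * \<alpha> ((?u \<phi>)(s := v j)))"
    proof (rule alternating_form_sum[OF assms(1,2)])
      have "\<phi> i < N" if "i < s" for i using \<phi> that by auto
      then show "?u \<phi> i \<in> T" if "i < N" for i using assms(3) wT that by simp
      show "s < N" using Suc.prems(1) by simp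
      show "v j \<in> T" if "j \<in> {..<N}" for j using assms(3) that by simp
    qed
    moreover have "(?u \<phi>)(s := \<Sum>j<N. B s j *\<^sub>R v j) = ?u \<phi>"
      unfolding Suc.prems(2)[OF lessI, symmetric] by (simp add: fun_eq_iff)
    ultimately show "complex_of_real (\<Prod>i<s. B i (\<phi> i)) * \<alpha> (?u \<phi>) = 
      complex_of_real (\<Prod>i<s. B i (\<phi> i)) * (\<Sum>j<N. complex_of_real (B s j) * \<alpha> ((?u \<phi>)(s := v j)))"
      by simp
  qed
  also have "\<dots> = (\<Sum>(\<phi>, j)\<in>?P \<times> {..<N}. complex_of_real (\<Prod>i<s. B i (\<phi> i)) *
      (complex_of_real (B s j) * \<alpha> ((?u \<phi>)(s := v j))))"
    by (simp add: sum_distrib_left sum.cartesian_product)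
  also have "\<dots> = (\<Sum>(j, \<phi>)\<in>{..<N} \<times> ?P. complex_of_real (\<Prod>i<s. B i (\<phi> i)) *
      (complex_of_real (B s j) * \<alpha> ((?u \<phi>)(s := v j))))"
    by (subst (2) sum.cartesian_product[symmetric], subst sum.swap, simp add: sum.cartesian_product)
  also have "\<dots> = (\<Sum>\<phi>\<in>PiE {..<Suc s} (\<lambda>_. {..<N}). complex_of_real (\<Prod>i<Suc s. B i (\<phi> i)) *
     \<alpha> (\<lambda>i. if i < Suc s then v (\<phi> i) else w i))"
  proof -
    have "PiE {..<Suc s} (\<lambda>_. {..<N}) = (\<lambda>(y, g). g(s := y)) ` ({..<N} \<times> ?P)"
      by (simp add: lessThan_Suc PiE_insert_eq)
    moreover have "inj_on (\<lambda>(y, g). g(s := y)) ({..<N} \<times> ?P)"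
      by (rule inj_combinator) simp
    ultimately have "(\<Sum>\<phi>\<in>PiE {..<Suc s} (\<lambda>_. {..<N}). complex_of_real (\<Prod>i<Suc s. B i (\<phi> i)) *
     \<alpha> (\<lambda>i. if i < Suc s then v (\<phi> i) else w i)) = (\<Sum>(j, \<phi>)\<in>{..<N} \<times> ?P.
      complex_of_real (\<Prod>i<Suc s. B i ((\<phi>(s := j)) i)) *
     \<alpha> (\<lambda>i. if i < Suc s then v ((\<phi>(s := j)) i) else w i))"
      by (simp add: sum.reindex case_prod_unfold)
    also have "\<dots> = (\<Sum>(j, \<phi>)\<in>{..<N} \<times> ?P. complex_of_real (\<Prod>i<s. B i (\<phi> i)) *
      (complex_of_real (B s j) * \<alpha> ((?u \<phi>)(s := v j))))"
    proof (rule sum.cong[OF refl], clarify)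
      fix j \<phi> assume "\<phi> \<in> ?P"
      have "(\<lambda>i. if i < Suc s then v ((\<phi>(s := j)) i) else w i) = (?u \<phi>)(s := v j)"
        by (auto simp: fun_eq_iff less_Suc_eq)
      moreover have "(\<Prod>i<Suc s. B i ((\<phi>(s := j)) i)) = (\<Prod>i<s. B i (\<phi> i)) * B s j"
        by simp
      ultimately show "complex_of_real (\<Prod>i<Suc s. B i ((\<phi>(s := j)) i)) *
     \<alpha> (\<lambda>i. if i < Suc s then v ((\<phi>(s := j)) i) else w i) = complex_of_real (\<Prod>i<s. B i (\<phi> i)) *
      (complex_of_real (B s j) * \<alpha> ((?u \<phi>)(s := v j)))" by simp
    qed
    finally show ?thesis by simp
  qed
  finally show ?case .
qed

text \<open>Leibniz's formula over the index set {..<N}: forms act on sequences of vectors, while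
  \<open>det\<close> is indexed by a finite type.\<close>

definition nat_det :: "nat \<Rightarrow> (nat \<Rightarrow> nat \<Rightarrow> real) \<Rightarrow> real" where
  "nat_det N B = (\<Sum>\<pi> | \<pi> permutes {..<N}. of_int (sign \<pi>) * (\<Prod>i<N. B i (\<pi> i)))"

text \<open>In the full expansion a non-injective index map repeats a vector and contributes 0. The
  injective ones are permutations and contribute their sign.\<close>

lemma alternating_form_top:
  assumes \<alpha>: "alternating_form N T \<alpha>" and T: "subspace T" and v: "\<And>i. i < N \<Longrightarrow> v i \<in> T"
    and w: "\<And>i. i < N \<Longrightarrow> w i = (\<Sum>j<N. B i j *\<^sub>R v j)"
  shows "\<alpha> w = complex_of_real (nat_det N B) * \<alpha> v"
proof -
  let ?P = "PiE {..<N} (\<lambda>_. {..<N})"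
  let ?t = "\<lambda>\<phi>. complex_of_real (\<Prod>i<N. B i (\<phi> i)) * \<alpha> (\<lambda>i. if i < N then v (\<phi> i) else w i)"
  let ?R = "(\<lambda>\<pi>. restrict \<pi> {..<N}) ` {\<pi>. \<pi> permutes {..<N}}"
  have wT: "w i \<in> T" if "i < N" for i
    unfolding w[OF that] using v by (intro subspace_sum[OF T] subspace_scale[OF T]) auto
  have "\<alpha> w = sum ?t ?P"
    by (rule alternating_form_expand[OF \<alpha> T v order_refl w wT])
  also have "\<dots> = sum ?t ?R"
  proof (rule sum.mono_neutral_right)
    show "finite ?P" by (simp add: finite_PiE)
    show "?R \<subseteq> ?P"
    proof
      fix \<phi> assume "\<phi> \<in> ?R"
      then obtain \<pi> where \<pi>: "\<pi> permutes {..<N}" "\<phi> = restrict \<pi> {..<N}" by blast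
      have "\<pi> i \<in> {..<N}" if "i \<in> {..<N}" for i
        using permutes_in_image[OF \<pi>(1)] that by blast
      then show "\<phi> \<in> ?P" unfolding \<pi>(2) by (rule restrict_PiE_iff[THEN iffD2, rule_format])
    qed
    show "\<forall>\<phi>\<in>?P - ?R. ?t \<phi> = 0"
    proof
      fix \<phi> assume \<phi>: "\<phi> \<in> ?P - ?R"
      have "\<not> inj_on \<phi> {..<N}"
      proof
        assume inj: "inj_on \<phi> {..<N}"
        have "\<phi> ` {..<N} = {..<N}"
          using \<phi> by (intro endo_inj_surj[OF _ _ inj]) auto
        then have "(\<lambda>i. if i < N then \<phi> i else i) permutes {..<N}"
          using inj by (intro bij_imp_permutes) (auto simp: bij_betw_def inj_on_def)
        moreover have "\<phi> = restrict (\<lambda>i. if i < N then \<phi> i else i) {..<N}"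
          using \<phi> by (auto simp: fun_eq_iff PiE_def extensional_def)
        ultimately show False using \<phi> by blast
      qed
      then obtain i j where "i < N" "j < N" "i \<noteq> j" "\<phi> i = \<phi> j"
        by (auto simp: inj_on_def)
      moreover have "\<phi> l < N" if "l < N" for l using that \<phi> by auto
      ultimately have "\<alpha> (\<lambda>i. if i < N then v (\<phi> i) else w i) = 0"
        by (intro alternating_form_eq_0[OF \<alpha>, of _ i j]) (auto simp: v)
      then show "?t \<phi> = 0" by simp
    qed
  qed
  also have "\<dots> = (\<Sum>\<pi> | \<pi> permutes {..<N}. ?t (restrict \<pi> {..<N}))"
  proof (rule sum.reindex[unfolded o_def])
    show "inj_on (\<lambda>\<pi>. restrict \<pi> {..<N}) {\<pi>. \<pi> permutes {..<N}}"
    proof (rule inj_onI, rule ext)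
      fix p q i assume "p \<in> {\<pi>. \<pi> permutes {..<N}}" "q \<in> {\<pi>. \<pi> permutes {..<N}}"
        "restrict p {..<N} = restrict q {..<N}"
      then show "p i = q i"
        by (cases "i < N") (auto simp: permutes_not_in dest: fun_cong[of _ _ i])
    qed
  qed
  also have "\<dots> = (\<Sum>\<pi> | \<pi> permutes {..<N}. complex_of_real (of_int (sign \<pi>) * (\<Prod>i<N. B i (\<pi> i))) * \<alpha> v)"
  proof (rule sum.cong[OF refl])
    fix \<pi> assume "\<pi> \<in> {\<pi>. \<pi> permutes {..<N}}"
    then have \<pi>: "\<pi> permutes {..<N}" by simp
    have "\<alpha> (\<lambda>i. if i < N then v (restrict \<pi> {..<N} i) else w i) = \<alpha> (\<lambda>i. v (\<pi> i))"
      by (rule alternating_form_cong[OF \<alpha>]) auto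
    also have "\<dots> = of_int (sign \<pi>) * \<alpha> v"
      by (rule alternating_form_permute[OF \<alpha> T v \<pi>])
    finally show "?t (restrict \<pi> {..<N}) = complex_of_real (of_int (sign \<pi>) * (\<Prod>i<N. B i (\<pi> i))) * \<alpha> v"
      by simp
  qed
  also have "\<dots> = complex_of_real (nat_det N B) * \<alpha> v"
    unfolding nat_det_def by (simp add: sum_distrib_right)
  finally show ?thesis .
qed

lemma nat_det_eq_det:
  fixes A :: "real^'m^'m"
  assumes "bij_betw h {..<N} (UNIV :: 'm::finite set)"
  shows "nat_det N (\<lambda>i j. A $ h i $ h j) = det A"
proof -
  have inj: "inj_on h {..<N}" and im: "h ` {..<N} = UNIV" using assms by (auto simp: bij_betw_def)
  let ?F = "map_permutation {..<N} h"
  have "det A = (\<Sum>p | p permutes (UNIV::'m set). of_int (sign p) * (\<Prod>i\<in>UNIV. A $ i $ p i))"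
    by (simp add: det_def)
  also have "\<dots> = (\<Sum>\<pi> | \<pi> permutes {..<N}. of_int (sign (?F \<pi>)) * (\<Prod>i\<in>UNIV. A $ i $ ?F \<pi> i))"
  proof -
    have "bij_betw ?F {\<pi>. \<pi> permutes {..<N}} {p. p permutes (UNIV::'m set)}"
    proof -
      have "?F \<pi> = (\<lambda>x. if x \<in> UNIV then h (\<pi> (inv_into {..<N} h x)) else x)" for \<pi>
        unfolding map_permutation_def restrict_id_def im by (auto simp: fun_eq_iff)
      then have "?F = (\<lambda>\<pi> x. if x \<in> UNIV then h (\<pi> (inv_into {..<N} h x)) else x)" by (rule ext)
      then show ?thesis using bij_betw_permutations[OF assms] by simp
    qed
    from sum.reindex_bij_betw[OF this, of "\<lambda>p. of_int (sign p) * (\<Prod>i\<in>UNIV. A $ i $ p i)"]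
    show ?thesis by simp
  qed
  also have "\<dots> = (\<Sum>\<pi> | \<pi> permutes {..<N}. of_int (sign \<pi>) * (\<Prod>i<N. A $ h i $ h (\<pi> i)))"
  proof (rule sum.cong[OF refl])
    fix \<pi> assume "\<pi> \<in> {\<pi>. \<pi> permutes {..<N}}"
    then have \<pi>: "\<pi> permutes {..<N}" by simp
    have "(\<Prod>i\<in>UNIV. A $ i $ ?F \<pi> i) = (\<Prod>i<N. A $ h i $ ?F \<pi> (h i))"
      using prod.reindex_bij_betw[OF assms, of "\<lambda>i. A $ i $ ?F \<pi> i"] by simp
    also have "\<dots> = (\<Prod>i<N. A $ h i $ h (\<pi> i))"
      by (rule prod.cong[OF refl]) (simp add: map_permutation_apply[OF inj])
    finally show "of_int (sign (?F \<pi>)) * (\<Prod>i\<in>UNIV. A $ i $ ?F \<pi> i) =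
        of_int (sign \<pi>) * (\<Prod>i<N. A $ h i $ h (\<pi> i))"
      using sign_map_permutation[OF inj \<pi>] by simp
  qed
  finally show ?thesis by (simp add: nat_det_def)
qed

text \<open>With the other slots fixed, the vectors that give 0 form a subspace. Slot by slot this
  lets S be replaced by its span.\<close>

lemma alternating_form_vanish:
  assumes \<alpha>: "alternating_form N UNIV \<alpha>"
    and S: "\<And>u. (\<And>i. i < N \<Longrightarrow> u i \<in> S) \<Longrightarrow> \<alpha> u = 0"
    and u: "\<And>i. i < N \<Longrightarrow> u i \<in> span S"
  shows "\<alpha> u = 0"
proof -
  have "\<alpha> u = 0" if "s \<le> N" "\<And>i. i < s \<Longrightarrow> u i \<in> span S" "\<And>i. s \<le> i \<Longrightarrow> i < N \<Longrightarrow> u i \<in> S" for s u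
    using that
  proof (induction s arbitrary: u)
    case 0
    then show ?case using S by simp
  next
    case (Suc s)
    let ?Z = "{x. \<alpha> (u(s := x)) = 0}"
    have lin: "\<alpha> (u(s := a *\<^sub>R x + b *\<^sub>R y)) =
          complex_of_real a * \<alpha> (u(s := x)) + complex_of_real b * \<alpha> (u(s := y))" for a b x y
      using Suc.prems by (intro alternating_form_linear[OF \<alpha>]) auto
    have "subspace ?Z"
      unfolding subspace_def using lin[of 0 0 0 0] lin[of 1 _ 1 _] lin[of _ _ 0 0] by auto
    moreover have "S \<subseteq> ?Z"
    proof
      fix x assume x: "x \<in> S"
      have "\<alpha> (u(s := x)) = 0"
      proof (rule Suc.IH)
        show "s \<le> N" using Suc.prems by simp
        show "(u(s := x)) i \<in> span S" if "i < s" for i using Suc.prems(2)[of i] that by simp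
        show "(u(s := x)) i \<in> S" if "s \<le> i" "i < N" for i
          using Suc.prems(3)[of i] that x by (cases "i = s") auto
      qed
      then show "x \<in> ?Z" by simp
    qed
    ultimately have "span S \<subseteq> ?Z" by (rule span_minimal[rotated])
    moreover have "u s \<in> span S" using Suc.prems(2) by simp
    ultimately have "\<alpha> (u(s := u s)) = 0" by blast
    then show ?case by simp
  qed
  from this[of N] show ?thesis using u by simp
qed

section \<open>Wedge products and powers of the symplectic form\<close>

lemma wedge_cong:
  assumes "alternating_form k T \<alpha>" "alternating_form l T \<beta>" "\<And>i. i < k + l \<Longrightarrow> v i = w i"
  shows "wedge k l \<alpha> \<beta> v = wedge k l \<alpha> \<beta> w"
proof -
  have "\<alpha> (\<lambda>i. v (\<pi> i)) = \<alpha> (\<lambda>i. w (\<pi> i)) \<and> \<beta> (\<lambda>i. v (\<pi> (k + i))) = \<beta> (\<lambda>i. w (\<pi> (k + i)))"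
    if "\<pi> permutes {..<k + l}" for \<pi>
  proof -
    have "\<pi> i < k + l" if "i < k + l" for i
      using permutes_in_image[OF \<open>\<pi> permutes _\<close>, of i] that by simp
    then show ?thesis using assms(3)
      by (auto intro!: alternating_form_cong[OF assms(1)] alternating_form_cong[OF assms(2)])
  qed
  then have "(\<Sum>\<pi> | \<pi> permutes {..<k + l}. of_int (sign \<pi>) * \<alpha> (\<lambda>i. v (\<pi> i)) * \<beta> (\<lambda>i. v (\<pi> (k + i)))) =
     (\<Sum>\<pi> | \<pi> permutes {..<k + l}. of_int (sign \<pi>) * \<alpha> (\<lambda>i. w (\<pi> i)) * \<beta> (\<lambda>i. w (\<pi> (k + i))))"
    by (intro sum.cong refl) simp
  then show ?thesis unfolding wedge_def by simp
qed

text \<open>Composing the summation index on the left with the transposition permutes the terms and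
  reverses each sign.\<close>

lemma wedge_transpose:
  assumes "a < k + l" "b < k + l" "a \<noteq> b"
  shows "wedge k l \<alpha> \<beta> (\<lambda>i. v (Transposition.transpose a b i)) = - wedge k l \<alpha> \<beta> v"
proof -
  let ?\<tau> = "Transposition.transpose a b"
  let ?S = "{\<pi>. \<pi> permutes {..<k + l}}"
  let ?t = "\<lambda>\<pi>. of_int (sign \<pi>) * \<alpha> (\<lambda>i. v (\<pi> i)) * \<beta> (\<lambda>i. v (\<pi> (k + i)))"
  have bij: "bij_betw (\<lambda>\<pi>. ?\<tau> \<circ> \<pi>) ?S ?S"
    by (rule bij_betw_byWitness[of _ "\<lambda>\<pi>. ?\<tau> \<circ> \<pi>"])
      (use assms in \<open>auto simp: fun_eq_iff permutes_swap_id intro!: permutes_compose\<close>)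
  have "sum ?t ?S = (\<Sum>\<pi>\<in>?S. ?t (?\<tau> \<circ> \<pi>))"
    using sum.reindex_bij_betw[OF bij, of ?t] by simp
  also have "\<dots> = (\<Sum>\<pi>\<in>?S. - (of_int (sign \<pi>) * \<alpha> (\<lambda>i. v (?\<tau> (\<pi> i))) * \<beta> (\<lambda>i. v (?\<tau> (\<pi> (k + i))))))"
  proof (rule sum.cong[OF refl])
    fix \<pi> assume "\<pi> \<in> ?S"
    then have "permutation \<pi>" using permutes_imp_permutation[of "{..<k+l}"] by auto
    then have "sign (?\<tau> \<circ> \<pi>) = - sign \<pi>"
      using sign_compose[OF permutation_swap_id[of a b]] assms sign_swap_id[of a b] by simp
    then show "?t (?\<tau> \<circ> \<pi>) = - (of_int (sign \<pi>) * \<alpha> (\<lambda>i. v (?\<tau> (\<pi> i))) * \<beta> (\<lambda>i. v (?\<tau> (\<pi> (k + i)))))"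
      by simp
  qed
  finally show ?thesis unfolding wedge_def by (simp add: sum_negf)
qed

lemma wedge_alternating:
  assumes \<alpha>: "alternating_form k T \<alpha>" and \<beta>: "alternating_form l T \<beta>"
  shows "alternating_form (k + l) T (wedge k l \<alpha> \<beta>)"
proof (rule alternating_formI)
  show "wedge k l \<alpha> \<beta> v = wedge k l \<alpha> \<beta> w" if "\<And>i. i < k + l \<Longrightarrow> v i = w i" for v w
    by (rule wedge_cong[OF assms that])
next
  fix v :: "nat \<Rightarrow> 'a" and i x y a b
  assume v: "\<And>j. j < k + l \<Longrightarrow> v j \<in> T" and i: "i < k + l" and x: "x \<in> T" and y: "y \<in> T"
  let ?z = "a *\<^sub>R x + b *\<^sub>R y"
  let ?t = "\<lambda>z \<pi>. of_int (sign \<pi>) * \<alpha> (\<lambda>j. (v(i := z)) (\<pi> j)) * \<beta> (\<lambda>j. (v(i := z)) (\<pi> (k + j)))"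
  have "?t ?z \<pi> = complex_of_real a * ?t x \<pi> + complex_of_real b * ?t y \<pi>" if \<pi>: "\<pi> permutes {..<k + l}" for \<pi>
  proof -
    have lt: "\<pi> j < k + l" if "j < k + l" for j
      using permutes_in_image[OF \<pi>, of j] that by simp
    \<comment> \<open>Exactly one position p receives the modified vector. It is a slot of \<alpha>
      if p < k and a slot of \<beta> otherwise, and the other factor does not change.\<close>
    obtain p where p: "p < k + l" "\<pi> p = i"
      using \<pi> i by (metis lessThan_iff permutes_in_image permutes_surj surjD)
    have pi_eq: "\<pi> j = i \<longleftrightarrow> j = p" for j
      using p \<pi> by (metis permutes_inj injD)
    show ?thesis
    proof (cases "p < k")
      case True
      have A: "(\<lambda>j. (v(i := z)) (\<pi> j)) = (\<lambda>j. v (\<pi> j))(p := z)" for z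
        using pi_eq by (auto simp: fun_eq_iff)
      have B: "(\<lambda>j. (v(i := z)) (\<pi> (k + j))) = (\<lambda>j. v (\<pi> (k + j)))" for z
        using pi_eq True by (auto simp: fun_eq_iff)
      have "\<alpha> ((\<lambda>j. v (\<pi> j))(p := ?z)) = complex_of_real a * \<alpha> ((\<lambda>j. v (\<pi> j))(p := x))
         + complex_of_real b * \<alpha> ((\<lambda>j. v (\<pi> j))(p := y))"
        by (rule alternating_form_linear[OF \<alpha>]) (use True x y v lt in auto)
      then show ?thesis unfolding A B by (simp add: algebra_simps)
    next
      case False
      then obtain q where q: "p = k + q" "q < l" using p by (metis add_less_cancel_left le_Suc_ex not_less)
      have A: "\<alpha> (\<lambda>j. (v(i := z)) (\<pi> j)) = \<alpha> (\<lambda>j. v (\<pi> j))" for z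
        using pi_eq False by (intro alternating_form_cong[OF \<alpha>]) auto
      have B: "(\<lambda>j. (v(i := z)) (\<pi> (k + j))) = (\<lambda>j. v (\<pi> (k + j)))(q := z)" for z
        using pi_eq q by (auto simp: fun_eq_iff)
      have "\<beta> ((\<lambda>j. v (\<pi> (k + j)))(q := ?z)) = complex_of_real a * \<beta> ((\<lambda>j. v (\<pi> (k + j)))(q := x))
         + complex_of_real b * \<beta> ((\<lambda>j. v (\<pi> (k + j)))(q := y))"
        by (rule alternating_form_linear[OF \<beta>]) (use q x y v lt in auto)
      then show ?thesis unfolding A B by (simp add: algebra_simps)
    qed
  qed
  then have "(\<Sum>\<pi> | \<pi> permutes {..<k + l}. ?t ?z \<pi>) =
      complex_of_real a * (\<Sum>\<pi> | \<pi> permutes {..<k + l}. ?t x \<pi>) + complex_of_real b * (\<Sum>\<pi> | \<pi> permutes {..<k + l}. ?t y \<pi>)"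
    by (simp add: sum_distrib_left sum.distrib)
  then show "wedge k l \<alpha> \<beta> (v(i := ?z)) = complex_of_real a * wedge k l \<alpha> \<beta> (v(i := x)) +
     complex_of_real b * wedge k l \<alpha> \<beta> (v(i := y))"
    unfolding wedge_def by (simp add: add_divide_distrib)
next
  fix v :: "nat \<Rightarrow> 'a" and i j
  assume "i < k + l" "j < k + l" "i \<noteq> j" and eq: "v i = v j"
  then have "wedge k l \<alpha> \<beta> (\<lambda>m. v (Transposition.transpose i j m)) = - wedge k l \<alpha> \<beta> v"
    by (intro wedge_transpose)
  moreover have "(\<lambda>m. v (Transposition.transpose i j m)) = v"
    using eq by (auto simp: fun_eq_iff Transposition.transpose_def)
  ultimately show "wedge k l \<alpha> \<beta> v = 0" by simp
qed

text \<open>Only permutations preserving the first \<open>k\<close> indices contribute.\<close>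

lemma wedge_eval:
  assumes \<alpha>: "alternating_form k T \<alpha>" and \<beta>: "alternating_form 2 T \<beta>" and T: "subspace T"
    and v: "\<And>i. i < k + 2 \<Longrightarrow> v i \<in> T"
    and zero: "\<And>i x. i < k \<Longrightarrow> x \<in> T \<Longrightarrow> \<beta> (\<lambda>j. if j = 0 then v i else x) = 0"
  shows "wedge k 2 \<alpha> \<beta> v = \<alpha> v * \<beta> (\<lambda>i. v (k + i))"
proof -
  let ?s = "Transposition.transpose k (Suc k)"
  let ?A = "{\<pi>. \<pi> permutes {..<k}}"
  let ?S = "{\<pi>. \<pi> permutes {..<k + 2}}"
  let ?t = "\<lambda>\<pi>. of_int (sign \<pi>) * \<alpha> (\<lambda>i. v (\<pi> i)) * \<beta> (\<lambda>i. v (\<pi> (k + i)))"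
  let ?c = "\<alpha> v * \<beta> (\<lambda>i. v (k + i))"
  have fin: "finite ?A" "finite ?S" by (auto intro: finite_permutations)
  have sw: "\<beta> (\<lambda>j. u (Transposition.transpose 0 1 j)) = - \<beta> u" if "u 0 \<in> T" "u 1 \<in> T" for u
    by (rule alternating_form_transpose[OF \<beta> T]) (use that less_2_cases in auto)
  have sub: "?A \<subseteq> ?S" by (auto intro: permutes_subset)
  have sA: "(\<lambda>\<pi>. \<pi> \<circ> ?s) ` ?A \<subseteq> ?S"
  proof
    fix p assume "p \<in> (\<lambda>\<pi>. \<pi> \<circ> ?s) ` ?A"
    then obtain \<pi> where "\<pi> permutes {..<k}" "p = \<pi> \<circ> ?s" by blast
    moreover have "?s permutes {..<k + 2}" by (intro permutes_swap_id) auto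
    ultimately show "p \<in> ?S" using sub permutes_compose by blast
  qed
  have disj: "?A \<inter> (\<lambda>\<pi>. \<pi> \<circ> ?s) ` ?A = {}"
  proof -
    have "(\<pi> \<circ> ?s) k \<noteq> k" if "\<pi> permutes {..<k}" for \<pi>
      using permutes_not_in[OF that, of "Suc k"] by simp
    moreover have "\<pi> k = k" if "\<pi> permutes {..<k}" for \<pi>
      using that by (simp add: permutes_not_in)
    ultimately show ?thesis by blast
  qed
  have inj: "inj_on (\<lambda>\<pi>. \<pi> \<circ> ?s) ?A"
    by (rule inj_onI) (metis comp_assoc comp_id transpose_comp_involutory)
  \<comment> \<open>Such a permutation feeds one of the first k vectors into \<beta>, where
    \<open>zero\<close> annihilates it; in the second slot this needs the antisymmetry
    \<open>sw\<close>.\<close>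
  have outside: "?t \<pi> = 0" if \<pi>: "\<pi> permutes {..<k + 2}" "\<pi> \<notin> ?A" "\<pi> \<notin> (\<lambda>\<pi>. \<pi> \<circ> ?s) ` ?A" for \<pi>
  proof -
    have lt: "\<pi> j < k + 2" if "j < k + 2" for j
      using permutes_in_image[OF \<pi>(1), of j] that by simp
    have ne: "\<pi> k \<noteq> \<pi> (Suc k)" using \<pi>(1) by (metis n_not_Suc_n permutes_inj injD)
    have "\<pi> k < k \<or> \<pi> (Suc k) < k"
    proof (rule ccontr)
      assume "\<not> ?thesis"
      then have "\<pi> k \<in> {k, Suc k}" "\<pi> (Suc k) \<in> {k, Suc k}" using lt[of k] lt[of "Suc k"] by auto
      then consider "\<pi> k = k" "\<pi> (Suc k) = Suc k" | "\<pi> k = Suc k" "\<pi> (Suc k) = k" using ne by auto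
      then show False
      proof cases
        case 1
        have "\<pi> permutes {..<k}"
          by (rule permutes_superset[OF \<pi>(1)]) (use 1 in \<open>auto simp: less_Suc_eq\<close>)
        then show False using \<pi> by simp
      next
        case 2
        have "\<pi> \<circ> ?s permutes {..<k + 2}" using \<pi>(1) by (intro permutes_compose permutes_swap_id) auto
        then have "\<pi> \<circ> ?s permutes {..<k}"
          by (rule permutes_superset) (use 2 in \<open>auto simp: less_Suc_eq\<close>)
        moreover have "\<pi> = (\<pi> \<circ> ?s) \<circ> ?s" by (simp add: comp_assoc)
        ultimately show False using \<pi>(3) by blast
      qed
    qed
    then have "\<beta> (\<lambda>i. v (\<pi> (k + i))) = 0"
    proof
      assume a: "\<pi> k < k"
      have "\<beta> (\<lambda>i. v (\<pi> (k + i))) = \<beta> (\<lambda>j. if j = 0 then v (\<pi> k) else v (\<pi> (Suc k)))"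
        by (rule alternating_form_cong[OF \<beta>]) (auto simp: less_2_cases_iff)
      also have "\<dots> = 0" using a lt[of "Suc k"] v by (intro zero) auto
      finally show ?thesis .
    next
      assume a: "\<pi> (Suc k) < k"
      have "\<beta> (\<lambda>i. v (\<pi> (k + i))) = \<beta> (\<lambda>i. (\<lambda>j. if j = 0 then v (\<pi> (Suc k)) else v (\<pi> k)) (Transposition.transpose 0 1 i))"
        by (rule alternating_form_cong[OF \<beta>]) (auto simp: less_2_cases_iff Transposition.transpose_def)
      also have "\<dots> = - \<beta> (\<lambda>j. if j = 0 then v (\<pi> (Suc k)) else v (\<pi> k))"
        using lt[of k] lt[of "Suc k"] v by (intro sw) auto
      also have "\<dots> = 0" using zero[of "\<pi> (Suc k)" "v (\<pi> k)"] a lt[of k] v by auto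
      finally show ?thesis .
    qed
    then show ?thesis by simp
  qed
  have tA: "?t \<pi> = ?c" if \<pi>: "\<pi> permutes {..<k}" for \<pi>
  proof -
    have "\<alpha> (\<lambda>i. v (\<pi> i)) = of_int (sign \<pi>) * \<alpha> v"
      by (rule alternating_form_permute[OF \<alpha> T _ \<pi>]) (use v in auto)
    moreover have "\<pi> (k + i) = k + i" for i using \<pi> by (simp add: permutes_not_in)
    moreover have "of_int (sign \<pi>) * of_int (sign \<pi>) = (1::complex)"
      by (metis of_int_1 of_int_mult sign_idempotent)
    ultimately show ?thesis by (simp add: mult.assoc[symmetric])
  qed
  have tsA: "?t (\<pi> \<circ> ?s) = ?c" if \<pi>: "\<pi> permutes {..<k}" for \<pi>
  proof -
    have "permutation \<pi>" using \<pi> permutes_imp_permutation by blast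
    then have sg: "sign (\<pi> \<circ> ?s) = - sign \<pi>"
      using sign_compose[OF _ permutation_swap_id[of k "Suc k"], of \<pi>] sign_swap_id[of k "Suc k"] by simp
    have "\<alpha> (\<lambda>i. v ((\<pi> \<circ> ?s) i)) = \<alpha> (\<lambda>i. v (\<pi> i))"
      by (rule alternating_form_cong[OF \<alpha>]) (auto simp: Transposition.transpose_def)
    moreover have "\<beta> (\<lambda>i. v ((\<pi> \<circ> ?s) (k + i))) = \<beta> (\<lambda>i. (\<lambda>j. v (\<pi> (k + j))) (Transposition.transpose 0 1 i))"
      by (rule alternating_form_cong[OF \<beta>]) (auto simp: less_2_cases_iff Transposition.transpose_def)
    moreover have "\<beta> (\<lambda>i. (\<lambda>j. v (\<pi> (k + j))) (Transposition.transpose 0 1 i)) = - \<beta> (\<lambda>j. v (\<pi> (k + j)))"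
      using \<pi> v by (intro sw) (auto simp: permutes_not_in)
    ultimately have "?t (\<pi> \<circ> ?s) = ?t \<pi>" unfolding sg by simp
    then show ?thesis using tA[OF \<pi>] by simp
  qed
  \<comment> \<open>The two families, with the last two indices kept or exchanged, have k! members
    each, all of value \<open>?c\<close>. Their total 2 k! is exactly the normalising factor of
    \<open>wedge\<close>.\<close>
  have "sum ?t ?S = sum ?t (?A \<union> (\<lambda>\<pi>. \<pi> \<circ> ?s) ` ?A)"
    by (rule sum.mono_neutral_right) (use fin sub sA outside in auto)
  also have "\<dots> = sum ?t ?A + sum ?t ((\<lambda>\<pi>. \<pi> \<circ> ?s) ` ?A)"
    by (rule sum.union_disjoint) (use fin disj in auto)
  also have "\<dots> = (\<Sum>\<pi>\<in>?A. ?c) + (\<Sum>\<pi>\<in>?A. ?c)"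
    using tA tsA by (simp add: sum.reindex[OF inj])
  also have "\<dots> = 2 * fact k * ?c"
    using card_permutations[of "{..<k}" k] by simp
  finally have "sum ?t ?S = (fact k * fact 2) * ?c" by (simp add: fact_2)
  then show ?thesis unfolding wedge_def by simp
qed

section \<open>The form \<sigma> and its powers\<close>

lemma sigma_add_left: "sigma (x + y) z = sigma x z + sigma y z"
  by (simp add: sigma_def sum.distrib[symmetric] algebra_simps)

lemma sigma_scaleR_left: "sigma (a *\<^sub>R x) z = complex_of_real a * sigma x z"
  by (simp add: sigma_def sum_distrib_left algebra_simps scaleR_conv_of_real[where 'a=complex])

lemma sigma_commute: "sigma x y = - sigma y x"
  by (simp add: sigma_def sum_negf[symmetric])

lemma sigma_self [simp]: "sigma x x = 0"
  by (simp add: sigma_def)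

lemma sigma_cscale_left: "sigma (cscale c x) z = c * sigma x z"
  by (simp add: sigma_def cscale_def sum_distrib_left algebra_simps)

lemma sigma_cscale_right: "sigma z (cscale c x) = c * sigma z x"
  by (simp add: sigma_def cscale_def sum_distrib_left algebra_simps)

lemma bounded_bilinear_sigma: "bounded_bilinear sigma"
proof (rule bilinear_conv_bounded_bilinear[THEN iffD1])
  show "bilinear (sigma :: 'n::finite phase \<Rightarrow> _)"
    unfolding bilinear_def
  proof (intro conjI allI linearI)
    fix x y z :: "'n phase" and r :: real
    show "sigma x (y + z) = sigma x y + sigma x z"
      using sigma_add_left[of y z x] sigma_commute[of x] by simp
    show "sigma x (r *\<^sub>R y) = r *\<^sub>R sigma x y"
      using sigma_scaleR_left[of r y x] sigma_commute[of x] by (simp add: scaleR_conv_of_real)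
    show "sigma (x + y) z = sigma x z + sigma y z" by (rule sigma_add_left)
    show "sigma (r *\<^sub>R x) z = r *\<^sub>R sigma x z" by (simp add: sigma_scaleR_left scaleR_conv_of_real)
  qed
qed

interpretation sigma: bounded_bilinear sigma by (rule bounded_bilinear_sigma)

lemma alternating_sigma: "alternating_form 2 UNIV (\<lambda>v. sigma (v 0) (v 1))"
proof (rule alternating_formI)
  show "sigma (v 0) (v 1) = sigma (w 0) (w 1)" if "\<And>i. i < 2 \<Longrightarrow> v i = w i" for v w :: "nat \<Rightarrow> 'n::finite phase"
    using that by simp
  show "sigma ((v(i := a *\<^sub>R x + b *\<^sub>R y)) 0) ((v(i := a *\<^sub>R x + b *\<^sub>R y)) 1) =
       complex_of_real a * sigma ((v(i := x)) 0) ((v(i := x)) 1) +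
       complex_of_real b * sigma ((v(i := y)) 0) ((v(i := y)) 1)" if "i < 2" for v :: "nat \<Rightarrow> 'n::finite phase" and i x y a b
    using that by (auto simp: less_2_cases_iff sigma.add_left sigma.add_right sigma.scaleR_left
        sigma.scaleR_right scaleR_conv_of_real)
  show "sigma (v 0) (v 1) = 0" if "i < 2" "j < 2" "i \<noteq> j" "v i = v j" for v :: "nat \<Rightarrow> 'n::finite phase" and i j
    using that by (auto simp: less_2_cases_iff)
qed

lemma alternating_sigma_power: "alternating_form (2 * m) UNIV (sigma_power m)"
proof (induction m)
  case 0
  show ?case by (rule alternating_formI) auto
next
  case (Suc m)
  then show ?case using wedge_alternating[OF Suc alternating_sigma] by simp
qed

lemma sigma_power_Suc:
  "sigma_power (Suc m) v = (\<Sum>\<pi> | \<pi> permutes {..<2 * m + 2}.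
      of_int (sign \<pi>) * sigma_power m (\<lambda>i. v (\<pi> i)) * sigma (v (\<pi> (2 * m))) (v (\<pi> (Suc (2 * m))))) / (fact (2 * m) * 2)"
  by (simp add: wedge_def fact_2)

lemma permutes_lt: "\<pi> permutes {..<N} \<Longrightarrow> i < N \<Longrightarrow> \<pi> i < (N::nat)"
  using permutes_in_image[of \<pi> "{..<N}" i] by simp

lemma sigma_power_gram:
  assumes "\<And>i j. i < 2 * m \<Longrightarrow> j < 2 * m \<Longrightarrow> sigma (v i) (v j) = sigma (w i) (w j)"
  shows "sigma_power m v = sigma_power m w"
  using assms
proof (induction m arbitrary: v w)
  case 0
  then show ?case by simp
next
  case (Suc m)
  have "sigma_power m (\<lambda>i. v (\<pi> i)) = sigma_power m (\<lambda>i. w (\<pi> i)) \<and>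
     sigma (v (\<pi> (2 * m))) (v (\<pi> (Suc (2 * m)))) = sigma (w (\<pi> (2 * m))) (w (\<pi> (Suc (2 * m))))"
    if "\<pi> permutes {..<2 * m + 2}" for \<pi>
    using permutes_lt[OF that] Suc.prems by (intro conjI Suc.IH) simp_all
  then show ?case unfolding sigma_power_Suc
    by (intro arg_cong2[where f="(/)"] arg_cong2[where f="(*)"] sum.cong refl) blast+
qed

lemma sigma_power_real:
  assumes "\<And>i j. i < 2 * m \<Longrightarrow> j < 2 * m \<Longrightarrow> sigma (v i) (v j) \<in> \<real>"
  shows "sigma_power m v \<in> \<real>"
  using assms
proof (induction m arbitrary: v)
  case 0
  then show ?case by simp
next
  case (Suc m)
  have "sigma_power m (\<lambda>i. v (\<pi> i)) \<in> \<real>" "sigma (v (\<pi> (2 * m))) (v (\<pi> (Suc (2 * m)))) \<in> \<real>"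
    if "\<pi> permutes {..<2 * m + 2}" for \<pi>
    using permutes_lt[OF that] Suc.prems by (auto intro!: Suc.IH)
  moreover have "(fact (2 * m) :: complex) \<in> \<real>" by (metis Reals_of_nat of_nat_fact)
  ultimately show ?case unfolding sigma_power_Suc
    by (intro Reals_divide Reals_mult sum_in_Reals) auto
qed

lemma Ck_sigma_power:
  assumes "open U" "\<And>i j. i < 2 * m \<Longrightarrow> j < 2 * m \<Longrightarrow> Ck k U (\<lambda>y. sigma (v i y) (v j y))"
  shows "Ck k U (\<lambda>y. sigma_power m (\<lambda>i. v i y))"
  using assms(2)
proof (induction m arbitrary: v)
  case 0
  then show ?case by simp
next
  case (Suc m)
  have "Ck k U (\<lambda>y. sigma_power m (\<lambda>i. v (\<pi> i) y))"
    "Ck k U (\<lambda>y. sigma (v (\<pi> (2 * m)) y) (v (\<pi> (Suc (2 * m))) y))"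
    if "\<pi> permutes {..<2 * m + 2}" for \<pi>
    using permutes_lt[OF that] Suc.prems by (auto intro!: Suc.IH[of "\<lambda>i. v (\<pi> i)"])
  then show ?case unfolding sigma_power_Suc divide_inverse
    by (intro Ck_mult Ck_sum assms(1) Ck_const) auto
qed

text \<open>\<sigma>^m is a polynomial in the pairings of its arguments, so families whose pairings
  agree to first order have values that agree to first order. \<open>ham_divergence\<close> uses
  this to exchange a frame moving along the Hamilton field for one that moves linearly.\<close>

lemma sigma_power_same_derivative:
  fixes v w :: "nat \<Rightarrow> real \<Rightarrow> 'a::finite phase"
  assumes "\<And>i j. i < 2 * m \<Longrightarrow> j < 2 * m \<Longrightarrow>
      \<exists>d. ((\<lambda>t. sigma (v i t) (v j t)) has_vector_derivative d) (at 0) \<and>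
          ((\<lambda>t. sigma (w i t) (w j t)) has_vector_derivative d) (at (0::real))"
    and "\<And>i j. i < 2 * m \<Longrightarrow> j < 2 * m \<Longrightarrow> sigma (v i 0) (v j 0) = sigma (w i 0) (w j 0)"
  shows "\<exists>d. ((\<lambda>t. sigma_power m (\<lambda>i. v i t)) has_vector_derivative d) (at 0) \<and>
             ((\<lambda>t. sigma_power m (\<lambda>i. w i t)) has_vector_derivative d) (at 0)"
  using assms
proof (induction m arbitrary: v w)
  case 0
  then show ?case by (intro exI[of _ 0]) simp
next
  case (Suc m)
  let ?P = "{\<pi>. \<pi> permutes {..<2 * m + 2}}"
  define R where "R \<pi> a b \<longleftrightarrow> ((\<lambda>t. sigma_power m (\<lambda>i. v (\<pi> i) t)) has_vector_derivative a) (at 0) \<and>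
      ((\<lambda>t. sigma_power m (\<lambda>i. w (\<pi> i) t)) has_vector_derivative a) (at 0) \<and>
      ((\<lambda>t. sigma (v (\<pi> (2 * m)) t) (v (\<pi> (Suc (2 * m))) t)) has_vector_derivative b) (at 0) \<and>
      ((\<lambda>t. sigma (w (\<pi> (2 * m)) t) (w (\<pi> (Suc (2 * m))) t)) has_vector_derivative b) (at 0)" for \<pi> a b
  have lt: "\<pi> i < 2 * Suc m" if "i < 2 * Suc m" "\<pi> \<in> ?P" for i \<pi>
    using permutes_lt[of \<pi> "2 * m + 2" i] that by simp
  have e1: "sigma_power m (\<lambda>i. v (\<pi> i) 0) = sigma_power m (\<lambda>i. w (\<pi> i) 0)" if "\<pi> \<in> ?P" for \<pi>
    by (rule sigma_power_gram) (use lt[OF _ that] in \<open>intro Suc.prems(2); simp\<close>)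
  have e2: "sigma (v (\<pi> (2 * m)) 0) (v (\<pi> (Suc (2 * m))) 0) = sigma (w (\<pi> (2 * m)) 0) (w (\<pi> (Suc (2 * m))) 0)"
    if "\<pi> \<in> ?P" for \<pi>
    using Suc.prems(2)[OF lt[OF _ that, of "2 * m"] lt[OF _ that, of "Suc (2 * m)"]] by simp
  have "\<forall>\<pi>\<in>?P. \<exists>a b. R \<pi> a b"
  proof
    fix \<pi> assume \<pi>: "\<pi> \<in> ?P"
    have "\<exists>d. ((\<lambda>t. sigma_power m (\<lambda>i. v (\<pi> i) t)) has_vector_derivative d) (at 0) \<and>
             ((\<lambda>t. sigma_power m (\<lambda>i. w (\<pi> i) t)) has_vector_derivative d) (at 0)"
    proof (rule Suc.IH)
      fix i j assume ij: "i < 2 * m" "j < 2 * m"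
      have ij': "\<pi> i < 2 * Suc m" "\<pi> j < 2 * Suc m" using lt[OF _ \<pi>, of i] lt[OF _ \<pi>, of j] ij by simp_all
      show "\<exists>d. ((\<lambda>t. sigma (v (\<pi> i) t) (v (\<pi> j) t)) has_vector_derivative d) (at 0) \<and>
          ((\<lambda>t. sigma (w (\<pi> i) t) (w (\<pi> j) t)) has_vector_derivative d) (at 0)"
        by (rule Suc.prems(1)[OF ij'])
      show "sigma (v (\<pi> i) 0) (v (\<pi> j) 0) = sigma (w (\<pi> i) 0) (w (\<pi> j) 0)"
        by (rule Suc.prems(2)[OF ij'])
    qed
    moreover have "\<exists>d. ((\<lambda>t. sigma (v (\<pi> (2 * m)) t) (v (\<pi> (Suc (2 * m))) t)) has_vector_derivative d) (at 0) \<and>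
          ((\<lambda>t. sigma (w (\<pi> (2 * m)) t) (w (\<pi> (Suc (2 * m))) t)) has_vector_derivative d) (at 0)"
      by (rule Suc.prems(1)[OF lt[OF _ \<pi>] lt[OF _ \<pi>]]) simp_all
    ultimately show "\<exists>a b. R \<pi> a b" unfolding R_def by blast
  qed
  from bchoice[OF this] obtain a where "\<forall>\<pi>\<in>?P. \<exists>b. R \<pi> (a \<pi>) b" ..
  from bchoice[OF this] obtain b where ab: "\<forall>\<pi>\<in>?P. R \<pi> (a \<pi>) (b \<pi>)" ..
  have der: "((\<lambda>t. sigma_power (Suc m) (\<lambda>i. u i t)) has_vector_derivative
      (\<Sum>\<pi>\<in>?P. of_int (sign \<pi>) * (sigma_power m (\<lambda>i. u (\<pi> i) 0) * b \<pi> +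
      a \<pi> * sigma (u (\<pi> (2 * m)) 0) (u (\<pi> (Suc (2 * m))) 0))) * inverse (fact (2 * m) * 2)) (at 0)"
    if 1: "\<And>\<pi>. \<pi> \<in> ?P \<Longrightarrow> ((\<lambda>t. sigma_power m (\<lambda>i. u (\<pi> i) t)) has_vector_derivative a \<pi>) (at 0)"
      and 2: "\<And>\<pi>. \<pi> \<in> ?P \<Longrightarrow> ((\<lambda>t. sigma (u (\<pi> (2 * m)) t) (u (\<pi> (Suc (2 * m))) t)) has_vector_derivative b \<pi>) (at 0)"
    for u :: "nat \<Rightarrow> real \<Rightarrow> 'a phase"
    unfolding sigma_power_Suc divide_inverse mult.assoc
    by (intro has_vector_derivative_mult_left has_vector_derivative_sum has_vector_derivative_mult_right
      has_vector_derivative_mult 1 2)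
  have A: "((\<lambda>t. sigma_power (Suc m) (\<lambda>i. v i t)) has_vector_derivative
      (\<Sum>\<pi>\<in>?P. of_int (sign \<pi>) * (sigma_power m (\<lambda>i. v (\<pi> i) 0) * b \<pi> +
      a \<pi> * sigma (v (\<pi> (2 * m)) 0) (v (\<pi> (Suc (2 * m))) 0))) * inverse (fact (2 * m) * 2)) (at 0)"
    by (rule der) (use ab in \<open>simp_all add: R_def\<close>)
  have B: "((\<lambda>t. sigma_power (Suc m) (\<lambda>i. w i t)) has_vector_derivative
      (\<Sum>\<pi>\<in>?P. of_int (sign \<pi>) * (sigma_power m (\<lambda>i. w (\<pi> i) 0) * b \<pi> +
      a \<pi> * sigma (w (\<pi> (2 * m)) 0) (w (\<pi> (Suc (2 * m))) 0))) * inverse (fact (2 * m) * 2)) (at 0)"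
    by (rule der) (use ab in \<open>simp_all add: R_def\<close>)
  have E: "(\<Sum>\<pi>\<in>?P. of_int (sign \<pi>) * (sigma_power m (\<lambda>i. v (\<pi> i) 0) * b \<pi> +
      a \<pi> * sigma (v (\<pi> (2 * m)) 0) (v (\<pi> (Suc (2 * m))) 0))) =
      (\<Sum>\<pi>\<in>?P. of_int (sign \<pi>) * (sigma_power m (\<lambda>i. w (\<pi> i) 0) * b \<pi> +
      a \<pi> * sigma (w (\<pi> (2 * m)) 0) (w (\<pi> (Suc (2 * m))) 0)))"
    by (intro sum.cong refl) (simp only: e1 e2)
  show ?case using A[unfolded E] B by (intro exI conjI)
qed

text \<open>\<open>alternating_form\<close> records linearity over the reals only. Here the complex
  homogeneity of \<sigma>^m is recovered: every permutation meets each index once, so all scalars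
  come out as one product.\<close>

lemma sigma_power_cscale:
  "sigma_power m (\<lambda>i. cscale (c i) (v i)) = (\<Prod>i<2 * m. c i) * sigma_power m v"
proof (induction m arbitrary: c v)
  case 0
  then show ?case by simp
next
  case (Suc m)
  have "sigma_power m (\<lambda>i. cscale (c (\<pi> i)) (v (\<pi> i))) *
      sigma (cscale (c (\<pi> (2 * m))) (v (\<pi> (2 * m)))) (cscale (c (\<pi> (Suc (2 * m)))) (v (\<pi> (Suc (2 * m))))) =
      (\<Prod>i<2 * Suc m. c i) * (sigma_power m (\<lambda>i. v (\<pi> i)) * sigma (v (\<pi> (2 * m))) (v (\<pi> (Suc (2 * m)))))"
    if \<pi>: "\<pi> permutes {..<2 * m + 2}" for \<pi>
  proof -
    have "(\<Prod>i<2 * m + 2. c i) = (\<Prod>i<2 * m + 2. c (\<pi> i))"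
      using prod.permute[OF \<pi>, of c] by (simp add: o_def)
    also have "\<dots> = (\<Prod>i<2 * m. c (\<pi> i)) * c (\<pi> (2 * m)) * c (\<pi> (Suc (2 * m)))"
      by simp
    finally show ?thesis
      using Suc.IH[of "\<lambda>i. c (\<pi> i)" "\<lambda>i. v (\<pi> i)"] by (simp add: sigma_cscale_left sigma_cscale_right)
  qed
  then have "(\<Sum>\<pi> | \<pi> permutes {..<2 * m + 2}. of_int (sign \<pi>) * sigma_power m (\<lambda>i. cscale (c (\<pi> i)) (v (\<pi> i))) *
      sigma (cscale (c (\<pi> (2 * m))) (v (\<pi> (2 * m)))) (cscale (c (\<pi> (Suc (2 * m)))) (v (\<pi> (Suc (2 * m)))))) =
     (\<Sum>\<pi> | \<pi> permutes {..<2 * m + 2}. (\<Prod>i<2 * Suc m. c i) * (of_int (sign \<pi>) * sigma_power m (\<lambda>i. v (\<pi> i)) *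
        sigma (v (\<pi> (2 * m))) (v (\<pi> (Suc (2 * m))))))"
    by (intro sum.cong refl) (simp only: mem_Collect_eq mult.assoc mult.left_commute)
  then show ?case unfolding sigma_power_Suc by (simp only: sum_distrib_left times_divide_eq_right)
qed

subsection \<open>Non-degeneracy\<close>

text \<open>The pairing matrix of a symplectic basis whose dual vectors stand next to each other, at
  positions 2j and 2j + 1.\<close>

definition std_symplectic :: "nat \<Rightarrow> nat \<Rightarrow> complex" where
  "std_symplectic a b = (if even a \<and> b = Suc a then 1 else if even b \<and> a = Suc b then -1 else 0)"

lemma std_symplectic_alt: "std_symplectic a b = (if a div 2 = b div 2 then
    (if even a \<and> odd b then 1 else if odd a \<and> even b then -1 else 0) else 0)"
proof -
  have e1: "even a \<and> b = Suc a \<longleftrightarrow> a div 2 = b div 2 \<and> even a \<and> odd b" by presburger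
  have e2: "even b \<and> a = Suc b \<longleftrightarrow> a div 2 = b div 2 \<and> odd a \<and> even b" by presburger
  show ?thesis unfolding std_symplectic_def e1 e2 by auto
qed

text \<open>\<tau> exchanges the whole j-th pair with the m-th pair. It is the identity or a product
  of two transpositions, hence even, and it respects the pairing.\<close>

lemma std_symplectic_perm:
  fixes m j :: nat
  defines "\<tau> \<equiv> Transposition.transpose (2 * j) (2 * m) \<circ> Transposition.transpose (Suc (2 * j)) (Suc (2 * m))"
  assumes "j \<le> m"
  shows "std_symplectic (\<tau> a) (\<tau> b) = std_symplectic a b"
    and "\<tau> (2 * j) = 2 * m" and "\<tau> (Suc (2 * j)) = Suc (2 * m)" and "sign \<tau> = 1"
    and "\<tau> permutes {..<2 * m + 2}" and "\<tau> (\<tau> x) = x"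
proof -
  have t: "\<tau> x = (if x = 2 * j then 2 * m else if x = 2 * m then 2 * j else if x = Suc (2 * j) then Suc (2 * m)
     else if x = Suc (2 * m) then Suc (2 * j) else x)" for x
    unfolding \<tau>_def by (auto simp: Transposition.transpose_def)
  show "\<tau> (2 * j) = 2 * m" unfolding t by simp
  show "\<tau> (Suc (2 * j)) = Suc (2 * m)" unfolding t by (simp, presburger)
  show "\<tau> (\<tau> x) = x" unfolding t by auto
  show "sign \<tau> = 1" unfolding \<tau>_def
    by (cases "j = m") (simp_all add: sign_compose permutation_swap_id sign_swap_id)
  show "\<tau> permutes {..<2 * m + 2}" unfolding \<tau>_def using assms(2)
    by (intro permutes_compose permutes_swap_id) auto
  have q: "x = 2 * i \<longleftrightarrow> even x \<and> x div 2 = i" "x = Suc (2 * i) \<longleftrightarrow> odd x \<and> x div 2 = i" for x i :: nat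
    by presburger+
  have d1: "\<tau> x div 2 = Transposition.transpose j m (x div 2)" for x
    unfolding t by (cases "even x") (simp_all add: q Transposition.transpose_def)
  have d2: "even (\<tau> x) = even x" for x
    unfolding t by (cases "even x") (simp_all add: q)
  have inj: "Transposition.transpose j m x = Transposition.transpose j m y \<longleftrightarrow> x = y" for x y
    by (metis transpose_involutory)
  show "std_symplectic (\<tau> a) (\<tau> b) = std_symplectic a b"
    unfolding std_symplectic_alt d1 d2 inj ..
qed

text \<open>Every permutation contributing to \<open>\<sigma>\<^sup>m\<close> on a symplectic basis preserves the pairing up to
  transpositions, and then contributes with a positive sign.\<close>

lemma sigma_power_std:
  "\<exists>C>0. \<forall>v :: nat \<Rightarrow> 'n::finite phase.
     (\<forall>a<2 * m. \<forall>b<2 * m. sigma (v a) (v b) = std_symplectic a b) \<longrightarrow> sigma_power m v = complex_of_real C"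
proof (induction m)
  case 0
  show ?case by (intro exI[of _ 1]) simp
next
  case (Suc m)
  then obtain C where C: "C > 0" "\<And>v :: nat \<Rightarrow> 'n phase.
     (\<And>a b. a < 2 * m \<Longrightarrow> b < 2 * m \<Longrightarrow> sigma (v a) (v b) = std_symplectic a b) \<Longrightarrow> sigma_power m v = complex_of_real C"
    by blast
  let ?P = "{\<pi>. \<pi> permutes {..<2 * m + 2}}"
  let ?Q = "{\<pi> \<in> ?P. std_symplectic (\<pi> (2 * m)) (\<pi> (Suc (2 * m))) \<noteq> 0}"
  have fin: "finite ?P" by (intro finite_permutations) simp
  have key: "of_int (sign \<pi>) * sigma_power m (\<lambda>i. v (\<pi> i)) * sigma (v (\<pi> (2 * m))) (v (\<pi> (Suc (2 * m)))) =
      complex_of_real C"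
    if v: "\<And>a b. a < 2 * m + 2 \<Longrightarrow> b < 2 * m + 2 \<Longrightarrow> sigma (v a) (v b) = std_symplectic a b"
      and \<pi>: "\<pi> permutes {..<2 * m + 2}" and nz: "std_symplectic (\<pi> (2 * m)) (\<pi> (Suc (2 * m))) \<noteq> 0"
    for v :: "nat \<Rightarrow> 'n phase" and \<pi>
  proof -
    let ?J = "std_symplectic (\<pi> (2 * m)) (\<pi> (Suc (2 * m)))"
    let ?s = "Transposition.transpose (2 * m) (Suc (2 * m))"
    have lt: "\<pi> i < 2 * m + 2" if "i < 2 * m + 2" for i by (rule permutes_lt[OF \<pi> that])
    \<comment> \<open>A nonzero pairing means that the last two slots hold the j-th pair, in order
      or reversed. The permutation t undoes a reversal, and its sign is the value of the
      pairing.\<close>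
    obtain j t where jt: "j \<le> m" "t permutes {..<2 * m + 2}" "\<And>x. t (t x) = x" "of_int (sign t) = ?J"
      "\<And>x. x < 2 * m \<Longrightarrow> t x = x" 
      "\<pi> (2 * m) = 2 * j \<and> \<pi> (Suc (2 * m)) = Suc (2 * j) \<and> t = id \<or>
       \<pi> (2 * m) = Suc (2 * j) \<and> \<pi> (Suc (2 * m)) = 2 * j \<and> t = ?s"
    proof (cases "even (\<pi> (2 * m))")
      case True
      then obtain j where j: "\<pi> (2 * m) = 2 * j" by (auto elim: evenE)
      then have "\<pi> (Suc (2 * m)) = Suc (2 * j)" using nz
        by (auto simp: std_symplectic_def split: if_splits) (metis even_Suc dvd_triv_left)
      then show ?thesis using j lt[of "2 * m"] by (intro that[of j id]) (simp_all add: permutes_id std_symplectic_def)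
    next
      case False
      then have "even (\<pi> (Suc (2 * m)))" "\<pi> (2 * m) = Suc (\<pi> (Suc (2 * m)))"
        using nz by (auto simp: std_symplectic_def split: if_splits)
      then obtain j where j: "\<pi> (Suc (2 * m)) = 2 * j" "\<pi> (2 * m) = Suc (2 * j)" by (metis evenE)
      then show ?thesis using lt[of "Suc (2 * m)"]
        by (intro that[of j ?s]) (auto simp: permutes_swap_id std_symplectic_def sign_swap_id)
    qed
    define \<tau> where "\<tau> = Transposition.transpose (2 * j) (2 * m) \<circ> Transposition.transpose (Suc (2 * j)) (Suc (2 * m))"
    note \<tau> = std_symplectic_perm[OF jt(1), folded \<tau>_def]
    \<comment> \<open>After \<tau> and t the last two indices are fixed. What remains permutes the
      first 2m indices, so the induction hypothesis applies to the basis reordered by \<tau> and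
      t.\<close>
    let ?\<pi> = "t \<circ> (\<tau> \<circ> \<pi>)"
    have p0: "?\<pi> permutes {..<2 * m + 2}"
      by (intro permutes_compose \<pi> \<tau> jt)
    have p: "?\<pi> permutes {..<2 * m}"
    proof (rule permutes_superset[OF p0])
      fix x assume "x \<in> {..<2 * m + 2} - {..<2 * m}"
      then have "x = 2 * m \<or> x = Suc (2 * m)" by auto
      then show "?\<pi> x = x" using jt(6) \<tau>(2,3) by auto
    qed
    let ?v = "\<lambda>i. v (\<tau> (t i))"
    have "permutation t" "permutation \<tau>" "permutation \<pi>"
      using permutes_imp_permutation[of "{..<2 * m + 2}"] jt(2) \<tau>(5) \<pi> by auto
    then have sg: "sign ?\<pi> = sign t * sign \<pi>"
      by (simp add: sign_compose permutation_compose \<tau>(4))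
    have "(\<lambda>i. v (\<pi> i)) = (\<lambda>i. ?v (?\<pi> i))" by (simp add: jt(3) \<tau>(6))
    then have "sigma_power m (\<lambda>i. v (\<pi> i)) = of_int (sign ?\<pi>) * sigma_power m ?v"
      using alternating_form_permute[OF alternating_sigma_power subspace_UNIV _ p, of ?v] by simp
    also have "sigma_power m ?v = complex_of_real C"
    proof (rule C(2))
      fix a b assume ab: "a < 2 * m" "b < 2 * m"
      have lt\<tau>: "\<tau> x < 2 * m + 2" if "x < 2 * m" for x using permutes_lt[OF \<tau>(5), of x] that by simp
      show "sigma (?v a) (?v b) = std_symplectic a b"
        using v[OF lt\<tau>[OF ab(1)] lt\<tau>[OF ab(2)]] \<tau>(1) jt(5) ab by simp
    qed
    finally have "sigma_power m (\<lambda>i. v (\<pi> i)) = of_int (sign t * sign \<pi>) * complex_of_real C"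
      unfolding sg .
    moreover have "sigma (v (\<pi> (2 * m))) (v (\<pi> (Suc (2 * m)))) = of_int (sign t)"
      using v[OF lt lt, of "2 * m" "Suc (2 * m)"] jt(4) by simp
    moreover have "of_int (sign \<pi>) * (of_int (sign t * sign \<pi>) * c) * of_int (sign t) = (c::complex)" for c
      by (cases t rule: sign_cases; cases \<pi> rule: sign_cases) simp_all
    ultimately show ?thesis by (simp only:)
  qed
  \<comment> \<open>All contributions equal C; the identity shows that there is at least one, so the
    total is positive.\<close>
  have "id \<in> ?Q" by (simp add: permutes_id std_symplectic_def)
  then have "?Q \<noteq> {}" by blast
  then have card: "card ?Q > 0" using fin by (simp only: card_gt_0_iff) simp
  show ?case
  proof (intro exI[of _ "real (card ?Q) * C / (fact (2 * m) * 2)"] conjI allI impI)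
    show "0 < real (card ?Q) * C / (fact (2 * m) * 2)" using card C(1) by simp
    fix v :: "nat \<Rightarrow> 'n phase"
    assume v: "\<forall>a<2 * Suc m. \<forall>b<2 * Suc m. sigma (v a) (v b) = std_symplectic a b"
    have v': "sigma (v a) (v b) = std_symplectic a b" if "a < 2 * m + 2" "b < 2 * m + 2" for a b
      using v that by simp
    let ?t = "\<lambda>\<pi>. of_int (sign \<pi>) * sigma_power m (\<lambda>i. v (\<pi> i)) * sigma (v (\<pi> (2 * m))) (v (\<pi> (Suc (2 * m))))"
    have "sum ?t ?P = sum ?t ?Q"
    proof (rule sum.mono_neutral_right[OF fin])
      show "\<forall>\<pi>\<in>?P - ?Q. ?t \<pi> = 0"
      proof
        fix \<pi> assume "\<pi> \<in> ?P - ?Q"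
        then have "\<pi> permutes {..<2 * m + 2}" "std_symplectic (\<pi> (2 * m)) (\<pi> (Suc (2 * m))) = 0" by auto
        then have "sigma (v (\<pi> (2 * m))) (v (\<pi> (Suc (2 * m)))) = 0"
          using v' permutes_lt[of \<pi> "2 * m + 2" "2 * m"] permutes_lt[of \<pi> "2 * m + 2" "Suc (2 * m)"] by simp
        then show "?t \<pi> = 0" by simp
      qed
    qed auto
    also have "\<dots> = (\<Sum>\<pi>\<in>?Q. complex_of_real C)"
      by (rule sum.cong[OF refl]) (use key[OF v'] in blast)
    finally show "sigma_power (Suc m) v = complex_of_real (real (card ?Q) * C / (fact (2 * m) * 2))"
      unfolding sigma_power_Suc by simp
  qed
qed

text \<open>One fixed enumeration of each finite type translates between sequences of vectors, on
  which forms act, and coordinates of \<open>real^'m\<close>. The type \<open>'n bit0\<close> has 2n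
  elements, so \<open>real^('n bit0)\<close> serves as the space of dimension 2n.\<close>

definition ix :: "nat \<Rightarrow> 'm::finite" where
  "ix = (SOME h. bij_betw h {..<CARD('m)} UNIV)"

lemma bij_ix: "bij_betw ix {..<CARD('m)} (UNIV :: 'm::finite set)"
proof -
  have "\<exists>h. bij_betw h {..<CARD('m)} (UNIV :: 'm::finite set)"
    using ex_bij_betw_nat_finite[of "UNIV :: 'm set"] by (simp add: atLeast0LessThan)
  then show ?thesis unfolding ix_def by (rule someI_ex)
qed

lemma bij_ix2: "bij_betw ix {..<2 * CARD('n)} (UNIV :: ('n::finite) bit0 set)"
  using bij_ix[where 'm="'n bit0"] by simp

lemma linear_cscale: "linear (cscale c)"
  by (rule linearI) (simp_all add: cscale_def prod_eq_iff vec_eq_iff algebra_simps)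

lemma cscale_span:
  assumes "x \<in> span S" "\<And>s. s \<in> S \<Longrightarrow> cscale c s \<in> span S"
  shows "cscale c x \<in> span S"
proof -
  have "cscale c ` span S = span (cscale c ` S)" by (rule linear_span_image[OF linear_cscale, symmetric])
  also have "\<dots> \<subseteq> span S" using assms(2) by (intro span_minimal) auto
  finally show ?thesis using assms(1) by blast
qed

text \<open>A real subspace of dimension \<open>2n\<close> on which \<open>\<sigma>\<close> is real and non-degenerate is totally real,
  so that a real basis of it is a complex basis of the phase space.\<close>

lemma sigma_power_nonzero:
  fixes D :: "real^('n::finite bit0) \<Rightarrow> 'n phase"
  assumes D: "linear D" and real: "\<And>u w. sigma (D u) (D w) \<in> \<real>"
    and nondeg: "\<And>u. (\<And>w. sigma (D u) (D w) = 0) \<Longrightarrow> u = 0"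
  shows "sigma_power CARD('n) (\<lambda>i. D (axis (ix i) 1)) \<noteq> 0"
proof
  assume zero: "sigma_power CARD('n) (\<lambda>i. D (axis (ix i) 1)) = 0"
  \<comment> \<open>F is the complexification of D. It is injective since \<sigma> is real on the
    range of D: pairing \<open>F p\<close> with \<open>D w\<close> splits into real and imaginary
    parts, and non-degeneracy kills both. By dimension F is onto.\<close>
  define F where "F p = D (fst p) + cscale \<i> (D (snd p))" for p :: "(real^('n bit0)) \<times> (real^('n bit0))"
  have linF: "linear F"
    unfolding F_def
    by (intro linear_compose_add linear_compose[OF linear_fst D, unfolded o_def]
      linear_compose[OF linear_compose[OF linear_snd D] linear_cscale, unfolded o_def])
  have "inj F"
  proof (rule linear_injective_0[OF linF, THEN iffD2], intro allI impI)
    fix p assume p: "F p = 0"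
    have "sigma (D (fst p)) (D w) = 0 \<and> sigma (D (snd p)) (D w) = 0" for w
    proof -
      have "sigma (D (fst p)) (D w) + \<i> * sigma (D (snd p)) (D w) = sigma (F p) (D w)"
        unfolding F_def by (simp add: sigma.add_left sigma_cscale_left)
      also have "\<dots> = 0" unfolding p by (rule sigma.zero_left)
      finally have e: "sigma (D (fst p)) (D w) + \<i> * sigma (D (snd p)) (D w) = 0" .
      obtain a b where "sigma (D (fst p)) (D w) = of_real a" "sigma (D (snd p)) (D w) = of_real b"
        using real by (meson Reals_cases)
      then show ?thesis using e by (simp add: complex_eq_iff)
    qed
    then have "fst p = 0" "snd p = 0" using nondeg by blast+
    then show "p = 0" by (simp add: prod_eq_iff)
  qed
  then have "dim (range F) = DIM('n phase)"
    using dim_image_eq[OF linF, of UNIV] by (simp add: dim_UNIV)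
  moreover have "subspace (range F)" using linear_subspace_image[OF linF subspace_UNIV] .
  ultimately have surjF: "range F = UNIV"
    by (metis dim_eq_full span_eq_iff)
  \<comment> \<open>Because F is onto, the complex multiples of the frame span the phase space over
    the reals.\<close>
  define S where "S = {cscale c (D (axis k 1)) |c k. True}"
  have D_span: "D u \<in> span S" for u
  proof -
    have "D u = D (\<Sum>k\<in>UNIV. (u $ k) *\<^sub>R axis k 1)" 
      using basis_expansion[of u] by (simp add: scalar_mult_eq_scaleR)
    also have "\<dots> = (\<Sum>k\<in>UNIV. (u $ k) *\<^sub>R D (axis k 1))"
      by (simp add: linear_sum[OF D] linear_cmul[OF D])
    also have "\<dots> \<in> span S"
    proof (intro span_sum span_scale span_base)
      fix k show "D (axis k 1) \<in> S" unfolding S_def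
        by (rule CollectI, rule exI[of _ 1], rule exI[of _ k]) (simp add: cscale_def)
    qed
    finally show ?thesis .
  qed
  have S_span: "x \<in> span S" for x
  proof -
    obtain p where "x = F p" using surjF[THEN equalityD2] by blast
    moreover have "cscale \<i> (D (snd p)) \<in> span S"
    proof (rule cscale_span[OF D_span])
      fix s assume "s \<in> S"
      then obtain c k where "s = cscale c (D (axis k 1))" unfolding S_def by blast
      then have "cscale \<i> s = cscale (\<i> * c) (D (axis k 1))" by (simp add: cscale_def vector_smult_assoc)
      then show "cscale \<i> s \<in> span S" by (intro span_base) (auto simp: S_def)
    qed
    ultimately show ?thesis unfolding F_def by (simp add: span_add D_span)
  qed
  \<comment> \<open>For arguments from S the complex factors come out. A repeated frame vector gives
    0, and otherwise the arguments are a permutation of the frame, where \<sigma>^n is assumed to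
    vanish.\<close>
  have vanish: "sigma_power CARD('n) u = 0" if u: "\<And>i. i < 2 * CARD('n) \<Longrightarrow> u i \<in> S" for u
  proof -
    have "\<forall>i. \<exists>c k. i < 2 * CARD('n) \<longrightarrow> u i = cscale c (D (axis k 1))"
      using u unfolding S_def by blast
    then obtain c k where ck: "\<And>i. i < 2 * CARD('n) \<Longrightarrow> u i = cscale (c i) (D (axis (k i) 1))" by metis
    have "sigma_power CARD('n) u = sigma_power CARD('n) (\<lambda>i. cscale (c i) (D (axis (k i) 1)))"
      by (rule alternating_form_cong[OF alternating_sigma_power]) (rule ck)
    also have "\<dots> = (\<Prod>i<2 * CARD('n). c i) * sigma_power CARD('n) (\<lambda>i. D (axis (k i) 1))"
      by (rule sigma_power_cscale)
    also have "sigma_power CARD('n) (\<lambda>i. D (axis (k i) 1)) = 0"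
    proof (cases "inj_on k {..<2 * CARD('n)}")
      case False
      then obtain i j where ij: "i < 2 * CARD('n)" "j < 2 * CARD('n)" "i \<noteq> j" "k i = k j"
        by (auto simp: inj_on_def)
      show ?thesis
        by (rule alternating_form_eq_0[OF alternating_sigma_power _ ij(1,2,3)]) (simp_all add: ij)
    next
      case True
      let ?I = "{..<2 * CARD('n)}"
      let ?g = "inv_into ?I (ix :: nat \<Rightarrow> 'n bit0)"
      define \<pi> where "\<pi> i = (if i < 2 * CARD('n) then ?g (k i) else i)" for i
      have bg: "bij_betw ?g UNIV ?I" by (rule bij_betw_inv_into[OF bij_ix2])
      have inj: "inj_on \<pi> ?I"
      proof (rule inj_onI)
        fix x y assume xy: "x \<in> ?I" "y \<in> ?I" "\<pi> x = \<pi> y"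
        then have "?g (k x) = ?g (k y)" by (simp add: \<pi>_def)
        then have "k x = k y" using bg by (metis bij_betw_imp_inj_on injD)
        then show "x = y" using True xy by (simp add: inj_on_def)
      qed
      have sub: "\<pi> ` ?I \<subseteq> ?I" using bij_betwE[OF bg] by (auto simp: \<pi>_def)
      have "\<pi> ` ?I = ?I" by (rule endo_inj_surj[OF _ sub inj]) simp
      then have p: "\<pi> permutes ?I"
        using inj by (intro bij_imp_permutes) (auto simp: bij_betw_def \<pi>_def)
      have "ix (\<pi> i) = k i" if "i < 2 * CARD('n)" for i
        using that bij_betw_inv_into_right[OF bij_ix2, of "k i"] by (simp add: \<pi>_def)
      then have "sigma_power CARD('n) (\<lambda>i. D (axis (k i) 1)) = sigma_power CARD('n) (\<lambda>i. D (axis (ix (\<pi> i)) 1))"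
        by (intro alternating_form_cong[OF alternating_sigma_power]) simp
      also have "\<dots> = of_int (sign \<pi>) * sigma_power CARD('n) (\<lambda>i. D (axis (ix i) 1))"
        by (rule alternating_form_permute[OF alternating_sigma_power subspace_UNIV _ p, of "\<lambda>i. D (axis (ix i) 1)"]) simp
      finally show ?thesis using zero by simp
    qed
    finally show ?thesis by simp
  qed
  obtain C where C: "C > 0" "\<And>v :: nat \<Rightarrow> 'n phase.
     (\<And>a b. a < 2 * CARD('n) \<Longrightarrow> b < 2 * CARD('n) \<Longrightarrow> sigma (v a) (v b) = std_symplectic a b) \<Longrightarrow>
     sigma_power CARD('n) v = complex_of_real C"
    using sigma_power_std[of "CARD('n)", where 'n='n] by blast
  let ?k = "\<lambda>a. (ix :: nat \<Rightarrow> 'n) (a div 2)"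
  \<comment> \<open>The standard symplectic basis, on which \<sigma>^n is positive by
    \<open>sigma_power_std\<close>. The \<xi>-vector precedes its x-vector so that their pairing is
    +1.\<close>
  define e :: "nat \<Rightarrow> 'n phase" where "e a = (if even a then (0, axis (?k a) 1) else (axis (?k a) 1, 0))" for a
  have keq: "?k a = ?k b \<longleftrightarrow> a div 2 = b div 2" if "a < 2 * CARD('n)" "b < 2 * CARD('n)" for a b
  proof -
    have "a div 2 \<in> {..<CARD('n)}" "b div 2 \<in> {..<CARD('n)}" using that by auto
    then show ?thesis using bij_ix[where 'm='n] by (metis bij_betw_imp_inj_on inj_onD)
  qed
  have "sigma_power CARD('n) e = complex_of_real C"
  proof (rule C(2))
    fix a b assume ab: "a < 2 * CARD('n)" "b < 2 * CARD('n)"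
    have ax: "(\<Sum>j\<in>UNIV. axis p (1::complex) $ j * axis q 1 $ j) = (if p = q then 1 else 0)" for p q :: 'n
      by (simp add: axis_def if_distrib[of "\<lambda>x. x * _"] cong: if_cong)
    have "sigma (e a) (e b) = (if even a \<and> odd b then (if ?k a = ?k b then 1 else 0) else
       if odd a \<and> even b then - (if ?k b = ?k a then 1 else 0) else 0)"
      unfolding e_def sigma_def by (cases "even a"; cases "even b") (simp_all add: sum_negf ax)
    also have "\<dots> = std_symplectic a b"
      unfolding keq[OF ab] keq[OF ab(2) ab(1)] std_symplectic_alt by auto
    finally show "sigma (e a) (e b) = std_symplectic a b" .
  qed
  moreover have "sigma_power CARD('n) e = 0"
    by (rule alternating_form_vanish[OF alternating_sigma_power vanish]) (auto simp: S_span)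
  ultimately show False using C(1) by simp
qed

section \<open>Holomorphic functions on phase space\<close>

lemma cscale_linear_left: "linear (\<lambda>c. cscale c v)"
  by (rule linearI) (simp_all add: cscale_def prod_eq_iff vec_eq_iff algebra_simps)

lemma phase_holomorphic_has_derivative:
  assumes "phase_holomorphic_on p \<Omega>" "z \<in> \<Omega>"
  shows "(p has_derivative frechet_derivative p (at z)) (at z)"
    and "frechet_derivative p (at z) (cscale c v) = c * frechet_derivative p (at z) v"
proof -
  obtain D where D: "(p has_derivative D) (at z)" "\<And>c v. D (cscale c v) = c * D v"
    using assms unfolding phase_holomorphic_on_def by blast
  have e: "D = frechet_derivative p (at z)" by (rule frechet_derivative_at[OF D(1)])
  show "(p has_derivative frechet_derivative p (at z)) (at z)" using D(1) unfolding e .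
  show "frechet_derivative p (at z) (cscale c v) = c * frechet_derivative p (at z) v" using D(2) unfolding e .
qed

text \<open>The Cauchy kernel for the first derivative at z, on the circle of radius r in the
  complex line through z in direction v, parametrised by t in [0, 1].\<close>

definition circ_integrand :: "('n::finite phase \<Rightarrow> complex) \<Rightarrow> 'n phase \<Rightarrow> real \<Rightarrow> 'n phase \<Rightarrow> real \<Rightarrow> complex" where
  "circ_integrand p v r z t = p (z + cscale (of_real r * exp (2 * of_real pi * \<i> * of_real t)) v) *
     (exp (- (2 * of_real pi * \<i> * of_real t)) / of_real r)"

text \<open>\<open>phase_holomorphic_on\<close> only grants a derivative at each point. As an
  integral over values of p the derivative becomes continuous in z, then holomorphic itself, and
  iteration yields all classes \<open>Ck\<close>.\<close>

lemma phase_Cauchy_derivative: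
  fixes p :: "'n::finite phase \<Rightarrow> complex"
  assumes \<Omega>: "open \<Omega>" and p: "phase_holomorphic_on p \<Omega>"
    and r: "r > 0" and sub: "\<And>c. norm c \<le> r \<Longrightarrow> z + cscale c v \<in> \<Omega>"
  shows "(circ_integrand p v r z has_integral frechet_derivative p (at z) v) {0..1}"
proof -
  define F where "F c = p (z + cscale c v)" for c
  have dF: "(F has_field_derivative frechet_derivative p (at (z + cscale c v)) v) (at c)" if "norm c \<le> r" for c
  proof -
    have "((\<lambda>c. z + cscale c v) has_derivative (\<lambda>c. cscale c v)) (at c)"
      using linear_imp_has_derivative[OF cscale_linear_left, of v "at c"]
      by (auto intro!: derivative_eq_intros)
    from diff_chain_at[OF this phase_holomorphic_has_derivative(1)[OF p sub[OF that]]]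
    show ?thesis unfolding has_field_derivative_def F_def o_def
      by (simp add: phase_holomorphic_has_derivative(2)[OF p sub[OF that]] mult_commute_abs)
  qed
  have hol: "F holomorphic_on ball 0 r"
  proof (rule holomorphic_onI)
    fix x :: complex assume "x \<in> ball 0 r"
    then have "norm x \<le> r" by simp
    from dF[OF this] show "F field_differentiable (at x within ball 0 r)"
      using field_differentiable_at_within field_differentiable_def by blast
  qed
  have cont: "continuous_on (cball 0 r) F"
  proof (rule continuous_at_imp_continuous_on, rule ballI)
    fix x :: complex assume "x \<in> cball 0 r"
    then have "norm x \<le> r" by simp
    from DERIV_isCont[OF dF[OF this]] show "isCont F x" .
  qed
  have "((\<lambda>u. F u / (u - 0)\<^sup>2) has_contour_integral (2 * of_real pi * \<i>) * deriv F 0) (circlepath 0 r)"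
    using Cauchy_has_contour_integral_higher_derivative_circlepath[OF cont hol, of 0 1] r
    by (simp add: numeral_2_eq_2)
  moreover have "deriv F 0 = frechet_derivative p (at z) v"
    using DERIV_imp_deriv[OF dF[of 0]] r by (simp add: cscale_def zero_prod_def[symmetric])
  ultimately have "((\<lambda>u. F u / u\<^sup>2) has_contour_integral (2 * of_real pi * \<i>) * frechet_derivative p (at z) v) (circlepath 0 r)"
    by simp
  then have "((\<lambda>t. F (circlepath 0 r t) / (circlepath 0 r t)\<^sup>2 * vector_derivative (circlepath 0 r) (at t))
     has_integral (2 * of_real pi * \<i>) * frechet_derivative p (at z) v) {0..1}"
    by (simp add: has_contour_integral)
  then have "((\<lambda>t. 1 / (2 * of_real pi * \<i>) * (F (circlepath 0 r t) / (circlepath 0 r t)\<^sup>2 * vector_derivative (circlepath 0 r) (at t)))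
     has_integral 1 / (2 * of_real pi * \<i>) * ((2 * of_real pi * \<i>) * frechet_derivative p (at z) v)) {0..1}"
    by (rule has_integral_mult_right)
  moreover have "1 / (2 * of_real pi * \<i>) * (F (circlepath 0 r t) / (circlepath 0 r t)\<^sup>2 * vector_derivative (circlepath 0 r) (at t)) =
      circ_integrand p v r z t" for t
  proof -
    have "circlepath 0 r t = of_real r * exp (2 * of_real pi * \<i> * of_real t)"
      by (simp add: circlepath)
    moreover have "vector_derivative (circlepath 0 r) (at t) = 2 * of_real pi * \<i> * of_real r * exp (2 * of_real pi * \<i> * of_real t)"
      by (simp add: vector_derivative_circlepath)
    ultimately show ?thesis
      unfolding circ_integrand_def F_def exp_minus using r by (simp add: field_simps power2_eq_square)
  qed
  ultimately show ?thesis by simp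
qed

text \<open>A single radius serves all centres near z0, so that z can vary under the integral
  sign.\<close>

lemma phase_circle_nbhd:
  fixes v :: "'n::finite phase"
  assumes "open \<Omega>" "z0 \<in> \<Omega>"
  obtains r \<delta> where "r > 0" "\<delta> > 0" "\<And>z c. z \<in> ball z0 \<delta> \<Longrightarrow> norm c \<le> r \<Longrightarrow> z + cscale c v \<in> \<Omega>"
proof -
  obtain e where e: "e > 0" "ball z0 e \<subseteq> \<Omega>" using assms open_contains_ball by blast
  obtain K where K: "K > 0" "\<And>c. norm (cscale c v) \<le> norm c * K"
    using bounded_linear.pos_bounded[OF cscale_linear_left[THEN linear_conv_bounded_linear[THEN iffD1]], of v] by blast
  show ?thesis
  proof (rule that[of "e / (2 * K)" "e / 2"])
    show "z + cscale c v \<in> \<Omega>" if "z \<in> ball z0 (e / 2)" "norm c \<le> e / (2 * K)" for z c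
    proof -
      have "norm (cscale c v) \<le> e / (2 * K) * K"
        using K(2)[of c] mult_right_mono[OF that(2), of K] K(1) by linarith
      then have "norm (cscale c v) \<le> e / 2" using K(1) by simp
      moreover have "dist z0 (z + cscale c v) \<le> dist z0 z + norm (cscale c v)"
        by (metis dist_triangle add_diff_cancel_left' dist_norm dist_commute)
      ultimately have "z + cscale c v \<in> ball z0 e" using that(1) by simp
      then show ?thesis using e(2) by blast
    qed
  qed (use e K in auto)
qed

lemma phase_holomorphic_continuous:
  assumes "phase_holomorphic_on p \<Omega>" shows "continuous_on \<Omega> p"
  using phase_holomorphic_has_derivative(1)[OF assms]
  by (meson continuous_at_imp_continuous_on has_derivative_continuous)

lemma phase_holomorphic_frechet_continuous:
  fixes p :: "'n::finite phase \<Rightarrow> complex"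
  assumes \<Omega>: "open \<Omega>" and p: "phase_holomorphic_on p \<Omega>"
  shows "continuous_on \<Omega> (\<lambda>z. frechet_derivative p (at z) v)"
proof (rule continuous_at_imp_continuous_on, rule ballI)
  fix z0 assume "z0 \<in> \<Omega>"
  then obtain r \<delta> where r: "r > 0" "\<delta> > 0" and
    sub: "\<And>z c. z \<in> ball z0 \<delta> \<Longrightarrow> norm c \<le> r \<Longrightarrow> z + cscale c v \<in> \<Omega>"
    using phase_circle_nbhd[OF \<Omega>] by metis
  have c1: "continuous_on S (\<lambda>x. cscale (f x) v)" if "continuous_on S f" for S and f :: "'n phase \<times> real \<Rightarrow> complex"
    using bounded_linear.continuous_on[OF cscale_linear_left[THEN linear_conv_bounded_linear[THEN iffD1]] that] .
  have cp: "continuous_on (ball z0 \<delta> \<times> cbox 0 1)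
       (\<lambda>x. p (fst x + cscale (of_real r * exp (2 * of_real pi * \<i> * of_real (snd x))) v))"
  proof (rule continuous_on_compose2[OF phase_holomorphic_continuous[OF p]])
    show "continuous_on (ball z0 \<delta> \<times> cbox 0 1) (\<lambda>x. fst x + cscale (of_real r * exp (2 * of_real pi * \<i> * of_real (snd x))) v)"
      by (intro continuous_intros c1)
    show "(\<lambda>x. fst x + cscale (of_real r * exp (2 * of_real pi * \<i> * of_real (snd x))) v) ` (ball z0 \<delta> \<times> cbox 0 1) \<subseteq> \<Omega>"
      using sub r by (auto simp: norm_mult)
  qed
  have "continuous_on (ball z0 \<delta> \<times> cbox 0 1) (\<lambda>(z, t). circ_integrand p v r z t)"
    unfolding circ_integrand_def split_beta
    by (intro continuous_intros cp) (use r in auto)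
  then have "continuous_on (ball z0 \<delta>) (\<lambda>z. integral (cbox 0 1) (circ_integrand p v r z))"
    by (rule integral_continuous_on_param)
  then have "continuous_on (ball z0 \<delta>) (\<lambda>z. frechet_derivative p (at z) v)"
    by (rule continuous_on_eq) (use phase_Cauchy_derivative[OF \<Omega> p r(1) sub] in \<open>simp add: integral_unique\<close>)
  then show "isCont (\<lambda>z. frechet_derivative p (at z) v) z0"
    using r by (simp add: continuous_on_eq_continuous_at)
qed

text \<open>The Cauchy integral is differentiated under the integral sign; Leibniz's rule needs a
  jointly continuous derivative of the integrand, which the preceding lemma provides. Complex
  linearity passes through the integral.\<close>

lemma phase_holomorphic_frechet:
  fixes p :: "'n::finite phase \<Rightarrow> complex"
  assumes \<Omega>: "open \<Omega>" and p: "phase_holomorphic_on p \<Omega>"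
  shows "phase_holomorphic_on (\<lambda>z. frechet_derivative p (at z) v) \<Omega>"
  unfolding phase_holomorphic_on_def
proof
  fix z0 assume "z0 \<in> \<Omega>"
  then obtain r \<delta> where r: "r > 0" "\<delta> > 0" and
    sub: "\<And>z c. z \<in> ball z0 \<delta> \<Longrightarrow> norm c \<le> r \<Longrightarrow> z + cscale c v \<in> \<Omega>"
    using phase_circle_nbhd[OF \<Omega>] by metis
  define p' where "p' z = Blinfun (frechet_derivative p (at z))" for z
  have p': "blinfun_apply (p' z) = frechet_derivative p (at z)" if "z \<in> \<Omega>" for z
    unfolding p'_def using phase_holomorphic_has_derivative(1)[OF p that]
    by (intro bounded_linear_Blinfun_apply) (rule has_derivative_bounded_linear)
  have cp': "continuous_on \<Omega> p'"
  proof (rule continuous_on_blinfun_componentwise)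
    fix i :: "'n phase"
    show "continuous_on \<Omega> (\<lambda>z. blinfun_apply (p' z) i)"
      using phase_holomorphic_frechet_continuous[OF \<Omega> p, of i] by (rule continuous_on_eq) (simp add: p')
  qed
  have c1: "continuous_on S (\<lambda>x. cscale (f x) v)" if "continuous_on S f" for S and f :: "'n phase \<times> real \<Rightarrow> complex"
    using bounded_linear.continuous_on[OF cscale_linear_left[THEN linear_conv_bounded_linear[THEN iffD1]] that] .
  let ?w = "\<lambda>t. cscale (of_real r * exp (2 * of_real pi * \<i> * of_real t)) v"
  let ?e = "\<lambda>t. exp (- (2 * of_real pi * \<i> * of_real t)) / of_real r :: complex"
  define fx where "fx z t = blinfun_mult_right (?e t) o\<^sub>L p' (z + ?w t)" for z t
  have inO: "z + ?w t \<in> \<Omega>" if "z \<in> ball z0 \<delta>" for z t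
    using sub[OF that] r by (auto simp: norm_mult)
  have fx: "blinfun_apply (fx z t) h = frechet_derivative p (at (z + ?w t)) h * ?e t" if "z \<in> ball z0 \<delta>" for z t h
    using p'[OF inO[OF that]] by (simp add: fx_def)
  have int: "circ_integrand p v r z integrable_on cbox 0 1" if "z \<in> ball z0 \<delta>" for z
    using phase_Cauchy_derivative[OF \<Omega> p r(1) sub[OF that]] by (auto simp: integrable_on_def)
  have cfx: "continuous_on (ball z0 \<delta> \<times> cbox 0 1) (\<lambda>(z, t). fx z t)"
    unfolding fx_def split_beta
  proof (intro continuous_intros)
    show "continuous_on (ball z0 \<delta> \<times> cbox 0 1) (\<lambda>x. p' (fst x + ?w (snd x)))"
      by (rule continuous_on_compose2[OF cp']) (use inO in \<open>auto intro!: continuous_intros c1\<close>)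
  qed (use r in auto)
  have "((\<lambda>z. integral (cbox 0 1) (circ_integrand p v r z)) has_derivative
     blinfun_apply (integral (cbox 0 1) (fx z0))) (at z0 within ball z0 \<delta>)"
  proof (rule leibniz_rule[OF _ int cfx])
    show "((\<lambda>z. circ_integrand p v r z t) has_derivative blinfun_apply (fx z t)) (at z within ball z0 \<delta>)"
      if z: "z \<in> ball z0 \<delta>" for z t
    proof -
      have "((\<lambda>z. z + ?w t) has_derivative (\<lambda>h. h)) (at z within ball z0 \<delta>)"
        by (auto intro!: derivative_eq_intros)
      from has_derivative_compose[OF this phase_holomorphic_has_derivative(1)[OF p inO[OF z]]]
      have "((\<lambda>z. p (z + ?w t)) has_derivative frechet_derivative p (at (z + ?w t))) (at z within ball z0 \<delta>)" .
      from has_derivative_mult_left[OF this, of "?e t"]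
      have "((\<lambda>z. circ_integrand p v r z t) has_derivative (\<lambda>h. frechet_derivative p (at (z + ?w t)) h * ?e t)) (at z within ball z0 \<delta>)"
        unfolding circ_integrand_def .
      moreover have "blinfun_apply (fx z t) = (\<lambda>h. frechet_derivative p (at (z + ?w t)) h * ?e t)"
        by (rule ext) (rule fx[OF z])
      ultimately show ?thesis by simp
    qed
  qed (use r in auto)
  then have d: "((\<lambda>z. integral (cbox 0 1) (circ_integrand p v r z)) has_derivative
     blinfun_apply (integral (cbox 0 1) (fx z0))) (at z0)"
    using r at_within_open[of z0 "ball z0 \<delta>"] by simp
  have d2: "((\<lambda>z. frechet_derivative p (at z) v) has_derivative
     blinfun_apply (integral (cbox 0 1) (fx z0))) (at z0)"
    by (rule has_derivative_transform_within_open[OF d, of "ball z0 \<delta>"])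
      (use r phase_Cauchy_derivative[OF \<Omega> p r(1) sub] in \<open>auto simp: integral_unique\<close>)
  have fxi: "fx z0 integrable_on cbox 0 1"
    by (rule integrable_continuous, rule continuous_on_compose2[OF cfx, of _ "\<lambda>t. (z0, t)", simplified])
      (use r in \<open>auto intro!: continuous_intros\<close>)
  have ap: "blinfun_apply (integral (cbox 0 1) (fx z0)) h = integral (cbox 0 1) (\<lambda>t. blinfun_apply (fx z0 t) h)" for h
    using integral_linear[OF fxi blinfun.bounded_linear_left[of h]] by (simp add: o_def)
  have "blinfun_apply (integral (cbox 0 1) (fx z0)) (cscale c h) = c * blinfun_apply (integral (cbox 0 1) (fx z0)) h" for c h
  proof -
    have "blinfun_apply (fx z0 t) (cscale c h) = c * blinfun_apply (fx z0 t) h" for t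
      using r fx phase_holomorphic_has_derivative(2)[OF p inO[of z0]] by simp
    then show ?thesis unfolding ap by simp
  qed
  then show "\<exists>D. ((\<lambda>z. frechet_derivative p (at z) v) has_derivative D) (at z0) \<and> (\<forall>c v. D (cscale c v) = c * D v)"
    using d2 by blast
qed

lemma phase_holomorphic_Ck:
  assumes "open \<Omega>" "phase_holomorphic_on p \<Omega>"
  shows "Ck k \<Omega> p"
  using assms(2)
proof (induction k arbitrary: p)
  case 0
  then show ?case by (simp add: phase_holomorphic_continuous)
next
  case (Suc k)
  show ?case
    by (rule Ck_SucI[OF assms(1) phase_holomorphic_has_derivative(1)[OF Suc.prems]])
      (auto intro: Suc.IH phase_holomorphic_frechet[OF assms(1) Suc.prems])
qed

text \<open>With L the graph map of \<Phi>, the tube is the image of an open set under the real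
  linear map F(a, b) = L a + i L b, so it suffices that F is bijective. If F(a, b) = 0 then a = - i
  b, and each component l of L satisfies l(i b) = i l(b). Thus its antilinear part vanishes at b, so
  the Levi form is 0 at b, and strict plurisubharmonicity gives b = 0.\<close>

lemma open_tube:
  fixes \<Phi> :: "complex^'n::finite \<Rightarrow> real"
  assumes q: "real_quadratic_form \<Phi>" and psh: "strictly_psh \<Phi>" and W: "openin (top_of_set (Lambda \<Phi>)) W"
  shows "open (tube \<Phi> W)"
proof -
  obtain B where B: "bilinear B" "\<And>x. \<Phi> x = B x x" using q unfolding real_quadratic_form_def by blast
  have bB: "bounded_bilinear B" using B(1) by (simp add: bilinear_conv_bounded_bilinear)
  have dPhi: "frechet_derivative (\<lambda>y. complex_of_real (\<Phi> y)) (at x) = (\<lambda>v. complex_of_real (B x v + B v x))" for x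
  proof -
    have "((\<lambda>y. complex_of_real (B y y)) has_derivative (\<lambda>v. complex_of_real (B x v + B v x))) (at x)"
      by (intro has_derivative_of_real bounded_bilinear.FDERIV[OF bB] has_derivative_ident)
    from frechet_derivative_at[OF this] show ?thesis unfolding B(2) by simp
  qed
  define l where "l k x = d_hol k (\<lambda>y. complex_of_real (\<Phi> y)) x" for k x
  have lin: "linear (l k)" for k
    unfolding l_def d_hol_def dPhi
    by (rule linearI) (simp_all add: bounded_bilinear.add_left[OF bB] bounded_bilinear.add_right[OF bB]
      bounded_bilinear.scaleR_left[OF bB] bounded_bilinear.scaleR_right[OF bB] scaleR_conv_of_real[where 'a=complex] algebra_simps add_divide_distrib diff_divide_distrib)
  define L where "L x = weight_graph \<Phi> x" for x
  have L: "L x = (x, \<chi> j. 2 / \<i> * l j x)" for x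
    unfolding L_def weight_graph_def l_def ..
  have linL: "linear L"
    by (rule linearI) (simp_all add: L prod_eq_iff vec_eq_iff linear_add[OF lin] linear_cmul[OF lin] algebra_simps)
  have levi: "levi_matrix \<Phi> x $ j $ k = (l k (axis j 1) + \<i> * l k (axis j \<i>)) / 2" for x j k
  proof -
    have "levi_matrix \<Phi> x $ j $ k = d_antihol j (l k) x"
      unfolding levi_matrix_def l_def by simp
    also have "frechet_derivative (l k) (at x) = l k"
      using frechet_derivative_at[OF linear_imp_has_derivative[OF lin]] by metis
    then have "d_antihol j (l k) x = (l k (axis j 1) + \<i> * l k (axis j \<i>)) / 2"
      unfolding d_antihol_def by simp
    finally show ?thesis .
  qed
  \<comment> \<open>The right-hand side is the antilinear part of the real linear map
    \<open>l k\<close>, and the left-hand side computes it from the values on the axes. This links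
    the Levi matrix to L.\<close>
  have antilin: "(\<Sum>j\<in>UNIV. (l k (axis j 1) + \<i> * l k (axis j \<i>)) / 2 * cnj (z $ j)) = (l k z + \<i> * l k (\<i> *s z)) / 2" for k z
  proof -
    have rep: "x = (\<Sum>j\<in>UNIV. Re (x $ j) *\<^sub>R axis j 1 + Im (x $ j) *\<^sub>R axis j \<i>)" for x :: "complex^'n"
    proof -
      have "(\<Sum>j\<in>UNIV. (Re (x $ j) *\<^sub>R axis j 1 + Im (x $ j) *\<^sub>R axis j \<i>) $ i) = x $ i" for i
      proof -
        have "(\<Sum>j\<in>UNIV. (Re (x $ j) *\<^sub>R axis j 1 + Im (x $ j) *\<^sub>R axis j \<i>) $ i) =
           (\<Sum>j\<in>UNIV. if j = i then x $ j else 0)"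
          by (rule sum.cong[OF refl]) (auto simp: axis_def complex_eq_iff)
        then show ?thesis by simp
      qed
      then show ?thesis by (simp add: vec_eq_iff)
    qed
    have lrep: "l k x = (\<Sum>j\<in>UNIV. complex_of_real (Re (x $ j)) * l k (axis j 1) + complex_of_real (Im (x $ j)) * l k (axis j \<i>))" for x
      by (subst rep[of x]) (simp add: linear_sum[OF lin] linear_add[OF lin] linear_cmul[OF lin] scaleR_conv_of_real[where 'a=complex])
    have "l k z + \<i> * l k (\<i> *s z) = (\<Sum>j\<in>UNIV. (l k (axis j 1) + \<i> * l k (axis j \<i>)) * cnj (z $ j))"
      unfolding lrep[of z] lrep[of "\<i> *s z"] sum_distrib_left sum.distrib[symmetric]
    proof (rule sum.cong[OF refl])
      fix j
      have c: "cnj (z $ j) = complex_of_real (Re (z $ j)) - \<i> * complex_of_real (Im (z $ j))"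
        by (simp add: complex_eq_iff)
      show "complex_of_real (Re (z $ j)) * l k (axis j 1) + complex_of_real (Im (z $ j)) * l k (axis j \<i>) +
          \<i> * (complex_of_real (Re ((\<i> *s z) $ j)) * l k (axis j 1) + complex_of_real (Im ((\<i> *s z) $ j)) * l k (axis j \<i>)) =
         (l k (axis j 1) + \<i> * l k (axis j \<i>)) * cnj (z $ j)"
        unfolding c by (simp add: algebra_simps)
    qed
    then show ?thesis by (simp add: sum_divide_distrib[symmetric])
  qed
  define F where "F p = L (fst p) + cscale \<i> (L (snd p))" for p :: "'n phase"
  have lcs: "linear (cscale \<i> :: 'n phase \<Rightarrow> _)"
    by (rule linearI) (simp_all add: cscale_def prod_eq_iff vec_eq_iff algebra_simps)
  have linF: "linear F"
    unfolding F_def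
    by (intro linear_compose_add linear_compose[OF linear_fst linL, unfolded o_def]
      linear_compose[OF linear_compose[OF linear_snd linL] lcs, unfolded o_def])
  have inj: "inj F"
  proof (rule linear_injective_0[OF linF, THEN iffD2], intro allI impI)
    fix p assume p: "F p = 0"
    let ?a = "fst p" and ?b = "snd p"
    have "fst (F p) = 0" "snd (F p) = 0" using p by simp_all
    then have a: "?a + \<i> *s ?b = 0" and k: "\<And>k. l k ?a + \<i> * l k ?b = 0"
      unfolding F_def L cscale_def by (auto simp: vec_eq_iff algebra_simps)
    have a': "?a = - (\<i> *s ?b)" using a by (simp add: eq_neg_iff_add_eq_0)
    have lk: "l k (\<i> *s ?b) = \<i> * l k ?b" for k
      using k[of k] unfolding a' by (simp add: linear_neg[OF lin])
    have "(\<Sum>j\<in>UNIV. (l k (axis j 1) + \<i> * l k (axis j \<i>)) / 2 * cnj (?b $ j)) = 0" for k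
      unfolding antilin lk by simp
    then have z: "(\<Sum>k\<in>UNIV. (\<Sum>j\<in>UNIV. levi_matrix \<Phi> 0 $ j $ k * cnj (?b $ j)) * ?b $ k) = 0"
      unfolding levi by simp
    have "(\<Sum>j\<in>UNIV. \<Sum>k\<in>UNIV. levi_matrix \<Phi> 0 $ j $ k * cnj (?b $ j) * ?b $ k) = 0"
      by (subst sum.swap) (use z in \<open>simp add: sum_distrib_right\<close>)
    then have "?b = 0" using psh[unfolded strictly_psh_def, rule_format, of ?b 0] by auto
    then show "p = 0" using a' by (simp add: prod_eq_iff)
  qed
  then have surj: "surj F" using linear_inj_imp_surj[OF linF] by blast
  obtain Ow where Ow: "open Ow" "W = Lambda \<Phi> \<inter> Ow" using W by (auto simp: openin_open)
  have "tube \<Phi> W = F ` (UNIV \<times> (L -` Ow))"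
  proof -
    have "tube \<Phi> W = {L a + cscale \<i> (L b) |a b. L b \<in> Ow}"
    proof -
      have "range (weight_graph \<Phi>) = range L" unfolding L_def ..
      then show ?thesis unfolding tube_def Ow(2) Lambda_def by (simp only: ) blast
    qed
    also have "\<dots> = F ` (UNIV \<times> (L -` Ow))"
    proof (intro set_eqI iffI)
      fix x assume "x \<in> {L a + cscale \<i> (L b) |a b. L b \<in> Ow}"
      then obtain a b where "x = L a + cscale \<i> (L b)" "L b \<in> Ow" by blast
      then show "x \<in> F ` (UNIV \<times> (L -` Ow))"
        by (intro image_eqI[of _ _ "(a, b)"]) (simp_all add: F_def)
    next
      fix x assume "x \<in> F ` (UNIV \<times> (L -` Ow))"
      then obtain p where "x = F p" "L (snd p) \<in> Ow" by auto
      then show "x \<in> {L a + cscale \<i> (L b) |a b. L b \<in> Ow}" unfolding F_def by blast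
    qed
    finally show ?thesis .
  qed
  moreover have "open (UNIV \<times> (L -` Ow))"
    by (intro open_Times open_UNIV continuous_open_vimage Ow(1))
      (rule linear_continuous_at[OF linL[THEN linear_conv_bounded_linear[THEN iffD1]]])
  ultimately show ?thesis using open_surjective_linear_image[OF _ linF surj] by simp
qed

section \<open>A globally parametrized symplectic manifold\<close>

text \<open>An affine substitution merely maps the list of directions by L. In this way the curves t
  \<mapsto> g(y + t u), which realise the tangent vectors, inherit \<open>smooth_on\<close> from
  g.\<close>

lemma iter_deriv_affine:
  fixes f :: "'a::real_normed_vector \<Rightarrow> 'b::real_normed_vector" and L :: "'c::real_normed_vector \<Rightarrow> 'a"
  assumes f: "smooth_on UNIV f" and L: "bounded_linear L"
  shows "iter_deriv vs (\<lambda>x. f (a + L x)) = (\<lambda>x. iter_deriv (map L vs) f (a + L x))"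
proof (induction vs)
  case Nil
  then show ?case by simp
next
  case (Cons v vs)
  have "frechet_derivative (\<lambda>x. iter_deriv (map L vs) f (a + L x)) (at x) v =
     frechet_derivative (iter_deriv (map L vs) f) (at (a + L x)) (L v)" for x
  proof -
    have "iter_deriv (map L vs) f differentiable at (a + L x)"
      using f unfolding smooth_on_def by blast
    then have 1: "(iter_deriv (map L vs) f has_derivative
        frechet_derivative (iter_deriv (map L vs) f) (at (a + L x))) (at (a + L x))"
      by (simp add: frechet_derivative_works)
    have "((\<lambda>x. a + L x) has_derivative L) (at x)"
      using bounded_linear_imp_has_derivative[OF L] by (auto intro!: derivative_eq_intros)
    from diff_chain_at[OF this 1] have "((\<lambda>x. iter_deriv (map L vs) f (a + L x)) has_derivative
      (\<lambda>v. frechet_derivative (iter_deriv (map L vs) f) (at (a + L x)) (L v))) (at x)"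
      by (simp add: o_def)
    from frechet_derivative_at[OF this] show ?thesis by metis
  qed
  then show ?case by (simp add: Cons.IH)
qed

lemma smooth_on_affine:
  fixes f :: "'a::real_normed_vector \<Rightarrow> 'b::real_normed_vector" and L :: "'c::real_normed_vector \<Rightarrow> 'a"
  assumes f: "smooth_on UNIV f" and L: "bounded_linear L"
  shows "smooth_on U (\<lambda>x. f (a + L x))"
  unfolding smooth_on_def iter_deriv_affine[OF assms]
proof (intro allI ballI)
  fix vs :: "'c list" and x
  have d: "iter_deriv (map L vs) f differentiable at (a + L x)"
    using f unfolding smooth_on_def by blast
  have "(\<lambda>x. a + L x) differentiable at x"
    using bounded_linear_imp_has_derivative[OF L, of "at x"] unfolding differentiable_def
    by (auto intro!: derivative_eq_intros exI)
  from differentiable_chain_at[OF this d] show "(\<lambda>x. iter_deriv (map L vs) f (a + L x)) differentiable at x"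
    by (simp add: o_def)
qed

lemma vec_expand: "(u :: real^'m::finite) = (\<Sum>k\<in>UNIV. (u $ k) *\<^sub>R axis k 1)"
  using basis_expansion[of u] by (simp add: scalar_mult_eq_scaleR)

lemma Ck_vec:
  fixes f :: "'a::real_normed_vector \<Rightarrow> real^'m::finite"
  assumes "open U" "\<And>i. Ck k U (\<lambda>x. f x $ i)"
  shows "Ck k U f"
proof -
  have "Ck k U (\<lambda>x. \<Sum>i\<in>UNIV. (f x $ i) *\<^sub>R axis i (1::real))"
    by (intro Ck_sum Ck_scaleR Ck_const assms)
  then show ?thesis by (rule Ck_cong[OF assms(1)]) (rule vec_expand[symmetric])
qed

lemma Ck_vec_nth: "open U \<Longrightarrow> Ck k U f \<Longrightarrow> Ck k U (\<lambda>x. (f x :: real^'m::finite) $ i)"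
  by (rule Ck_bounded_linear[OF _ bounded_linear_vec_nth])

lemma Ck_det:
  fixes M :: "'a::real_normed_vector \<Rightarrow> real^'m^'m::finite"
  assumes "open U" "\<And>i j. Ck k U (\<lambda>x. M x $ i $ j)"
  shows "Ck k U (\<lambda>x. det (M x))"
  unfolding det_def by (intro Ck_sum Ck_mult Ck_const Ck_prod assms)

text \<open>The product rule for a multilinear map, proved by letting s slots move and the others
  rest. The minus sign matches the frame for which it is used in
  \<open>ham_divergence\<close>.\<close>

lemma alternating_form_line_derivative:
  assumes \<alpha>: "alternating_form N UNIV \<alpha>"
  shows "((\<lambda>t. \<alpha> (\<lambda>i. a i - t *\<^sub>R b i)) has_vector_derivative - (\<Sum>i<N. \<alpha> (a(i := b i)))) (at 0)"
proof -
  have "((\<lambda>t. \<alpha> (\<lambda>i. if i < s then a i - t *\<^sub>R b i else a i)) has_vector_derivative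
      - (\<Sum>i<s. \<alpha> (a(i := b i)))) (at 0)" if "s \<le> N" for s a
    using that
  proof (induction s arbitrary: a)
    case 0
    then show ?case by simp
  next
    case (Suc s)
    let ?w = "\<lambda>x t i. if i < s then (a(s := x)) i - t *\<^sub>R b i else (a(s := x)) i"
    have eq: "\<alpha> (\<lambda>i. if i < Suc s then a i - t *\<^sub>R b i else a i) =
        \<alpha> (?w (a s) t) - complex_of_real t * \<alpha> (?w (b s) t)" for t
    proof -
      have "\<alpha> ((?w (a s) t)(s := 1 *\<^sub>R a s + (- t) *\<^sub>R b s)) = complex_of_real 1 * \<alpha> ((?w (a s) t)(s := a s)) +
         complex_of_real (- t) * \<alpha> ((?w (a s) t)(s := b s))"
        using Suc.prems by (intro alternating_form_linear[OF \<alpha>]) auto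
      moreover have "(?w (a s) t)(s := 1 *\<^sub>R a s + (- t) *\<^sub>R b s) = (\<lambda>i. if i < Suc s then a i - t *\<^sub>R b i else a i)"
        by (auto simp: fun_eq_iff less_Suc_eq)
      moreover have "(?w (a s) t)(s := a s) = ?w (a s) t" "(?w (a s) t)(s := b s) = ?w (b s) t"
        by (auto simp: fun_eq_iff)
      ultimately show ?thesis by simp
    qed
    have d1: "((\<lambda>t. \<alpha> (?w x t)) has_vector_derivative - (\<Sum>i<s. \<alpha> ((a(s := x))(i := b i)))) (at 0)" for x
      using Suc.IH[of "a(s := x)", OF Suc_leD[OF Suc.prems]] .
    have d2: "((\<lambda>t. complex_of_real t) has_vector_derivative 1) (at 0)"
      using has_vector_derivative_of_real[OF DERIV_ident, of "at 0"] by (simp add: has_real_derivative_iff_has_vector_derivative)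
    have "((\<lambda>t. \<alpha> (?w (a s) t) - complex_of_real t * \<alpha> (?w (b s) t)) has_vector_derivative
       - (\<Sum>i<s. \<alpha> ((a(s := a s))(i := b i))) - (complex_of_real 0 * - (\<Sum>i<s. \<alpha> ((a(s := b s))(i := b i))) + 1 * \<alpha> (?w (b s) 0))) (at 0)"
      by (intro has_vector_derivative_diff has_vector_derivative_mult d1 d2)
    moreover have w: "?w (b s) 0 = a(s := b s)" by (auto simp: fun_eq_iff)
    have "- (\<Sum>i<s. \<alpha> ((a(s := a s))(i := b i))) - (complex_of_real 0 * - (\<Sum>i<s. \<alpha> ((a(s := b s))(i := b i))) + 1 * \<alpha> (?w (b s) 0))
       = - (\<Sum>i<Suc s. \<alpha> (a(i := b i)))"
      unfolding sum.lessThan_Suc fun_upd_triv w of_real_0 mult_zero_left mult_1_left add_0_left minus_add_distrib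
      by (rule diff_conv_add_uminus)
    ultimately show ?case unfolding eq by (simp only:)
  qed
  from this[of N a] have d: "((\<lambda>t. \<alpha> (\<lambda>i. if i < N then a i - t *\<^sub>R b i else a i)) has_vector_derivative
      - (\<Sum>i<N. \<alpha> (a(i := b i)))) (at 0)" by simp
  have "\<alpha> (\<lambda>i. if i < N then a i - t *\<^sub>R b i else a i) = \<alpha> (\<lambda>i. a i - t *\<^sub>R b i)" for t
    by (rule alternating_form_cong[OF \<alpha>]) simp
  then show ?thesis using d by simp
qed

text \<open>A global chart of \<Lambda>. Its domain is \<open>real^('n bit0)\<close> because
  determinants and the change of variables formula are used on spaces of the form
  \<open>real^'m\<close>. Smoothness of the inverse is expressed by local extensions to the ambient
  space.\<close>

locale param_manifold =
  fixes \<Lambda> :: "'n::finite phase set" and g :: "real^('n bit0) \<Rightarrow> 'n phase"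
  assumes g_smooth: "smooth_on UNIV g"
    and inj_g: "inj g" and range_g: "range g = \<Lambda>"
    and inv_g: "\<And>\<rho>. \<rho> \<in> \<Lambda> \<Longrightarrow> \<exists>U G. open U \<and> \<rho> \<in> U \<and> Cinf U G \<and> (\<forall>z\<in>\<Lambda> \<inter> U. G z = inv g z)"
    and sigma_real: "\<And>\<rho> s t. \<rho> \<in> \<Lambda> \<Longrightarrow> s \<in> tangent_space \<Lambda> \<rho> \<Longrightarrow> t \<in> tangent_space \<Lambda> \<rho> \<Longrightarrow> sigma s t \<in> \<real>"
    and sigma_nondeg: "\<And>\<rho> s. \<rho> \<in> \<Lambda> \<Longrightarrow> s \<in> tangent_space \<Lambda> \<rho> \<Longrightarrow>
        (\<And>t. t \<in> tangent_space \<Lambda> \<rho> \<Longrightarrow> sigma s t = 0) \<Longrightarrow> s = 0"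
begin

definition "Dg y u = frechet_derivative g (at y) u"

lemma Ck_g: "Ck k UNIV g"
  by (rule smooth_on_imp_Ck[OF g_smooth])

lemma has_derivative_g: "(g has_derivative Dg y) (at y)"
  using Ck_has_derivative[OF Ck_g, of y] by (simp add: Dg_def[abs_def])

lemma Ck_Dg: "Ck k UNIV (\<lambda>y. Dg y u)"
  using Ck_frechet[OF Ck_g] by (simp add: Dg_def)

lemma linear_Dg: "linear (Dg y)"
  by (rule has_derivative_linear[OF has_derivative_g])

lemma g_in [simp]: "g y \<in> \<Lambda>" using range_g by blast

lemma inv_g_g [simp]: "inv g (g y) = y" by (rule inv_f_f[OF inj_g])

lemma g_inv_g: "\<rho> \<in> \<Lambda> \<Longrightarrow> g (inv g \<rho>) = \<rho>" using range_g by (simp add: f_inv_into_f)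

lemma continuous_g: "continuous_on UNIV g"
  by (rule Ck_continuous_on[OF Ck_g])

lemma continuous_inv_g: "continuous_on \<Lambda> (inv g)"
proof -
  have "continuous (at \<rho> within \<Lambda>) (inv g)" if "\<rho> \<in> \<Lambda>" for \<rho>
  proof -
    obtain U G where U: "open U" "\<rho> \<in> U" "Ck 0 U G" "\<forall>z\<in>\<Lambda> \<inter> U. G z = inv g z"
      using inv_g[OF \<open>\<rho> \<in> \<Lambda>\<close>] by blast
    have "isCont G \<rho>" using U by (simp add: continuous_on_eq_continuous_at)
    then have "continuous (at \<rho> within \<Lambda>) G" by (rule continuous_at_imp_continuous_at_within)
    moreover obtain d where "d > 0" "ball \<rho> d \<subseteq> U" using U open_contains_ball by blast
    ultimately show ?thesis
      by (rule_tac continuous_transform_within[of \<rho> \<Lambda> G d]) (use U that in \<open>auto simp: dist_commute\<close>)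
  qed
  then show ?thesis by (simp add: continuous_on_eq_continuous_within)
qed

text \<open>Differentiating \<open>G (g y) = y\<close> shows that the derivative of any local
  extension G of the inverse is a left inverse of \<open>Dg y\<close>; so g is an immersion.\<close>

lemma local_inverse:
  obtains U G where "open U" "g y \<in> U" "Cinf U G" "\<And>z. z \<in> \<Lambda> \<Longrightarrow> z \<in> U \<Longrightarrow> G z = inv g z"
    "(G has_derivative frechet_derivative G (at (g y))) (at (g y))"
    "\<And>u. frechet_derivative G (at (g y)) (Dg y u) = u"
proof -
  obtain U G where U: "open U" "g y \<in> U" "Cinf U G" "\<forall>z\<in>\<Lambda> \<inter> U. G z = inv g z"
    using inv_g[OF g_in[of y]] by (elim exE conjE)
  have G': "(G has_derivative frechet_derivative G (at (g y))) (at (g y))"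
    using Ck_has_derivative[of 0 U G] U by blast
  have "((\<lambda>y. G (g y)) has_derivative (\<lambda>u. frechet_derivative G (at (g y)) (Dg y u))) (at y)"
    using diff_chain_at[OF has_derivative_g G'] by (simp add: o_def)
  then have "((\<lambda>y. y) has_derivative (\<lambda>u. frechet_derivative G (at (g y)) (Dg y u))) (at y)"
  proof (rule has_derivative_transform_within_open)
    show "open (g -` U)" using continuous_g U(1) by (simp add: open_vimage)
    show "y \<in> g -` U" using U by simp
    show "G (g x) = x" if "x \<in> g -` U" for x using U(4) that by simp
  qed
  then have "(\<lambda>u. frechet_derivative G (at (g y)) (Dg y u)) = (\<lambda>u. u)"
    using has_derivative_unique has_derivative_ident by blast
  then have "frechet_derivative G (at (g y)) (Dg y u) = u" for u by (rule fun_cong)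
  then show ?thesis using that[OF U(1,2,3) _ G'] U(4) by blast
qed

lemma Dg_inj: "Dg y u = Dg y v \<Longrightarrow> u = v"
  by (rule local_inverse[of y]) metis

text \<open>The parameter curve is differentiable because it is locally \<gamma> followed by a
  smooth extension of the inverse. The extension agrees with the inverse on \<Lambda> only, so
  \<gamma> has to stay in \<Lambda> near 0.\<close>

lemma pullback_derivative:
  assumes dv: "(\<gamma> has_vector_derivative v) (at 0)" and \<gamma>0: "\<gamma> 0 = g y"
    and ev\<Lambda>: "\<forall>\<^sub>F t in nhds (0::real). \<gamma> t \<in> \<Lambda>"
  obtains u where "((\<lambda>t. inv g (\<gamma> t)) has_vector_derivative u) (at 0)" "Dg y u = v"
proof -
  obtain U G where U: "open U" "g y \<in> U" "\<And>z. z \<in> \<Lambda> \<Longrightarrow> z \<in> U \<Longrightarrow> G z = inv g z"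
    "(G has_derivative frechet_derivative G (at (g y))) (at (g y))"
    "\<And>u. frechet_derivative G (at (g y)) (Dg y u) = u"
    by (rule local_inverse[of y]) blast
  let ?u = "frechet_derivative G (at (g y)) v"
  have G\<gamma>: "((\<lambda>t. G (\<gamma> t)) has_vector_derivative ?u) (at 0)"
    using vector_derivative_diff_chain_within[of \<gamma> v 0 UNIV G] U(4) dv \<gamma>0
    by (simp add: o_def has_derivative_at_withinI)
  have "\<forall>\<^sub>F t in nhds 0. \<gamma> t \<in> \<Lambda> \<and> \<gamma> t \<in> U"
  proof (rule eventually_conj[OF ev\<Lambda>])
    have "isCont \<gamma> 0" using dv has_vector_derivative_continuous by blast
    then have "\<forall>\<^sub>F t in at 0. \<gamma> t \<in> U" using U(1,2) \<gamma>0 by (simp add: isCont_def tendsto_def)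
    then show "\<forall>\<^sub>F t in nhds 0. \<gamma> t \<in> U" using U(2) \<gamma>0 by (simp add: eventually_nhds_conv_at)
  qed
  then obtain S where S: "open S" "0 \<in> S" "\<And>t. t \<in> S \<Longrightarrow> \<gamma> t \<in> \<Lambda> \<and> \<gamma> t \<in> U"
    by (auto simp: eventually_nhds)
  have c: "((\<lambda>t. inv g (\<gamma> t)) has_vector_derivative ?u) (at 0)"
    by (rule has_vector_derivative_transform_within_open[OF G\<gamma> S(1,2)]) (use S(3) U(3) in auto)
  have "((\<lambda>t. g (inv g (\<gamma> t))) has_vector_derivative Dg y ?u) (at 0)"
    using vector_derivative_diff_chain_within[of "\<lambda>t. inv g (\<gamma> t)" ?u 0 UNIV g "Dg y"] c has_derivative_g \<gamma>0
    by (simp add: o_def has_derivative_at_withinI)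
  then have "(\<gamma> has_vector_derivative Dg y ?u) (at 0)"
    by (rule has_vector_derivative_transform_within_open[OF _ S(1,2)]) (use S(3) g_inv_g in auto)
  then have "Dg y ?u = v" using dv vector_derivative_unique_at by blast
  then show ?thesis using that c by blast
qed

lemma curve_pullback:
  assumes "curve_through \<Lambda> (g y) v \<gamma>"
  obtains u where "((\<lambda>t. inv g (\<gamma> t)) has_vector_derivative u) (at 0)" "Dg y u = v"
    "\<forall>\<^sub>F t in at 0. \<gamma> t \<in> \<Lambda>" "\<gamma> 0 = g y"
proof -
  obtain \<epsilon> where e: "\<epsilon> > 0" "\<gamma> ` {-\<epsilon><..<\<epsilon>} \<subseteq> \<Lambda>" "\<gamma> 0 = g y" and dv: "(\<gamma> has_vector_derivative v) (at 0)"
    using assms unfolding curve_through_def by blast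
  have "\<forall>\<^sub>F t in nhds 0. t \<in> {-\<epsilon><..<\<epsilon>}" using e(1) by (intro eventually_nhds_in_open) auto
  then have ev: "\<forall>\<^sub>F t in nhds 0. \<gamma> t \<in> \<Lambda>" by eventually_elim (use e(2) in blast)
  obtain u where u: "((\<lambda>t. inv g (\<gamma> t)) has_vector_derivative u) (at 0)" "Dg y u = v"
    by (rule pullback_derivative[OF dv e(3) ev])
  have "\<forall>\<^sub>F t in at 0. \<gamma> t \<in> \<Lambda>" using ev by (simp add: eventually_nhds_conv_at)
  from that[OF u this e(3)] show ?thesis .
qed

lemma curve_line: "curve_through \<Lambda> (g y) (Dg y u) (\<lambda>t. g (y + t *\<^sub>R u))"
  unfolding curve_through_def
proof (intro conjI exI[of _ 1])
  show "smooth_on {-1<..<1} (\<lambda>t. g (y + t *\<^sub>R u))"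
    by (rule smooth_on_affine[OF g_smooth bounded_linear_scaleR_left])
  have "((\<lambda>t. y + t *\<^sub>R u) has_vector_derivative u) (at 0)"
    by (auto intro!: derivative_eq_intros simp: has_vector_derivative_def)
  from vector_derivative_diff_chain_within[OF this, of g "Dg y"] 
  show "((\<lambda>t. g (y + t *\<^sub>R u)) has_vector_derivative Dg y u) (at 0)"
    using has_derivative_g by (simp add: o_def has_derivative_at_withinI)
qed auto

lemma tangent_space_eq: "tangent_space \<Lambda> (g y) = range (Dg y)"
proof
  show "tangent_space \<Lambda> (g y) \<subseteq> range (Dg y)"
    unfolding tangent_space_def using curve_pullback by blast
  show "range (Dg y) \<subseteq> tangent_space \<Lambda> (g y)"
    unfolding tangent_space_def using curve_line by blast
qed

lemma curve_derivative:
  assumes h: "((\<lambda>y. h (g y)) has_derivative h') (at y)" and c: "curve_through \<Lambda> (g y) (Dg y u) \<gamma>"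
  shows "((\<lambda>t. h (\<gamma> t)) has_vector_derivative h' u) (at 0)"
proof -
  obtain u' where u': "((\<lambda>t. inv g (\<gamma> t)) has_vector_derivative u') (at 0)" "Dg y u' = Dg y u"
    "\<forall>\<^sub>F t in at 0. \<gamma> t \<in> \<Lambda>" "\<gamma> 0 = g y"
    by (rule curve_pullback[OF c])
  have "u' = u" by (rule Dg_inj[OF u'(2)])
  have A: "((\<lambda>t. h (g (inv g (\<gamma> t)))) has_vector_derivative h' u) (at 0)"
    using vector_derivative_diff_chain_within[of "\<lambda>t. inv g (\<gamma> t)" u 0 UNIV "\<lambda>y. h (g y)" h'] u' \<open>u' = u\<close> h
    by (simp add: o_def has_derivative_at_withinI)
  obtain S where S: "open S" "0 \<in> S" "\<And>t. t \<in> S \<Longrightarrow> t \<noteq> 0 \<Longrightarrow> \<gamma> t \<in> \<Lambda>"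
    using u'(3) by (auto simp: eventually_at_topological)
  have B: "\<gamma> t \<in> \<Lambda>" if "t \<in> S" for t using S(3)[OF that] u'(4) by (cases "t = 0") auto
  show ?thesis
    by (rule has_vector_derivative_transform_within_open[OF A S(1,2)]) (simp add: g_inv_g B)
qed

text \<open>Resolves the definite description: all curves with the given velocity yield the same
  derivative of h, and the image of a line is one such curve, which makes the value unique.\<close>

lemma differential_on_eq:
  assumes "((\<lambda>y. h (g y)) has_derivative h') (at y)"
  shows "differential_on \<Lambda> h (g y) (Dg y u) = h' u"
  unfolding differential_on_def
proof (rule the_equality)
  show "\<forall>\<gamma>. curve_through \<Lambda> (g y) (Dg y u) \<gamma> \<longrightarrow> ((\<lambda>t. h (\<gamma> t)) has_vector_derivative h' u) (at 0)"
    using curve_derivative[OF assms] by blast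
  show "w = h' u" if "\<forall>\<gamma>. curve_through \<Lambda> (g y) (Dg y u) \<gamma> \<longrightarrow> ((\<lambda>t. h (\<gamma> t)) has_vector_derivative w) (at 0)" for w
    using that curve_line curve_derivative[OF assms curve_line] vector_derivative_unique_at by blast
qed

text \<open>Curves in S are curves in \<Lambda> along which p is constant. Hence tangent vectors of
  S are tangent to \<Lambda> and killed by dp, and on them the differentials of h along S and along
  \<Lambda> coincide.\<close>

lemma tangent_sub_level:
  assumes S: "S = {\<rho> \<in> \<Lambda>. p \<rho> = (0::real)}" and v: "v \<in> tangent_space S (g y)"
    and p: "((\<lambda>y. p (g y)) has_derivative p') (at y)" and h: "((\<lambda>y. h (g y)) has_derivative h') (at y)"
  obtains u where "v = Dg y u" "p' u = 0" "differential_on S h (g y) v = (h' u :: real)"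
    "\<exists>c. c 0 = y \<and> (c has_vector_derivative u) (at 0) \<and> (\<forall>\<^sub>F t in at (0::real). p (g (c t)) = 0)"
proof -
  have sub: "curve_through \<Lambda> \<rho> v \<gamma>" if "curve_through S \<rho> v \<gamma>" for \<rho> v \<gamma>
    using that unfolding curve_through_def S by blast
  obtain \<gamma> where \<gamma>: "curve_through S (g y) v \<gamma>" using v unfolding tangent_space_def by blast
  obtain u where u: "((\<lambda>t. inv g (\<gamma> t)) has_vector_derivative u) (at 0)" "Dg y u = v"
    "\<forall>\<^sub>F t in at 0. \<gamma> t \<in> \<Lambda>" "\<gamma> 0 = g y"
    by (rule curve_pullback[OF sub[OF \<gamma>]])
  obtain \<epsilon> where e: "\<epsilon> > 0" "\<gamma> ` {-\<epsilon><..<\<epsilon>} \<subseteq> S"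
    using \<gamma> unfolding curve_through_def by blast
  have "\<forall>\<^sub>F t in at 0. t \<in> {-\<epsilon><..<\<epsilon>}" using e(1) by (intro eventually_at_in_open') auto
  then have "\<forall>\<^sub>F t in at 0. \<gamma> t \<in> S" by eventually_elim (use e(2) in blast)
  then have ev: "\<forall>\<^sub>F t in at 0. p (g (inv g (\<gamma> t))) = 0"
    by eventually_elim (auto simp: S g_inv_g)
  have "((\<lambda>t. p (\<gamma> t)) has_vector_derivative p' u) (at 0)"
    using curve_derivative[OF p, of u \<gamma>] sub[OF \<gamma>] u(2) by simp
  moreover have "((\<lambda>t. p (\<gamma> t)) has_vector_derivative 0) (at 0)"
  proof (rule has_vector_derivative_transform_within_open[of "\<lambda>t. 0" 0 0 "{-\<epsilon><..<\<epsilon>}"])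
    fix t assume "t \<in> {-\<epsilon><..<\<epsilon>}"
    then have "\<gamma> t \<in> S" using e(2) by blast
    then show "0 = p (\<gamma> t)" unfolding S by simp
  qed (use e(1) in simp_all)
  ultimately have "p' u = 0" using vector_derivative_unique_at by blast
  moreover have "differential_on S h (g y) v = h' u"
    unfolding differential_on_def
  proof (rule the_equality)
    show "\<forall>\<gamma>. curve_through S (g y) v \<gamma> \<longrightarrow> ((\<lambda>t. h (\<gamma> t)) has_vector_derivative h' u) (at 0)"
      using curve_derivative[OF h] sub u(2) by blast
    then show "w = h' u" if "\<forall>\<gamma>. curve_through S (g y) v \<gamma> \<longrightarrow> ((\<lambda>t. h (\<gamma> t)) has_vector_derivative w) (at 0)" for w
      using that \<gamma> vector_derivative_unique_at by blast
  qed
  moreover have "\<exists>c. c 0 = y \<and> (c has_vector_derivative u) (at 0) \<and> (\<forall>\<^sub>F t in at (0::real). p (g (c t)) = 0)"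
    by (rule exI[of _ "\<lambda>t. inv g (\<gamma> t)"]) (use u(1,4) ev in simp)
  ultimately show ?thesis
    by (intro that[of u] u(2)[symmetric])
qed

section \<open>The symplectic form, Hamilton fields and volume in the parameter space\<close>

definition "om y u w = Re (sigma (Dg y u) (Dg y w))"

lemma sigma_Dg: "sigma (Dg y u) (Dg y w) = complex_of_real (om y u w)"
  unfolding om_def using sigma_real[of "g y" "Dg y u" "Dg y w"] tangent_space_eq[of y] by simp

lemma om_nondeg: "(\<And>w. om y u w = 0) \<Longrightarrow> u = 0"
proof -
  assume om0: "\<And>w. om y u w = 0"
  have "Dg y u = 0"
  proof (rule sigma_nondeg[of "g y"])
    show "Dg y u \<in> tangent_space \<Lambda> (g y)" by (simp add: tangent_space_eq)
    fix t assume "t \<in> tangent_space \<Lambda> (g y)"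
    then obtain w where "t = Dg y w" unfolding tangent_space_eq by blast
    then show "sigma (Dg y u) t = 0" using sigma_Dg om0 by simp
  qed simp
  then have "Dg y u = Dg y 0" using linear_0[OF linear_Dg] by simp
  then show "u = 0" by (rule Dg_inj)
qed

lemma bilinear_om: "bounded_bilinear (om y)"
proof -
  have "bilinear (om y)"
    unfolding bilinear_def om_def
    by (intro conjI allI linearI) (simp_all add: linear_add[OF linear_Dg] linear_cmul[OF linear_Dg]
      sigma.add_left sigma.add_right sigma.scaleR_left sigma.scaleR_right)
  then show ?thesis by (simp add: bilinear_conv_bounded_bilinear)
qed

text \<open>The exchanged indices make \<open>Gram y *v u\<close> the vector that represents
  \<open>om y u\<close> with respect to the inner product.\<close>

definition "Gram y = (\<chi> i j. om y (axis j 1) (axis i 1))"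

lemma om_eq: "om y u w = (Gram y *v u) \<bullet> w"
proof -
  interpret bounded_bilinear "om y" by (rule bilinear_om)
  have "om y u w = om y (\<Sum>j\<in>UNIV. (u $ j) *\<^sub>R axis j 1) (\<Sum>i\<in>UNIV. (w $ i) *\<^sub>R axis i 1)"
    using vec_expand[of u] vec_expand[of w] by simp
  also have "\<dots> = (\<Sum>i\<in>UNIV. \<Sum>j\<in>UNIV. w $ i * (u $ j * om y (axis j 1) (axis i 1)))"
    by (simp add: sum_left sum_right scaleR_left scaleR_right sum_distrib_left)
  also have "\<dots> = (Gram y *v u) \<bullet> w"
    by (simp add: Gram_def matrix_vector_mult_def inner_vec_def sum_distrib_left mult_ac)
  finally show ?thesis .
qed

lemma det_Gram: "det (Gram y) \<noteq> 0"
proof -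
  have "inj ((*v) (Gram y))"
  proof (rule linear_injective_0[THEN iffD2])
    show "\<forall>x. Gram y *v x = 0 \<longrightarrow> x = 0"
      using om_nondeg[of y] unfolding om_eq by simp
  qed simp
  then show ?thesis using det_nz_iff_inj[of "(*v) (Gram y)"] by simp
qed

lemma Ck_Gram: "Ck k UNIV (\<lambda>y. Gram y $ i $ j)"
  unfolding Gram_def om_def
  by (simp, intro Ck_bounded_linear[OF open_UNIV bounded_linear_Re] Ck_bilinear[OF open_UNIV bounded_bilinear_sigma] Ck_Dg)

text \<open>Cramer's rule for the linear system \<open>om y (ham P y) w = - P' w\<close>. The
  explicit quotient of determinants makes the regularity of the Hamilton field visible.\<close>

definition "ham P y = (\<chi> k. det (\<chi> i j. if j = k then - frechet_derivative P (at y) (axis i 1) else Gram y $ i $ j) / det (Gram y))"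

lemma om_ham:
  assumes "(P has_derivative P') (at y)"
  shows "om y (ham P y) w = - P' w"
proof -
  have lin: "linear P'" by (rule has_derivative_linear[OF assms])
  have P': "P' = frechet_derivative P (at y)" by (rule frechet_derivative_at[OF assms])
  have "Gram y *v ham P y = (\<chi> i. - P' (axis i 1))"
    using cramer[OF det_Gram, of y "ham P y" "\<chi> i. - P' (axis i 1)"] unfolding ham_def P' by (simp cong: if_cong)
  then have "om y (ham P y) w = (\<Sum>i\<in>UNIV. - P' (axis i 1) * (w $ i))"
    unfolding om_eq by (simp add: inner_vec_def)
  also have "\<dots> = - P' (\<Sum>i\<in>UNIV. (w $ i) *\<^sub>R axis i 1)"
    by (simp add: linear_sum[OF lin] linear_cmul[OF lin] sum_negf mult.commute)
  finally show ?thesis using vec_expand[of w] by simp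
qed

lemma Ck_ham:
  assumes "Ck (Suc k) UNIV P"
  shows "Ck k UNIV (ham P)"
proof (rule Ck_vec[OF open_UNIV])
  fix i
  have 1: "Ck k UNIV (\<lambda>y. if b = i then - frechet_derivative P (at y) (axis a 1) else Gram y $ a $ b)" for a b
    using Ck_uminus[OF open_UNIV Ck_frechet[OF assms]] Ck_Gram by (cases "b = i") simp_all
  have "Ck k UNIV (\<lambda>y. det (\<chi> a b. if b = i then - frechet_derivative P (at y) (axis a 1) else Gram y $ a $ b) * inverse (det (Gram y)))"
    by (intro Ck_mult open_UNIV Ck_det Ck_inverse Ck_Gram det_Gram) (use 1 in simp)
  then show "Ck k UNIV (\<lambda>y. ham P y $ i)"
    unfolding ham_def by (simp add: divide_inverse)
qed

lemma hamilton_field_eq: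
  assumes "((\<lambda>y. h (g y)) has_derivative h') (at y)"
  shows "hamilton_field \<Lambda> h (g y) = Dg y (ham (\<lambda>y. h (g y)) y)"
  unfolding hamilton_field_def tangent_space_eq
proof (rule the_equality)
  show "Dg y (ham (\<lambda>y. h (g y)) y) \<in> range (Dg y) \<and>
    (\<forall>t\<in>range (Dg y). sigma (Dg y (ham (\<lambda>y. h (g y)) y)) t = - complex_of_real (differential_on \<Lambda> h (g y) t))"
    using om_ham[OF assms] differential_on_eq[OF assms] by (auto simp: sigma_Dg)
  fix v assume v: "v \<in> range (Dg y) \<and> (\<forall>t\<in>range (Dg y). sigma v t = - complex_of_real (differential_on \<Lambda> h (g y) t))"
  then obtain u where u: "v = Dg y u" by blast
  have "om y (u - ham (\<lambda>y. h (g y)) y) w = 0" for w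
  proof -
    have "sigma (Dg y u) (Dg y w) = - complex_of_real (differential_on \<Lambda> h (g y) (Dg y w))"
      using conjunct2[OF v, rule_format, of "Dg y w"] unfolding u by simp
    then have "om y u w = - h' w"
      unfolding sigma_Dg differential_on_eq[OF assms] by (simp only: of_real_minus[symmetric] of_real_eq_iff)
    then show ?thesis using om_ham[OF assms, of w] bounded_bilinear.diff_left[OF bilinear_om] by simp
  qed
  then have "u - ham (\<lambda>y. h (g y)) y = 0" by (rule om_nondeg)
  then show "v = Dg y (ham (\<lambda>y. h (g y)) y)" using u by simp
qed

lemma hamilton_derivative_eq:
  assumes "((\<lambda>y. h (g y)) has_derivative h') (at y)" "((\<lambda>y. k (g y)) has_derivative k') (at y)"
  shows "hamilton_derivative \<Lambda> h k (g y) = k' (ham (\<lambda>y. h (g y)) y)"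
  unfolding hamilton_derivative_def hamilton_field_eq[OF assms(1)] by (rule differential_on_eq[OF assms(2)])

text \<open>The coefficient of \<sigma>^n/n! in the coordinates g. Its sign depends on g and on the
  enumeration \<open>ix\<close>, so densities use its absolute value.\<close>

definition "vol y = Re (sigma_power CARD('n) (\<lambda>i. Dg y (axis (ix i) 1)) / fact CARD('n))"

lemma sigma_power_Dg: "sigma_power CARD('n) (\<lambda>i. Dg y (axis (ix i) 1)) / fact CARD('n) = complex_of_real (vol y)"
proof -
  have "sigma_power CARD('n) (\<lambda>i. Dg y (axis (ix i) 1)) \<in> \<real>"
    by (rule sigma_power_real) (simp add: sigma_Dg)
  moreover have "(fact CARD('n) :: complex) \<in> \<real>" by (metis Reals_of_nat of_nat_fact)
  ultimately show ?thesis unfolding vol_def by (simp add: Reals_divide)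
qed

lemma vol_nonzero: "vol y \<noteq> 0"
proof -
  have "sigma_power CARD('n) (\<lambda>i. Dg y (axis (ix i) 1)) \<noteq> 0"
    by (rule sigma_power_nonzero[OF linear_Dg]) (auto simp: sigma_Dg intro: om_nondeg)
  then show ?thesis using sigma_power_Dg[of y] by auto
qed

lemma Ck_vol: "Ck k UNIV vol"
  unfolding vol_def divide_inverse
  by (intro Ck_bounded_linear[OF open_UNIV bounded_linear_Re] Ck_mult open_UNIV Ck_const Ck_sigma_power
    Ck_bilinear[OF open_UNIV bounded_bilinear_sigma] Ck_Dg)

end

section \<open>Liouville's theorem\<close>

lemma integrable_compact_support:
  fixes F :: "'a::euclidean_space \<Rightarrow> 'b::euclidean_space"
  assumes "continuous_on UNIV F" "compact K" "\<And>x. x \<notin> K \<Longrightarrow> F x = 0"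
  shows "integrable lborel F"
proof -
  have "integrable lborel (\<lambda>x. indicator K x *\<^sub>R F x)"
    by (rule borel_integrable_compact[OF assms(2)]) (rule continuous_on_subset[OF assms(1) subset_UNIV])
  moreover have "(\<lambda>x. indicator K x *\<^sub>R F x) = F"
    using assms(3) by (auto simp: fun_eq_iff indicator_def)
  ultimately show ?thesis by simp
qed

text \<open>By translation invariance the difference quotients have integral 0. They converge to the
  derivative and, by the mean value theorem, are dominated by its supremum on a compact set.\<close>

lemma integral_directional_derivative_zero:
  fixes F :: "'a::euclidean_space \<Rightarrow> real"
  assumes F: "Ck (Suc 0) UNIV F" and K: "compact K" "\<And>x. x \<notin> K \<Longrightarrow> F x = 0"
  shows "(\<integral>x. frechet_derivative F (at x) v \<partial>lborel) = 0"
proof -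
  let ?F' = "\<lambda>x. frechet_derivative F (at x) v"
  have der: "(F has_derivative frechet_derivative F (at x)) (at x)" for x
    using Ck_has_derivative[OF F] by simp
  have contF: "continuous_on UNIV F" by (rule Ck_continuous_on[OF F])
  have contF': "continuous_on UNIV ?F'" using Ck_frechet[OF F] by simp
  have F'0: "?F' x = 0" if "x \<notin> K" for x
  proof -
    have "(F has_derivative (\<lambda>h. 0)) (at x)"
      by (rule has_derivative_transform_within_open[of "\<lambda>x. 0" _ _ _ "- K"])
        (use K that compact_imp_closed in auto)
    from frechet_derivative_at[OF this] show ?thesis by (metis)
  qed
  obtain B where B: "\<And>x. \<bar>?F' x\<bar> \<le> B"
  proof -
    have "bounded (?F' ` K)"
      by (rule compact_imp_bounded, rule compact_continuous_image[OF continuous_on_subset[OF contF'] K(1)]) simp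
    then obtain B where "\<And>x. x \<in> K \<Longrightarrow> \<bar>?F' x\<bar> \<le> B" by (auto simp: bounded_iff)
    then have "\<bar>?F' x\<bar> \<le> max B 0" for x using F'0[of x] by (cases "x \<in> K") (auto simp: le_max_iff_disj)
    then show ?thesis by (rule that)
  qed
  \<comment> \<open>The points that a step \<open>s *\<^sub>R v\<close> with 0 \<le> s \<le> 1
    carries into K. Off K' and K all the difference quotients below vanish.\<close>
  define K' where "K' = (\<lambda>(x, s). x - s *\<^sub>R v) ` (K \<times> {0..1})"
  have K': "compact K'" unfolding K'_def split_beta
    by (intro compact_continuous_image compact_Times K(1) compact_Icc continuous_intros)
  define h where "h n = inverse (real (Suc n))" for n
  have h: "0 < h n" "h n \<le> 1" for n unfolding h_def by (auto simp: field_simps)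
  define q where "q n x = (F (x + h n *\<^sub>R v) - F x) / h n" for n x
  have line: "((\<lambda>t. F (x + t *\<^sub>R v)) has_real_derivative ?F' (x + t *\<^sub>R v)) (at t)" for x t
  proof -
    have "((\<lambda>t. x + t *\<^sub>R v) has_derivative (\<lambda>s. s *\<^sub>R v)) (at t)"
      by (auto intro!: derivative_eq_intros)
    from diff_chain_at[OF this der] show ?thesis
      unfolding has_field_derivative_def o_def
      by (simp add: linear_cmul[OF has_derivative_linear[OF der]] mult_commute_abs)
  qed
  have intF: "integrable lborel F" by (rule integrable_compact_support[OF contF K])
  have tr: "integrable lborel (\<lambda>x. F (x + a))" "(\<integral>x. F (x + a) \<partial>lborel) = (\<integral>x. F x \<partial>lborel)" for a
  proof -
    show "integrable lborel (\<lambda>x. F (x + a))"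
    proof (rule integrable_compact_support)
      show "continuous_on UNIV (\<lambda>x. F (x + a))"
        by (rule continuous_on_compose2[OF contF]) (auto intro!: continuous_intros)
      show "compact ((\<lambda>x. x - a) ` K)" by (intro compact_continuous_image K(1) continuous_intros)
      show "F (x + a) = 0" if "x \<notin> (\<lambda>x. x - a) ` K" for x
      proof (rule K(2))
        show "x + a \<notin> K" using that by (metis add_diff_cancel_right' image_eqI)
      qed
    qed
    have "(\<integral>x. F (a + x) \<partial>lborel) = (\<integral>x. F x \<partial>(distr lborel borel ((+) a)))"
      using intF by (subst integral_distr) auto
    then show "(\<integral>x. F (x + a) \<partial>lborel) = (\<integral>x. F x \<partial>lborel)"
      by (simp add: lborel_distr_plus add.commute)
  qed
  have intq: "(\<integral>x. q n x \<partial>lborel) = 0" for n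
    unfolding q_def using tr[of "h n *\<^sub>R v"] intF by simp
  have "(\<lambda>n. \<integral>x. q n x \<partial>lborel) \<longlonglongrightarrow> (\<integral>x. ?F' x \<partial>lborel)"
  proof (rule integral_dominated_convergence[where w="\<lambda>x. indicator (K' \<union> K) x * B"])
    show "?F' \<in> borel_measurable lborel" using borel_measurable_continuous_onI[OF contF'] by simp
    show "q n \<in> borel_measurable lborel" for n
      unfolding q_def using tr(1)[of "h n *\<^sub>R v"] intF by auto
    have "integrable lborel (\<lambda>x. indicator (K' \<union> K) x *\<^sub>R B)"
      by (rule borel_integrable_compact) (use K' K in auto)
    then show "integrable lborel (\<lambda>x. indicator (K' \<union> K) x * B)" by simp
    show "AE x in lborel. norm (q n x) \<le> indicator (K' \<union> K) x * B" for n
    proof (rule AE_I2)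
      fix x
      obtain z where z: "F (x + h n *\<^sub>R v) - F (x + 0 *\<^sub>R v) = (h n - 0) * ?F' (x + z *\<^sub>R v)"
        using MVT2[OF h(1)[of n], of "\<lambda>t. F (x + t *\<^sub>R v)" "\<lambda>t. ?F' (x + t *\<^sub>R v)"] line by blast
      then have q: "q n x = ?F' (x + z *\<^sub>R v)" using h(1)[of n] by (simp add: q_def)
      show "norm (q n x) \<le> indicator (K' \<union> K) x * B"
      proof (cases "x \<in> K' \<union> K")
        case True
        then show ?thesis using B[of "x + z *\<^sub>R v"] unfolding q by simp
      next
        case False
        have "x + h n *\<^sub>R v \<notin> K"
        proof
          assume a: "x + h n *\<^sub>R v \<in> K"
          have "x \<in> K'" unfolding K'_def
            by (rule image_eqI[of _ _ "(x + h n *\<^sub>R v, h n)"]) (use a h[of n] in auto)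
          then show False using False by simp
        qed
        then have "q n x = 0" unfolding q_def using K(2) False by simp
        then show ?thesis using False by simp
      qed
    qed
    show "AE x in lborel. (\<lambda>n. q n x) \<longlonglongrightarrow> ?F' x"
    proof (rule AE_I2)
      fix x
      have "((\<lambda>t. (F (x + t *\<^sub>R v) - F x) / t) \<longlongrightarrow> ?F' x) (at 0)"
        using line[of x 0] by (simp add: has_field_derivative_iff)
      moreover have "filterlim h (at 0) sequentially"
        unfolding h_def filterlim_at by (intro conjI LIMSEQ_inverse_real_of_nat) auto
      ultimately show "(\<lambda>n. q n x) \<longlonglongrightarrow> ?F' x"
        unfolding q_def by (rule filterlim_compose)
    qed
  qed
  then show ?thesis unfolding intq using LIMSEQ_unique tendsto_const by metis
qed

context param_manifold
begin

text \<open>Liouville's theorem: the divergence of \<open>vol\<close> times the Hamilton field is 0.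
  At y two moving frames are compared, v t = Dg (y + t H) e, whose \<sigma>^n yields the derivative
  of \<open>vol\<close> along H, and w t = Dg y e - t Dg y (A e), whose \<sigma>^n yields minus the
  trace of A = H'. Their pairings agree to first order because H is infinitesimally
  symplectic.\<close>

lemma ham_divergence:
  assumes P: "Ck (Suc (Suc 0)) UNIV P"
  shows "frechet_derivative vol (at y) (ham P y) +
    vol y * (\<Sum>k\<in>UNIV. frechet_derivative (ham P) (at y) (axis k 1) $ k) = 0"
proof -
  define H where "H = ham P"
  define A where "A = frechet_derivative H (at y)"
  define D2 where "D2 u w = frechet_derivative (\<lambda>z. Dg z u) (at y) w" for u w
  have CH: "Ck (Suc 0) UNIV H" unfolding H_def by (rule Ck_ham[OF P])
  have dH: "(H has_derivative A) (at y)" unfolding A_def using Ck_has_derivative[OF CH] by simp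
  have linA: "linear A" by (rule has_derivative_linear[OF dH])
  have dDg: "((\<lambda>z. Dg z u) has_derivative D2 u) (at y)" for u
    unfolding D2_def[abs_def] using Ck_has_derivative[OF Ck_Dg[of "Suc 0"]] by simp
  have linD2: "linear (D2 u)" for u by (rule has_derivative_linear[OF dDg])
  have sym: "D2 u w = D2 w u" for u w
    unfolding D2_def Dg_def by (rule frechet_derivative_symmetric[OF open_UNIV Ck_g]) simp
  have D2_expand: "D2 u w = (\<Sum>k\<in>UNIV. (u $ k) *\<^sub>R D2 (axis k 1) w)" for u w
  proof -
    have "D2 u w = D2 w (\<Sum>k\<in>UNIV. (u $ k) *\<^sub>R axis k 1)" using sym[of u w] vec_expand[of u] by simp
    also have "\<dots> = (\<Sum>k\<in>UNIV. (u $ k) *\<^sub>R D2 w (axis k 1))"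
      by (simp add: linear_sum[OF linD2] linear_cmul[OF linD2])
    finally show ?thesis using sym by simp
  qed
  have Dg_expand: "Dg z u = (\<Sum>k\<in>UNIV. (u $ k) *\<^sub>R Dg z (axis k 1))" for z u
  proof -
    have "Dg z u = Dg z (\<Sum>k\<in>UNIV. (u $ k) *\<^sub>R axis k 1)" using vec_expand[of u] by simp
    then show ?thesis by (simp add: linear_sum[OF linear_Dg] linear_cmul[OF linear_Dg])
  qed
  \<comment> \<open>X is the Hamilton field as a vector field in the ambient space along g. There
    \<sigma> has constant coefficients, so only X and \<open>Dg\<close> are differentiated.\<close>
  define X where "X z = Dg z (H z)" for z
  define X' where "X' u = D2 (H y) u + Dg y (A u)" for u
  have dX: "(X has_derivative X') (at y)"
  proof -
    have dHk: "((\<lambda>z. H z $ k) has_derivative (\<lambda>u. A u $ k)) (at y)" for k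
      by (rule bounded_linear.has_derivative[OF bounded_linear_vec_nth dH])
    have "((\<lambda>z. \<Sum>k\<in>UNIV. (H z $ k) *\<^sub>R Dg z (axis k 1)) has_derivative
      (\<lambda>u. \<Sum>k\<in>UNIV. (H y $ k) *\<^sub>R D2 (axis k 1) u + (A u $ k) *\<^sub>R Dg y (axis k 1))) (at y)"
      by (intro has_derivative_sum has_derivative_scaleR dHk dDg)
    then show ?thesis
      unfolding X_def X'_def Dg_expand[of _ "H _"] D2_expand[of "H y"] Dg_expand[of y "A _"] sum.distrib .
  qed
  have S: "sigma (X' u) (Dg y w) + sigma (X y) (D2 w u) =
      - complex_of_real (frechet_derivative (\<lambda>z. frechet_derivative P (at z) w) (at y) u)" for u w
  proof -
    have Pz: "(P has_derivative frechet_derivative P (at z)) (at z)" for z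
      using Ck_has_derivative[OF P] by simp
    have e: "sigma (X z) (Dg z w) = complex_of_real (- frechet_derivative P (at z) w)" for z
      unfolding X_def sigma_Dg H_def using om_ham[OF Pz] by simp
    have "((\<lambda>z. sigma (X z) (Dg z w)) has_derivative (\<lambda>u. sigma (X y) (D2 w u) + sigma (X' u) (Dg y w))) (at y)"
      by (rule sigma.FDERIV[OF dX dDg])
    moreover have "((\<lambda>z. complex_of_real (- frechet_derivative P (at z) w)) has_derivative
       (\<lambda>u. complex_of_real (- frechet_derivative (\<lambda>z. frechet_derivative P (at z) w) (at y) u))) (at y)"
      using Ck_has_derivative[OF Ck_frechet[OF P], of y w]
      by (intro has_derivative_of_real has_derivative_minus) simp
    ultimately have "(\<lambda>u. sigma (X y) (D2 w u) + sigma (X' u) (Dg y w)) =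
       (\<lambda>u. complex_of_real (- frechet_derivative (\<lambda>z. frechet_derivative P (at z) w) (at y) u))"
      unfolding e by (rule has_derivative_unique)
    from fun_cong[OF this, of u] show ?thesis by (simp add: add.commute)
  qed
  \<comment> \<open>Both the second derivative of g and the Hessian of P are symmetric, so the
    remaining term of S is symmetric as well. This is invariance of \<sigma> under the flow, to
    first order.\<close>
  have symm: "sigma (X' u) (Dg y w) = sigma (X' w) (Dg y u)" for u w
  proof -
    have "frechet_derivative (\<lambda>z. frechet_derivative P (at z) w) (at y) u =
       frechet_derivative (\<lambda>z. frechet_derivative P (at z) u) (at y) w"
      by (rule frechet_derivative_symmetric[OF open_UNIV P]) simp
    then show ?thesis using S[of u w] S[of w u] sym[of u w] by (metis add_right_cancel)
  qed
  define e where "e i = (axis (ix i) 1 :: real^('n bit0))" for i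
  define v where "v i t = Dg (y + t *\<^sub>R H y) (e i)" for i and t :: real
  define w where "w i t = Dg y (e i) - t *\<^sub>R Dg y (A (e i))" for i and t :: real
  have dv: "(v i has_vector_derivative (X' (e i) - Dg y (A (e i)))) (at 0)" for i
  proof -
    have "((\<lambda>t. y + t *\<^sub>R H y) has_vector_derivative H y) (at 0)"
      by (auto intro!: derivative_eq_intros simp: has_vector_derivative_def)
    from vector_derivative_diff_chain_within[OF this, of "\<lambda>z. Dg z (e i)" "D2 (e i)"]
    have "(v i has_vector_derivative D2 (e i) (H y)) (at 0)"
      using dDg by (simp add: o_def v_def[abs_def] has_derivative_at_withinI)
    then show ?thesis unfolding X'_def using sym by simp
  qed
  have dw: "(w i has_vector_derivative - Dg y (A (e i))) (at 0)" for i
    unfolding w_def[abs_def] by (auto intro!: derivative_eq_intros simp: has_vector_derivative_def)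
  have bil: "((\<lambda>t. sigma (a t) (b t)) has_vector_derivative sigma (a 0) b' + sigma a' (b 0)) (at 0)"
    if "(a has_vector_derivative a') (at (0::real))" "(b has_vector_derivative b') (at 0)" for a b :: "real \<Rightarrow> 'n phase" and a' b'
    by (rule sigma.has_vector_derivative[OF that])
  have v0: "v i 0 = Dg y (e i)" "w i 0 = Dg y (e i)" for i by (simp_all add: v_def w_def)
  have "\<exists>d. ((\<lambda>t. sigma_power CARD('n) (\<lambda>i. v i t)) has_vector_derivative d) (at 0) \<and>
             ((\<lambda>t. sigma_power CARD('n) (\<lambda>i. w i t)) has_vector_derivative d) (at 0)"
  proof (rule sigma_power_same_derivative)
    fix i j
    show "sigma (v i 0) (v j 0) = sigma (w i 0) (w j 0)" unfolding v0 ..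
    \<comment> \<open>By \<open>symm\<close> the two terms with X' cancel, which leaves the
      derivative of the pairing of w i and w j.\<close>
    have "sigma (Dg y (e i)) (X' (e j) - Dg y (A (e j))) + sigma (X' (e i) - Dg y (A (e i))) (Dg y (e j)) =
       sigma (Dg y (e i)) (- Dg y (A (e j))) + sigma (- Dg y (A (e i))) (Dg y (e j))"
      using symm[of "e i" "e j"] sigma_commute[of "Dg y (e i)" "X' (e j)"]
      by (simp add: sigma.diff_left sigma.diff_right sigma.minus_left sigma.minus_right)
    then show "\<exists>d. ((\<lambda>t. sigma (v i t) (v j t)) has_vector_derivative d) (at 0) \<and>
          ((\<lambda>t. sigma (w i t) (w j t)) has_vector_derivative d) (at 0)"
      using bil[OF dv[of i] dv[of j]] bil[OF dw[of i] dw[of j]] unfolding v0 by auto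
  qed
  then obtain d where d: "((\<lambda>t. sigma_power CARD('n) (\<lambda>i. v i t)) has_vector_derivative d) (at 0)"
      "((\<lambda>t. sigma_power CARD('n) (\<lambda>i. w i t)) has_vector_derivative d) (at 0)" by (elim exE conjE)
  let ?\<alpha> = "sigma_power CARD('n) :: (nat \<Rightarrow> 'n phase) \<Rightarrow> complex"
  let ?a = "\<lambda>i. Dg y (e i)"
  let ?N = "2 * CARD('n)"
  have "d = - (\<Sum>i<?N. ?\<alpha> (?a(i := Dg y (A (e i)))))"
    using alternating_form_line_derivative[OF alternating_sigma_power, of "CARD('n)" ?a "\<lambda>i. Dg y (A (e i))"]
      d(2) unfolding w_def by (rule vector_derivative_unique_at[rotated])
  also have "(\<Sum>i<?N. ?\<alpha> (?a(i := Dg y (A (e i))))) = (\<Sum>i<?N. complex_of_real (A (e i) $ ix i) * ?\<alpha> ?a)"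
  proof (rule sum.cong[OF refl])
    fix i assume "i \<in> {..<?N}"
    then have i: "i < ?N" by simp
    have "?\<alpha> (?a(i := Dg y (A (e i)))) = (\<Sum>k\<in>UNIV. complex_of_real (A (e i) $ k) * ?\<alpha> (?a(i := Dg y (axis k 1))))"
      unfolding Dg_expand[of y "A (e i)"] by (rule alternating_form_sum[OF alternating_sigma_power subspace_UNIV _ i]) auto
    \<comment> \<open>A component of A (e i) along another frame vector repeats that vector; only
      the diagonal coefficient survives, and the trace appears.\<close>
    also have "\<dots> = (\<Sum>k\<in>UNIV. if k = ix i then complex_of_real (A (e i) $ k) * ?\<alpha> ?a else 0)"
    proof (rule sum.cong[OF refl])
      fix k :: "'n bit0"
      show "complex_of_real (A (e i) $ k) * ?\<alpha> (?a(i := Dg y (axis k 1))) =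
        (if k = ix i then complex_of_real (A (e i) $ k) * ?\<alpha> ?a else 0)"
      proof (cases "k = ix i")
        case True
        then have "?a(i := Dg y (axis k 1)) = ?a" by (auto simp: fun_eq_iff e_def)
        then show ?thesis using True by (simp only: if_True refl simp_thms)
      next
        case False
        obtain j where j: "j < ?N" "k = ix j"
          using bij_ix2[where 'n='n] by (metis UNIV_I bij_betw_def imageE lessThan_iff)
        then have "j \<noteq> i" using False by blast
        have "?\<alpha> (?a(i := Dg y (axis k 1))) = 0"
          by (rule alternating_form_eq_0[OF alternating_sigma_power _ i j(1)]) (use \<open>j \<noteq> i\<close> j(2) in \<open>auto simp: e_def\<close>)
        then show ?thesis using False by (simp only: if_False mult_zero_right)
      qed
    qed
    also have "\<dots> = complex_of_real (A (e i) $ ix i) * ?\<alpha> ?a" by (subst sum.delta) auto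
    finally show "?\<alpha> (?a(i := Dg y (A (e i)))) = complex_of_real (A (e i) $ ix i) * ?\<alpha> ?a" .
  qed
  also have "\<dots> = complex_of_real (\<Sum>k\<in>UNIV. A (axis k 1) $ k) * ?\<alpha> ?a"
  proof -
    have "(\<Sum>k\<in>UNIV. A (axis k 1) $ k) = (\<Sum>i<?N. A (e i) $ ix i)"
      unfolding e_def by (rule sum.reindex_bij_betw[OF bij_ix2, symmetric])
    then show ?thesis by (simp add: sum_distrib_right)
  qed
  finally have d_eq: "d = - (complex_of_real (\<Sum>k\<in>UNIV. A (axis k 1) $ k) * ?\<alpha> ?a)" .
  have "((\<lambda>t. vol (y + t *\<^sub>R H y)) has_vector_derivative frechet_derivative vol (at y) (H y)) (at 0)"
  proof -
    have "((\<lambda>t. y + t *\<^sub>R H y) has_vector_derivative H y) (at 0)"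
      by (auto intro!: derivative_eq_intros simp: has_vector_derivative_def)
    from vector_derivative_diff_chain_within[OF this, of vol "frechet_derivative vol (at y)"]
    show ?thesis
      using Ck_has_derivative[OF Ck_vol[of "Suc 0"], of y] by (simp add: o_def has_derivative_at_withinI)
  qed
  then have 1: "((\<lambda>t. complex_of_real (vol (y + t *\<^sub>R H y))) has_vector_derivative
     complex_of_real (frechet_derivative vol (at y) (H y))) (at 0)"
    by (rule bounded_linear.has_vector_derivative[OF bounded_linear_of_real])
  have "((\<lambda>t. sigma_power CARD('n) (\<lambda>i. v i t) / fact CARD('n)) has_vector_derivative d / fact CARD('n)) (at 0)"
    by (rule has_vector_derivative_divide[OF d(1)])
  then have "((\<lambda>t. complex_of_real (vol (y + t *\<^sub>R H y))) has_vector_derivative d / fact CARD('n)) (at 0)"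
    unfolding v_def e_def sigma_power_Dg .
  with 1 have "complex_of_real (frechet_derivative vol (at y) (H y)) = d / fact CARD('n)"
    by (rule vector_derivative_unique_at)
  also have "\<dots> = - (complex_of_real (\<Sum>k\<in>UNIV. A (axis k 1) $ k) * (?\<alpha> ?a / fact CARD('n)))"
    unfolding d_eq by simp
  also have "?\<alpha> ?a / fact CARD('n) = complex_of_real (vol y)"
    unfolding e_def by (rule sigma_power_Dg)
  finally have "complex_of_real (frechet_derivative vol (at y) (H y)) =
      complex_of_real (- ((\<Sum>k\<in>UNIV. A (axis k 1) $ k) * vol y))"
    by (simp only: of_real_mult of_real_minus)
  then have "frechet_derivative vol (at y) (H y) = - ((\<Sum>k\<in>UNIV. A (axis k 1) $ k) * vol y)"
    by (simp only: of_real_eq_iff)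
  then show ?thesis unfolding A_def H_def by (simp add: mult.commute)
qed

text \<open>By \<open>ham_divergence\<close> the integrand is the divergence of the field \<phi> vol
  H, and each of its coordinate derivatives integrates to 0.\<close>

lemma integral_ham_zero:
  assumes P: "Ck (Suc (Suc 0)) UNIV P" and \<phi>: "Ck (Suc 0) UNIV \<phi>"
    and K: "compact K" "\<And>y. y \<notin> K \<Longrightarrow> \<phi> y = 0"
  shows "(\<integral>y. vol y * frechet_derivative \<phi> (at y) (ham P y) \<partial>lborel) = 0"
proof -
  define F where "F k y = vol y * (ham P y $ k) * \<phi> y" for k y
  have CH: "Ck (Suc 0) UNIV (\<lambda>y. ham P y $ k)" for k
    by (rule Ck_vec_nth[OF open_UNIV Ck_ham[OF P]])
  have CF: "Ck (Suc 0) UNIV (F k)" for k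
    unfolding F_def[abs_def] by (intro Ck_mult open_UNIV Ck_vol CH \<phi>)
  have F0: "F k y = 0" if "y \<notin> K" for k y using K(2)[OF that] by (simp add: F_def)
  have int0: "(\<integral>y. frechet_derivative (F k) (at y) (axis k 1) \<partial>lborel) = 0" for k
    by (rule integral_directional_derivative_zero[OF CF K(1) F0])
  have int: "integrable lborel (\<lambda>y. frechet_derivative (F k) (at y) (axis k 1))" for k
  proof (rule integrable_compact_support[OF _ K(1)])
    show "continuous_on UNIV (\<lambda>y. frechet_derivative (F k) (at y) (axis k 1))" using Ck_frechet[OF CF] by simp
    show "frechet_derivative (F k) (at x) (axis k 1) = 0" if "x \<notin> K" for x
    proof -
      have "(F k has_derivative (\<lambda>h. 0)) (at x)"
        by (rule has_derivative_transform_within_open[of "\<lambda>x. 0" _ _ _ "- K"])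
          (use K that compact_imp_closed F0 in auto)
      from frechet_derivative_at[OF this] show ?thesis by (metis)
    qed
  qed
  have "vol y * frechet_derivative \<phi> (at y) (ham P y) = (\<Sum>k\<in>UNIV. frechet_derivative (F k) (at y) (axis k 1))" for y
  proof -
    let ?H = "ham P y"
    let ?A = "frechet_derivative (ham P) (at y)"
    have dH: "(ham P has_derivative ?A) (at y)" using Ck_has_derivative[OF Ck_ham[OF P], of y] by simp
    have dv: "(vol has_derivative frechet_derivative vol (at y)) (at y)"
      using Ck_has_derivative[OF Ck_vol[of "Suc 0"], of y] by simp
    have d\<phi>: "(\<phi> has_derivative frechet_derivative \<phi> (at y)) (at y)"
      using Ck_has_derivative[OF \<phi>, of y] by simp
    have dF: "frechet_derivative (F k) (at y) (axis k 1) = (frechet_derivative vol (at y) (axis k 1) * (?H $ k)) * \<phi> y +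
        vol y * \<phi> y * (?A (axis k 1) $ k) + vol y * (?H $ k * frechet_derivative \<phi> (at y) (axis k 1))" for k
    proof -
      have "((\<lambda>y. ham P y $ k) has_derivative (\<lambda>u. ?A u $ k)) (at y)"
        by (rule bounded_linear.has_derivative[OF bounded_linear_vec_nth dH])
      from has_derivative_mult[OF has_derivative_mult[OF dv this] d\<phi>]
      have "(F k has_derivative (\<lambda>u. vol y * (?H $ k) * frechet_derivative \<phi> (at y) u +
         (vol y * (?A u $ k) + frechet_derivative vol (at y) u * (?H $ k)) * \<phi> y)) (at y)"
        unfolding F_def[abs_def] .
      from frechet_derivative_at[OF this, symmetric] show ?thesis by (simp add: algebra_simps)
    qed
    have lin: "L ?H = (\<Sum>k\<in>UNIV. ?H $ k * L (axis k 1))" if "linear L" for L :: "real^('n bit0) \<Rightarrow> real"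
    proof -
      have "L ?H = L (\<Sum>k\<in>UNIV. (?H $ k) *\<^sub>R axis k 1)" using vec_expand[of ?H] by simp
      then show ?thesis by (simp add: linear_sum[OF that] linear_cmul[OF that])
    qed
    have "(\<Sum>k\<in>UNIV. frechet_derivative (F k) (at y) (axis k 1)) =
       \<phi> y * (frechet_derivative vol (at y) ?H + vol y * (\<Sum>k\<in>UNIV. ?A (axis k 1) $ k)) +
       vol y * frechet_derivative \<phi> (at y) ?H"
      unfolding dF lin[OF has_derivative_linear[OF dv]] lin[OF has_derivative_linear[OF d\<phi>]]
      by (simp add: sum.distrib sum_distrib_left algebra_simps)
    then show ?thesis using ham_divergence[OF P, of y] by simp
  qed
  then show ?thesis using int int0 by simp
qed

end

section \<open>The Liouville density\<close>

lemma vec_expand_ix: "(u :: real^('n::finite bit0)) = (\<Sum>j<2 * CARD('n). (u $ ix j) *\<^sub>R axis (ix j) 1)"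
proof -
  have "(\<Sum>j<2 * CARD('n). (u $ ix j) *\<^sub>R axis (ix j) (1::real)) = (\<Sum>k\<in>UNIV. (u $ k) *\<^sub>R axis k 1)"
    by (rule sum.reindex_bij_betw[OF bij_ix2])
  then show ?thesis using vec_expand[of u] by (rule trans[OF _ sym, rotated])
qed

lemma wedge_1_1:
  "wedge 1 1 (\<lambda>s. a (s 0)) (\<lambda>s. b (s 0)) v = a (v 0) * b (v 1) - a (v 1) * b (v (0::nat))"
proof -
  have e: "{..<(1::nat) + 1} = {0, 1}" by auto
  have s: "{\<pi>. \<pi> permutes {0, 1::nat}} = {id, Transposition.transpose 0 1}"
    by (auto simp: permutes_doubleton_iff)
  have ne: "id \<noteq> Transposition.transpose 0 (1::nat)"
    by (metis id_apply transpose_apply_first zero_neq_one)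
  show ?thesis unfolding wedge_def e s using ne by (simp add: sign_swap_id)
qed

context param_manifold
begin

text \<open>\<Theta> supplies a frame whose first k vectors lie in the kernel of q' and whose last
  two have q'-values 1 and -i, that is dP = 1, dQ = 0 and dP = 0, dQ = 1 for q = P - iQ. On the last
  two the form (i/2) dq \<and> d(cnj q) is -1, so by \<open>wedge_eval\<close> every admissible L
  takes the value - \<sigma>^n/n! on that frame. L itself is not unique, but its value on the kernel
  vectors is.\<close>

lemma liouville_density_eq:
  fixes q :: "'n phase \<Rightarrow> complex"
  defines "k \<equiv> 2 * CARD('n) - 2"
  assumes q: "((\<lambda>y. q (g y)) has_derivative q') (at y)"
    and \<Theta>: "linear \<Theta>" "surj \<Theta>"
    and q0: "\<And>i. i < k \<Longrightarrow> q' (\<Theta> (axis (ix i) 1)) = 0"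
    and q1: "q' (\<Theta> (axis (ix k) 1)) = 1" "q' (\<Theta> (axis (ix (Suc k)) 1)) = - \<i>"
    and v: "\<And>i. i < k \<Longrightarrow> v i = Dg y (\<Theta> (axis (ix i) 1))"
  shows "liouville_density \<Lambda> q (g y) v = \<bar>vol y * det (matrix \<Theta>)\<bar>"
proof -
  let ?N = "2 * CARD('n)"
  have k2: "k + 2 = ?N" unfolding k_def using zero_less_card_finite[where 'a='n] by linarith
  define T where "T = tangent_space \<Lambda> (g y)"
  have T: "T = range (Dg y)" unfolding T_def by (rule tangent_space_eq)
  have subT: "subspace T" unfolding T by (rule linear_subspace_image[OF linear_Dg subspace_UNIV])
  define v0 where "v0 i = Dg y (\<Theta> (axis (ix i) 1))" for i
  have v0T: "v0 i \<in> T" for i by (simp add: T v0_def)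
  define dq where "dq = differential_on \<Lambda> q (g y)"
  define dqb where "dqb = differential_on \<Lambda> (\<lambda>z. cnj (q z)) (g y)"
  have dq: "dq (Dg y u) = q' u" for u unfolding dq_def by (rule differential_on_eq[OF q])
  have dqb: "dqb (Dg y u) = cnj (q' u)" for u unfolding dqb_def
    by (rule differential_on_eq[OF has_derivative_cnj[OF q]])
  define \<beta> where "\<beta> u = \<i> / 2 * wedge 1 1 (\<lambda>s. dq (s 0)) (\<lambda>s. dqb (s 0)) u" for u
  have lin: "linear q'" by (rule has_derivative_linear[OF q])
  have alt\<beta>: "alternating_form 2 T \<beta>"
  proof -
    have 1: "alternating_form 1 T (\<lambda>s. dq (s 0))"
    proof (rule alternating_form_1I)
      fix x y' a b assume "x \<in> T" "y' \<in> T"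
      then obtain u w where uw: "x = Dg y u" "y' = Dg y w" unfolding T by blast
      have "a *\<^sub>R x + b *\<^sub>R y' = Dg y (a *\<^sub>R u + b *\<^sub>R w)"
        unfolding uw by (simp add: linear_add[OF linear_Dg] linear_cmul[OF linear_Dg])
      then show "dq (a *\<^sub>R x + b *\<^sub>R y') = complex_of_real a * dq x + complex_of_real b * dq y'"
        by (simp add: uw dq linear_add[OF lin] linear_cmul[OF lin] scaleR_conv_of_real[where 'a=complex])
    qed
    have 2: "alternating_form 1 T (\<lambda>s. dqb (s 0))"
    proof (rule alternating_form_1I)
      fix x y' a b assume "x \<in> T" "y' \<in> T"
      then obtain u w where uw: "x = Dg y u" "y' = Dg y w" unfolding T by blast
      have "a *\<^sub>R x + b *\<^sub>R y' = Dg y (a *\<^sub>R u + b *\<^sub>R w)"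
        unfolding uw by (simp add: linear_add[OF linear_Dg] linear_cmul[OF linear_Dg])
      then show "dqb (a *\<^sub>R x + b *\<^sub>R y') = complex_of_real a * dqb x + complex_of_real b * dqb y'"
        by (simp add: uw dqb linear_add[OF lin] linear_cmul[OF lin] scaleR_conv_of_real[where 'a=complex])
    qed
    have "alternating_form (1 + 1) T \<beta>" unfolding \<beta>_def[abs_def]
      by (intro alternating_form_scale wedge_alternating 1 2)
    then show ?thesis unfolding one_add_one .
  qed
  have \<beta>0: "\<beta> (\<lambda>j. if j = 0 then v0 i else x) = 0" if "i < k" for i x
    unfolding \<beta>_def wedge_1_1 using q0[OF that] by (simp add: v0_def dq dqb)
  have \<beta>1: "\<beta> (\<lambda>i. v0 (k + i)) = -1"
    unfolding \<beta>_def wedge_1_1 using q1 by (simp add: v0_def dq dqb)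
  have eval: "wedge k 2 L \<beta> v0 = - L v0" if L: "alternating_form k T L" for L
    using wedge_eval[OF L alt\<beta> subT, of v0] v0T \<beta>0 \<beta>1 by simp
  have Lv: "L v = L v0" if L: "alternating_form k T L" for L
    by (rule alternating_form_cong[OF L]) (simp add: v v0_def)
  let ?sp = "\<lambda>w. sigma_power CARD('n) w / fact CARD('n) :: complex"
  have altsp: "alternating_form ?N T ?sp"
  proof -
    have "alternating_form ?N T (\<lambda>w. inverse (fact CARD('n)) * sigma_power CARD('n) w)"
      by (intro alternating_form_scale alternating_form_subset[OF alternating_sigma_power subset_UNIV])
    then show ?thesis by (simp add: divide_inverse mult.commute)
  qed
  \<comment> \<open>A witness for L: fill the last two slots of \<sigma>^n/n! with the last two
    frame vectors. The minus sign compensates \<open>\<beta>1\<close>.\<close>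
  define L0 where "L0 u = - ?sp (\<lambda>i. if i < k then u i else v0 i)" for u
  have altL0: "alternating_form k T L0"
  proof (rule alternating_formI)
    show "L0 u = L0 w" if "\<And>i. i < k \<Longrightarrow> u i = w i" for u w
    proof -
      have "(\<lambda>i. if i < k then u i else v0 i) = (\<lambda>i. if i < k then w i else v0 i)" using that by auto
      then show ?thesis unfolding L0_def by simp
    qed
    show "L0 (u(i := a *\<^sub>R x + b *\<^sub>R z)) = complex_of_real a * L0 (u(i := x)) + complex_of_real b * L0 (u(i := z))"
      if "\<And>j. j < k \<Longrightarrow> u j \<in> T" "i < k" "x \<in> T" "z \<in> T" for u i x z a b
    proof -
      have e: "(\<lambda>j. if j < k then (u(i := c)) j else v0 j) = (\<lambda>j. if j < k then u j else v0 j)(i := c)" for c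
        using that(2) by (auto simp: fun_eq_iff)
      show ?thesis unfolding L0_def e
        using alternating_form_linear[OF altsp, of "\<lambda>j. if j < k then u j else v0 j" i x z a b] that v0T k2
        by simp
    qed
    show "L0 u = 0" if "\<And>l. l < k \<Longrightarrow> u l \<in> T" "i < k" "j < k" "i \<noteq> j" "u i = u j" for u i j
    proof -
      have "?sp (\<lambda>i. if i < k then u i else v0 i) = 0"
        by (rule alternating_form_eq_0[OF altsp, of _ i j]) (use that v0T k2 in auto)
      then show ?thesis unfolding L0_def by simp
    qed
  qed
  have L0v: "L0 v0 = - ?sp v0" unfolding L0_def by simp
  \<comment> \<open>Both sides are forms of top degree on T and agree on the basis v0, hence
    everywhere.\<close>
  have ok: "wedge k 2 L0 \<beta> w = ?sp w" if w: "\<And>i. i < ?N \<Longrightarrow> w i \<in> T" for w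
  proof -
    have "\<exists>B. \<forall>i<?N. w i = (\<Sum>j<?N. B i j *\<^sub>R v0 j)"
    proof -
      have "\<exists>c. w i = (\<Sum>j<?N. c j *\<^sub>R v0 j)" if i: "i < ?N" for i
      proof -
        obtain u where u: "w i = Dg y u" using w[OF i] unfolding T by blast
        obtain x where x: "u = \<Theta> x" using \<Theta>(2) by blast
        have "x = (\<Sum>j<?N. (x $ ix j) *\<^sub>R axis (ix j) 1)"
          by (rule vec_expand_ix)
        then have "u = \<Theta> (\<Sum>j<?N. (x $ ix j) *\<^sub>R axis (ix j) 1)" using x by simp
        then have "w i = (\<Sum>j<?N. (x $ ix j) *\<^sub>R v0 j)"
          unfolding u v0_def
          by (simp add: linear_sum[OF \<Theta>(1)] linear_cmul[OF \<Theta>(1)] linear_sum[OF linear_Dg] linear_cmul[OF linear_Dg])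
        then show ?thesis by (rule exI[of _ "\<lambda>j. x $ ix j"])
      qed
      then have "\<forall>i. \<exists>c. i < ?N \<longrightarrow> w i = (\<Sum>j<?N. c j *\<^sub>R v0 j)" by blast
      from choice[OF this] obtain B where "\<forall>i. i < ?N \<longrightarrow> w i = (\<Sum>j<?N. B i j *\<^sub>R v0 j)" ..
      then show ?thesis by (intro exI[of _ B])
    qed
    then obtain B where B: "\<And>i. i < ?N \<Longrightarrow> w i = (\<Sum>j<?N. B i j *\<^sub>R v0 j)" by blast
    have altw: "alternating_form ?N T (wedge k 2 L0 \<beta>)"
      using wedge_alternating[OF altL0 alt\<beta>] unfolding k2 .
    have "wedge k 2 L0 \<beta> w = complex_of_real (nat_det ?N B) * wedge k 2 L0 \<beta> v0"
      by (rule alternating_form_top[OF altw subT v0T B])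
    also have "wedge k 2 L0 \<beta> v0 = ?sp v0" unfolding eval[OF altL0] L0v by simp
    also have "complex_of_real (nat_det ?N B) * ?sp v0 = ?sp w"
      by (rule alternating_form_top[OF altsp subT v0T B, symmetric])
    finally show ?thesis .
  qed
  have "liouville_density \<Lambda> q (g y) v = (THE c. \<exists>L. alternating_form k T L \<and>
        (\<forall>w. (\<forall>i<?N. w i \<in> T) \<longrightarrow> wedge k 2 L \<beta> w = sigma_power CARD('n) w / fact CARD('n)) \<and> c = norm (L v))"
    unfolding liouville_density_def k_def T_def \<beta>_def[abs_def] dq_def dqb_def by (rule refl)
  also have "\<dots> = norm (?sp v0)"
  proof (rule the_equality)
    show "\<exists>L. alternating_form k T L \<and>
        (\<forall>w. (\<forall>i<?N. w i \<in> T) \<longrightarrow> wedge k 2 L \<beta> w = ?sp w) \<and> norm (?sp v0) = norm (L v)"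
      using altL0 ok Lv[OF altL0] L0v by (intro exI[of _ L0]) simp
    fix c assume "\<exists>L. alternating_form k T L \<and>
        (\<forall>w. (\<forall>i<?N. w i \<in> T) \<longrightarrow> wedge k 2 L \<beta> w = ?sp w) \<and> c = norm (L v)"
    then obtain L where L: "alternating_form k T L" "wedge k 2 L \<beta> v0 = ?sp v0" "c = norm (L v)"
      using v0T by blast
    have "- L v = ?sp v0" using L(2) unfolding eval[OF L(1)] Lv[OF L(1)] .
    then show "c = norm (?sp v0)" unfolding L(3) by (metis norm_minus_cancel)
  qed
  also have "?sp v0 = complex_of_real (det (matrix \<Theta>)) * complex_of_real (vol y)"
  proof -
    \<comment> \<open>Passing from the coordinate frame to the frame v0 multiplies a top form by the
      determinant of \<Theta>.\<close>
    have "v0 i = (\<Sum>j<?N. (\<Theta> (axis (ix i) 1) $ ix j) *\<^sub>R Dg y (axis (ix j) 1))" for i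
    proof -
      let ?u = "\<Theta> (axis (ix i) 1)"
      have "?u = (\<Sum>j<?N. (?u $ ix j) *\<^sub>R axis (ix j) 1)"
        by (rule vec_expand_ix)
      then have "v0 i = Dg y (\<Sum>j<?N. (?u $ ix j) *\<^sub>R axis (ix j) 1)" by (simp add: v0_def)
      then show ?thesis by (simp add: linear_sum[OF linear_Dg] linear_cmul[OF linear_Dg])
    qed
    then have "?sp v0 = complex_of_real (nat_det ?N (\<lambda>i j. \<Theta> (axis (ix i) 1) $ ix j)) * ?sp (\<lambda>j. Dg y (axis (ix j) 1))"
      by (intro alternating_form_top[OF altsp subT]) (auto simp: T)
    also have "nat_det ?N (\<lambda>i j. \<Theta> (axis (ix i) 1) $ ix j) = det (matrix \<Theta>)"
    proof -
      have "(\<lambda>i j. \<Theta> (axis (ix i) 1) $ ix j) = (\<lambda>i j. transpose (matrix \<Theta>) $ ix i $ ix j)"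
        by (simp add: transpose_def matrix_def)
      then show ?thesis using nat_det_eq_det[OF bij_ix2, of "transpose (matrix \<Theta>)"] by (simp only: det_transpose)
    qed
    finally show ?thesis unfolding sigma_power_Dg .
  qed
  finally show ?thesis by (simp add: norm_mult abs_mult mult.commute)
qed

end

section \<open>An approximate identity\<close>

text \<open>At s = 0 the difference quotient is bounded by a positive power of \<bar>h\<bar>; this
  is where the exponent has to be at least two.\<close>

lemma DERIV_truncated_power:
  "((\<lambda>s::real. (max 0 s) ^ Suc (Suc n)) has_real_derivative real (Suc (Suc n)) * (max 0 s) ^ Suc n) (at s)"
proof -
  consider "s > 0" | "s < 0" | "s = 0" by linarith
  then show ?thesis
  proof cases
    case 1
    have "((\<lambda>s::real. s ^ Suc (Suc n)) has_real_derivative real (Suc (Suc n)) * s ^ Suc n) (at s)"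
      using DERIV_pow[of "Suc (Suc n)" s] by simp
    then have "((\<lambda>s::real. (max 0 s) ^ Suc (Suc n)) has_real_derivative real (Suc (Suc n)) * s ^ Suc n) (at s)"
      by (rule has_field_derivative_transform_within_open[of _ _ _ "{0<..}"]) (use 1 in auto)
    then show ?thesis using 1 by simp
  next
    case 2
    have "((\<lambda>s::real. 0) has_real_derivative 0) (at s)" by simp
    then have "((\<lambda>s::real. (max 0 s) ^ Suc (Suc n)) has_real_derivative 0) (at s)"
      by (rule has_field_derivative_transform_within_open[of _ _ _ "{..<0}"]) (use 2 in auto)
    then show ?thesis using 2 by simp
  next
    case 3
    have "((\<lambda>h::real. \<bar>h\<bar> ^ Suc n) \<longlongrightarrow> \<bar>0\<bar> ^ Suc n) (at 0)" by (intro tendsto_intros)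
    then have l: "((\<lambda>h::real. \<bar>h\<bar> ^ Suc n) \<longlongrightarrow> 0) (at 0)" by simp
    have "((\<lambda>h::real. (max 0 h) ^ Suc (Suc n) / h) \<longlongrightarrow> 0) (at 0)"
    proof (rule Lim_null_comparison[OF _ l], rule always_eventually, rule allI)
      fix h :: real
      show "norm ((max 0 h) ^ Suc (Suc n) / h) \<le> \<bar>h\<bar> ^ Suc n"
      proof (cases "h > 0")
        case False
        then have "max 0 h = 0" by simp
        then show ?thesis using zero_le_power[of "\<bar>h\<bar>" "Suc n"] by simp
      qed simp
    qed
    then show ?thesis using 3 by (simp add: has_field_derivative_iff)
  qed
qed

text \<open>The uniform quadratic B-spline, supported in \<open>[-3/2, 3/2]\<close>, and its odd primitive. Finite smoothness
  suffices for the integrations by parts and keeps the approximate identity polynomial.\<close>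

definition bspline :: "real \<Rightarrow> real" where
  "bspline s = ((max 0 (s + 3/2))\<^sup>2 - 3 * (max 0 (s + 1/2))\<^sup>2 + 3 * (max 0 (s - 1/2))\<^sup>2 - (max 0 (s - 3/2))\<^sup>2) / 2"

definition bspline_int :: "real \<Rightarrow> real" where
  "bspline_int s = ((max 0 (s + 3/2)) ^ 3 - 3 * (max 0 (s + 1/2)) ^ 3 + 3 * (max 0 (s - 1/2)) ^ 3 - (max 0 (s - 3/2)) ^ 3) / 6 - 1/2"

lemma DERIV_bspline_int: "(bspline_int has_real_derivative bspline s) (at s)"
proof -
  have d: "((\<lambda>s::real. (max 0 (s + c)) ^ 3) has_real_derivative 3 * (max 0 (s + c))\<^sup>2) (at s)" for c
    using DERIV_shift[of "\<lambda>s. (max 0 s) ^ 3" "3 * (max 0 (s + c))\<^sup>2" s c] DERIV_truncated_power[of 1 "s + c"]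
    by (simp add: numeral_3_eq_3 numeral_2_eq_2)
  have d': "((\<lambda>s::real. (max 0 (s - c)) ^ 3) has_real_derivative 3 * (max 0 (s - c))\<^sup>2) (at s)" for c
    using d[of "- c"] by simp
  have "(bspline_int has_real_derivative (3 * (max 0 (s + 3/2))\<^sup>2 - 3 * (3 * (max 0 (s + 1/2))\<^sup>2)
      + 3 * (3 * (max 0 (s - 1/2))\<^sup>2) - 3 * (max 0 (s - 3/2))\<^sup>2) / 6 - 0) (at s)"
    unfolding bspline_int_def[abs_def]
    by (intro DERIV_diff DERIV_add DERIV_cmult DERIV_cdivide DERIV_const d d')
  moreover have "(3 * (max 0 (s + 3/2))\<^sup>2 - 3 * (3 * (max 0 (s + 1/2))\<^sup>2)
      + 3 * (3 * (max 0 (s - 1/2))\<^sup>2) - 3 * (max 0 (s - 3/2))\<^sup>2) / 6 - 0 = bspline s"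
    unfolding bspline_def by (simp add: field_simps)
  ultimately show ?thesis by (simp only:)
qed

lemma Ck_real_deriv:
  fixes f :: "real \<Rightarrow> real"
  assumes "\<And>s. (f has_real_derivative f' s) (at s)" "Ck k UNIV f'"
  shows "Ck (Suc k) UNIV f"
proof (rule Ck_SucI[OF open_UNIV])
  show "(f has_derivative (\<lambda>h. f' x * h)) (at x)" for x
    using assms(1)[of x] by (simp add: has_field_derivative_def)
  show "Ck k UNIV (\<lambda>x. f' x * v)" for v by (intro Ck_mult open_UNIV assms(2) Ck_const)
qed

lemma Ck_bspline: "Ck (Suc 0) UNIV bspline"
proof -
  have d: "((\<lambda>s::real. (max 0 (s + c))\<^sup>2) has_real_derivative 2 * max 0 (s + c)) (at s)" for c s
    using DERIV_shift[of "\<lambda>s. (max 0 s)\<^sup>2" "2 * max 0 (s + c)" s c] DERIV_truncated_power[of 0 "s + c"]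
    by (simp add: numeral_2_eq_2)
  have d': "((\<lambda>s::real. (max 0 (s - c))\<^sup>2) has_real_derivative 2 * max 0 (s - c)) (at s)" for c s
    using d[of "- c"] by simp
  have "(bspline has_real_derivative ((2 * max 0 (s + 3/2)) - 3 * (2 * max 0 (s + 1/2)) + 3 * (2 * max 0 (s - 1/2))
      - (2 * max 0 (s - 3/2))) / 2) (at s)" for s
    unfolding bspline_def[abs_def]
    by (intro DERIV_diff DERIV_add DERIV_cmult DERIV_cdivide d d')
  then show ?thesis by (rule Ck_real_deriv) (auto intro!: continuous_intros)
qed

lemma Ck_bspline_int: "Ck (Suc (Suc 0)) UNIV bspline_int"
  by (rule Ck_real_deriv[OF DERIV_bspline_int Ck_bspline])

lemma continuous_bspline: "continuous_on S bspline"
  by (rule continuous_on_subset[OF Ck_continuous_on[OF Ck_bspline] subset_UNIV])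

lemma bspline_nonneg: "bspline s \<ge> 0"
proof -
  consider "s \<le> -3/2" | "-3/2 \<le> s" "s \<le> -1/2" | "-1/2 \<le> s" "s \<le> 1/2" | "1/2 \<le> s" "s \<le> 3/2" | "3/2 \<le> s" by linarith
  then show ?thesis
  proof cases
    case 1 then show ?thesis by (simp add: bspline_def max_def)
  next
    case 2
    then have "max 0 (s + 1/2) = 0" "max 0 (s - 1/2) = 0" "max 0 (s - 3/2) = 0" by simp_all
    then show ?thesis unfolding bspline_def by simp
  next
    case 3
    then have "bspline s = 3/4 - s\<^sup>2"
      by (auto simp: bspline_def max_def power2_eq_square field_simps)
    moreover have "s\<^sup>2 \<le> (1/2)\<^sup>2" using 3 by (intro abs_le_square_iff[THEN iffD1]) auto
    ultimately show ?thesis by (simp add: power2_eq_square)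
  next
    case 4
    then have e: "bspline s = (s - 3/2)\<^sup>2 / 2"
      by (auto simp: bspline_def max_def power2_eq_square field_simps)
    show ?thesis unfolding e by simp
  next
    case 5
    then have "bspline s = 0"
      by (auto simp: bspline_def max_def power2_eq_square field_simps)
    then show ?thesis by simp
  qed
qed

lemma bspline_0: "\<bar>s\<bar> \<ge> 3/2 \<Longrightarrow> bspline s = 0"
  by (cases "s \<ge> 0") (auto simp: bspline_def max_def power2_eq_square field_simps)

lemma bspline_int_ge: "s \<ge> 3/2 \<Longrightarrow> bspline_int s = 1/2"
  by (auto simp: bspline_int_def max_def power3_eq_cube field_simps)

lemma bspline_int_le: "s \<le> -3/2 \<Longrightarrow> bspline_int s = -1/2"
  by (auto simp: bspline_int_def max_def power3_eq_cube field_simps)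

lemma mono_bspline_int: "a \<le> b \<Longrightarrow> bspline_int a \<le> bspline_int b"
  by (rule DERIV_nonneg_imp_nondecreasing) (use DERIV_bspline_int bspline_nonneg in auto)

lemma bspline_int_sign: "s * bspline_int s \<ge> 0"
proof -
  have z: "bspline_int 0 = 0" by (simp add: bspline_int_def power3_eq_cube)
  show ?thesis
    using mono_bspline_int[of 0 s] mono_bspline_int[of s 0] unfolding z
    by (cases "s \<ge> 0") (auto simp: zero_le_mult_iff)
qed

lemma nn_integral_bspline: "(\<integral>\<^sup>+s. ennreal (bspline s) \<partial>lborel) = 1"
proof -
  have "(\<integral>\<^sup>+s. ennreal (bspline s) * indicator {-2..2} s \<partial>lborel) = ennreal (bspline_int 2 - bspline_int (-2))"
    by (rule nn_integral_FTC_Icc)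
      (use DERIV_bspline_int bspline_nonneg in \<open>auto intro: borel_measurable_continuous_onI continuous_bspline has_field_derivative_at_within\<close>)
  moreover have "ennreal (bspline s) * indicator {-2..2} s = ennreal (bspline s)" for s
    using bspline_0[of s] by (auto simp: indicator_def)
  ultimately show ?thesis by (simp add: bspline_int_ge bspline_int_le)
qed

text \<open>Rescaling by m + 1 preserves the mass 1. The support has radius 3/(2(m + 1)); the rule
  \<open>bump_0\<close> works with twice that radius.\<close>

definition bump :: "nat \<Rightarrow> real \<Rightarrow> real" where "bump m s = real (Suc m) * bspline (real (Suc m) * s)"

lemma bump_nonneg: "bump m s \<ge> 0" by (simp add: bump_def bspline_nonneg)

lemma bump_0: "\<bar>s\<bar> \<ge> 3 / real (Suc m) \<Longrightarrow> bump m s = 0"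
proof -
  assume "\<bar>s\<bar> \<ge> 3 / real (Suc m)"
  then have "real (Suc m) * \<bar>s\<bar> \<ge> 3" by (simp add: field_simps)
  then have "\<bar>real (Suc m) * s\<bar> \<ge> 3/2" by (simp add: abs_mult)
  then show ?thesis by (simp add: bump_def bspline_0)
qed

lemma Ck_bump: "Ck (Suc 0) UNIV (bump m)"
proof -
  have "Ck (Suc 0) UNIV (\<lambda>s. bspline (real (Suc m) * s))"
    by (rule Ck_compose[OF open_UNIV open_UNIV Ck_bspline]) (auto intro: Ck_linear simp del: Ck.simps of_nat_Suc)
  then show ?thesis unfolding bump_def[abs_def] by (intro Ck_mult open_UNIV Ck_const)
qed

lemma continuous_bump: "continuous_on S (bump m)"
  by (rule continuous_on_subset[OF Ck_continuous_on[OF Ck_bump] subset_UNIV])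

section \<open>Lebesgue measure in coordinates\<close>

text \<open>Chart formulas integrate over \<open>PiM {..<k}\<close>, the tube integrals over
  \<open>real^'m\<close>. \<open>emb\<close> places the former in the latter as the span of the
  first k axes in the enumeration \<open>ix\<close>.\<close>

definition emb :: "nat \<Rightarrow> (nat \<Rightarrow> real) \<Rightarrow> real^'m::finite" where
  "emb k x = (\<Sum>i<k. x i *\<^sub>R axis (ix i) 1)"

lemma ix_inj: "i < CARD('m) \<Longrightarrow> j < CARD('m) \<Longrightarrow> (ix i :: 'm::finite) = ix j \<longleftrightarrow> i = j"
  using bij_ix[where 'm='m] by (auto simp: bij_betw_def inj_on_def)

lemma emb_nth: "k \<le> CARD('m) \<Longrightarrow> j < CARD('m) \<Longrightarrow> (emb k x :: real^'m::finite) $ ix j = (if j < k then x j else 0)"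
proof -
  assume k: "k \<le> CARD('m)" and j: "j < CARD('m)"
  have "(x i *\<^sub>R axis (ix i) 1 :: real^'m) $ ix j = (if i = j then x i else 0)" if "i < k" for i
    using ix_inj[of j i, where 'm='m] that k j by (auto simp: axis_def)
  then have "(emb k x :: real^'m) $ ix j = (\<Sum>i<k. if i = j then x i else 0)"
    unfolding emb_def sum_component by (intro sum.cong refl) simp
  then show ?thesis by simp
qed

lemma ix_cases: obtains i where "i < CARD('m)" "(a :: 'm::finite) = ix i"
  using bij_ix[where 'm='m] by (metis UNIV_I bij_betw_def imageE lessThan_iff)

lemma measurable_emb [measurable]: "emb k \<in> measurable (PiM {..<k} (\<lambda>_. lborel)) (borel :: (real^'m::finite) measure)"
  unfolding emb_def[abs_def] by measurable

lemma lborel_eq_PiM: "(lborel :: (real^'m::finite) measure) = distr (PiM {..<CARD('m)} (\<lambda>_. lborel)) borel (emb CARD('m))"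
proof (rule lborel_eqI)
  interpret product_sigma_finite "\<lambda>_. lborel :: real measure"
    by (simp add: product_sigma_finite_def sigma_finite_lborel)
  let ?N = "CARD('m)"
  fix l u :: "real^'m" assume lu: "\<And>b. b \<in> Basis \<Longrightarrow> l \<bullet> b \<le> u \<bullet> b"
  have Basis: "(Basis :: (real^'m) set) = (\<lambda>a. axis a 1) ` UNIV" by (auto simp: Basis_vec_def)
  have le: "l $ a \<le> u $ a" for a using lu[of "axis a 1"] by (simp add: Basis inner_axis)
  have "emb ?N -` box l u \<inter> space (PiM {..<?N} (\<lambda>_. lborel)) = PiE {..<?N} (\<lambda>i. {l $ ix i <..< u $ ix i})"
  proof (rule set_eqI)
    fix x :: "nat \<Rightarrow> real"
    have "emb ?N x \<in> box l u \<longleftrightarrow> (\<forall>a. l $ a < emb ?N x $ a \<and> emb ?N x $ a < u $ a)" by (simp add: mem_box_cart)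
    also have "\<dots> \<longleftrightarrow> (\<forall>i<?N. l $ ix i < x i \<and> x i < u $ ix i)"
    proof -
      have "(emb ?N x :: real^'m) $ ix i = x i" if "i < ?N" for i using emb_nth[of ?N i x, where 'm='m] that by simp
      moreover have "(\<forall>a. R a) \<longleftrightarrow> (\<forall>i<?N. R (ix i))" for R :: "'m \<Rightarrow> bool"
        by (metis ix_cases)
      ultimately show ?thesis by simp
    qed
    finally show "x \<in> emb ?N -` box l u \<inter> space (PiM {..<?N} (\<lambda>_. lborel)) \<longleftrightarrow> x \<in> PiE {..<?N} (\<lambda>i. {l $ ix i <..< u $ ix i})"
      by (auto simp: space_PiM PiE_def Pi_def)
  qed
  then have "emeasure (distr (PiM {..<?N} (\<lambda>_. lborel)) borel (emb ?N)) (box l u) =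
     emeasure (PiM {..<?N} (\<lambda>_. lborel)) (PiE {..<?N} (\<lambda>i. {l $ ix i <..< u $ ix i}))"
    by (subst emeasure_distr) auto
  also have "\<dots> = (\<Prod>i<?N. emeasure lborel {l $ ix i <..< u $ ix i})"
    by (subst emeasure_PiM) auto
  also have "\<dots> = (\<Prod>i<?N. ennreal (u $ ix i - l $ ix i))" using le by (simp add: emeasure_lborel_Ioo)
  also have "\<dots> = ennreal (\<Prod>i<?N. u $ ix i - l $ ix i)" using le by (simp add: prod_ennreal)
  also have "(\<Prod>i<?N. u $ ix i - l $ ix i) = (\<Prod>a\<in>UNIV. u $ a - l $ a)"
    by (rule prod.reindex_bij_betw[OF bij_ix, of "\<lambda>a. u $ a - l $ a"])
  also have "\<dots> = (\<Prod>b\<in>Basis. (u - l) \<bullet> b)"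
    unfolding Basis by (subst prod.reindex) (auto simp: inj_on_def axis_eq_axis inner_axis)
  finally show "emeasure (distr (PiM {..<?N} (\<lambda>_. lborel)) borel (emb ?N)) (box l u) = ennreal (\<Prod>b\<in>Basis. (u - l) \<bullet> b)" .
qed simp

text \<open>Fubini in the coordinates k and k + 1: G sees z with both removed, and each spline
  integrates to 1.\<close>

lemma nn_integral_split:
  fixes G :: "real^'m::finite \<Rightarrow> ennreal"
  assumes N: "CARD('m) = k + 2" and [measurable]: "G \<in> borel_measurable borel"
  shows "(\<integral>\<^sup>+z. ennreal (bspline (z $ ix k)) * ennreal (bspline (z $ ix (Suc k))) *
      G (z - (z $ ix k) *\<^sub>R axis (ix k) 1 - (z $ ix (Suc k)) *\<^sub>R axis (ix (Suc k)) 1) \<partial>lborel) =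
     (\<integral>\<^sup>+x. G (emb k x) \<partial>PiM {..<k} (\<lambda>_. lborel))"
proof -
  interpret product_sigma_finite "\<lambda>_. lborel :: real measure"
    by (simp add: product_sigma_finite_def sigma_finite_lborel)
  have [measurable]: "bspline \<in> borel_measurable borel" by (rule borel_measurable_continuous_onI[OF continuous_bspline])
  let ?F = "\<lambda>z :: real^'m. ennreal (bspline (z $ ix k)) * ennreal (bspline (z $ ix (Suc k))) *
      G (z - (z $ ix k) *\<^sub>R axis (ix k) 1 - (z $ ix (Suc k)) *\<^sub>R axis (ix (Suc k)) 1)"
  have nthm [measurable]: "(\<lambda>z :: real^'m. z $ a) \<in> borel_measurable borel" for a
    by (rule borel_measurable_continuous_onI) (intro continuous_intros)
  have Fm [measurable]: "?F \<in> borel_measurable borel" by measurable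
  have ins: "{..<CARD('m)} = insert (Suc k) (insert k {..<k})" unfolding N by auto
  have m1: "(\<lambda>x. ?F (emb CARD('m) x)) \<in> borel_measurable (PiM (insert (Suc k) (insert k {..<k})) (\<lambda>_. lborel))"
    unfolding ins[symmetric] by measurable
  have fs: "?F (emb CARD('m) (x(k := s, Suc k := t))) = ennreal (bspline s) * ennreal (bspline t) * G (emb k x)" for x s t
  proof -
    let ?x = "x(k := s, Suc k := t)"
    have "(emb CARD('m) ?x :: real^'m) $ ix k = s" "(emb CARD('m) ?x :: real^'m) $ ix (Suc k) = t"
      using emb_nth[of "CARD('m)" k ?x, where 'm='m] emb_nth[of "CARD('m)" "Suc k" ?x, where 'm='m] N by simp_all
    moreover have "(emb CARD('m) ?x :: real^'m) = emb k x + s *\<^sub>R axis (ix k) 1 + t *\<^sub>R axis (ix (Suc k)) (1::real)"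
      unfolding emb_def N by simp
    ultimately show ?thesis by (simp add: algebra_simps)
  qed
  have "(\<integral>\<^sup>+z. ?F z \<partial>lborel) = (\<integral>\<^sup>+x. ?F (emb CARD('m) x) \<partial>PiM {..<CARD('m)} (\<lambda>_. lborel))"
    by (subst lborel_eq_PiM, subst nn_integral_distr) simp_all
  also have "\<dots> = (\<integral>\<^sup>+x. (\<integral>\<^sup>+t. ?F (emb CARD('m) (x(Suc k := t))) \<partial>lborel) \<partial>PiM (insert k {..<k}) (\<lambda>_. lborel))"
    unfolding ins by (rule product_nn_integral_insert[OF _ _ m1]) auto
  also have "\<dots> = (\<integral>\<^sup>+x. (\<integral>\<^sup>+s. (\<integral>\<^sup>+t. ?F (emb CARD('m) (x(k := s, Suc k := t))) \<partial>lborel) \<partial>lborel) \<partial>PiM {..<k} (\<lambda>_. lborel))"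
  proof (rule product_nn_integral_insert)
    have "(\<lambda>(x, t). ?F (emb CARD('m) (x(Suc k := t)))) \<in> borel_measurable (PiM (insert k {..<k}) (\<lambda>_. lborel) \<Otimes>\<^sub>M lborel)"
    proof -
      have "(\<lambda>(x, t). x(Suc k := t)) \<in> measurable (PiM (insert k {..<k}) (\<lambda>_. lborel) \<Otimes>\<^sub>M lborel) (PiM (insert (Suc k) (insert k {..<k})) (\<lambda>_. lborel :: real measure))"
        by (rule measurable_add_dim)
      from measurable_compose[OF this m1] show ?thesis by (simp add: split_beta)
    qed
    then show "(\<lambda>x. \<integral>\<^sup>+t. ?F (emb CARD('m) (x(Suc k := t))) \<partial>lborel) \<in> borel_measurable (PiM (insert k {..<k}) (\<lambda>_. lborel))"
      using sigma_finite_measure.borel_measurable_nn_integral[OF sigma_finite_lborel] by (simp add: split_beta)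
  qed auto
  also have "\<dots> = (\<integral>\<^sup>+x. G (emb k x) \<partial>PiM {..<k} (\<lambda>_. lborel))"
    unfolding fs by (simp add: nn_integral_multc nn_integral_cmult nn_integral_bspline)
  finally show ?thesis .
qed

text \<open>Shrinking the two normal coordinates by c = 1/(m + 1) turns the bumps into a fixed
  kernel \<theta>, with J evaluated at T c z. As c tends to 0 this tends to J at the projection of z
  onto the slice, and \<open>nn_integral_split\<close> evaluates the limit.\<close>

lemma bump_limit:
  fixes J :: "real^'m::finite \<Rightarrow> real"
  assumes N: "CARD('m) = k + 2" and J: "continuous_on UNIV J" "\<And>z. J z \<ge> 0"
    and K: "compact K" "\<And>z. z \<notin> K \<Longrightarrow> J z = 0"
  obtains L where "L \<ge> 0"
    "(\<lambda>m. \<integral>z. bump m (z $ ix k) * bump m (z $ ix (Suc k)) * J z \<partial>lborel) \<longlonglongrightarrow> L"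
    "(\<integral>\<^sup>+x. ennreal (J (emb k x)) \<partial>PiM {..<k} (\<lambda>_. lborel)) = ennreal L"
proof -
  let ?a = "axis (ix k) 1 :: real^'m" and ?b = "axis (ix (Suc k)) 1 :: real^'m"
  have ab: "ix k \<noteq> (ix (Suc k) :: 'm)" using ix_inj[of k "Suc k", where 'm='m] N by simp
  define T where "T c z = z + ((c - 1) * z $ ix k) *\<^sub>R ?a + ((c - 1) * z $ ix (Suc k)) *\<^sub>R ?b" for c and z :: "real^'m"
  have Tn: "T c z $ i = (if i = ix k \<or> i = ix (Suc k) then c * z $ i else z $ i)" for c z i
    unfolding T_def using ab by (auto simp: axis_def algebra_simps)
  define \<theta> where "\<theta> z = bspline (z $ ix k) * bspline (z $ ix (Suc k))" for z :: "real^'m"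
  have cont\<theta>: "continuous_on UNIV \<theta>" unfolding \<theta>_def
    by (intro continuous_intros continuous_on_compose2[OF continuous_bspline]) auto
  have \<theta>0: "\<theta> z \<ge> 0" for z by (simp add: \<theta>_def bspline_nonneg)
  have contT: "continuous_on UNIV (T c)" for c unfolding T_def by (intro continuous_intros)
  define I where "I m z = \<theta> z * J (T (1 / real (Suc m)) z)" for m z
  define I0 where "I0 z = \<theta> z * J (T 0 z)" for z
  obtain B where B: "\<And>z. J z \<le> B" "B \<ge> 0"
  proof -
    have "bounded (J ` K)"
      by (rule compact_imp_bounded, rule compact_continuous_image[OF continuous_on_subset[OF J(1)] K(1)]) simp
    then obtain B where "\<And>x. x \<in> K \<Longrightarrow> \<bar>J x\<bar> \<le> B" by (auto simp: bounded_iff)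
    then have "J x \<le> max B 0" for x using K(2)[of x] by (cases "x \<in> K") (force simp: le_max_iff_disj)+
    then show ?thesis by (rule that) simp
  qed
  obtain R where R: "R > 0" "\<And>z. z \<in> K \<Longrightarrow> norm z \<le> R"
    using compact_imp_bounded[OF K(1)] bounded_pos by blast
  obtain C where C: "\<And>z. \<theta> z \<le> C" "C \<ge> 0"
  proof -
    obtain b where b: "\<And>s. bspline s \<le> b" "b \<ge> 0"
    proof -
      have "bounded (bspline ` {-2..2})" by (intro compact_imp_bounded compact_continuous_image continuous_bspline) simp
      then obtain b where "\<And>x. x \<in> {-2..2} \<Longrightarrow> \<bar>bspline x\<bar> \<le> b" unfolding bounded_iff by force
      then have "bspline x \<le> max b 0" for x using bspline_0[of x] by (cases "x \<in> {-2..2}") (force simp: le_max_iff_disj)+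
      then show ?thesis by (rule that) simp
    qed
    have "\<theta> z \<le> b * b" for z unfolding \<theta>_def by (intro mult_mono b bspline_nonneg)
    then show ?thesis using b by (intro that[of "b * b"]) auto
  qed
  \<comment> \<open>A box that contains the supports for every c: the kernel bounds the two normal
    coordinates by 3/2, and T leaves the others unchanged, so they are bounded by R.\<close>
  define K' where "K' = {z :: real^'m. \<forall>i. \<bar>z $ i\<bar> \<le> R + 2}"
  have K': "compact K'"
  proof -
    have "K' = cbox (\<chi> i. - (R + 2)) (\<chi> i. R + 2)" unfolding K'_def
      by (rule set_eqI) (simp only: mem_box_cart mem_Collect_eq abs_le_iff vec_lambda_beta minus_le_iff conj_commute)
    then show ?thesis by simp
  qed
  have supp: "\<theta> z * J (T c z) = 0" if "z \<notin> K'" for c z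
  proof (rule ccontr)
    assume nz: "\<theta> z * J (T c z) \<noteq> 0"
    then have "\<bar>z $ ix k\<bar> < 3/2" "\<bar>z $ ix (Suc k)\<bar> < 3/2" unfolding \<theta>_def using bspline_0 by force+
    moreover have "T c z \<in> K" using nz K(2) by force
    then have "\<bar>T c z $ i\<bar> \<le> R" for i using R(2) component_le_norm_cart[of "T c z" i] by force
    then have "i \<noteq> ix k \<Longrightarrow> i \<noteq> ix (Suc k) \<Longrightarrow> \<bar>z $ i\<bar> \<le> R" for i using Tn[of c z i] by (metis)
    ultimately have "\<bar>z $ i\<bar> \<le> R + 2" for i using R(1) by (cases "i = ix k"; cases "i = ix (Suc k)") force+
    then show False using that unfolding K'_def by blast
  qed
  have contI: "continuous_on UNIV (\<lambda>z. \<theta> z * J (T c z))" for c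
    by (intro continuous_intros cont\<theta> continuous_on_compose2[OF J(1) contT]) auto
  have scale: "(\<integral>z. bump m (z $ ix k) * bump m (z $ ix (Suc k)) * J z \<partial>lborel) = (\<integral>z. I m z \<partial>lborel)" for m
  proof -
    define c where "c = 1 / real (Suc m)"
    have c: "c > 0" by (simp add: c_def)
    define cf where "cf b = (if b = ?a \<or> b = ?b then c else 1)" for b :: "real^'m"
    have Basis: "(Basis :: (real^'m) set) = (\<lambda>a. axis a 1) ` UNIV" by (auto simp: Basis_vec_def)
    have Teq: "T c z = 0 + (\<Sum>b\<in>Basis. (cf b * (z \<bullet> b)) *\<^sub>R b)" for z
    proof -
      have "(\<Sum>b\<in>Basis. (cf b * (z \<bullet> b)) *\<^sub>R b) = (\<Sum>i\<in>UNIV. (T c z $ i) *\<^sub>R axis i 1)"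
        unfolding Basis by (subst sum.reindex) (auto simp: inj_on_def axis_eq_axis inner_axis cf_def Tn intro!: sum.cong)
      then show ?thesis using vec_expand[of "T c z"] by simp
    qed
    \<comment> \<open>The Jacobian c * c cancels the two factors 1/c that the bumps acquire under
      T.\<close>
    have pr: "(\<Prod>b\<in>Basis. \<bar>cf b\<bar>) = c * c"
    proof -
      have "(\<Prod>b\<in>Basis. \<bar>cf b\<bar>) = (\<Prod>b\<in>{?a, ?b}. \<bar>cf b\<bar>)"
        by (rule prod.mono_neutral_right) (auto simp: cf_def)
      also have "\<dots> = c * c" using ab c by (simp add: cf_def axis_eq_axis)
      finally show ?thesis .
    qed
    have L: "lborel = density (distr lborel borel (T c)) (\<lambda>_. ennreal (c * c))"
    proof -
      have "T c = (\<lambda>z. 0 + (\<Sum>b\<in>Basis. (cf b * (z \<bullet> b)) *\<^sub>R b))" by (rule ext) (rule Teq)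
      moreover have "cf b \<noteq> 0" for b using c by (simp add: cf_def)
      ultimately show ?thesis using lborel_affine_euclidean[of cf 0] unfolding pr by simp
    qed
    let ?f = "\<lambda>z. bump m (z $ ix k) * bump m (z $ ix (Suc k)) * J z"
    have fm: "?f \<in> borel_measurable borel"
      by (rule borel_measurable_continuous_onI) (intro continuous_intros J continuous_on_compose2[OF continuous_bump], auto)
    have Tm: "T c \<in> borel_measurable borel" by (rule borel_measurable_continuous_onI[OF contT])
    have "(\<integral>z. ?f z \<partial>lborel) = (\<integral>z. ?f z \<partial>density (distr lborel borel (T c)) (\<lambda>_. ennreal (c * c)))"
      using L by simp
    also have "\<dots> = (\<integral>z. (c * c) *\<^sub>R ?f z \<partial>distr lborel borel (T c))"
      using c fm by (intro integral_density) auto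
    also have "\<dots> = (\<integral>z. (c * c) *\<^sub>R ?f (T c z) \<partial>lborel)"
      using fm Tm by (intro integral_distr) auto
    also have "\<dots> = (\<integral>z. I m z \<partial>lborel)"
    proof (rule Bochner_Integration.integral_cong[OF refl])
      fix z
      have "bump m (T c z $ ix k) = bspline (z $ ix k) / c" "bump m (T c z $ ix (Suc k)) = bspline (z $ ix (Suc k)) / c"
      proof -
        have "real (Suc m) * (c * x) = x" for x by (simp add: c_def)
        moreover have "real (Suc m) * x = x / c" for x by (simp add: c_def)
        ultimately show "bump m (T c z $ ix k) = bspline (z $ ix k) / c" "bump m (T c z $ ix (Suc k)) = bspline (z $ ix (Suc k)) / c"
          unfolding bump_def Tn by simp_all
      qed
      then show "(c * c) *\<^sub>R ?f (T c z) = I m z" unfolding I_def \<theta>_def c_def[symmetric] using c by simp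
    qed
    finally show ?thesis .
  qed
  have lim: "(\<lambda>m. \<integral>z. I m z \<partial>lborel) \<longlonglongrightarrow> (\<integral>z. I0 z \<partial>lborel)"
  proof (rule integral_dominated_convergence[where w="\<lambda>z. indicator K' z * (C * B)"])
    show "I0 \<in> borel_measurable lborel" unfolding I0_def[abs_def] using borel_measurable_continuous_onI[OF contI] by simp
    show "I m \<in> borel_measurable lborel" for m unfolding I_def[abs_def] using borel_measurable_continuous_onI[OF contI] by simp
    have "integrable lborel (\<lambda>x. indicator K' x *\<^sub>R (C * B))"
      by (rule borel_integrable_compact) (use K' in auto)
    then show "integrable lborel (\<lambda>x. indicator K' x * (C * B))" by simp
    show "AE z in lborel. norm (I m z) \<le> indicator K' z * (C * B)" for m
    proof (rule AE_I2)
      fix z show "norm (I m z) \<le> indicator K' z * (C * B)"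
      proof (cases "z \<in> K'")
        case True
        have "norm (I m z) = \<theta> z * J (T (1 / real (Suc m)) z)" unfolding I_def using \<theta>0 J(2) by simp
        also have "\<dots> \<le> C * B" using C B \<theta>0 J(2) by (intro mult_mono) auto
        finally show ?thesis using True by simp
      next
        case False
        then show ?thesis unfolding I_def using supp by simp
      qed
    qed
    show "AE z in lborel. (\<lambda>m. I m z) \<longlonglongrightarrow> I0 z"
    proof (rule AE_I2)
      fix z
      have e: "(\<lambda>m. 1 / real (Suc m)) \<longlonglongrightarrow> 0" using LIMSEQ_inverse_real_of_nat by (simp add: inverse_eq_divide)
      have "(\<lambda>m. T (1 / real (Suc m)) z) \<longlonglongrightarrow> T 0 z"
        unfolding T_def by (intro tendsto_intros e)
      moreover have "isCont J (T 0 z)" using J(1) by (simp add: continuous_on_eq_continuous_at)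
      ultimately have "(\<lambda>m. J (T (1 / real (Suc m)) z)) \<longlonglongrightarrow> J (T 0 z)" by (rule isCont_tendsto_compose[rotated])
      then show "(\<lambda>m. I m z) \<longlonglongrightarrow> I0 z" unfolding I_def I0_def by (intro tendsto_intros)
    qed
  qed
  have int0: "integrable lborel I0"
    unfolding I0_def[abs_def] by (rule integrable_compact_support[OF contI K' supp])
  have I0n: "I0 z \<ge> 0" for z unfolding I0_def using \<theta>0 J(2) by simp
  have Jm: "(\<lambda>z. ennreal (J z)) \<in> borel_measurable borel"
    using borel_measurable_continuous_onI[OF J(1)] by simp
  have "ennreal (\<integral>z. I0 z \<partial>lborel) = (\<integral>\<^sup>+z. ennreal (I0 z) \<partial>lborel)"
    using nn_integral_eq_integral[OF int0] I0n by simp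
  also have "\<dots> = (\<integral>\<^sup>+z. ennreal (bspline (z $ ix k)) * ennreal (bspline (z $ ix (Suc k))) *
      ennreal (J (z - (z $ ix k) *\<^sub>R ?a - (z $ ix (Suc k)) *\<^sub>R ?b)) \<partial>lborel)"
    unfolding I0_def \<theta>_def T_def
    by (intro nn_integral_cong) (simp add: ennreal_mult' bspline_nonneg algebra_simps)
  also have "\<dots> = (\<integral>\<^sup>+x. ennreal (J (emb k x)) \<partial>PiM {..<k} (\<lambda>_. lborel))"
    by (rule nn_integral_split[OF N Jm])
  finally show ?thesis
    using that[of "\<integral>z. I0 z \<partial>lborel"] lim I0n unfolding scale by simp
qed

section \<open>The inverse function theorem with smooth inverse\<close>

lemma Ck_blinfun_frechet:
  fixes Y :: "'a::euclidean_space \<Rightarrow> 'b::euclidean_space"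
  assumes "Ck (Suc 0) U Y"
  shows "y \<in> U \<Longrightarrow> blinfun_apply (Blinfun (frechet_derivative Y (at y))) = frechet_derivative Y (at y)"
    and "continuous_on U (\<lambda>y. Blinfun (frechet_derivative Y (at y)))"
proof -
  have a: "blinfun_apply (Blinfun (frechet_derivative Y (at y))) = frechet_derivative Y (at y)" if "y \<in> U" for y
    by (intro bounded_linear_Blinfun_apply has_derivative_bounded_linear[OF Ck_has_derivative[OF assms that]])
  then show "y \<in> U \<Longrightarrow> blinfun_apply (Blinfun (frechet_derivative Y (at y))) = frechet_derivative Y (at y)" .
  show "continuous_on U (\<lambda>y. Blinfun (frechet_derivative Y (at y)))"
  proof (rule continuous_on_blinfun_componentwise)
    fix i :: 'a
    have "continuous_on U (\<lambda>y. frechet_derivative Y (at y) i)" using Ck_frechet[OF assms] by simp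
    then show "continuous_on U (\<lambda>y. blinfun_apply (Blinfun (frechet_derivative Y (at y))) i)"
      by (rule continuous_on_eq) (simp add: a)
  qed
qed

text \<open>The inverse function theorem provides a differentiable \<Theta>. By Cramer's rule its
  derivative is a rational expression in the entries of the derivative of Y at \<Theta> z, so if
  \<Theta> has class k then so has its derivative, and \<Theta> has class k + 1.\<close>

lemma inverse_function_Cinf:
  fixes Y :: "real^'m::finite \<Rightarrow> real^'m"
  assumes U: "open U" "Cinf U Y" "y0 \<in> U" and inj: "\<And>u. frechet_derivative Y (at y0) u = 0 \<Longrightarrow> u = 0"
  obtains Ob V \<Theta> where "open Ob" "Ob \<subseteq> U" "y0 \<in> Ob" "open V" "homeomorphism Ob V Y \<Theta>" "Cinf V \<Theta>"
    "\<And>y. y \<in> Ob \<Longrightarrow> det (matrix (frechet_derivative Y (at y))) \<noteq> 0"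
    "\<And>z u. z \<in> V \<Longrightarrow> frechet_derivative Y (at (\<Theta> z)) (frechet_derivative \<Theta> (at z) u) = u"
proof -
  let ?Y' = "\<lambda>y. frechet_derivative Y (at y)"
  have Y1: "Ck (Suc 0) U Y" using U(2) by blast
  have lin: "linear (?Y' y)" if "y \<in> U" for y by (rule has_derivative_linear[OF Ck_has_derivative[OF Y1 that]])
  have lin0: "linear (?Y' y0)" by (rule lin[OF U(3)])
  have "inj (?Y' y0)" using linear_injective_0[OF lin0] inj by blast
  then obtain L where L: "linear L" "L \<circ> ?Y' y0 = id"
    using linear_injective_left_inverse[OF lin0] by blast
  note bl = Ck_blinfun_frechet[OF Y1]
  have bL: "blinfun_apply (Blinfun L) = L"
    using L(1) by (intro bounded_linear_Blinfun_apply) (simp add: linear_conv_bounded_linear)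
  have "Blinfun L o\<^sub>L Blinfun (?Y' y0) = id_blinfun"
    by (rule blinfun_eqI) (use bL bl(1)[OF U(3)] L(2) in \<open>simp add: fun_eq_iff\<close>)
  from inverse_function_theorem[OF U(1) _ bl(2) U(3) this]
  obtain Ob V \<Theta> \<Theta>' where *: "open Ob" "Ob \<subseteq> U" "y0 \<in> Ob" "open V" "homeomorphism Ob V Y \<Theta>"
    "\<And>z. z \<in> V \<Longrightarrow> (\<Theta> has_derivative \<Theta>' z) (at z)"
    "\<And>z. z \<in> V \<Longrightarrow> \<Theta>' z = inv (blinfun_apply (Blinfun (?Y' (\<Theta> z))))"
    "\<And>z. z \<in> V \<Longrightarrow> bij (blinfun_apply (Blinfun (?Y' (\<Theta> z))))"
    using bl(1) Ck_has_derivative[OF Y1] by metis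
  have \<Theta>Ob: "\<Theta> z \<in> Ob" if "z \<in> V" for z using *(5) that by (auto simp: homeomorphism_def)
  have \<Theta>U: "\<Theta> z \<in> U" if "z \<in> V" for z using \<Theta>Ob[OF that] *(2) by blast
  have bijY: "bij (?Y' (\<Theta> z))" if "z \<in> V" for z using *(8)[OF that] bl(1)[OF \<Theta>U[OF that]] by simp
  have \<Theta>': "\<Theta>' z = inv (?Y' (\<Theta> z))" if "z \<in> V" for z using *(7)[OF that] bl(1)[OF \<Theta>U[OF that]] by simp
  have det: "det (matrix (?Y' y)) \<noteq> 0" if "y \<in> Ob" for y
  proof -
    have "Y y \<in> V" "\<Theta> (Y y) = y" using *(5) that by (auto simp: homeomorphism_def)
    then have "bij (?Y' y)" using bijY[of "Y y"] by simp
    then show ?thesis using det_nz_iff_inj[OF lin[of y]] that *(2) by (auto simp: bij_def)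
  qed
  have fd: "frechet_derivative \<Theta> (at z) = inv (?Y' (\<Theta> z))" if "z \<in> V" for z
    using frechet_derivative_at[OF *(6)[OF that]] \<Theta>'[OF that] by simp
  have Y\<Theta>: "?Y' (\<Theta> z) (frechet_derivative \<Theta> (at z) u) = u" if "z \<in> V" for z u
    unfolding fd[OF that] by (rule surj_f_inv_f[OF bij_is_surj[OF bijY[OF that]]])
  have "Ck k V \<Theta>" for k
  proof (induction k)
    case 0
    then show ?case using *(5) by (simp add: homeomorphism_def)
  next
    case (Suc k)
    define M where "M z = matrix (?Y' (\<Theta> z))" for z
    have Mz: "M z *v u = ?Y' (\<Theta> z) u" if "z \<in> V" for z u
      unfolding M_def using fun_cong[OF matrix_vector_mul(2)[OF lin[OF \<Theta>U[OF that]]], of u] .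
    have CM: "Ck k V (\<lambda>z. M z $ i $ j)" for i j
    proof -
      have "Ck k V (\<lambda>z. ?Y' (\<Theta> z) (axis j 1))"
      proof (rule Ck_compose[OF *(4) U(1) _ Suc \<Theta>U])
        have "Ck (Suc k) U Y" using U(2) by blast
        then show "Ck k U (\<lambda>y. ?Y' y (axis j 1))" by (rule Ck_frechet)
      qed
      then show ?thesis unfolding M_def matrix_def by (simp add: Ck_vec_nth[OF *(4)])
    qed
    have detM: "det (M z) \<noteq> 0" if "z \<in> V" for z using det[OF \<Theta>Ob[OF that]] by (simp add: M_def)
    show ?case
    proof (rule Ck_SucI[OF *(4)])
      show "(\<Theta> has_derivative \<Theta>' z) (at z)" if "z \<in> V" for z by (rule *(6)[OF that])
      fix v :: "real^'m"
      have "Ck k V (\<lambda>z. \<chi> a. det (\<chi> i j. if j = a then v $ i else M z $ i $ j) / det (M z))"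
      proof (rule Ck_vec[OF *(4)])
        fix a
        have 1: "Ck k V (\<lambda>z. if j = a then v $ i else M z $ i $ j)" for i j
          using CM by (cases "j = a") simp_all
        have "Ck k V (\<lambda>z. det (\<chi> i j. if j = a then v $ i else M z $ i $ j) * inverse (det (M z)))"
          by (intro Ck_mult *(4) Ck_det Ck_inverse CM detM) (use 1 in simp)
        then show "Ck k V (\<lambda>z. (\<chi> a. det (\<chi> i j. if j = a then v $ i else M z $ i $ j) / det (M z)) $ a)"
          by (simp add: divide_inverse)
      qed
      then show "Ck k V (\<lambda>z. \<Theta>' z v)"
      proof (rule Ck_cong[OF *(4)])
        fix z assume z: "z \<in> V"
        have "M z *v \<Theta>' z v = v"
          unfolding Mz[OF z] \<Theta>'[OF z] by (rule surj_f_inv_f[OF bij_is_surj[OF bijY[OF z]]])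
        then show "(\<chi> a. det (\<chi> i j. if j = a then v $ i else M z $ i $ j) / det (M z)) = \<Theta>' z v"
          using cramer[OF detM[OF z]] by simp
      qed
    qed
  qed
  then show ?thesis using that[OF *(1-5) _ det Y\<Theta>] by blast
qed

section \<open>Regular common level sets of two functions\<close>

lemma integral_change_of_variables_real:
  fixes f :: "real^'m::{finite,wellorder} \<Rightarrow> real" and \<Theta> :: "real^'m::_ \<Rightarrow> real^'m::_"
  assumes V: "V \<in> sets lebesgue" and d: "\<And>z. z \<in> V \<Longrightarrow> (\<Theta> has_derivative \<Theta>' z) (at z within V)"
    and inj: "inj_on \<Theta> V" and f: "f absolutely_integrable_on \<Theta> ` V"
  shows "integral (\<Theta> ` V) f = integral V (\<lambda>z. \<bar>det (matrix (\<Theta>' z))\<bar> * f (\<Theta> z))"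
proof -
  let ?f = "\<lambda>y. vec (f y) :: real^1"
  have "?f absolutely_integrable_on \<Theta> ` V" using f by (simp add: absolutely_integrable_on_1_iff)
  then have "integral (\<Theta> ` V) ?f = integral V (\<lambda>z. \<bar>det (matrix (\<Theta>' z))\<bar> *\<^sub>R ?f (\<Theta> z))"
    using integral_change_of_variables[OF V d inj, of ?f] by blast
  then have "integral (\<Theta> ` V) ?f $ 1 = integral V (\<lambda>z. \<bar>det (matrix (\<Theta>' z))\<bar> *\<^sub>R ?f (\<Theta> z)) $ 1" by simp
  then show ?thesis unfolding integral_on_1_eq by simp
qed

lemma frechet_nth:
  fixes Y Y' :: "'a::real_normed_vector \<Rightarrow> real^'m::finite"
  assumes "(Y has_derivative Y') (at y)" "\<And>y. Y y $ i = p y"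
  shows "Y' u $ i = frechet_derivative p (at y) u"
proof -
  have "((\<lambda>y. Y y $ i) has_derivative (\<lambda>u. Y' u $ i)) (at y)"
    by (rule bounded_linear.has_derivative[OF bounded_linear_vec_nth assms(1)])
  then have "(p has_derivative (\<lambda>u. Y' u $ i)) (at y)" using assms(2) by simp
  from frechet_derivative_at[OF this] show ?thesis by (rule fun_cong)
qed

lemma linear_det_nonzero_inj:
  assumes "linear f" "det (matrix f) \<noteq> 0" "f u = f (w :: real^'m::finite)"
  shows "u = w"
proof -
  have "inj f" using det_nz_iff_inj[OF assms(1)] assms(2) by blast
  then show ?thesis using assms(3) by (rule injD)
qed

text \<open>\<open>indep\<close> expresses independence of dP and dQ on the common zero set by dual
  vectors a, b, which is the form used to complete coordinates. The level 1/2 in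
  \<open>compact_P\<close> is one that P exceeds near infinity, where p tends to 1.\<close>

locale level_set = param_manifold \<Lambda> g for \<Lambda> :: "'n::finite phase set" and g +
  fixes q :: "'n phase \<Rightarrow> complex" and P Q :: "real^('n bit0) \<Rightarrow> real"
  assumes q_g: "\<And>y. q (g y) = complex_of_real (P y) - \<i> * complex_of_real (Q y)"
    and Cinf_P: "Cinf UNIV P" and Cinf_Q: "Cinf UNIV Q"
    and indep: "\<And>y. P y = 0 \<Longrightarrow> Q y = 0 \<Longrightarrow> \<exists>a b. frechet_derivative P (at y) a = 1 \<and> frechet_derivative Q (at y) a = 0 \<and>
       frechet_derivative P (at y) b = 0 \<and> frechet_derivative Q (at y) b = 1"
    and compact_P: "compact {y. \<bar>P y\<bar> \<le> 1/2}"
begin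

definition "kk = 2 * CARD('n) - 2"

abbreviation embk :: "(nat \<Rightarrow> real) \<Rightarrow> real^('n bit0)" where "embk \<equiv> emb kk"

definition "S = {\<rho> \<in> \<Lambda>. q \<rho> = 0}"

definition lin :: "(nat \<Rightarrow> 'n phase) \<Rightarrow> (nat \<Rightarrow> real) \<Rightarrow> 'n phase" where
  "lin e y = (\<Sum>i<kk. y i *\<^sub>R e i)"

text \<open>The integrand of the chart formula in \<open>is_density_measure\<close>, restricted to
  the domain of the chart but not yet to a set A.\<close>

definition dens :: "(nat \<Rightarrow> 'n phase) \<Rightarrow> 'n phase set \<Rightarrow> ('n phase \<Rightarrow> 'n phase) \<Rightarrow> (nat \<Rightarrow> real) \<Rightarrow> ennreal" where
  "dens e W \<psi> y = ennreal (liouville_density \<Lambda> q (\<psi> (lin e y)) (\<lambda>i. frechet_derivative \<psi> (at (lin e y)) (e i)))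
     * indicator W (lin e y)"

lemma kk: "kk + 2 = 2 * CARD('n)" "CARD('n bit0) = kk + 2"
proof -
  show 1: "kk + 2 = 2 * CARD('n)" using zero_less_card_finite[where 'a='n] unfolding kk_def by linarith
  show "CARD('n bit0) = kk + 2" unfolding 1 by simp
qed

lemma q_g_0: "q (g y) = 0 \<longleftrightarrow> P y = 0 \<and> Q y = 0"
  unfolding q_g by (auto simp: complex_eq_iff)

lemma g_in_S: "g y \<in> S \<longleftrightarrow> P y = 0 \<and> Q y = 0"
  unfolding S_def by (simp add: q_g_0)

lemma S_subset: "S \<subseteq> \<Lambda>" unfolding S_def by blast

lemma span_lin:
  assumes "inj_on e {..<kk}" "x \<in> span (e ` {..<kk})"
  obtains b where "x = lin e b"
proof -
  have "x \<in> range (\<lambda>u. \<Sum>v\<in>e ` {..<kk}. u v *\<^sub>R v)"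
    using assms(2) span_finite[of "e ` {..<kk}"] by simp
  then obtain u where "x = (\<Sum>v\<in>e ` {..<kk}. u v *\<^sub>R v)" by blast
  also have "\<dots> = lin e (\<lambda>i. u (e i))" unfolding lin_def by (simp add: sum.reindex[OF assms(1)])
  finally show ?thesis by (rule that)
qed

lemma lin_in_span: "lin e y \<in> span (e ` {..<kk})"
  unfolding lin_def by (intro span_sum span_scale span_base) auto

lemma lin_upd: "i < kk \<Longrightarrow> lin e (y(i := y i + t)) = lin e y + t *\<^sub>R e i"
proof -
  assume i: "i < kk"
  have "lin e (y(i := y i + t)) = (\<Sum>j<kk. y j *\<^sub>R e j + (if j = i then t *\<^sub>R e i else 0))"
    unfolding lin_def by (intro sum.cong) (auto simp: scaleR_add_left)
  then show ?thesis using i by (simp add: sum.distrib lin_def)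
qed

lemma emb_upd: "i < k \<Longrightarrow> emb k (y(i := y i + t)) = emb k y + t *\<^sub>R axis (ix i) (1::real)"
proof -
  assume i: "i < k"
  have "emb k (y(i := y i + t)) = (\<Sum>j<k. y j *\<^sub>R axis (ix j) (1::real) + (if j = i then t *\<^sub>R axis (ix i) 1 else 0))"
    unfolding emb_def by (intro sum.cong) (auto simp: scaleR_add_left)
  then show ?thesis using i by (simp add: sum.distrib emb_def)
qed

lemma q_has_derivative:
  "((\<lambda>y. q (g y)) has_derivative (\<lambda>u. complex_of_real (frechet_derivative P (at y) u) -
     \<i> * complex_of_real (frechet_derivative Q (at y) u))) (at y)"
proof -
  have "(P has_derivative frechet_derivative P (at y)) (at y)" "(Q has_derivative frechet_derivative Q (at y)) (at y)"
    using Ck_has_derivative[OF spec[OF Cinf_P, of "Suc 0"], of y] Ck_has_derivative[OF spec[OF Cinf_Q, of "Suc 0"], of y] by simp_all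
  then show ?thesis unfolding q_g
    by (intro has_derivative_diff has_derivative_of_real has_derivative_mult_right)
qed

text \<open>Near a point of \<open>S\<close>, the coordinates of a slice chart together with \<open>P\<close> and \<open>Q\<close> form a
  coordinate system of \<open>\<Lambda>\<close>.\<close>

lemma chart_local:
  assumes chart: "slice_chart kk S e W \<psi>" and x0: "x0 \<in> W \<inter> span (e ` {..<kk})"
  obtains Ob V Y \<Theta> where "open Ob" "inv g (\<psi> x0) \<in> Ob" "open V" "homeomorphism Ob V Y \<Theta>" "Cinf V \<Theta>"
    "\<And>y. embk y \<in> V \<longleftrightarrow> lin e y \<in> W \<and> inv g (\<psi> (lin e y)) \<in> Ob"
    "\<And>y. embk y \<in> V \<Longrightarrow> \<Theta> (embk y) = inv g (\<psi> (lin e y))"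
    "\<And>y. embk y \<in> V \<Longrightarrow> liouville_density \<Lambda> q (\<psi> (lin e y)) (\<lambda>i. frechet_derivative \<psi> (at (lin e y)) (e i)) =
       \<bar>vol (\<Theta> (embk y)) * det (matrix (frechet_derivative \<Theta> (at (embk y))))\<bar>"
    "\<And>z. z \<in> V \<Longrightarrow> P (\<Theta> z) = z $ ix kk \<and> Q (\<Theta> z) = z $ ix (Suc kk)"
proof -
  have e: "inj_on e {..<kk}" "independent (e ` {..<kk})" and W: "open W" "open (\<psi> ` W)" "inj_on \<psi> W"
    and sm: "smooth_on W \<psi>" "smooth_on (\<psi> ` W) (inv_into W \<psi>)"
    and slice: "\<psi> ` (W \<inter> span (e ` {..<kk})) = S \<inter> \<psi> ` W"
    using chart unfolding slice_chart_def by blast+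
  define \<iota> where "\<iota> = inv_into W \<psi>"
  have \<iota>\<psi>: "\<iota> (\<psi> x) = x" if "x \<in> W" for x unfolding \<iota>_def using W(3) that by (rule inv_into_f_f)
  have C\<iota>: "Ck k (\<psi> ` W) \<iota>" for k unfolding \<iota>_def by (rule smooth_on_imp_Ck[OF sm(2)])
  have C\<psi>: "Ck k W \<psi>" for k by (rule smooth_on_imp_Ck[OF sm(1)])
  \<comment> \<open>Linear coordinates on the plane of the chart, extended arbitrarily to the
    ambient space so that they can be applied to all points \<iota> (g y).\<close>
  obtain c :: "'n phase \<Rightarrow> real^('n bit0)" where c: "linear c" "\<And>i. i < kk \<Longrightarrow> c (e i) = axis (ix i) 1"
  proof -
    obtain c :: "'n phase \<Rightarrow> real^('n bit0)" where c: "linear c"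
      "\<forall>x\<in>e ` {..<kk}. c x = axis (ix (inv_into {..<kk} e x)) 1"
      using linear_independent_extend[OF e(2), of "\<lambda>x. axis (ix (inv_into {..<kk} e x)) 1"] by blast
    have "c (e i) = axis (ix i) 1" if "i < kk" for i
      using c(2) that inv_into_f_f[OF e(1), of i] by simp
    then show ?thesis by (rule that[OF c(1)])
  qed
  have c_lin: "c (lin e y) = embk y" for y
    unfolding lin_def emb_def by (simp add: linear_sum[OF c(1)] linear_cmul[OF c(1)] c(2))
  define V0 where "V0 = g -` (\<psi> ` W)"
  have V0: "open V0" unfolding V0_def using continuous_g W(2) by (simp add: open_vimage)
  \<comment> \<open>The coordinate system: the plane coordinates of g y after undoing the chart,
    followed by P and Q. On S it reproduces the chart parameters, see
    \<open>Y_chart\<close>.\<close>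
  define Y :: "real^('n bit0) \<Rightarrow> real^('n bit0)" where "Y y = embk (\<lambda>i. c (\<iota> (g y)) $ ix i) + P y *\<^sub>R axis (ix kk) 1 + Q y *\<^sub>R axis (ix (Suc kk)) 1" for y
  have ixk: "ix kk \<noteq> (ix (Suc kk) :: 'n bit0)" using ix_inj[of kk "Suc kk", where 'm="'n bit0"] kk by simp
  have ixi: "ix i \<noteq> (ix kk :: 'n bit0)" "ix i \<noteq> (ix (Suc kk) :: 'n bit0)" if "i < kk" for i
    using ix_inj[of i kk, where 'm="'n bit0"] ix_inj[of i "Suc kk", where 'm="'n bit0"] kk that by simp_all
  have emb_n: "(embk y :: real^('n bit0)) $ ix j = (if j < kk then y j else 0)" if "j < kk + 2" for y j
    by (rule emb_nth) (use kk that in simp_all)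
  have Yk: "Y y $ ix kk = P y" "Y y $ ix (Suc kk) = Q y" for y
    unfolding Y_def using emb_n[of kk] emb_n[of "Suc kk"] ixk by (simp_all add: axis_def)
  have Yi: "Y y $ ix i = c (\<iota> (g y)) $ ix i" if "i < kk" for y i
    unfolding Y_def using emb_n[of i] ixi[OF that] that by (simp add: axis_def)
  have vec_eqI: "z = z'" if "\<And>i. i < kk \<Longrightarrow> z $ ix i = z' $ ix i" "z $ ix kk = z' $ ix kk" "z $ ix (Suc kk) = z' $ ix (Suc kk)"
    for z z' :: "real^('n bit0)"
  proof -
    have "z $ a = z' $ a" for a
    proof -
      obtain i where i: "i < CARD('n bit0)" "a = ix i" by (rule ix_cases)
      then have "i < kk \<or> i = kk \<or> i = Suc kk" unfolding kk(2) by linarith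
      then show ?thesis using that i by blast
    qed
    then show ?thesis by (simp add: vec_eq_iff)
  qed
  have Y_chart: "Y y = embk b" if "g y = \<psi> (lin e b)" "lin e b \<in> W" for y b
  proof (rule vec_eqI)
    have "g y \<in> S" using that slice lin_in_span[of e b] by blast
    then have PQ: "P y = 0" "Q y = 0" unfolding g_in_S by simp_all
    show "Y y $ ix kk = embk b $ ix kk" "Y y $ ix (Suc kk) = embk b $ ix (Suc kk)"
      unfolding Yk PQ using emb_n[of kk b] emb_n[of "Suc kk" b] by simp_all
    show "Y y $ ix i = embk b $ ix i" if "i < kk" for i
      unfolding Yi[OF that] \<open>g y = \<psi> (lin e b)\<close> \<iota>\<psi>[OF \<open>lin e b \<in> W\<close>] c_lin ..
  qed
  have CY: "Ck k V0 Y" for k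
  proof -
    have 1: "Ck k V0 (\<lambda>y. \<iota> (g y))"
      by (rule Ck_compose[OF V0 W(2) C\<iota> Ck_subset[OF Ck_g subset_UNIV]]) (simp add: V0_def)
    have 2: "Ck k V0 (\<lambda>y. c (\<iota> (g y)) $ ix i)" for i
      by (rule Ck_vec_nth[OF V0 Ck_bounded_linear[OF V0 _ 1]]) (use c(1) in \<open>simp add: linear_conv_bounded_linear\<close>)
    have PQ: "Ck k V0 P" "Ck k V0 Q"
      using Ck_subset[OF spec[OF Cinf_P] subset_UNIV] Ck_subset[OF spec[OF Cinf_Q] subset_UNIV] by blast+
    show ?thesis unfolding Y_def[abs_def] emb_def
      by (intro Ck_add V0 Ck_sum Ck_scaleR Ck_const 2 PQ)
  qed
  let ?Y' = "\<lambda>y. frechet_derivative Y (at y)"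
  have Y': "(Y has_derivative ?Y' y) (at y)" if "y \<in> V0" for y
    by (rule Ck_has_derivative[OF CY[of "Suc 0"] that])
  have Y'k: "?Y' y u $ ix kk = frechet_derivative P (at y) u" "?Y' y u $ ix (Suc kk) = frechet_derivative Q (at y) u"
    if "y \<in> V0" for y u
    by (rule frechet_nth[OF Y'[OF that] Yk(1)], rule frechet_nth[OF Y'[OF that] Yk(2)])
  \<comment> \<open>Differentiate Y (inv g (\<psi> (lin e b))) = embk b in the i-th parameter: the
    i-th chart vector corresponds to the i-th axis.\<close>
  have tang: "\<exists>u. Dg y u = frechet_derivative \<psi> (at (lin e b)) (e i) \<and> ?Y' y u = axis (ix i) 1"
    if y: "g y = \<psi> (lin e b)" and b: "lin e b \<in> W" and i: "i < kk" for y b i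
  proof -
    let ?x = "lin e b"
    have yV0: "y \<in> V0" unfolding V0_def using y b by simp
    have line: "((\<lambda>t. ?x + t *\<^sub>R e i) has_vector_derivative e i) (at 0)"
      by (auto intro!: derivative_eq_intros simp: has_vector_derivative_def)
    from vector_derivative_diff_chain_within[OF this, of \<psi> "frechet_derivative \<psi> (at ?x)"]
    have d: "((\<lambda>t. \<psi> (?x + t *\<^sub>R e i)) has_vector_derivative frechet_derivative \<psi> (at ?x) (e i)) (at 0)"
      using Ck_has_derivative[OF C\<psi>[of "Suc 0"] b] by (simp add: o_def has_derivative_at_withinI)
    have "isCont (\<lambda>t. ?x + t *\<^sub>R e i) 0" by (intro continuous_intros)
    then have "\<forall>\<^sub>F t in at 0. ?x + t *\<^sub>R e i \<in> W" using W(1) b by (simp add: isCont_def tendsto_def)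
    then have evW: "\<forall>\<^sub>F t in nhds 0. ?x + t *\<^sub>R e i \<in> W" using b by (simp add: eventually_nhds_conv_at)
    have ev: "\<forall>\<^sub>F t in nhds 0. \<psi> (?x + t *\<^sub>R e i) \<in> \<Lambda>"
      using evW
    proof eventually_elim
      case (elim t)
      have "?x + t *\<^sub>R e i \<in> span (e ` {..<kk})"
        using lin_upd[OF i, of e b t] lin_in_span[of e "b(i := b i + t)"] by simp
      then show ?case using elim slice S_subset by blast
    qed
    have \<gamma>0: "\<psi> (?x + 0 *\<^sub>R e i) = g y" using y by simp
    obtain u where u: "((\<lambda>t. inv g (\<psi> (?x + t *\<^sub>R e i))) has_vector_derivative u) (at 0)"
      "Dg y u = frechet_derivative \<psi> (at ?x) (e i)"
      by (rule pullback_derivative[OF d \<gamma>0 ev])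
    have A: "((\<lambda>t. Y (inv g (\<psi> (?x + t *\<^sub>R e i)))) has_vector_derivative ?Y' y u) (at 0)"
      using vector_derivative_diff_chain_within[OF u(1), of Y "?Y' y"] Y'[OF yV0] y[symmetric]
      by (simp add: o_def has_derivative_at_withinI)
    obtain N where N: "open N" "0 \<in> N" "\<And>t. t \<in> N \<Longrightarrow> ?x + t *\<^sub>R e i \<in> W \<and> \<psi> (?x + t *\<^sub>R e i) \<in> \<Lambda>"
      using eventually_conj[OF evW ev] unfolding eventually_nhds by blast
    have B: "Y (inv g (\<psi> (?x + t *\<^sub>R e i))) = embk b + t *\<^sub>R axis (ix i) 1" if "t \<in> N" for t
    proof -
      have "Y (inv g (\<psi> (?x + t *\<^sub>R e i))) = embk (b(i := b i + t))"
        by (rule Y_chart) (use N(3)[OF that] in \<open>simp_all add: lin_upd[OF i] g_inv_g\<close>)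
      then show ?thesis by (simp add: emb_upd[OF i])
    qed
    have 1: "((\<lambda>t. embk b + t *\<^sub>R axis (ix i) 1) has_vector_derivative ?Y' y u) (at 0)"
      by (rule has_vector_derivative_transform_within_open[OF A N(1,2)]) (rule B)
    have "((\<lambda>t. embk b + t *\<^sub>R axis (ix i) (1::real)) has_vector_derivative axis (ix i) 1) (at 0)"
      by (auto intro!: derivative_eq_intros simp: has_vector_derivative_def)
    from vector_derivative_unique_at[OF 1 this] show ?thesis using u(2) by blast
  qed
  define y0 where "y0 = inv g (\<psi> x0)"
  have x0': "x0 \<in> W" "\<psi> x0 \<in> S" using x0 slice by blast+
  have gy0: "g y0 = \<psi> x0" unfolding y0_def using x0'(2) S_subset g_inv_g by blast
  have y0V: "y0 \<in> V0" unfolding V0_def using gy0 x0' by simp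
  obtain b0 where b0: "x0 = lin e b0" using x0 by (auto elim: span_lin[OF e(1)])
  have lin0: "linear (?Y' y0)" by (rule has_derivative_linear[OF Y'[OF y0V]])
  \<comment> \<open>By \<open>tang\<close> the range contains the first kk axes; the vectors a and b
    from \<open>indep\<close> supply the two missing directions.\<close>
  have "surj (?Y' y0)"
  proof -
    have sub: "subspace (range (?Y' y0))" by (rule linear_subspace_image[OF lin0 subspace_UNIV])
    have ai: "axis (ix i) 1 \<in> range (?Y' y0)" if "i < kk" for i
      using tang[of y0 b0 i] gy0 b0 x0'(1) that by (metis rangeI)
    have zk: "z \<in> range (?Y' y0)" if "z $ ix kk = 0" "z $ ix (Suc kk) = 0" for z
    proof -
      have "z = embk (\<lambda>i. z $ ix i)" by (rule vec_eqI) (use that emb_n in simp_all)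
      then have "z = (\<Sum>i<kk. (z $ ix i) *\<^sub>R axis (ix i) 1)" unfolding emb_def .
      also have "\<dots> \<in> range (?Y' y0)" by (intro subspace_sum[OF sub] subspace_scale[OF sub]) (use ai in auto)
      finally show ?thesis .
    qed
    obtain a b where ab: "frechet_derivative P (at y0) a = 1" "frechet_derivative Q (at y0) a = 0"
       "frechet_derivative P (at y0) b = 0" "frechet_derivative Q (at y0) b = 1"
      using indep[of y0] x0'(2) gy0 g_in_S[of y0] by metis
    have "z \<in> range (?Y' y0)" for z
    proof -
      let ?w = "(z $ ix kk) *\<^sub>R ?Y' y0 a + (z $ ix (Suc kk)) *\<^sub>R ?Y' y0 b"
      have "z - ?w \<in> range (?Y' y0)" by (rule zk) (simp_all add: Y'k[OF y0V] ab)
      moreover have "?w \<in> range (?Y' y0)" by (intro subspace_add[OF sub] subspace_scale[OF sub]) auto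
      ultimately have "(z - ?w) + ?w \<in> range (?Y' y0)" by (rule subspace_add[OF sub])
      then show ?thesis by simp
    qed
    then show ?thesis by blast
  qed
  then have "inj (?Y' y0)" using linear_surj_imp_inj[OF lin0] by blast
  then have inj0: "u = 0" if "?Y' y0 u = 0" for u
    using linear_injective_0[OF lin0] that by blast
  obtain Ob V \<Theta> where *: "open Ob" "Ob \<subseteq> V0" "y0 \<in> Ob" "open V" "homeomorphism Ob V Y \<Theta>" "Cinf V \<Theta>"
    "\<And>y. y \<in> Ob \<Longrightarrow> det (matrix (?Y' y)) \<noteq> 0"
    "\<And>z u. z \<in> V \<Longrightarrow> ?Y' (\<Theta> z) (frechet_derivative \<Theta> (at z) u) = u"
    using inverse_function_Cinf[OF V0 _ y0V inj0] CY by blast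
  have \<Theta>Ob: "\<Theta> z \<in> Ob" "Y (\<Theta> z) = z" if "z \<in> V" for z using *(5) that by (auto simp: homeomorphism_def)
  have YV: "Y y \<in> V" "\<Theta> (Y y) = y" if "y \<in> Ob" for y using *(5) that by (auto simp: homeomorphism_def)
  have PQ: "P (\<Theta> z) = z $ ix kk \<and> Q (\<Theta> z) = z $ ix (Suc kk)" if "z \<in> V" for z
    using Yk[of "\<Theta> z"] \<Theta>Ob(2)[OF that] by simp
  have fwd: "embk y \<in> V \<and> \<Theta> (embk y) = inv g (\<psi> (lin e y))" if "lin e y \<in> W" "inv g (\<psi> (lin e y)) \<in> Ob" for y
  proof -
    have "\<psi> (lin e y) \<in> \<Lambda>" using slice that(1) lin_in_span S_subset by blast
    then have "Y (inv g (\<psi> (lin e y))) = embk y" using that(1) by (intro Y_chart) (simp_all add: g_inv_g)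
    then show ?thesis using YV[OF that(2)] by simp
  qed
  \<comment> \<open>A point of V whose last two coordinates vanish satisfies P = Q = 0, so it lies
    on S and comes from the plane of the chart; its coordinates then identify it.\<close>
  have bwd: "lin e y \<in> W \<and> g (\<Theta> (embk y)) = \<psi> (lin e y)" if z: "embk y \<in> V" for y
  proof -
    let ?y1 = "\<Theta> (embk y)"
    have "P ?y1 = 0" "Q ?y1 = 0" using PQ[OF z] emb_n[of kk y] emb_n[of "Suc kk" y] by simp_all
    then have "g ?y1 \<in> S" unfolding g_in_S by simp
    moreover have "g ?y1 \<in> \<psi> ` W" using \<Theta>Ob(1)[OF z] *(2) unfolding V0_def by blast
    ultimately obtain x where x: "x \<in> W" "x \<in> span (e ` {..<kk})" "g ?y1 = \<psi> x" using slice by blast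
    obtain b where b: "x = lin e b" by (rule span_lin[OF e(1) x(2)])
    have "embk b = embk y" using Y_chart[of ?y1 b] x b \<Theta>Ob(2)[OF z] by simp
    then have "b i = y i" if "i < kk" for i using emb_n[of i b] emb_n[of i y] that by simp
    then have "lin e b = lin e y" unfolding lin_def by simp
    then show ?thesis using x b by simp
  qed
  have dn: "liouville_density \<Lambda> q (\<psi> (lin e y)) (\<lambda>i. frechet_derivative \<psi> (at (lin e y)) (e i)) =
       \<bar>vol (\<Theta> (embk y)) * det (matrix (frechet_derivative \<Theta> (at (embk y))))\<bar>" if z: "embk y \<in> V" for y
  proof -
    let ?z = "embk y :: real^('n bit0)"
    let ?y1 = "\<Theta> ?z" and ?T = "frechet_derivative \<Theta> (at ?z)"
    have y1: "?y1 \<in> V0" "?y1 \<in> Ob" using \<Theta>Ob(1)[OF z] *(2) by blast+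
    have gy: "g ?y1 = \<psi> (lin e y)" "lin e y \<in> W" using bwd[OF z] by simp_all
    have linT: "linear ?T" by (rule has_derivative_linear[OF Ck_has_derivative[OF spec[OF *(6), of "Suc 0"] z]])
    have linY: "linear (?Y' ?y1)" by (rule has_derivative_linear[OF Y'[OF y1(1)]])
    have "surj ?T"
    proof -
      have "inj ?T" by (rule inj_on_inverseI[of _ "?Y' ?y1"]) (rule *(8)[OF z])
      then show ?thesis using linear_inj_imp_surj[OF linT] by blast
    qed
    have dPQ: "frechet_derivative P (at ?y1) (?T u) = u $ ix kk" "frechet_derivative Q (at ?y1) (?T u) = u $ ix (Suc kk)" for u
      using Y'k[OF y1(1), of "?T u"] *(8)[OF z, of u] by simp_all
    have v: "frechet_derivative \<psi> (at (lin e y)) (e i) = Dg ?y1 (?T (axis (ix i) 1))" if i: "i < kk" for i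
    proof -
      obtain u where u: "Dg ?y1 u = frechet_derivative \<psi> (at (lin e y)) (e i)" "?Y' ?y1 u = axis (ix i) 1"
        using tang[OF gy i] by blast
      have "u = ?T (axis (ix i) 1)"
        by (rule linear_det_nonzero_inj[OF linY *(7)[OF y1(2)]]) (simp add: u(2) *(8)[OF z])
      then show ?thesis using u(1) by simp
    qed
    show ?thesis
      unfolding gy(1)[symmetric]
      by (rule liouville_density_eq[OF q_has_derivative linT \<open>surj ?T\<close>, folded kk_def])
        (use v ixi ixi[THEN not_sym] ixk gy in \<open>simp_all add: dPQ axis_def\<close>)
  qed
  show ?thesis
  proof (rule that[OF *(1) _ *(4,5,6)])
    show "inv g (\<psi> x0) \<in> Ob" using *(3) unfolding y0_def .
    show "embk y \<in> V \<longleftrightarrow> lin e y \<in> W \<and> inv g (\<psi> (lin e y)) \<in> Ob" for y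
    proof
      assume z: "embk y \<in> V"
      have "inv g (\<psi> (lin e y)) = \<Theta> (embk y)" using bwd[OF z] inv_g_g by metis
      then show "lin e y \<in> W \<and> inv g (\<psi> (lin e y)) \<in> Ob" using bwd[OF z] \<Theta>Ob(1)[OF z] by simp
    qed (use fwd in blast)
    show "\<Theta> (embk y) = inv g (\<psi> (lin e y))" if "embk y \<in> V" for y
      using bwd[OF that] inv_g_g by metis
  qed (use dn PQ in blast)+
qed

definition "tube_integrand m \<phi> y = bump m (P y) * bump m (Q y) * \<phi> y * \<bar>vol y\<bar>"

lemma cont_PQvol: "continuous_on A P" "continuous_on A Q" "continuous_on A vol"
  using continuous_on_subset[OF Ck_continuous_on[OF spec[OF Cinf_P, of 0]] subset_UNIV]
    continuous_on_subset[OF Ck_continuous_on[OF spec[OF Cinf_Q, of 0]] subset_UNIV]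
    continuous_on_subset[OF Ck_continuous_on[OF Ck_vol[of 0]] subset_UNIV] by blast+

lemma continuous_tube_integrand:
  "continuous_on UNIV \<phi> \<Longrightarrow> continuous_on UNIV (tube_integrand m \<phi>)"
  unfolding tube_integrand_def[abs_def]
  by (intro continuous_intros cont_PQvol continuous_on_compose2[OF continuous_bump]) auto

text \<open>In the coordinates of \<open>chart_local\<close> the functions P and Q are the last two
  coordinates, so the tube integral becomes one of the integrals in \<open>bump_limit\<close>, with
  J containing the factor \<bar>vol det \<Theta>'\<bar>. On the slice this factor is the Liouville
  density of the chart.\<close>

lemma chart_limit:
  assumes chart: "slice_chart kk S e W \<psi>" and x0: "x0 \<in> W \<inter> span (e ` {..<kk})"
  shows "\<exists>r>0. \<forall>\<phi>. continuous_on UNIV \<phi> \<and> (\<forall>y. \<phi> y \<ge> 0) \<and> (\<forall>y. y \<notin> ball (inv g (\<psi> x0)) r \<longrightarrow> \<phi> y = 0) \<longrightarrow>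
     (\<exists>L\<ge>0. (\<lambda>m. \<integral>y. tube_integrand m \<phi> y \<partial>lborel) \<longlonglongrightarrow> L \<and>
       (\<integral>\<^sup>+y. dens e W \<psi> y * ennreal (\<phi> (inv g (\<psi> (lin e y)))) \<partial>PiM {..<kk} (\<lambda>_. lborel)) = ennreal L)"
proof -
  obtain Ob V Y \<Theta> where *: "open Ob" "inv g (\<psi> x0) \<in> Ob" "open V" "homeomorphism Ob V Y \<Theta>" "Cinf V \<Theta>"
    "\<And>y. embk y \<in> V \<longleftrightarrow> lin e y \<in> W \<and> inv g (\<psi> (lin e y)) \<in> Ob"
    "\<And>y. embk y \<in> V \<Longrightarrow> \<Theta> (embk y) = inv g (\<psi> (lin e y))"
    "\<And>y. embk y \<in> V \<Longrightarrow> liouville_density \<Lambda> q (\<psi> (lin e y)) (\<lambda>i. frechet_derivative \<psi> (at (lin e y)) (e i)) =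
       \<bar>vol (\<Theta> (embk y)) * det (matrix (frechet_derivative \<Theta> (at (embk y))))\<bar>"
    "\<And>z. z \<in> V \<Longrightarrow> P (\<Theta> z) = z $ ix kk \<and> Q (\<Theta> z) = z $ ix (Suc kk)"
    by (rule chart_local[OF chart x0]) blast
  let ?y0 = "inv g (\<psi> x0)"
  obtain r where r: "r > 0" "cball ?y0 r \<subseteq> Ob" using *(1,2) open_contains_cball by blast
  have \<Theta>Ob: "\<Theta> z \<in> Ob" "Y (\<Theta> z) = z" if "z \<in> V" for z using *(4) that by (auto simp: homeomorphism_def)
  have YV: "Y y \<in> V" "\<Theta> (Y y) = y" if "y \<in> Ob" for y using *(4) that by (auto simp: homeomorphism_def)
  have cY: "continuous_on Ob Y" and c\<Theta>: "continuous_on V \<Theta>" and \<Theta>V: "\<Theta> ` V = Ob"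
    using *(4) by (auto simp: homeomorphism_def)
  let ?D = "\<lambda>z. det (matrix (frechet_derivative \<Theta> (at z)))"
  have cD: "continuous_on V ?D"
  proof -
    have "Ck 0 V (\<lambda>z. matrix (frechet_derivative \<Theta> (at z)) $ i $ j)" for i j
      unfolding matrix_def
      using Ck_vec_nth[OF *(3) Ck_frechet[OF spec[OF *(5), of "Suc 0"], of "axis j 1"], of i] by simp
    from Ck_det[OF *(3) this] show ?thesis by simp
  qed
  show ?thesis
  proof (rule exI[of _ r], rule conjI[OF r(1)], intro allI impI)
    fix \<phi> :: "real^('n bit0) \<Rightarrow> real" assume \<phi>: "continuous_on UNIV \<phi> \<and> (\<forall>y. \<phi> y \<ge> 0) \<and> (\<forall>y. y \<notin> ball ?y0 r \<longrightarrow> \<phi> y = 0)"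
    then have c\<phi>: "continuous_on A \<phi>" for A using continuous_on_subset by blast
    \<comment> \<open>Extension by 0 is continuous because J is supported in the image K of a closed
      ball, a compact subset of V.\<close>
    define J where "J z = (if z \<in> V then \<phi> (\<Theta> z) * \<bar>vol (\<Theta> z) * ?D z\<bar> else 0)" for z
    define K where "K = Y ` cball ?y0 r"
    have K: "compact K" unfolding K_def by (intro compact_continuous_image continuous_on_subset[OF cY r(2)] compact_cball)
    have KV: "K \<subseteq> V" unfolding K_def using r(2) YV by blast
    have J0: "J z = 0" if "z \<notin> K" for z
    proof (cases "z \<in> V")
      case True
      have "\<Theta> z \<notin> cball ?y0 r"
      proof
        assume "\<Theta> z \<in> cball ?y0 r"
        then have "Y (\<Theta> z) \<in> K" unfolding K_def by blast
        then show False using \<Theta>Ob(2)[OF True] that by simp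
      qed
      then have "\<Theta> z \<notin> ball ?y0 r" by auto
      then show ?thesis unfolding J_def using \<phi> by simp
    qed (simp add: J_def)
    have Jn: "J z \<ge> 0" for z unfolding J_def using \<phi> by simp
    have contJ: "continuous_on UNIV J"
    proof -
      have "continuous_on V (\<lambda>z. \<phi> (\<Theta> z) * \<bar>vol (\<Theta> z) * ?D z\<bar>)"
        by (intro continuous_intros cD continuous_on_compose2[OF c\<phi>[of UNIV] c\<Theta>]
          continuous_on_compose2[OF cont_PQvol(3)[of UNIV] c\<Theta>]) auto
      then have "continuous_on V J" by (rule continuous_on_eq) (simp add: J_def)
      moreover have "continuous_on (- K) J"
        by (rule continuous_on_eq[OF continuous_on_const[of _ 0]]) (simp add: J0)
      ultimately have "continuous_on (V \<union> - K) J"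
        using *(3) K by (intro continuous_on_open_Un) (auto intro: compact_imp_closed)
      moreover have "V \<union> - K = UNIV" using KV by blast
      ultimately show ?thesis by simp
    qed
    have cov: "(\<integral>y. tube_integrand m \<phi> y \<partial>lborel) =
       (\<integral>z. bump m (z $ ix kk) * bump m (z $ ix (Suc kk)) * J z \<partial>lborel)" for m
    proof -
      let ?F = "tube_integrand m \<phi>"
      let ?G = "\<lambda>z. bump m (z $ ix kk) * bump m (z $ ix (Suc kk)) * J z"
      have F0: "?F y = 0" if "y \<notin> cball ?y0 r" for y
      proof -
        have "y \<notin> ball ?y0 r" using that by auto
        then show ?thesis using \<phi> by (simp add: tube_integrand_def)
      qed
      have intF: "integrable lborel ?F"
        by (rule integrable_compact_support[OF continuous_tube_integrand compact_cball F0]) (use \<phi> in blast)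
      have cG: "continuous_on UNIV ?G"
        by (intro continuous_intros contJ continuous_on_compose2[OF continuous_bump]) auto
      have intG: "integrable lborel ?G"
        by (rule integrable_compact_support[OF cG K]) (simp add: J0)
      have Fres: "(\<lambda>y. if y \<in> \<Theta> ` V then ?F y else 0) = ?F"
      proof (rule ext)
        fix y
        have "?F y = 0" if "y \<notin> \<Theta> ` V"
          by (rule F0) (use that r(2) \<Theta>V in blast)
        then show "(if y \<in> \<Theta> ` V then ?F y else 0) = ?F y" by simp
      qed
      have "?F absolutely_integrable_on UNIV"
        using intF by (simp add: absolutely_integrable_on_def integrable_on_lborel)
      then have F_ai: "?F absolutely_integrable_on \<Theta> ` V"
        using absolutely_integrable_restrict_UNIV[of "\<Theta> ` V" ?F] Fres by simp
      have "(\<integral>y. ?F y \<partial>lborel) = integral UNIV ?F" by (rule integral_lborel[OF intF, symmetric])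
      also have "\<dots> = integral (\<Theta> ` V) ?F"
        using Henstock_Kurzweil_Integration.integral_restrict_UNIV[of "\<Theta> ` V" ?F] Fres by simp
      also have "\<dots> = integral V (\<lambda>z. \<bar>?D z\<bar> * ?F (\<Theta> z))"
      proof (rule integral_change_of_variables_real[OF _ _ _ F_ai])
        show "V \<in> sets lebesgue" using *(3) by simp
        show "(\<Theta> has_derivative frechet_derivative \<Theta> (at z)) (at z within V)" if "z \<in> V" for z
          by (rule has_derivative_at_withinI[OF Ck_has_derivative[OF spec[OF *(5), of "Suc 0"] that]])
        show "inj_on \<Theta> V" by (rule inj_on_inverseI[of _ Y]) (rule \<Theta>Ob(2))
      qed
      also have "\<dots> = integral V ?G"
        by (rule integral_cong) (simp add: J_def tube_integrand_def *(9) abs_mult)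
      also have "\<dots> = integral UNIV (\<lambda>z. if z \<in> V then ?G z else 0)"
        by (rule Henstock_Kurzweil_Integration.integral_restrict_UNIV[symmetric])
      also have "(\<lambda>z. if z \<in> V then ?G z else 0) = ?G" by (auto simp: fun_eq_iff J_def)
      also have "integral UNIV ?G = (\<integral>z. ?G z \<partial>lborel)" by (rule integral_lborel[OF intG])
      finally show ?thesis .
    qed
    obtain L where L: "L \<ge> 0" "(\<lambda>m. \<integral>z. bump m (z $ ix kk) * bump m (z $ ix (Suc kk)) * J z \<partial>lborel) \<longlonglongrightarrow> L"
      "(\<integral>\<^sup>+x. ennreal (J (embk x)) \<partial>PiM {..<kk} (\<lambda>_. lborel)) = ennreal L"
      by (rule bump_limit[OF kk(2) contJ Jn K J0])
    have pt: "dens e W \<psi> y * ennreal (\<phi> (inv g (\<psi> (lin e y)))) = ennreal (J (embk y))" for y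
    proof (cases "embk y \<in> V")
      case True
      then have "lin e y \<in> W" using *(6) by blast
      then show ?thesis unfolding dens_def J_def *(8)[OF True] using True \<phi> *(7)[OF True]
        by (simp add: ennreal_mult' mult.commute)
    next
      case False
      then have "lin e y \<notin> W \<or> inv g (\<psi> (lin e y)) \<notin> Ob" using *(6) by blast
      moreover have "inv g (\<psi> (lin e y)) \<notin> Ob \<Longrightarrow> inv g (\<psi> (lin e y)) \<notin> ball ?y0 r" using r(2) by force
      ultimately show ?thesis unfolding dens_def J_def using False \<phi> by (auto)
    qed
    show "\<exists>L\<ge>0. (\<lambda>m. \<integral>y. tube_integrand m \<phi> y \<partial>lborel) \<longlonglongrightarrow> L \<and>
       (\<integral>\<^sup>+y. dens e W \<psi> y * ennreal (\<phi> (inv g (\<psi> (lin e y)))) \<partial>PiM {..<kk} (\<lambda>_. lborel)) = ennreal L"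
      unfolding pt cov using L by blast
  qed
qed

end

section \<open>Existence of slice charts for the common level set\<close>

lemma Cinf_imp_smooth_on:
  assumes "Cinf U f" shows "smooth_on U f"
  unfolding smooth_on_def
proof
  fix vs
  show "\<forall>x\<in>U. iter_deriv vs f differentiable (at x)"
    using assms
  proof (induction vs arbitrary: f rule: rev_induct)
    case Nil
    then have "Ck (Suc 0) U f" by blast
    then show ?case by simp
  next
    case (snoc v vs)
    have "Ck k U (\<lambda>x. frechet_derivative f (at x) v)" for k
      by (rule Ck_frechet) (use snoc.prems in blast)
    then have "\<forall>x\<in>U. iter_deriv vs (\<lambda>x. frechet_derivative f (at x) v) differentiable at x"
      by (intro snoc.IH) blast
    then show ?case unfolding iter_deriv_frechet .
  qed
qed

lemma euclidean_isomorphism: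
  assumes "DIM('a::euclidean_space) = DIM('b::euclidean_space)"
  shows "\<exists>(L :: 'a \<Rightarrow> 'b) L'. linear L \<and> linear L' \<and> (\<forall>x. L' (L x) = x) \<and> (\<forall>x. L (L' x) = x)"
proof -
  obtain L :: "'a \<Rightarrow> 'b" and L' where "linear L" "linear L'" "\<And>x. norm (L x) = norm x" "\<And>x. norm (L' x) = norm x"
    "\<And>x. L' (L x) = x" "\<And>x. L (L' x) = x"
    by (rule isomorphisms_UNIV_UNIV[OF assms]) blast
  then have "linear L \<and> linear L' \<and> (\<forall>x. L' (L x) = x) \<and> (\<forall>x. L (L' x) = x)" by simp
  then show ?thesis by (intro exI)
qed

text \<open>Slice charts live in the phase space, while \<open>inverse_function_Cinf\<close> uses
  matrices over \<open>real^'m\<close>. A linear isomorphism carries the result across.\<close>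

lemma inverse_function_Cinf_iso:
  fixes \<Phi> :: "'a::euclidean_space \<Rightarrow> 'a" and L :: "real^'m::finite \<Rightarrow> 'a" and L' :: "'a \<Rightarrow> real^'m"
  assumes L: "linear L" "linear L'" "\<And>x. L' (L x) = x" "\<And>x. L (L' x) = x"
    and U: "open U" "Cinf U \<Phi>" "p0 \<in> U" and inj: "\<And>u. frechet_derivative \<Phi> (at p0) u = 0 \<Longrightarrow> u = 0"
  obtains Ob V \<Theta> where "open Ob" "Ob \<subseteq> U" "p0 \<in> Ob" "open V" "homeomorphism Ob V \<Phi> \<Theta>" "Cinf V \<Theta>"
proof -
  have bL: "bounded_linear L" "bounded_linear L'" using L by (simp_all add: linear_conv_bounded_linear)
  have cL: "continuous_on A L" "continuous_on B L'" for A B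
    using bL by (simp_all add: linear_continuous_on)
  define Y where "Y x = L' (\<Phi> (L x))" for x
  have U': "open (L -` U)" using cL(1)[of UNIV] U(1) by (simp add: open_vimage)
  have "Ck k (L -` U) (\<lambda>x. \<Phi> (L x))" for k
    by (rule Ck_compose[OF U' U(1) _ Ck_linear[OF L(1)]]) (use U(2) in auto)
  then have CY: "Cinf (L -` U) Y" unfolding Y_def[abs_def] using Ck_bounded_linear[OF U' bL(2)] by blast
  have p0: "L' p0 \<in> L -` U" using U(3) L(4) by simp
  have d\<Phi>: "(\<Phi> has_derivative frechet_derivative \<Phi> (at p0)) (at p0)"
    by (rule Ck_has_derivative[OF spec[OF U(2), of "Suc 0"] U(3)])
  have "((\<lambda>x. \<Phi> (L x)) has_derivative (\<lambda>u. frechet_derivative \<Phi> (at p0) (L u))) (at (L' p0))"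
    using diff_chain_at[OF bounded_linear_imp_has_derivative[OF bL(1)], of \<Phi> "frechet_derivative \<Phi> (at p0)" "L' p0"] d\<Phi> L(4)
    by (simp add: o_def)
  then have "(Y has_derivative (\<lambda>u. L' (frechet_derivative \<Phi> (at p0) (L u)))) (at (L' p0))"
    unfolding Y_def[abs_def] by (rule bounded_linear.has_derivative[OF bL(2)])
  from frechet_derivative_at[OF this]
  have Y': "frechet_derivative Y (at (L' p0)) u = L' (frechet_derivative \<Phi> (at p0) (L u))" for u by metis
  have injY: "u = 0" if "frechet_derivative Y (at (L' p0)) u = 0" for u
  proof -
    have "L (L' (frechet_derivative \<Phi> (at p0) (L u))) = L 0" using that unfolding Y' by simp
    then have "frechet_derivative \<Phi> (at p0) (L u) = 0" using L(4) linear_0[OF L(1)] by simp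
    from inj[OF this] have "L' (L u) = L' 0" by (rule arg_cong)
    then show ?thesis using L(3) linear_0[OF L(2)] by simp
  qed
  obtain O1 V1 \<Theta>1 where *: "open O1" "O1 \<subseteq> L -` U" "L' p0 \<in> O1" "open V1" "homeomorphism O1 V1 Y \<Theta>1" "Cinf V1 \<Theta>1"
    by (rule inverse_function_Cinf[OF U' CY p0 injY]) blast
  have imL: "L ` A = L' -` A" for A
  proof (intro equalityI subsetI)
    fix x assume "x \<in> L' -` A"
    then show "x \<in> L ` A" using L(4)[of x] by (intro image_eqI[of _ _ "L' x"]) simp_all
  qed (use L(3) in auto)
  show ?thesis
  proof (rule that[of "L ` O1" "L ` V1" "\<lambda>v. L (\<Theta>1 (L' v))"])
    show "open (L ` O1)" "open (L ` V1)" unfolding imL using *(1,4) cL(2)[of UNIV] by (simp_all add: open_vimage)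
    show "L ` O1 \<subseteq> U" using *(2) by blast
    show "p0 \<in> L ` O1" unfolding imL using *(3) by simp
    have h: "Y ` O1 = V1" "\<Theta>1 ` V1 = O1" "continuous_on O1 Y" "continuous_on V1 \<Theta>1"
      "\<And>x. x \<in> O1 \<Longrightarrow> \<Theta>1 (Y x) = x" "\<And>y. y \<in> V1 \<Longrightarrow> Y (\<Theta>1 y) = y"
      using *(5) by (auto simp: homeomorphism_def)
    have \<Phi>Y: "\<Phi> (L x) = L (Y x)" for x unfolding Y_def using L(4) by simp
    show "homeomorphism (L ` O1) (L ` V1) \<Phi> (\<lambda>v. L (\<Theta>1 (L' v)))"
    proof (rule homeomorphismI)
      show "continuous_on (L ` O1) \<Phi>"
        by (rule continuous_on_subset[OF Ck_continuous_on[OF spec[OF U(2), of 0]]]) (use *(2) in blast)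
      show "continuous_on (L ` V1) (\<lambda>v. L (\<Theta>1 (L' v)))"
        by (rule continuous_on_compose2[OF cL(1)[of UNIV] continuous_on_compose2[OF h(4) cL(2)]]) (use L(3) in auto)
      show "\<Phi> ` L ` O1 \<subseteq> L ` V1" using \<Phi>Y h(1) by auto
      show "(\<lambda>v. L (\<Theta>1 (L' v))) ` L ` V1 \<subseteq> L ` O1" using L(3) h(2) by auto
      show "L (\<Theta>1 (L' (\<Phi> x))) = x" if "x \<in> L ` O1" for x using that \<Phi>Y L(3) h(5) by auto
      show "\<Phi> (L (\<Theta>1 (L' y))) = y" if "y \<in> L ` V1" for y using that \<Phi>Y L(3) h(6) by auto
    qed
    show "Cinf (L ` V1) (\<lambda>v. L (\<Theta>1 (L' v)))"
    proof
      fix k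
      have o: "open (L ` V1)" unfolding imL using *(4) cL(2)[of UNIV] by (simp add: open_vimage)
      have "Ck k (L ` V1) (\<lambda>v. \<Theta>1 (L' v))"
        by (rule Ck_compose[OF o *(4) spec[OF *(6)] Ck_linear[OF L(2)]]) (use L(3) in auto)
      then show "Ck k (L ` V1) (\<lambda>v. L (\<Theta>1 (L' v)))" by (rule Ck_bounded_linear[OF o bL(1)])
    qed
  qed
qed

context level_set
begin

lemma vec_split:
  fixes z z' :: "real^('n bit0)"
  assumes "\<And>i. i < kk \<Longrightarrow> z $ ix i = z' $ ix i" "z $ ix kk = z' $ ix kk" "z $ ix (Suc kk) = z' $ ix (Suc kk)"
  shows "z = z'"
proof -
  have "z $ a = z' $ a" for a
  proof -
    obtain i where i: "i < CARD('n bit0)" "a = ix i" by (rule ix_cases)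
    then have "i < kk \<or> i = kk \<or> i = Suc kk" unfolding kk(2) by linarith
    then show ?thesis using assms i by blast
  qed
  then show ?thesis by (simp add: vec_eq_iff)
qed

lemma ix_kk: "ix kk \<noteq> (ix (Suc kk) :: 'n bit0)"
  "i < kk \<Longrightarrow> ix i \<noteq> (ix kk :: 'n bit0)" "i < kk \<Longrightarrow> ix i \<noteq> (ix (Suc kk) :: 'n bit0)"
  using ix_inj[of kk "Suc kk", where 'm="'n bit0"] ix_inj[of i kk, where 'm="'n bit0"]
    ix_inj[of i "Suc kk", where 'm="'n bit0"] kk by simp_all

lemma embk_nth: "j < kk + 2 \<Longrightarrow> embk y $ ix j = (if j < kk then y j else 0)"
  by (rule emb_nth) (use kk in simp_all)

text \<open>Complete a, b to a basis and subtract from the other basis vectors the multiples of a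
  and b that bring them into the common kernel of p and p'. The coordinates in this basis, with a
  and b last, are the required A.\<close>

lemma adapted_iso:
  fixes p p' :: "real^('n bit0) \<Rightarrow> real"
  assumes lin: "linear p" "linear p'" and ab: "p a = 1" "p' a = 0" "p b = 0" "p' b = 1"
  obtains A :: "real^('n bit0) \<Rightarrow> real^('n bit0)"
    where "linear A" "inj A" "\<And>u. A u $ ix kk = p u" "\<And>u. A u $ ix (Suc kk) = p' u"
proof -
  have ne: "a \<noteq> b" using ab by auto
  have ind: "independent {a, b}"
  proof -
    have "a \<notin> span {b}"
    proof
      assume "a \<in> span {b}"
      then obtain c where "a = c *\<^sub>R b" by (auto simp: span_singleton)
      then show False using ab linear_cmul[OF lin(1), of c b] by simp
    qed
    moreover have "b \<noteq> 0" using ab linear_0[OF lin(2)] by auto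
    ultimately show ?thesis by (auto simp: independent_insert)
  qed
  obtain B where B: "{a, b} \<subseteq> B" "independent B" "span B = UNIV"
    using maximal_independent_subset_extend[OF subset_UNIV ind] by (metis subset_UNIV top.extremum_uniqueI)
  have finB: "finite B" using B(2) independent_bound by blast
  have "card B = CARD('n bit0)"
    using dim_span_eq_card_independent[OF B(2)] B(3) by (simp add: dim_UNIV)
  then have "card (B - {a, b}) = kk" using B(1) finB ne kk(2) by (simp add: card_Diff_subset)
  then obtain h where h: "bij_betw h {..<kk} (B - {a, b})"
    using ex_bij_betw_nat_finite[of "B - {a, b}"] finB by (auto simp: atLeast0LessThan)
  define w where "w i = h i - p (h i) *\<^sub>R a - p' (h i) *\<^sub>R b" for i
  have w0: "p (w i) = 0" "p' (w i) = 0" for i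
    unfolding w_def using ab by (simp_all add: linear_diff[OF lin(1)] linear_diff[OF lin(2)] linear_cmul[OF lin(1)] linear_cmul[OF lin(2)])
  define T where "T z = (\<Sum>i<kk. (z $ ix i) *\<^sub>R w i) + (z $ ix kk) *\<^sub>R a + (z $ ix (Suc kk)) *\<^sub>R b" for z :: "real^('n bit0)"
  have linT: "linear T" unfolding T_def
    by (rule linearI) (simp_all add: scaleR_add_left sum.distrib scaleR_add_right scaleR_sum_right)
  have pT: "p (T z) = z $ ix kk" "p' (T z) = z $ ix (Suc kk)" for z
    unfolding T_def using ab w0
    by (simp_all add: linear_add[OF lin(1)] linear_add[OF lin(2)] linear_sum[OF lin(1)] linear_sum[OF lin(2)]
      linear_cmul[OF lin(1)] linear_cmul[OF lin(2)])
  have "surj T"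
  proof -
    have sub: "subspace (range T)" by (rule linear_subspace_image[OF linT subspace_UNIV])
    have Ta: "T (axis (ix kk) 1) = a" "T (axis (ix (Suc kk)) 1) = b"
      unfolding T_def using ix_kk by (simp_all add: axis_def)
    have Tw: "T (axis (ix j) 1) = w j" if "j < kk" for j
    proof -
      have "(\<Sum>i<kk. (axis (ix j) (1::real) $ (ix i :: 'n bit0)) *\<^sub>R w i) = (\<Sum>i<kk. if i = j then w i else 0)"
        by (rule sum.cong[OF refl]) (use that kk ix_inj[where 'm="'n bit0"] in \<open>auto simp: axis_def\<close>)
      then show ?thesis unfolding T_def using that ix_kk(2,3)[OF that] by (simp add: axis_def)
    qed
    have ra: "a \<in> range T" "b \<in> range T" using Ta by (metis rangeI)+
    have "B \<subseteq> range T"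
    proof
      fix x assume x: "x \<in> B"
      show "x \<in> range T"
      proof (cases "x \<in> {a, b}")
        case False
        then obtain i where i: "i < kk" "x = h i" using h x by (auto simp: bij_betw_def)
        have "h i = w i + p (h i) *\<^sub>R a + p' (h i) *\<^sub>R b" unfolding w_def by simp
        moreover have "w i \<in> range T" using Tw[OF i(1)] by (metis rangeI)
        ultimately show ?thesis unfolding i(2) using ra
          by (metis subspace_add[OF sub] subspace_scale[OF sub])
      qed (use ra in blast)
    qed
    then have "span B \<subseteq> range T" by (rule span_minimal[OF _ sub])
    then show ?thesis using B(3) by blast
  qed
  then obtain A :: "real^('n bit0) \<Rightarrow> real^('n bit0)" where A: "linear A" "T \<circ> A = id" using linear_surjective_right_inverse[OF linT] by blast
  then have TA: "T (A u) = u" for u by (metis comp_apply id_apply)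
  show ?thesis
  proof (rule that[OF A(1)])
    show "inj A" by (rule inj_on_inverseI[of _ T]) (rule TA)
    show "A u $ ix kk = p u" "A u $ ix (Suc kk) = p' u" for u using pT[of "A u"] TA by simp_all
  qed
qed

text \<open>The ambient space is straightened by
  \<open>\<Phi> r = Dg y0 (Y (G r)) + pr (r - g (G r))\<close>. The first term holds the position
  along \<Lambda>, in coordinates Y that end with P and Q, placed in the tangent space; the second
  measures the deviation from \<Lambda> transversally. S becomes the part of the tangent plane where
  the last two coordinates vanish, and the chart is the inverse of \<Phi>.\<close>

lemma slice_chart_exists:
  assumes "\<rho> \<in> S"
  shows "\<exists>e W \<psi>. slice_chart kk S e W \<psi> \<and> \<rho> \<in> \<psi> ` W"
proof -
  define y0 where "y0 = inv g \<rho>"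
  have gy0: "g y0 = \<rho>" unfolding y0_def using assms S_subset g_inv_g by blast
  have PQ0: "P y0 = 0" "Q y0 = 0" using assms g_in_S[of y0] gy0 by simp_all
  obtain U G where U: "open U" "g y0 \<in> U" "Cinf U G" "\<And>z. z \<in> \<Lambda> \<Longrightarrow> z \<in> U \<Longrightarrow> G z = inv g z"
    "(G has_derivative frechet_derivative G (at (g y0))) (at (g y0))"
    "\<And>u. frechet_derivative G (at (g y0)) (Dg y0 u) = u"
    by (rule local_inverse[of y0]) blast
  define R where "R = frechet_derivative G (at \<rho>)"
  have R: "R (Dg y0 u) = u" for u using U(6) unfolding R_def gy0 .
  have linR: "linear R" unfolding R_def gy0[symmetric] by (rule has_derivative_linear[OF U(5)])
  have \<rho>U: "\<rho> \<in> U" using U(2) gy0 by simp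
  have G\<rho>: "G \<rho> = y0" unfolding y0_def by (rule U(4)[OF subsetD[OF S_subset assms] \<rho>U])
  have dP: "(P has_derivative frechet_derivative P (at y)) (at y)" and dQ: "(Q has_derivative frechet_derivative Q (at y)) (at y)" for y
    using Ck_has_derivative[OF spec[OF Cinf_P, of "Suc 0"], of y] Ck_has_derivative[OF spec[OF Cinf_Q, of "Suc 0"], of y] by simp_all
  obtain a b where ab: "frechet_derivative P (at y0) a = 1" "frechet_derivative Q (at y0) a = 0"
       "frechet_derivative P (at y0) b = 0" "frechet_derivative Q (at y0) b = 1"
    using indep[OF PQ0] by blast
  obtain A :: "real^('n bit0) \<Rightarrow> real^('n bit0)" where A: "linear A" "inj A" "\<And>u. A u $ ix kk = frechet_derivative P (at y0) u" "\<And>u. A u $ ix (Suc kk) = frechet_derivative Q (at y0) u"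
    by (rule adapted_iso[OF has_derivative_linear[OF dP] has_derivative_linear[OF dQ] ab(1,2,3,4)]) blast
  define Y where "Y y = embk (\<lambda>i. A y $ ix i) + P y *\<^sub>R axis (ix kk) 1 + Q y *\<^sub>R axis (ix (Suc kk)) 1" for y
  have Yk: "Y y $ ix kk = P y" "Y y $ ix (Suc kk) = Q y" for y
    unfolding Y_def using embk_nth[of kk] embk_nth[of "Suc kk"] ix_kk by (simp_all add: axis_def)
  have Yi: "Y y $ ix i = A y $ ix i" if "i < kk" for y i
    unfolding Y_def using embk_nth[of i] ix_kk(2,3)[OF that] that by (simp add: axis_def)
  have bA: "bounded_linear A" using A(1) by (simp add: linear_conv_bounded_linear)
  have CY: "Ck k UNIV Y" for k
  proof -
    have "Ck k UNIV (\<lambda>y. A y $ ix i)" for i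
      by (rule Ck_vec_nth[OF open_UNIV Ck_linear[OF A(1)]])
    then show ?thesis unfolding Y_def[abs_def] emb_def
      by (intro Ck_add open_UNIV Ck_sum Ck_scaleR Ck_const spec[OF Cinf_P] spec[OF Cinf_Q])
  qed
  have Y': "(Y has_derivative frechet_derivative Y (at y)) (at y)" for y
    by (rule Ck_has_derivative[OF CY[of "Suc 0"]]) simp
  have Y'0: "frechet_derivative Y (at y0) u = A u" for u
  proof (rule vec_split)
    show "frechet_derivative Y (at y0) u $ ix kk = A u $ ix kk"
      unfolding A(3) by (rule frechet_nth[OF Y' Yk(1)])
    show "frechet_derivative Y (at y0) u $ ix (Suc kk) = A u $ ix (Suc kk)"
      unfolding A(4) by (rule frechet_nth[OF Y' Yk(2)])
    fix i assume i: "i < kk"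
    have "((\<lambda>y. A y $ ix i) has_derivative (\<lambda>u. A u $ ix i)) (at y0)"
      by (rule bounded_linear_imp_has_derivative[OF bounded_linear_compose[OF bounded_linear_vec_nth bA]])
    from frechet_derivative_at[OF this]
    have "frechet_derivative (\<lambda>y. A y $ ix i) (at y0) u = A u $ ix i" by metis
    then show "frechet_derivative Y (at y0) u $ ix i = A u $ ix i"
      using frechet_nth[OF Y' Yi[OF i]] by simp
  qed
  \<comment> \<open>Since R is a left inverse of \<open>Dg y0\<close>, this is the projection onto
    the kernel of R along the tangent space.\<close>
  define pr where "pr u = u - Dg y0 (R u)" for u
  have linpr: "linear pr" unfolding pr_def
    by (intro linear_compose_sub linear_ident linear_compose[OF linR linear_Dg, unfolded o_def])
  have Rpr: "R (pr u) = 0" for u unfolding pr_def by (simp add: linear_diff[OF linR] R)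
  have prD: "pr (Dg y0 u) = 0" for u unfolding pr_def by (simp add: R)
  have bl: "bounded_linear (Dg y0)" "bounded_linear pr"
    using linear_Dg linpr by (simp_all add: linear_conv_bounded_linear)
  define \<Phi> where "\<Phi> r = Dg y0 (Y (G r)) + pr (r - g (G r))" for r
  have CgG: "Ck k U (\<lambda>r. g (G r))" for k
    by (rule Ck_compose[OF U(1) open_UNIV Ck_g]) (use U(3) in auto)
  have C\<Phi>: "Cinf U \<Phi>"
  proof
    fix k
    have "Ck k U (\<lambda>r. Y (G r))" by (rule Ck_compose[OF U(1) open_UNIV CY]) (use U(3) in auto)
    have 1: "Ck k U (\<lambda>r. Dg y0 (Y (G r)))" by (rule Ck_bounded_linear[OF U(1) bl(1) \<open>Ck k U (\<lambda>r. Y (G r))\<close>])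
    have "Ck k U (\<lambda>r. r - g (G r))"
      by (rule Ck_diff[OF U(1) Ck_subset[OF Ck_linear[OF linear_ident] subset_UNIV] CgG])
    then have 2: "Ck k U (\<lambda>r. pr (r - g (G r)))" by (rule Ck_bounded_linear[OF U(1) bl(2)])
    show "Ck k U \<Phi>" unfolding \<Phi>_def[abs_def] by (rule Ck_add[OF U(1) 1 2])
  qed
  have inj\<Phi>: "u = 0" if u: "frechet_derivative \<Phi> (at \<rho>) u = 0" for u
  proof -
    have G': "(G has_derivative R) (at \<rho>)" using U(5) unfolding R_def gy0 .
    have "frechet_derivative Y (at y0) = A" by (rule ext) (rule Y'0)
    then have "((\<lambda>r. Y (G r)) has_derivative (\<lambda>u. A (R u))) (at \<rho>)"
      using diff_chain_at[OF G', of Y A] Y'[of y0] G\<rho> by (simp add: o_def)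
    then have 1: "((\<lambda>r. Dg y0 (Y (G r))) has_derivative (\<lambda>u. Dg y0 (A (R u)))) (at \<rho>)"
      by (rule bounded_linear.has_derivative[OF bl(1)])
    have "((\<lambda>r. g (G r)) has_derivative (\<lambda>u. Dg y0 (R u))) (at \<rho>)"
      using diff_chain_at[OF G', of g "Dg y0"] has_derivative_g G\<rho> by (simp add: o_def)
    then have "((\<lambda>r. r - g (G r)) has_derivative (\<lambda>u. u - Dg y0 (R u))) (at \<rho>)"
      by (rule has_derivative_diff[OF has_derivative_ident])
    then have "((\<lambda>r. pr (r - g (G r))) has_derivative (\<lambda>u. pr (u - Dg y0 (R u)))) (at \<rho>)"
      by (rule bounded_linear.has_derivative[OF bl(2)])
    with 1 have "(\<Phi> has_derivative (\<lambda>u. Dg y0 (A (R u)) + pr (u - Dg y0 (R u)))) (at \<rho>)"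
      unfolding \<Phi>_def[abs_def] by (rule has_derivative_add)
    from frechet_derivative_at[OF this]
    have "frechet_derivative \<Phi> (at \<rho>) u = Dg y0 (A (R u)) + pr (u - Dg y0 (R u))" by (rule fun_cong[symmetric])
    also have "pr (u - Dg y0 (R u)) = pr u" unfolding linear_diff[OF linpr] prD by simp
    \<comment> \<open>The two terms lie in complementary subspaces. Applying R isolates the
      tangential one, so both vanish separately.\<close>
    finally have eq: "Dg y0 (A (R u)) + pr u = 0" unfolding u by (rule sym)
    have "R (Dg y0 (A (R u)) + pr u) = 0" unfolding eq by (rule linear_0[OF linR])
    then have A0: "A (R u) = 0" unfolding linear_add[OF linR] R Rpr by simp
    then have "A (R u) = A 0" unfolding linear_0[OF A(1)] .
    then have R0: "R u = 0" by (rule injD[OF A(2)])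
    have "pr u = 0" using eq unfolding A0 linear_0[OF linear_Dg] by simp
    then show "u = 0" unfolding pr_def R0 linear_0[OF linear_Dg] by simp
  qed
  have dim: "DIM(real^('n bit0 bit0)) = DIM('n phase)" by simp
  obtain L :: "real^('n bit0 bit0) \<Rightarrow> 'n phase" and L' where L: "linear L \<and> linear L' \<and> (\<forall>x. L' (L x) = x) \<and> (\<forall>x. L (L' x) = x)"
    using euclidean_isomorphism[OF dim] by (elim exE)
  obtain Ob V \<Theta> where *: "open Ob" "Ob \<subseteq> U" "\<rho> \<in> Ob" "open V" "homeomorphism Ob V \<Phi> \<Theta>" "Cinf V \<Theta>"
    by (rule inverse_function_Cinf_iso[OF conjunct1[OF L] conjunct1[OF conjunct2[OF L]]
        spec[OF conjunct1[OF conjunct2[OF conjunct2[OF L]]]] spec[OF conjunct2[OF conjunct2[OF conjunct2[OF L]]]] U(1) C\<Phi> \<rho>U inj\<Phi>])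
  have h: "\<Phi> ` Ob = V" "\<Theta> ` V = Ob" "continuous_on V \<Theta>"
      "\<And>x. x \<in> Ob \<Longrightarrow> \<Theta> (\<Phi> x) = x" "\<And>y. y \<in> V \<Longrightarrow> \<Phi> (\<Theta> y) = y"
      using *(5) by (auto simp: homeomorphism_def)
  \<comment> \<open>Shrunk so that g (G r) also stays where \<Phi> is injective; this is what later
    forces r = g (G r).\<close>
  define O1 where "O1 = Ob \<inter> (\<lambda>r. g (G r)) -` Ob"
  have "continuous_on Ob (\<lambda>r. g (G r))"
    by (rule continuous_on_subset[OF Ck_continuous_on[OF CgG[of 0]] *(2)])
  then have O1: "open O1" unfolding O1_def by (rule continuous_open_preimage[OF _ *(1) *(1)])
  have \<rho>O1: "\<rho> \<in> O1" unfolding O1_def using *(3) G\<rho> gy0 by simp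
  define W where "W = V \<inter> \<Theta> -` O1"
  have W: "open W" unfolding W_def by (rule continuous_open_preimage[OF h(3) *(4) O1])
  have \<Theta>W: "\<Theta> ` W = O1"
  proof
    show "\<Theta> ` W \<subseteq> O1" unfolding W_def by blast
    show "O1 \<subseteq> \<Theta> ` W"
    proof
      fix r assume r: "r \<in> O1"
      then have "r \<in> Ob" unfolding O1_def by blast
      then have "r = \<Theta> (\<Phi> r)" "\<Phi> r \<in> V" using h(4)[of r] h(1) by auto
      then show "r \<in> \<Theta> ` W" unfolding W_def using r by force
    qed
  qed
  define e where "e i = Dg y0 (axis (ix i) 1)" for i
  have inj_e: "inj_on e {..<kk}"
  proof (rule inj_onI)
    fix i j assume ij: "i \<in> {..<kk}" "j \<in> {..<kk}" "e i = e j"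
    then have "axis (ix i) (1::real) = axis (ix j :: 'n bit0) 1" unfolding e_def by (intro Dg_inj)
    then have "(ix i :: 'n bit0) = ix j" by (simp add: axis_eq_axis)
    then show "i = j" using ix_inj[of i j, where 'm="'n bit0"] kk ij by simp
  qed
  have e_lin: "lin e c = Dg y0 (embk c)" for c
    unfolding lin_def e_def emb_def by (simp add: linear_sum[OF linear_Dg] linear_cmul[OF linear_Dg])
  have ind_e: "independent (e ` {..<kk})"
  proof -
    have "\<forall>i<kk. c i = 0" if "(\<Sum>i<kk. c i *\<^sub>R e i) = 0" for c
    proof -
      have "Dg y0 (embk c) = Dg y0 0" using that e_lin[of c] unfolding lin_def by (simp add: linear_0[OF linear_Dg])
      then have "embk c = 0" by (rule Dg_inj)
      then show ?thesis using embk_nth[of _ c] by (metis less_add_same_cancel1 trans_less_add1 zero_index)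
    qed
    note 0 = this
    show ?thesis
    proof (rule independent_if_scalars_zero)
      fix f x assume f: "(\<Sum>x\<in>e ` {..<kk}. f x *\<^sub>R x) = 0" and x: "x \<in> e ` {..<kk}"
      have "(\<Sum>i<kk. f (e i) *\<^sub>R e i) = 0" using f by (simp add: sum.reindex[OF inj_e])
      then show "f x = 0" using 0[of "\<lambda>i. f (e i)"] x by auto
    qed simp
  qed
  have span_e: "v \<in> span (e ` {..<kk}) \<longleftrightarrow> (\<exists>c. v = Dg y0 (embk c))" for v
    using span_lin[OF inj_e, of v] lin_in_span[of e] e_lin by metis
  have slice: "\<Theta> ` (W \<inter> span (e ` {..<kk})) = S \<inter> \<Theta> ` W"
  proof (intro equalityI subsetI)
    fix r assume "r \<in> \<Theta> ` (W \<inter> span (e ` {..<kk}))"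
    then obtain v where v0: "v \<in> W" "v \<in> span (e ` {..<kk})" "r = \<Theta> v" by blast
    obtain c where c: "v = Dg y0 (embk c)" using v0(2) unfolding span_e ..
    note v = v0(1) c v0(3)
    have r: "r \<in> Ob" "g (G r) \<in> Ob" "\<Phi> r = v"
      using v h(5)[of v] unfolding W_def O1_def by auto
    have "R (\<Phi> r) = Y (G r)" unfolding \<Phi>_def by (simp add: linear_add[OF linR] R Rpr)
    then have YG: "Y (G r) = embk c" unfolding r(3) v(2) R by simp
    have PQ: "P (G r) = 0" "Q (G r) = 0"
      using Yk[of "G r"] embk_nth[of kk c] embk_nth[of "Suc kk" c] unfolding YG by simp_all
    have pr0: "pr (r - g (G r)) = 0" using r(3) unfolding \<Phi>_def YG v(2) by simp
    have GgG: "G (g (G r)) = G r" using U(4)[of "g (G r)"] r(2) *(2) by auto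
    \<comment> \<open>On the plane the transversal term is 0, so r and its companion g (G r) in
      \<Lambda> have the same image under \<Phi> and coincide. Hence r belongs to \<Lambda>.\<close>
    have "\<Phi> (g (G r)) = \<Phi> r" unfolding \<Phi>_def GgG pr0 by (simp add: linear_0[OF linpr])
    then have "g (G r) = r" using h(4)[OF r(1)] h(4)[OF r(2)] by metis
    moreover have "g (G r) \<in> S" unfolding g_in_S using PQ by simp
    ultimately show "r \<in> S \<inter> \<Theta> ` W" using v by auto
  next
    fix r assume "r \<in> S \<inter> \<Theta> ` W"
    then have r: "r \<in> S" "r \<in> O1" using \<Theta>W by simp_all
    then have rOb: "r \<in> Ob" unfolding O1_def by blast
    have r\<Lambda>: "r \<in> \<Lambda>" using r S_subset by blast
    have "r \<in> U" using rOb *(2) by (rule rev_subsetD)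
    then have Gr: "G r = inv g r" by (rule U(4)[OF r\<Lambda>])
    have gGr: "g (G r) = r" unfolding Gr by (rule g_inv_g[OF r\<Lambda>])
    then have PQ: "P (G r) = 0" "Q (G r) = 0" using r(1) g_in_S[of "G r"] by simp_all
    have "Y (G r) = embk (\<lambda>i. A (G r) $ ix i)" unfolding Y_def PQ by simp
    then have "\<Phi> r = Dg y0 (embk (\<lambda>i. A (G r) $ ix i))" unfolding \<Phi>_def gGr by (simp add: linear_0[OF linpr])
    then have "\<Phi> r \<in> span (e ` {..<kk})" unfolding span_e by blast
    moreover have \<Phi>V: "\<Phi> r \<in> V" using h(1) rOb by blast
    moreover have "\<Theta> (\<Phi> r) \<in> O1" unfolding h(4)[OF rOb] by (rule r(2))
    ultimately have "\<Phi> r \<in> W \<inter> span (e ` {..<kk})" unfolding W_def by simp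
    then show "r \<in> \<Theta> ` (W \<inter> span (e ` {..<kk}))" by (rule image_eqI[of r \<Theta>, OF h(4)[OF rOb, symmetric]])
  qed
  have WV: "W \<subseteq> V" unfolding W_def by blast
  have inj\<Theta>: "inj_on \<Theta> W" by (rule inj_on_inverseI[of _ \<Phi>]) (rule h(5)[OF subsetD[OF WV]])
  have sm1: "smooth_on W \<Theta>"
    by (rule Cinf_imp_smooth_on, rule allI, rule Ck_subset[OF spec[OF *(6)] WV])
  have O1U: "O1 \<subseteq> U" using *(2) unfolding O1_def by blast
  have sm2: "smooth_on O1 (inv_into W \<Theta>)"
  proof (rule Cinf_imp_smooth_on, rule allI)
    fix k
    have eq: "\<Phi> r = inv_into W \<Theta> r" if r: "r \<in> O1" for r
    proof -
      obtain v where v: "v \<in> W" "r = \<Theta> v" using r unfolding \<Theta>W[symmetric] by blast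
      show ?thesis using inv_into_f_f[OF inj\<Theta> v(1)] h(5)[OF subsetD[OF WV v(1)]] v(2) by simp
    qed
    show "Ck k O1 (inv_into W \<Theta>)" by (rule Ck_cong[OF O1 Ck_subset[OF spec[OF C\<Phi>] O1U] eq])
  qed
  have "slice_chart kk S e W \<Theta>"
    unfolding slice_chart_def \<Theta>W
    by (intro conjI) (rule inj_e ind_e W O1 inj\<Theta> sm1 sm2 slice[unfolded \<Theta>W])+
  moreover have "\<rho> \<in> \<Theta> ` W" unfolding \<Theta>W by (rule \<rho>O1)
  ultimately have "slice_chart kk S e W \<Theta> \<and> \<rho> \<in> \<Theta> ` W" by (rule conjI)
  then show ?thesis by (rule exI[of _ e, OF exI[of _ W, OF exI[of _ \<Theta>]]])
qed

end

section \<open>The Liouville measure as a limit over thin tubes\<close>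

lemma compact_positive_bound:
  fixes h :: "'a::topological_space \<Rightarrow> real"
  assumes "compact K" "continuous_on K h" "\<And>y. y \<in> K \<Longrightarrow> h y > 0"
  obtains c where "c > 0" "\<And>y. y \<in> K \<Longrightarrow> c \<le> h y"
proof (cases "K = {}")
  case True
  then show ?thesis by (intro that[of 1]) auto
next
  case False
  then obtain x where x: "x \<in> K" "\<forall>y\<in>K. h x \<le> h y" using continuous_attains_inf[OF assms(1) False assms(2)] by blast
  show ?thesis by (rule that[of "h x"]) (use x assms(3) in auto)
qed

text \<open>Lindelof's theorem gives a countable subcover; made disjoint, it cuts D into pieces on
  which the measures agree.\<close>

lemma emeasure_eq_local:
  fixes M N :: "'a::second_countable_topology measure"
  assumes sets: "sets M = sets borel" "sets N = sets borel"
    and loc: "\<And>x. x \<in> T \<Longrightarrow> \<exists>U. open U \<and> x \<in> U \<and> (\<forall>D\<in>sets borel. D \<subseteq> T \<inter> U \<longrightarrow> emeasure M D = emeasure N D)"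
    and D: "D \<in> sets borel" "D \<subseteq> T"
  shows "emeasure M D = emeasure N D"
proof -
  define F where "F = {U. open U \<and> (\<forall>D\<in>sets borel. D \<subseteq> T \<inter> U \<longrightarrow> emeasure M D = emeasure N D)}"
  obtain F' where F': "F' \<subseteq> F" "countable F'" "\<Union>F' = \<Union>F"
    by (rule Lindelof[of F]) (auto simp: F_def)
  have TF: "T \<subseteq> \<Union>F"
  proof
    fix x assume "x \<in> T"
    from loc[OF this] obtain U where U: "open U \<and> x \<in> U \<and> (\<forall>D\<in>sets borel. D \<subseteq> T \<inter> U \<longrightarrow> emeasure M D = emeasure N D)" ..
    then have "U \<in> F" unfolding F_def by simp
    then show "x \<in> \<Union>F" using U by (intro UnionI[of U]) simp_all
  qed
  show ?thesis
  proof (cases "F' = {}")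
    case True
    then have "D = {}" using TF F'(3) D(2) by blast
    then show ?thesis by simp
  next
    case False
    define B where "B = from_nat_into F'"
    have B: "range B = F'" unfolding B_def by (rule range_from_nat_into[OF False F'(2)])
    have BF: "B k \<in> F" for k using F'(1) B by blast
    define A where "A k = D \<inter> disjointed B k" for k
    have A: "range A \<subseteq> sets borel"
    proof -
      have "open (B k)" for k using BF[of k] unfolding F_def by simp
      then have "range B \<subseteq> sets borel" by auto
      then have "range (disjointed B) \<subseteq> sets borel" by (rule sets.range_disjointed_sets)
      then show ?thesis unfolding A_def using D(1) by blast
    qed
    have disj: "disjoint_family A" unfolding A_def
      using disjoint_family_disjointed[of B] by (auto simp: disjoint_family_on_def)
    have UA: "(\<Union>k. A k) = D"
    proof -
      have "(\<Union>k. A k) = D \<inter> \<Union>F" unfolding A_def Int_UN_distrib[symmetric] UN_disjointed_eq B F'(3) ..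
      then show ?thesis using subset_trans[OF D(2) TF] by (simp add: Int_absorb2)
    qed
    have eq: "emeasure M (A k) = emeasure N (A k)" for k
    proof -
      have 1: "A k \<subseteq> T \<inter> B k" unfolding A_def using D(2) disjointed_subset[of B k] by blast
      have 2: "A k \<in> sets borel" using A by blast
      have "\<forall>D\<in>sets borel. D \<subseteq> T \<inter> B k \<longrightarrow> emeasure M D = emeasure N D"
        using BF[of k] unfolding F_def by simp
      from mp[OF bspec[OF this 2] 1] show ?thesis .
    qed
    have "emeasure M D = (\<Sum>k. emeasure M (A k))"
      using suminf_emeasure[of A M] A sets disj UA by simp
    also have "\<dots> = (\<Sum>k. emeasure N (A k))" using eq by simp
    also have "\<dots> = emeasure N D" using suminf_emeasure[of A N] A sets disj UA by simp
    finally show ?thesis .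
  qed
qed

text \<open>\<open>infdist\<close> to the empty set is 0 by convention, so for G = UNIV the
  left-hand side would be 0; hence the assumption on the complement.\<close>

lemma open_indicator_limit:
  fixes G :: "'a::metric_space set"
  assumes "open G" "- G \<noteq> {}"
  shows "(\<lambda>k. ennreal (min 1 (real k * infdist y (- G)))) \<longlonglongrightarrow> indicator G y"
proof (cases "y \<in> G")
  case True
  have "closed (- G)" using assms(1) by (simp add: closed_Compl)
  then have pos: "infdist y (- G) > 0"
    using in_closed_iff_infdist_zero[of "- G" y] assms(2) True infdist_nonneg[of y "- G"] by auto
  have "\<forall>\<^sub>F k in sequentially. 1 / infdist y (- G) \<le> real k"
    using filterlim_real_sequentially by (simp add: filterlim_at_top)
  then have "\<forall>\<^sub>F k in sequentially. ennreal (min 1 (real k * infdist y (- G))) = indicator G y"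
  proof eventually_elim
    case (elim k)
    then have "1 \<le> real k * infdist y (- G)" using pos by (simp add: divide_le_eq)
    then show ?case using True by simp
  qed
  then show ?thesis by (rule tendsto_eventually)
next
  case False
  then show ?thesis by simp
qed

text \<open>Increasing limits of test functions give equality on open subsets of the ball. Open sets
  are stable under intersection and generate the Borel sets, and the measure of a smaller ball is
  finite, so equality extends to all Borel sets there and then by
  \<open>emeasure_eq_local\<close>.\<close>

lemma emeasure_eq_continuous:
  fixes M N :: "'a::euclidean_space measure"
  assumes sets: "sets M = sets borel" "sets N = sets borel"
    and loc: "\<And>x. x \<in> T \<Longrightarrow> \<exists>r>0. \<forall>\<phi>. continuous_on UNIV \<phi> \<and> (\<forall>y. \<phi> y \<ge> 0) \<and> (\<forall>y. y \<notin> ball x r \<longrightarrow> \<phi> y = 0) \<longrightarrow>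
       (\<exists>L. (\<integral>\<^sup>+y. ennreal (\<phi> y) \<partial>M) = ennreal L \<and> (\<integral>\<^sup>+y. ennreal (\<phi> y) \<partial>N) = ennreal L)"
    and D: "D \<in> sets borel" "D \<subseteq> T"
  shows "emeasure M D = emeasure N D"
proof (rule emeasure_eq_local[OF sets _ D])
  fix x assume xT: "x \<in> T"
  obtain r where r: "r > 0" and I: "\<forall>\<phi>. continuous_on UNIV \<phi> \<and> (\<forall>y. \<phi> y \<ge> 0) \<and> (\<forall>y. y \<notin> ball x r \<longrightarrow> \<phi> y = 0) \<longrightarrow>
       (\<exists>L. (\<integral>\<^sup>+y. ennreal (\<phi> y) \<partial>M) = ennreal L \<and> (\<integral>\<^sup>+y. ennreal (\<phi> y) \<partial>N) = ennreal L)"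
    using loc[OF xT] by (elim exE conjE)
  have meas: "(\<lambda>y. ennreal (\<phi> y)) \<in> borel_measurable M" "(\<lambda>y. ennreal (\<phi> y)) \<in> borel_measurable N"
    if "continuous_on UNIV \<phi>" for \<phi> :: "'a \<Rightarrow> real"
  proof -
    have "(\<lambda>y. ennreal (\<phi> y)) \<in> borel_measurable borel" using borel_measurable_continuous_onI[OF that] by measurable
    then show "(\<lambda>y. ennreal (\<phi> y)) \<in> borel_measurable M" "(\<lambda>y. ennreal (\<phi> y)) \<in> borel_measurable N"
      using sets by (simp_all cong: measurable_cong_sets)
  qed
  have G_eq: "emeasure M G = emeasure N G" if G: "open G" "G \<subseteq> ball x r" for G
  proof -
    have ne: "- G \<noteq> {}"
    proof
      assume "- G = {}"
      then have "ball x r = (UNIV :: 'a set)" using G(2) by blast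
      then have "bounded (UNIV :: 'a set)" using bounded_ball[of x r] by simp
      with not_bounded_UNIV show False by (rule notE)
    qed
    let ?\<phi> = "\<lambda>k y. min 1 (real k * infdist y (- G))"
    have cont: "continuous_on UNIV (?\<phi> k)" for k by (intro continuous_intros)
    have inc: "incseq (\<lambda>k y. ennreal (?\<phi> k y))"
      by (intro incseq_SucI le_funI ennreal_leI min.mono order.refl mult_right_mono infdist_nonneg) simp
    have lim: "(\<lambda>k. \<integral>\<^sup>+y. ennreal (?\<phi> k y) \<partial>L) \<longlonglongrightarrow> emeasure L G" if L: "L = M \<or> L = N" for L
    proof -
      have m: "(\<lambda>y. ennreal (?\<phi> k y)) \<in> borel_measurable L" for k by (rule disjE[OF L]) (simp_all only: meas[OF cont])
      have "(\<lambda>k. \<integral>\<^sup>+y. ennreal (?\<phi> k y) \<partial>L) \<longlonglongrightarrow> (\<integral>\<^sup>+y. indicator G y \<partial>L)"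
        by (rule nn_integral_LIMSEQ[OF inc m open_indicator_limit[OF G(1) ne]])
      moreover have "G \<in> sets L" by (rule disjE[OF L]) (simp_all add: sets G(1))
      ultimately show ?thesis by (simp only: nn_integral_indicator)
    qed
    have eq: "(\<integral>\<^sup>+y. ennreal (?\<phi> k y) \<partial>M) = (\<integral>\<^sup>+y. ennreal (?\<phi> k y) \<partial>N)" for k
    proof -
      have "?\<phi> k y = 0" if y: "y \<notin> ball x r" for y
      proof -
        have "y \<in> - G" using y G(2) by blast
        then show ?thesis by simp
      qed
      moreover have "?\<phi> k y \<ge> 0" for y using infdist_nonneg[of y "- G"] by simp
      ultimately have "continuous_on UNIV (?\<phi> k) \<and> (\<forall>y. ?\<phi> k y \<ge> 0) \<and> (\<forall>y. y \<notin> ball x r \<longrightarrow> ?\<phi> k y = 0)"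
        using cont[of k] by simp
      from mp[OF spec[OF I] this] show ?thesis by (elim exE conjE) simp
    qed
    have "(\<lambda>k. \<integral>\<^sup>+y. ennreal (?\<phi> k y) \<partial>M) \<longlonglongrightarrow> emeasure N G" unfolding eq by (rule lim) (rule disjI2[OF refl])
    with lim[OF disjI1[OF refl]] show ?thesis by (rule LIMSEQ_unique)
  qed
  let ?U = "ball x (r/2)"
  have fin: "emeasure M ?U \<noteq> \<infinity>"
  proof -
    \<comment> \<open>At least 1 on the ball of radius r/2 and 0 off the ball of radius r, so its
      finite integral bounds the measure of the smaller ball.\<close>
    let ?\<phi> = "\<lambda>y. max 0 (2 - 2 / r * dist x y)"
    have "continuous_on UNIV ?\<phi>" by (intro continuous_intros)
    moreover have "?\<phi> y = 0" if "y \<notin> ball x r" for y using that r by (simp add: field_simps)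
    ultimately obtain L where L: "(\<integral>\<^sup>+y. ennreal (?\<phi> y) \<partial>M) = ennreal L" using spec[OF I, of ?\<phi>] by auto
    have "emeasure M ?U = (\<integral>\<^sup>+y. indicator ?U y \<partial>M)" using sets by simp
    also have "\<dots> \<le> (\<integral>\<^sup>+y. ennreal (?\<phi> y) \<partial>M)"
    proof (rule nn_integral_mono)
      fix y
      have "1 \<le> ?\<phi> y" if "y \<in> ?U" using that r by (simp add: field_simps)
      then show "indicator ?U y \<le> ennreal (?\<phi> y)" by (auto simp: indicator_def ennreal_ge_1)
    qed
    finally show ?thesis unfolding L by (auto simp: top_unique)
  qed
  have U: "?U \<in> sets M" "?U \<in> sets N" using sets by simp_all
  have "density M (indicator ?U) = density N (indicator ?U)"
  proof (rule measure_eqI_generator_eq[where \<Omega>=UNIV and E="{G. open G}" and A="\<lambda>_. UNIV"])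
    show "Int_stable {G :: 'a set. open G}" by (auto simp: Int_stable_def)
    show "sets (density M (indicator ?U)) = sigma_sets UNIV {G. open G}"
      "sets (density N (indicator ?U)) = sigma_sets UNIV {G. open G}" using sets by (simp_all add: borel_def)
    show "emeasure (density M (indicator ?U)) X = emeasure (density N (indicator ?U)) X" if X: "X \<in> {G. open G}" for X
    proof -
      have "ball x (r/2) \<subseteq> ball x r" using r by (intro subset_ball) simp
      then have "?U \<inter> X \<subseteq> ball x r" by blast
      moreover have "open (?U \<inter> X)" using X by auto
      ultimately have "emeasure M (?U \<inter> X) = emeasure N (?U \<inter> X)" by (intro G_eq)
      then show ?thesis using X sets U by (simp add: emeasure_restricted)
    qed
    show "emeasure (density M (indicator ?U)) UNIV \<noteq> \<infinity>" for i :: nat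
      using fin emeasure_restricted[OF U(1), of UNIV] sets by simp
  qed auto
  then have eq: "emeasure M (?U \<inter> X) = emeasure N (?U \<inter> X)" if "X \<in> sets borel" for X
    using emeasure_restricted[OF U(1), of X] emeasure_restricted[OF U(2), of X] that sets by simp
  show "\<exists>U. open U \<and> x \<in> U \<and> (\<forall>D\<in>sets borel. D \<subseteq> T \<inter> U \<longrightarrow> emeasure M D = emeasure N D)"
  proof (intro exI conjI ballI impI)
    show "open ?U" "x \<in> ?U" using r by simp_all
    fix D assume D: "D \<in> sets borel" "D \<subseteq> T \<inter> ?U"
    then have "?U \<inter> D = D" by blast
    then show "emeasure M D = emeasure N D" using eq[OF D(1)] by simp
  qed
qed

context level_set
begin

definition "Z = {y. P y = 0 \<and> Q y = 0}"

text \<open>Off W the value of \<psi> is not controlled; the default 0 keeps the map Borel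
  measurable, and \<open>dens\<close> vanishes there.\<close>

definition chart_point :: "(nat \<Rightarrow> 'n phase) \<Rightarrow> 'n phase set \<Rightarrow> ('n phase \<Rightarrow> 'n phase) \<Rightarrow> (nat \<Rightarrow> real) \<Rightarrow> real^('n bit0)" where
  "chart_point e W \<psi> y = (if lin e y \<in> W then inv g (\<psi> (lin e y)) else 0)"

lemma dens_chart_point: "dens e W \<psi> y * F (inv g (\<psi> (lin e y))) = dens e W \<psi> y * F (chart_point e W \<psi> y)"
  unfolding dens_def chart_point_def by simp

lemma Z_closed: "closed Z"
proof -
  have "closed (P -` {0})" "closed (Q -` {0})"
    using cont_PQvol(1,2)[of UNIV] by (simp_all add: closed_vimage)
  moreover have "Z = P -` {0} \<inter> Q -` {0}" unfolding Z_def by auto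
  ultimately show ?thesis by (simp add: closed_Int)
qed

lemma Z_compact: "compact Z"
proof -
  have "Z = {y. \<bar>P y\<bar> \<le> 1/2} \<inter> Z" unfolding Z_def by auto
  then show ?thesis using compact_Int_closed[OF compact_P Z_closed] by simp
qed

lemma g_S_Z: "g -` S = Z" "S = g ` Z"
proof -
  show 1: "g -` S = Z" by (intro set_eqI) (simp add: Z_def g_in_S)
  show "S = g ` Z" unfolding 1[symmetric] image_vimage_eq range_g using S_subset by blast
qed

lemma S_closed: "closed S"
  unfolding g_S_Z(2)
  by (rule compact_imp_closed[OF compact_continuous_image[OF continuous_on_subset[OF continuous_g subset_UNIV] Z_compact]])

text \<open>The Liouville density is a definite description, so nothing about its dependence on the
  point is evident. The local formula of \<open>chart_local\<close> makes it continuous on the open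
  set of parameters that W admits.\<close>

lemma chart_measurable:
  assumes chart: "slice_chart kk S e W \<psi>"
  shows "dens e W \<psi> \<in> borel_measurable (PiM {..<kk} (\<lambda>_. lborel))"
    "chart_point e W \<psi> \<in> borel_measurable (PiM {..<kk} (\<lambda>_. lborel))"
proof -
  have W: "open W" and sm: "smooth_on W \<psi>" and slice: "\<psi> ` (W \<inter> span (e ` {..<kk})) = S \<inter> \<psi> ` W"
    using chart unfolding slice_chart_def by blast+
  have c\<psi>: "continuous_on W \<psi>" by (rule Ck_continuous_on[OF smooth_on_imp_Ck[OF sm, of 0]])
  define \<pi> :: "real^('n bit0) \<Rightarrow> nat \<Rightarrow> real" where "\<pi> z i = z $ ix i" for z i
  define c where "c z = lin e (\<pi> z)" for z
  have c_emb: "lin e y = c (embk y)" for y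
    unfolding c_def lin_def \<pi>_def by (rule sum.cong) (simp_all add: embk_nth)
  have cc: "continuous_on A c" for A unfolding c_def lin_def \<pi>_def by (intro continuous_intros)
  have cemb: "continuous_on A (\<lambda>z. embk (\<pi> z))" for A unfolding emb_def \<pi>_def by (intro continuous_intros)
  define A where "A = c -` W"
  have A: "open A" unfolding A_def using cc W by (simp add: open_vimage)
  define h where "h z = inv g (\<psi> (c z))" for z
  have "continuous_on A h" unfolding h_def
  proof (rule continuous_on_compose2[OF continuous_inv_g continuous_on_compose2[OF c\<psi> cc]])
    show "(\<lambda>z. \<psi> (c z)) ` A \<subseteq> \<Lambda>"
      using slice lin_in_span[of e] S_subset unfolding A_def c_def by blast
  qed (auto simp: A_def)
  then have "(\<lambda>z. indicator A z *\<^sub>R h z) \<in> borel_measurable borel"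
    using A by (intro borel_measurable_continuous_on_indicator) simp_all
  from measurable_compose[OF measurable_emb this]
  show "chart_point e W \<psi> \<in> borel_measurable (PiM {..<kk} (\<lambda>_. lborel))"
    by (rule measurable_cong[THEN iffD1, rotated]) (simp add: chart_point_def c_emb h_def A_def indicator_def)
  define \<delta> where "\<delta> z = liouville_density \<Lambda> q (\<psi> (c z)) (\<lambda>i. frechet_derivative \<psi> (at (c z)) (e i))" for z
  have "continuous (at z0 within A) \<delta>" if z0: "z0 \<in> A" for z0
  proof -
    have x0: "c z0 \<in> W \<inter> span (e ` {..<kk})" using z0 lin_in_span unfolding A_def c_def by blast
    obtain Ob V Y \<Theta> where *: "open Ob" "inv g (\<psi> (c z0)) \<in> Ob" "open V" "homeomorphism Ob V Y \<Theta>" "Cinf V \<Theta>"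
      "\<And>y. embk y \<in> V \<longleftrightarrow> lin e y \<in> W \<and> inv g (\<psi> (lin e y)) \<in> Ob"
      "\<And>y. embk y \<in> V \<Longrightarrow> \<Theta> (embk y) = inv g (\<psi> (lin e y))"
      "\<And>y. embk y \<in> V \<Longrightarrow> liouville_density \<Lambda> q (\<psi> (lin e y)) (\<lambda>i. frechet_derivative \<psi> (at (lin e y)) (e i)) =
         \<bar>vol (\<Theta> (embk y)) * det (matrix (frechet_derivative \<Theta> (at (embk y))))\<bar>"
      by (rule chart_local[OF chart x0]) blast
    let ?D = "\<lambda>z. det (matrix (frechet_derivative \<Theta> (at z)))"
    have cD: "continuous_on V ?D"
    proof -
      have "Ck 0 V (\<lambda>z. matrix (frechet_derivative \<Theta> (at z)) $ i $ j)" for i j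
        unfolding matrix_def
        using Ck_vec_nth[OF *(3) Ck_frechet[OF spec[OF *(5), of "Suc 0"], of "axis j 1"], of i] by simp
      from Ck_det[OF *(3) this] show ?thesis by simp
    qed
    have c\<Theta>: "continuous_on V \<Theta>" using *(4) by (simp add: homeomorphism_def)
    have cF: "continuous_on V (\<lambda>z. \<bar>vol (\<Theta> z) * ?D z\<bar>)"
      by (intro continuous_intros cD continuous_on_compose2[OF cont_PQvol(3)[of UNIV] c\<Theta>]) auto
    let ?V = "(\<lambda>z. embk (\<pi> z)) -` V"
    have V: "open ?V" using *(3) cemb by (simp add: open_vimage)
    have z0V: "z0 \<in> ?V" using *(6)[of "\<pi> z0"] *(2) x0 unfolding c_def by simp
    have "continuous_on ?V (\<lambda>z. \<bar>vol (\<Theta> (embk (\<pi> z))) * ?D (embk (\<pi> z))\<bar>)"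
      by (rule continuous_on_compose2[OF cF cemb]) auto
    then have "continuous_on ?V \<delta>"
      by (rule continuous_on_eq) (simp add: \<delta>_def c_def *(8))
    then have "isCont \<delta> z0" using V z0V continuous_on_eq_continuous_at by blast
    then show ?thesis by (rule continuous_at_imp_continuous_at_within)
  qed
  then have "continuous_on A \<delta>" by (simp add: continuous_on_eq_continuous_within)
  then have "(\<lambda>z. indicator A z *\<^sub>R \<delta> z) \<in> borel_measurable borel"
    using A by (intro borel_measurable_continuous_on_indicator) simp_all
  then have "(\<lambda>z. ennreal (indicator A z *\<^sub>R \<delta> z)) \<in> borel_measurable borel" by measurable
  from measurable_compose[OF measurable_emb this]
  show "dens e W \<psi> \<in> borel_measurable (PiM {..<kk} (\<lambda>_. lborel))"
    by (rule measurable_cong[THEN iffD1, rotated]) (simp add: dens_def c_emb \<delta>_def A_def indicator_def)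
qed

lemma chart_limit_at:
  assumes "slice_chart kk S e W \<psi>" "z \<in> Z" "g z \<in> \<psi> ` W"
  shows "\<exists>r>0. \<forall>\<phi>. continuous_on UNIV \<phi> \<and> (\<forall>y. \<phi> y \<ge> 0) \<and> (\<forall>y. y \<notin> ball z r \<longrightarrow> \<phi> y = 0) \<longrightarrow>
     (\<exists>L\<ge>0. (\<lambda>m. \<integral>y. tube_integrand m \<phi> y \<partial>lborel) \<longlonglongrightarrow> L \<and>
       (\<integral>\<^sup>+y. dens e W \<psi> y * ennreal (\<phi> (chart_point e W \<psi> y)) \<partial>PiM {..<kk} (\<lambda>_. lborel)) = ennreal L)"
proof -
  have "g z \<in> S" using assms(2) g_S_Z by blast
  then have "g z \<in> \<psi> ` (W \<inter> span (e ` {..<kk}))" using assms(1,3) unfolding slice_chart_def by blast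
  then obtain x0 where x0: "x0 \<in> W \<inter> span (e ` {..<kk})" "g z = \<psi> x0" by blast
  have z: "inv g (\<psi> x0) = z" unfolding x0(2)[symmetric] by (rule inv_g_g)
  obtain r where r: "r > 0" "\<forall>\<phi>. continuous_on UNIV \<phi> \<and> (\<forall>y. \<phi> y \<ge> 0) \<and> (\<forall>y. y \<notin> ball z r \<longrightarrow> \<phi> y = 0) \<longrightarrow>
     (\<exists>L\<ge>0. (\<lambda>m. \<integral>y. tube_integrand m \<phi> y \<partial>lborel) \<longlonglongrightarrow> L \<and>
       (\<integral>\<^sup>+y. dens e W \<psi> y * ennreal (\<phi> (inv g (\<psi> (lin e y)))) \<partial>PiM {..<kk} (\<lambda>_. lborel)) = ennreal L)"
    using chart_limit[OF assms(1) x0(1)] unfolding z by (elim exE conjE)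
  show ?thesis
  proof (rule exI[of _ r], rule conjI[OF r(1)], rule allI, rule impI)
    fix \<phi> :: "real^('n bit0) \<Rightarrow> real"
    assume \<phi>: "continuous_on UNIV \<phi> \<and> (\<forall>y. \<phi> y \<ge> 0) \<and> (\<forall>y. y \<notin> ball z r \<longrightarrow> \<phi> y = 0)"
    have "(\<lambda>y. dens e W \<psi> y * ennreal (\<phi> (inv g (\<psi> (lin e y))))) =
        (\<lambda>y. dens e W \<psi> y * ennreal (\<phi> (chart_point e W \<psi> y)))"
      by (rule ext) (rule dens_chart_point[where F="\<lambda>x. ennreal (\<phi> x)"])
    then show "\<exists>L\<ge>0. (\<lambda>m. \<integral>y. tube_integrand m \<phi> y \<partial>lborel) \<longlonglongrightarrow> L \<and>
       (\<integral>\<^sup>+y. dens e W \<psi> y * ennreal (\<phi> (chart_point e W \<psi> y)) \<partial>PiM {..<kk} (\<lambda>_. lborel)) = ennreal L"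
      using mp[OF spec[OF r(2)] \<phi>] by (simp only:)
  qed
qed

lemma dens_nonzero_imp:
  assumes "slice_chart kk S e W \<psi>" "dens e W \<psi> y \<noteq> 0"
  shows "chart_point e W \<psi> y \<in> Z" "lin e y \<in> W" "g (chart_point e W \<psi> y) = \<psi> (lin e y)"
proof -
  show W: "lin e y \<in> W"
  proof (rule ccontr)
    assume "lin e y \<notin> W"
    then show False using assms(2) unfolding dens_def by simp
  qed
  then have S: "\<psi> (lin e y) \<in> S" using assms(1) lin_in_span[of e y] unfolding slice_chart_def by blast
  show *: "g (chart_point e W \<psi> y) = \<psi> (lin e y)"
    unfolding chart_point_def using W g_inv_g[OF subsetD[OF S_subset S]] by simp
  show "chart_point e W \<psi> y \<in> Z" unfolding g_S_Z(1)[symmetric] vimage_eq * by (rule S)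
qed

text \<open>On the compact set where \<bar>P\<bar> \<le> 1/2 outside U, the sum \<bar>P\<bar> +
  \<bar>Q\<bar> has a lower bound c > 0, so one of the two is at least c/2. Once 3/(m + 1) is below
  both 1/2 and c/2, one bump vanishes at every point off U.\<close>

lemma tube_integrand_zero:
  assumes "open U" "Z \<subseteq> U"
  obtains m0 where "\<And>m \<phi> y. m \<ge> m0 \<Longrightarrow> y \<notin> U \<Longrightarrow> tube_integrand m \<phi> y = 0"
proof -
  let ?K = "{y. \<bar>P y\<bar> \<le> 1/2} - U"
  have 1: "compact ?K" by (rule compact_diff[OF compact_P assms(1)])
  have 2: "continuous_on ?K (\<lambda>y. \<bar>P y\<bar> + \<bar>Q y\<bar>)" by (intro continuous_intros cont_PQvol)
  have 3: "\<bar>P y\<bar> + \<bar>Q y\<bar> > 0" if "y \<in> ?K" for y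
  proof -
    have "y \<notin> Z" using that assms(2) by blast
    then show ?thesis unfolding Z_def by auto
  qed
  obtain c where c: "c > 0" "\<And>y. y \<in> ?K \<Longrightarrow> c \<le> \<bar>P y\<bar> + \<bar>Q y\<bar>"
    by (rule compact_positive_bound[OF 1 2]) (use 3 in auto)
  obtain m0 :: nat where m0: "3 / min (1/2) (c/2) \<le> real m0" by (rule exE[OF real_arch_simple])
  show ?thesis
  proof (rule that[of m0])
    fix m \<phi> and y assume m: "m \<ge> m0" and y: "y \<notin> U"
    have "3 / min (1/2) (c/2) \<le> real (Suc m)" using m0 m by linarith
    moreover have "min (1/2) (c/2) > 0" using c(1) by simp
    moreover have "3 / t \<le> s" if "3 / s \<le> t" "s > 0" "t > 0" for s t :: real
      using that by (simp add: divide_le_eq mult.commute)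
    ultimately have b: "3 / real (Suc m) \<le> min (1/2) (c/2)" by (simp only: of_nat_0_less_iff zero_less_Suc)
    show "tube_integrand m \<phi> y = 0"
    proof (cases "\<bar>P y\<bar> \<le> 1/2")
      case True
      then have "c \<le> \<bar>P y\<bar> + \<bar>Q y\<bar>" using c(2) y by blast
      then have "3 / real (Suc m) \<le> \<bar>P y\<bar> \<or> 3 / real (Suc m) \<le> \<bar>Q y\<bar>" using b by linarith
      then show ?thesis unfolding tube_integrand_def using bump_0[of m "P y"] bump_0[of m "Q y"] by auto
    next
      case False
      then have "3 / real (Suc m) \<le> \<bar>P y\<bar>" using b by linarith
      then show ?thesis unfolding tube_integrand_def using bump_0[of m "P y"] by auto
    qed
  qed
qed

text \<open>The index 5 is the first with 3/(m + 1) \<le> 1/2; from there on the first bump vanishes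
  off the compact set of \<open>compact_P\<close>.\<close>

lemma integrable_tube_integrand:
  assumes "continuous_on UNIV \<phi>" "m \<ge> 5"
  shows "integrable lborel (tube_integrand m \<phi>)"
proof (rule integrable_compact_support[OF continuous_tube_integrand[OF assms(1)] compact_P])
  fix y assume y: "y \<notin> {y. \<bar>P y\<bar> \<le> 1/2}"
  have "3 / real (Suc m) \<le> 1/2" using assms(2) by (simp add: field_simps)
  moreover have "1/2 \<le> \<bar>P y\<bar>" using y by simp
  ultimately have "3 / real (Suc m) \<le> \<bar>P y\<bar>" by (rule order_trans)
  then have "bump m (P y) = 0" by (rule bump_0)
  then show "tube_integrand m \<phi> y = 0" unfolding tube_integrand_def by simp
qed

text \<open>By \<open>chart_limit_at\<close> each chart measure is the tube limit near its points. Finitely many of them are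
  glued with a partition of unity, so no compatibility of charts has to be checked.\<close>

lemma tube_measure_exists:
  "\<exists>m :: (real^('n bit0)) measure. sets m = sets borel \<and> emeasure m (- Z) = 0 \<and>
    (\<forall>\<phi>. continuous_on UNIV \<phi> \<and> (\<forall>y. \<phi> y \<ge> 0) \<longrightarrow>
      (\<exists>L\<ge>0. (\<lambda>k. \<integral>y. tube_integrand k \<phi> y \<partial>lborel) \<longlonglongrightarrow> L \<and> (\<integral>\<^sup>+y. ennreal (\<phi> y) \<partial>m) = ennreal L))"
proof -
  let ?N = "PiM {..<kk} (\<lambda>_. lborel :: real measure)"
  define good where "good z e W \<psi> r \<longleftrightarrow> slice_chart kk S e W \<psi> \<and> r > (0::real) \<and>
    (\<forall>\<phi>. continuous_on UNIV \<phi> \<and> (\<forall>y. \<phi> y \<ge> 0) \<and> (\<forall>y. y \<notin> ball z r \<longrightarrow> \<phi> y = 0) \<longrightarrow>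
     (\<exists>L\<ge>0. (\<lambda>m. \<integral>y. tube_integrand m \<phi> y \<partial>lborel) \<longlonglongrightarrow> L \<and>
       (\<integral>\<^sup>+y. dens e W \<psi> y * ennreal (\<phi> (chart_point e W \<psi> y)) \<partial>?N) = ennreal L))"
    for z :: "real^('n bit0)" and e W \<psi> r
  have ex: "\<exists>t. good z (fst t) (fst (snd t)) (fst (snd (snd t))) (snd (snd (snd t)))" if z: "z \<in> Z" for z
  proof -
    have "g z \<in> S" unfolding g_S_Z(2) using z by (rule imageI)
    from slice_chart_exists[OF this] obtain e W \<psi> where c: "slice_chart kk S e W \<psi>" "g z \<in> \<psi> ` W"
      by (elim exE conjE)
    have "\<exists>r. good z e W \<psi> r" unfolding good_def using chart_limit_at[OF c(1) z c(2)] c(1) by simp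
    then obtain r where "good z e W \<psi> r" ..
    then show ?thesis by (intro exI[of _ "(e, W, \<psi>, r)"]) simp
  qed
  have "\<forall>z\<in>Z. \<exists>t. good z (fst t) (fst (snd t)) (fst (snd (snd t))) (snd (snd (snd t)))"
    by (rule ballI) (rule ex)
  from bchoice[OF this] obtain T where T: "\<forall>z\<in>Z. good z (fst (T z)) (fst (snd (T z))) (fst (snd (snd (T z)))) (snd (snd (snd (T z))))" ..
  define e where "e z = fst (T z)" for z
  define W where "W z = fst (snd (T z))" for z
  define \<psi> where "\<psi> z = fst (snd (snd (T z)))" for z
  define r where "r z = snd (snd (snd (T z)))" for z
  have good: "good z (e z) (W z) (\<psi> z) (r z)" if "z \<in> Z" for z
    using bspec[OF T that] unfolding e_def W_def \<psi>_def r_def .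
  have chart: "slice_chart kk S (e z) (W z) (\<psi> z)" and r: "r z > 0" if "z \<in> Z" for z
    using good[OF that] unfolding good_def by simp_all
  have lim: "\<exists>L\<ge>0. (\<lambda>m. \<integral>y. tube_integrand m \<phi> y \<partial>lborel) \<longlonglongrightarrow> L \<and>
       (\<integral>\<^sup>+y. dens (e z) (W z) (\<psi> z) y * ennreal (\<phi> (chart_point (e z) (W z) (\<psi> z) y)) \<partial>?N) = ennreal L"
    if "z \<in> Z" "continuous_on UNIV \<phi>" "\<And>y. \<phi> y \<ge> 0" "\<And>y. y \<notin> ball z (r z) \<Longrightarrow> \<phi> y = 0" for z \<phi>
    using good[OF that(1)] that(2-4) unfolding good_def by simp
  have Zcov: "Z \<subseteq> (\<Union>z\<in>Z. ball z (r z))"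
  proof
    fix z assume z: "z \<in> Z"
    show "z \<in> (\<Union>z\<in>Z. ball z (r z))" by (rule UN_I[OF z]) (simp add: r[OF z])
  qed
  obtain I where I: "I \<subseteq> Z" "finite I" "Z \<subseteq> (\<Union>z\<in>I. ball z (r z))"
    by (rule compactE_image[OF Z_compact _ Zcov]) simp_all
  have IZ: "z \<in> Z" if "z \<in> I" for z by (rule subsetD[OF I(1) that])
  define \<zeta> where "\<zeta> z y = max 0 (r z - dist z y)" for z y
  have c\<zeta>: "continuous_on A (\<zeta> z)" for A z unfolding \<zeta>_def by (intro continuous_intros)
  have \<zeta>0: "\<zeta> z y \<ge> 0" for z y unfolding \<zeta>_def by simp
  define s where "s y = (\<Sum>z\<in>I. \<zeta> z y)" for y
  have cs: "continuous_on A s" for A unfolding s_def[abs_def] by (rule continuous_on_sum) (rule c\<zeta>)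
  have spos: "s y > 0" if y: "y \<in> Z" for y
  proof -
    obtain z where z: "z \<in> I" "y \<in> ball z (r z)" using subsetD[OF I(3) y] by (rule UN_E)
    have "\<zeta> z y > 0" using z(2) unfolding \<zeta>_def by simp
    then show ?thesis unfolding s_def by (rule sum_pos2[OF I(2) z(1)]) (rule \<zeta>0)
  qed
  obtain c where c: "c > 0" "\<And>y. y \<in> Z \<Longrightarrow> c \<le> s y"
    by (rule compact_positive_bound[OF Z_compact cs]) (use spos in auto)
  have mpos: "max (s y) (c/2) > 0" for y using c(1) by (simp add: less_max_iff_disj)
  \<comment> \<open>The denominator never drops below c/2, so the weights are continuous on the
    whole space. It equals s near Z, where the weights therefore add up to 1.\<close>
  define \<chi>' where "\<chi>' z y = \<zeta> z y / max (s y) (c/2)" for z y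
  have c\<chi>: "continuous_on UNIV (\<chi>' z)" for z
  proof -
    have "continuous_on UNIV (\<lambda>y. max (s y) (c/2))" by (intro continuous_on_max cs continuous_on_const)
    moreover have "\<forall>y\<in>UNIV. max (s y) (c/2) \<noteq> 0" using mpos by (metis less_irrefl)
    ultimately show ?thesis unfolding \<chi>'_def by (rule continuous_on_divide[OF c\<zeta>])
  qed
  have \<chi>0: "\<chi>' z y \<ge> 0" for z y unfolding \<chi>'_def using \<zeta>0 mpos by (simp add: less_imp_le)
  have \<chi>out: "\<chi>' z y = 0" if "y \<notin> ball z (r z)" for z y using that unfolding \<chi>'_def \<zeta>_def by simp
  have \<chi>sum: "(\<Sum>z\<in>I. \<chi>' z y) = 1" if "s y > c/2" for y
  proof -
    have "(\<Sum>z\<in>I. \<chi>' z y) = s y / max (s y) (c/2)" unfolding \<chi>'_def s_def by (rule sum_divide_distrib[symmetric])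
    then show ?thesis using that c(1) by (simp add: max_def)
  qed
  let ?cp = "\<lambda>z. chart_point (e z) (W z) (\<psi> z)" and ?d = "\<lambda>z. dens (e z) (W z) (\<psi> z)"
  define F where "F w = ?d (fst w) (snd w) * ennreal (\<chi>' (fst w) (?cp (fst w) (snd w)))" for w
  define H where "H w = ?cp (fst w) (snd w)" for w
  \<comment> \<open>The finite sum of weighted chart measures is obtained as the image of a single
    measure, with the chart index as an additional discrete coordinate.\<close>
  let ?C = "count_space I \<Otimes>\<^sub>M ?N"
  have m\<chi>: "(\<lambda>y. ennreal (\<chi>' z y)) \<in> borel_measurable borel" for z
    using borel_measurable_continuous_onI[OF c\<chi>] by simp
  have cI: "countable I" using I(2) by (rule countable_finite)
  have mF: "F \<in> borel_measurable ?C"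
  proof (rule measurable_pair_measure_countable1[OF cI])
    fix z assume z: "z \<in> I"
    show "(\<lambda>y. F (z, y)) \<in> borel_measurable ?N" unfolding F_def fst_conv snd_conv
      by (intro borel_measurable_times_ennreal chart_measurable(1)[OF chart[OF IZ[OF z]]]
        measurable_compose[OF chart_measurable(2)[OF chart[OF IZ[OF z]]] m\<chi>])
  qed
  have mH: "H \<in> borel_measurable ?C"
  proof (rule measurable_pair_measure_countable1[OF cI])
    fix z assume z: "z \<in> I"
    show "(\<lambda>y. H (z, y)) \<in> borel_measurable ?N" unfolding H_def fst_conv snd_conv
      by (rule chart_measurable(2)[OF chart[OF IZ[OF z]]])
  qed
  define m where "m = distr (density ?C F) borel H"
  interpret product_sigma_finite "\<lambda>_. lborel :: real measure"
    by (simp add: product_sigma_finite_def sigma_finite_lborel)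
  interpret N: sigma_finite_measure ?N by (rule sigma_finite) simp
  have nn: "(\<integral>\<^sup>+y. f y \<partial>m) = (\<Sum>z\<in>I. \<integral>\<^sup>+y. ?d z y * (ennreal (\<chi>' z (?cp z y)) * f (?cp z y)) \<partial>?N)"
    if f: "f \<in> borel_measurable borel" for f
  proof -
    have mfH: "(\<lambda>w. f (H w)) \<in> borel_measurable ?C" by (rule measurable_compose[OF mH f])
    have mH': "H \<in> borel_measurable (density ?C F)" using mH by simp
    have "(\<integral>\<^sup>+y. f y \<partial>m) = (\<integral>\<^sup>+w. f (H w) \<partial>density ?C F)"
      unfolding m_def by (rule nn_integral_distr[OF mH']) (use f in simp)
    also have "\<dots> = (\<integral>\<^sup>+w. F w * f (H w) \<partial>?C)" by (rule nn_integral_density[OF mF mfH])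
    also have "\<dots> = (\<integral>\<^sup>+z. \<integral>\<^sup>+y. F (z, y) * f (H (z, y)) \<partial>?N \<partial>count_space I)"
      by (rule N.nn_integral_fst[symmetric]) (rule borel_measurable_times_ennreal[OF mF mfH])
    also have "\<dots> = (\<Sum>z\<in>I. \<integral>\<^sup>+y. F (z, y) * f (H (z, y)) \<partial>?N)" by (rule nn_integral_count_space_finite[OF I(2)])
    finally show ?thesis unfolding F_def H_def fst_conv snd_conv by (simp only: mult.assoc)
  qed
  have sets_m: "sets m = sets borel" unfolding m_def by simp
  have null: "emeasure m (- Z) = 0"
  proof -
    have Zb: "- Z \<in> sets borel" using Z_closed by simp
    have "emeasure m (- Z) = (\<integral>\<^sup>+y. indicator (- Z) y \<partial>m)" using Zb sets_m by simp
    also have "\<dots> = (\<Sum>z\<in>I. \<integral>\<^sup>+y. ?d z y * (ennreal (\<chi>' z (?cp z y)) * indicator (- Z) (?cp z y)) \<partial>?N)"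
      by (rule nn) (use Zb in simp)
    also have "\<dots> = 0"
    proof (rule sum.neutral, rule ballI)
      fix z assume z: "z \<in> I"
      have "?d z y * (ennreal (\<chi>' z (?cp z y)) * indicator (- Z) (?cp z y)) = 0" for y
      proof (cases "?d z y = 0")
        case False
        have "?cp z y \<in> Z" by (rule dens_nonzero_imp(1)[OF chart[OF IZ[OF z]] False])
        then show ?thesis by simp
      qed simp
      then show "(\<integral>\<^sup>+y. ?d z y * (ennreal (\<chi>' z (?cp z y)) * indicator (- Z) (?cp z y)) \<partial>?N) = 0"
        by (simp only: nn_integral_const mult_zero_left)
    qed
    finally show ?thesis .
  qed
  have main: "\<exists>L\<ge>0. (\<lambda>k. \<integral>y. tube_integrand k \<phi> y \<partial>lborel) \<longlonglongrightarrow> L \<and> (\<integral>\<^sup>+y. ennreal (\<phi> y) \<partial>m) = ennreal L"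
    if \<phi>: "continuous_on UNIV \<phi>" "\<And>y. \<phi> y \<ge> 0" for \<phi>
  proof -
    define \<phi>z where "\<phi>z z y = \<chi>' z y * \<phi> y" for z y
    have c\<phi>z: "continuous_on UNIV (\<phi>z z)" for z unfolding \<phi>z_def by (intro continuous_on_mult c\<chi> \<phi>(1))
    have ex: "\<exists>L. L \<ge> 0 \<and> (\<lambda>m. \<integral>y. tube_integrand m (\<phi>z z) y \<partial>lborel) \<longlonglongrightarrow> L \<and>
       (\<integral>\<^sup>+y. ?d z y * ennreal (\<phi>z z (?cp z y)) \<partial>?N) = ennreal L" if z: "z \<in> I" for z
    proof (rule lim[OF IZ[OF z] c\<phi>z])
      show "\<phi>z z y \<ge> 0" for y unfolding \<phi>z_def by (intro mult_nonneg_nonneg \<chi>0 \<phi>(2))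
      show "\<phi>z z y = 0" if "y \<notin> ball z (r z)" for y unfolding \<phi>z_def using \<chi>out[OF that] by simp
    qed
    have "\<forall>z\<in>I. \<exists>L. L \<ge> 0 \<and> (\<lambda>m. \<integral>y. tube_integrand m (\<phi>z z) y \<partial>lborel) \<longlonglongrightarrow> L \<and>
       (\<integral>\<^sup>+y. ?d z y * ennreal (\<phi>z z (?cp z y)) \<partial>?N) = ennreal L" by (rule ballI) (rule ex)
    from bchoice[OF this] obtain L where L: "\<forall>z\<in>I. L z \<ge> 0 \<and> (\<lambda>m. \<integral>y. tube_integrand m (\<phi>z z) y \<partial>lborel) \<longlonglongrightarrow> L z \<and>
       (\<integral>\<^sup>+y. ?d z y * ennreal (\<phi>z z (?cp z y)) \<partial>?N) = ennreal (L z)" ..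
    have m\<phi>: "(\<lambda>y. ennreal (\<phi> y)) \<in> borel_measurable borel" using borel_measurable_continuous_onI[OF \<phi>(1)] by simp
    have "(\<integral>\<^sup>+y. ennreal (\<phi> y) \<partial>m) = (\<Sum>z\<in>I. \<integral>\<^sup>+y. ?d z y * ennreal (\<phi>z z (?cp z y)) \<partial>?N)"
      unfolding nn[OF m\<phi>] \<phi>z_def by (simp only: ennreal_mult[OF \<chi>0 \<phi>(2)])
    also have "\<dots> = (\<Sum>z\<in>I. ennreal (L z))" by (rule sum.cong[OF refl]) (use L in simp)
    also have "\<dots> = ennreal (\<Sum>z\<in>I. L z)" by (rule sum_ennreal) (use L in simp)
    finally have 1: "(\<integral>\<^sup>+y. ennreal (\<phi> y) \<partial>m) = ennreal (\<Sum>z\<in>I. L z)" .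
    have 2: "(\<lambda>k. \<Sum>z\<in>I. \<integral>y. tube_integrand k (\<phi>z z) y \<partial>lborel) \<longlonglongrightarrow> (\<Sum>z\<in>I. L z)"
      by (rule tendsto_sum) (use L in simp)
    \<comment> \<open>The weights sum to 1 only on this neighbourhood of Z, but off it all tube
      integrands vanish for large k; so the pieces add up to the full tube integral.\<close>
    have o: "open {y. c/2 < s y}" by (rule open_Collect_less[OF continuous_on_const cs])
    have sub: "Z \<subseteq> {y. c/2 < s y}"
    proof
      fix y assume "y \<in> Z"
      then show "y \<in> {y. c/2 < s y}" using c(2)[of y] c(1) by simp
    qed
    obtain m0 where m0: "\<And>m \<phi> y. m \<ge> m0 \<Longrightarrow> y \<notin> {y. c/2 < s y} \<Longrightarrow> tube_integrand m \<phi> y = 0"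
      by (rule tube_integrand_zero[OF o sub]) blast
    have eq: "(\<Sum>z\<in>I. \<integral>y. tube_integrand k (\<phi>z z) y \<partial>lborel) = (\<integral>y. tube_integrand k \<phi> y \<partial>lborel)"
      if k: "k \<ge> max 5 m0" for k
    proof -
      have k5: "k \<ge> 5" and km: "k \<ge> m0" using k by simp_all
      have "(\<Sum>z\<in>I. \<integral>y. tube_integrand k (\<phi>z z) y \<partial>lborel) = (\<integral>y. (\<Sum>z\<in>I. tube_integrand k (\<phi>z z) y) \<partial>lborel)"
        by (rule Bochner_Integration.integral_sum[symmetric]) (rule integrable_tube_integrand[OF c\<phi>z k5])
      also have "(\<lambda>y. \<Sum>z\<in>I. tube_integrand k (\<phi>z z) y) = tube_integrand k \<phi>"
      proof (rule ext)
        fix y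
        show "(\<Sum>z\<in>I. tube_integrand k (\<phi>z z) y) = tube_integrand k \<phi> y"
        proof (cases "c/2 < s y")
          case True
          have "(\<Sum>z\<in>I. tube_integrand k (\<phi>z z) y) =
              (\<Sum>z\<in>I. \<chi>' z y * (bump k (P y) * bump k (Q y) * \<phi> y * \<bar>vol y\<bar>))"
            unfolding tube_integrand_def \<phi>z_def by (rule sum.cong[OF refl]) (simp only: mult_ac)
          also have "\<dots> = tube_integrand k \<phi> y"
            unfolding sum_distrib_right[symmetric] \<chi>sum[OF True] tube_integrand_def by simp
          finally show ?thesis .
        next
          case False
          then have "y \<notin> {y. c/2 < s y}" by simp
          from m0[OF km this] show ?thesis by simp
        qed
      qed
      finally show ?thesis .
    qed
    have "(\<lambda>k. \<integral>y. tube_integrand k \<phi> y \<partial>lborel) \<longlonglongrightarrow> (\<Sum>z\<in>I. L z)"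
      by (rule Lim_transform_eventually[OF 2 eventually_sequentiallyI[of "max 5 m0"]]) (rule eq)
    moreover have "(\<Sum>z\<in>I. L z) \<ge> 0" by (rule sum_nonneg) (use L in simp)
    ultimately show ?thesis using 1 by (intro exI[of _ "\<Sum>z\<in>I. L z"] conjI)
  qed
  show ?thesis using sets_m null main by (intro exI[of _ m] conjI allI impI) simp_all
qed

text \<open>The tube measure m is pushed forward by g. In every chart it agrees with the chart
  measure, as both integrate test functions to the same tube limit; this makes the image a density
  measure. Charts cover S, so there is no other, and the definite description denotes this
  one.\<close>

lemma liouville_measure_limit:
  fixes F :: "'n phase \<Rightarrow> complex"
  assumes \<phi>: "continuous_on UNIV \<phi>" and F: "\<And>y. y \<in> Z \<Longrightarrow> F (g y) = complex_of_real (\<phi> y)"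
  shows "\<exists>L. (\<lambda>k. \<integral>y. tube_integrand k \<phi> y \<partial>lborel) \<longlonglongrightarrow> L \<and>
    (LINT \<rho>:S|liouville_measure \<Lambda> q. F \<rho>) = complex_of_real L"
proof -
  let ?N = "PiM {..<kk} (\<lambda>_. lborel :: real measure)"
  from tube_measure_exists obtain m :: "(real^('n bit0)) measure"
    where m': "sets m = sets borel \<and> emeasure m (- Z) = 0 \<and>
    (\<forall>\<phi>. continuous_on UNIV \<phi> \<and> (\<forall>y. \<phi> y \<ge> 0) \<longrightarrow>
      (\<exists>L\<ge>0. (\<lambda>k. \<integral>y. tube_integrand k \<phi> y \<partial>lborel) \<longlonglongrightarrow> L \<and> (\<integral>\<^sup>+y. ennreal (\<phi> y) \<partial>m) = ennreal L))" ..
  then have sets_m[measurable_cong]: "sets m = sets borel" and null: "emeasure m (- Z) = 0" by simp_all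
  have m: "\<exists>L\<ge>0. (\<lambda>k. \<integral>y. tube_integrand k \<phi> y \<partial>lborel) \<longlonglongrightarrow> L \<and> (\<integral>\<^sup>+y. ennreal (\<phi> y) \<partial>m) = ennreal L"
    if "continuous_on UNIV \<phi>" "\<And>y. \<phi> y \<ge> 0" for \<phi>
    using m' that by simp
  have mg: "g \<in> borel_measurable m" using borel_measurable_continuous_onI[OF continuous_g] sets_m
    by (simp cong: measurable_cong_sets)
  have sp: "space m = UNIV" using sets_eq_imp_space_eq[OF sets_m] by simp
  \<comment> \<open>Any slice chart is allowed here, not only the finitely many from which m was
    built: near each of its points \<open>chart_limit_at\<close> gives the tube limit, which is also
    the integral against m.\<close>
  have chart_eq: "emeasure m D = (\<integral>\<^sup>+y. dens e W \<psi> y * indicator D (chart_point e W \<psi> y) \<partial>?N)"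
    if chart: "slice_chart kk S e W \<psi>" and D: "D \<in> sets borel" "D \<subseteq> Z \<inter> g -` (\<psi> ` W)" for D e W \<psi>
  proof -
    let ?cp = "chart_point e W \<psi>" and ?d = "dens e W \<psi>"
    define N where "N = distr (density ?N ?d) borel ?cp"
    have mcp: "?cp \<in> borel_measurable (density ?N ?d)" using chart_measurable(2)[OF chart] by simp
    have nn: "(\<integral>\<^sup>+y. f y \<partial>N) = (\<integral>\<^sup>+y. ?d y * f (?cp y) \<partial>?N)" if f: "f \<in> borel_measurable borel" for f
    proof -
      have "(\<integral>\<^sup>+y. f y \<partial>N) = (\<integral>\<^sup>+y. f (?cp y) \<partial>density ?N ?d)"
        unfolding N_def by (rule nn_integral_distr[OF mcp]) (use f in simp)
      also have "\<dots> = (\<integral>\<^sup>+y. ?d y * f (?cp y) \<partial>?N)"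
        by (rule nn_integral_density[OF chart_measurable(1)[OF chart] measurable_compose[OF chart_measurable(2)[OF chart] f]])
      finally show ?thesis .
    qed
    have sets_N: "sets N = sets borel" unfolding N_def by simp
    have "emeasure m D = emeasure N D"
    proof (rule emeasure_eq_continuous[OF sets_m sets_N _ D])
      fix x assume "x \<in> Z \<inter> g -` (\<psi> ` W)"
      then have x: "x \<in> Z" "g x \<in> \<psi> ` W" by simp_all
      from chart_limit_at[OF chart x] obtain r where r: "r > 0"
        "\<forall>\<phi>. continuous_on UNIV \<phi> \<and> (\<forall>y. \<phi> y \<ge> 0) \<and> (\<forall>y. y \<notin> ball x r \<longrightarrow> \<phi> y = 0) \<longrightarrow>
         (\<exists>L\<ge>0. (\<lambda>m. \<integral>y. tube_integrand m \<phi> y \<partial>lborel) \<longlonglongrightarrow> L \<and>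
           (\<integral>\<^sup>+y. ?d y * ennreal (\<phi> (?cp y)) \<partial>?N) = ennreal L)" by (elim exE conjE)
      show "\<exists>r>0. \<forall>\<phi>. continuous_on UNIV \<phi> \<and> (\<forall>y. \<phi> y \<ge> 0) \<and> (\<forall>y. y \<notin> ball x r \<longrightarrow> \<phi> y = 0) \<longrightarrow>
       (\<exists>L. (\<integral>\<^sup>+y. ennreal (\<phi> y) \<partial>m) = ennreal L \<and> (\<integral>\<^sup>+y. ennreal (\<phi> y) \<partial>N) = ennreal L)"
      proof (rule exI[of _ r], rule conjI[OF r(1)], rule allI, rule impI)
        fix \<phi> :: "real^('n bit0) \<Rightarrow> real" assume \<phi>: "continuous_on UNIV \<phi> \<and> (\<forall>y. \<phi> y \<ge> 0) \<and> (\<forall>y. y \<notin> ball x r \<longrightarrow> \<phi> y = 0)"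
        from mp[OF spec[OF r(2)] \<phi>] obtain L where L: "(\<lambda>m. \<integral>y. tube_integrand m \<phi> y \<partial>lborel) \<longlonglongrightarrow> L"
           "(\<integral>\<^sup>+y. ?d y * ennreal (\<phi> (?cp y)) \<partial>?N) = ennreal L" by (elim exE conjE)
        have "continuous_on UNIV \<phi>" "\<And>y. \<phi> y \<ge> 0" using \<phi> by simp_all
        from m[OF this] obtain L' where L': "(\<lambda>k. \<integral>y. tube_integrand k \<phi> y \<partial>lborel) \<longlonglongrightarrow> L'"
           "(\<integral>\<^sup>+y. ennreal (\<phi> y) \<partial>m) = ennreal L'" by (elim exE conjE)
        have LL: "L' = L" by (rule LIMSEQ_unique[OF L'(1) L(1)])
        have "(\<lambda>y. ennreal (\<phi> y)) \<in> borel_measurable borel"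
          using borel_measurable_continuous_onI[OF \<open>continuous_on UNIV \<phi>\<close>] by simp
        from nn[OF this] L(2) have "(\<integral>\<^sup>+y. ennreal (\<phi> y) \<partial>N) = ennreal L" by (rule trans)
        then show "\<exists>L. (\<integral>\<^sup>+y. ennreal (\<phi> y) \<partial>m) = ennreal L \<and> (\<integral>\<^sup>+y. ennreal (\<phi> y) \<partial>N) = ennreal L"
          using L'(2) unfolding LL by (intro exI[of _ L] conjI)
      qed
    qed
    also have "\<dots> = (\<integral>\<^sup>+y. indicator D y \<partial>N)" using D(1) sets_N by simp
    also have "\<dots> = (\<integral>\<^sup>+y. ?d y * indicator D (?cp y) \<partial>?N)" by (rule nn) (use D(1) in simp)
    finally show ?thesis .
  qed
  define \<mu> where "\<mu> = distr m borel g"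
  let ?\<delta> = "liouville_density \<Lambda> q"
  have em: "emeasure \<mu> A = emeasure m (g -` A)" if "A \<in> sets borel" for A
    unfolding \<mu>_def using emeasure_distr[OF mg that] sp by simp
  have Sb: "S \<in> sets borel" using S_closed by simp
  have dm: "is_density_measure kk S ?\<delta> \<mu>"
    unfolding is_density_measure_def
  proof (intro conjI allI impI ballI)
    show "sets \<mu> = sets borel" unfolding \<mu>_def by simp
    have "g -` (UNIV - S) = - Z" using g_S_Z(1) by (simp add: vimage_Compl Compl_eq_Diff_UNIV[symmetric])
    then have "emeasure \<mu> (UNIV - S) = 0" using em[of "UNIV - S"] Sb null by simp
    then show "UNIV - S \<in> null_sets \<mu>" unfolding null_sets_def \<mu>_def using Sb by simp
    fix e W \<psi> A assume chart: "slice_chart kk S e W \<psi>" and A: "A \<in> sets borel" "A \<subseteq> S \<inter> \<psi> ` W"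
    have gA: "g -` A \<in> sets borel" using measurable_sets[OF mg A(1)] sp sets_m by simp
    have "g -` A \<subseteq> Z \<inter> g -` (\<psi> ` W)"
      using vimage_mono[OF A(2), of g] unfolding vimage_Int g_S_Z(1) .
    from chart_eq[OF chart gA this]
    have "emeasure \<mu> A = (\<integral>\<^sup>+y. dens e W \<psi> y * indicator (g -` A) (chart_point e W \<psi> y) \<partial>?N)" using em[OF A(1)] by simp
    also have "\<dots> = (\<integral>\<^sup>+y. ennreal (?\<delta> (\<psi> (lin e y)) (\<lambda>i. frechet_derivative \<psi> (at (lin e y)) (e i))) *
        indicator {x \<in> W. \<psi> x \<in> A} (lin e y) \<partial>?N)"
    proof (rule nn_integral_cong)
      fix y
      show "dens e W \<psi> y * indicator (g -` A) (chart_point e W \<psi> y) =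
        ennreal (?\<delta> (\<psi> (lin e y)) (\<lambda>i. frechet_derivative \<psi> (at (lin e y)) (e i))) * indicator {x \<in> W. \<psi> x \<in> A} (lin e y)"
      proof (cases "lin e y \<in> W")
        case True
        have "\<psi> ` (W \<inter> span (e ` {..<kk})) = S \<inter> \<psi> ` W" using chart unfolding slice_chart_def by simp
        moreover have "\<psi> (lin e y) \<in> \<psi> ` (W \<inter> span (e ` {..<kk}))" by (rule imageI) (simp add: True lin_in_span)
        ultimately have "\<psi> (lin e y) \<in> S" by simp
        then have "\<psi> (lin e y) \<in> \<Lambda>" by (rule subsetD[OF S_subset])
        then have "g (chart_point e W \<psi> y) = \<psi> (lin e y)" unfolding chart_point_def using True g_inv_g by simp
        then show ?thesis unfolding dens_def using True by (simp add: indicator_def)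
      qed (simp add: dens_def indicator_def)
    qed
    finally show "emeasure \<mu> A = (\<integral>\<^sup>+y. (let x = (\<Sum>i<kk. y i *\<^sub>R e i) in
       ennreal (?\<delta> (\<psi> x) (\<lambda>i. frechet_derivative \<psi> (at x) (e i))) * indicator {x \<in> W. \<psi> x \<in> A} x) \<partial>?N)"
      unfolding Let_def lin_def .
  qed
  \<comment> \<open>The complement of S is null for both measures, and on the image of a chart the
    integral formula fixes the values.\<close>
  have uniq: "\<mu>' = \<mu>" if dm': "is_density_measure kk S ?\<delta> \<mu>'" for \<mu>'
  proof (rule measure_eqI)
    have s: "sets \<mu>' = sets borel" "sets \<mu> = sets borel" using dm dm' unfolding is_density_measure_def by simp_all
    then show "sets \<mu>' = sets \<mu>" by simp
    have n: "UNIV - S \<in> null_sets \<mu>'" "UNIV - S \<in> null_sets \<mu>" using dm dm' unfolding is_density_measure_def by simp_all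
    fix A assume "A \<in> sets \<mu>'"
    then have A: "A \<in> sets borel" using s by simp
    have AS: "A - (UNIV - S) = A \<inter> S" by blast
    have "emeasure \<mu>' (A \<inter> S) = emeasure \<mu> (A \<inter> S)"
    proof (rule emeasure_eq_local[OF s])
      show "A \<inter> S \<in> sets borel" using A Sb by simp
      show "A \<inter> S \<subseteq> S" by simp
      fix x assume "x \<in> S"
      from slice_chart_exists[OF this] obtain e W \<psi> where c: "slice_chart kk S e W \<psi>" "x \<in> \<psi> ` W" by (elim exE conjE)
      have "open (\<psi> ` W)" using c(1) unfolding slice_chart_def by simp
      moreover have "\<forall>D\<in>sets borel. D \<subseteq> S \<inter> \<psi> ` W \<longrightarrow> emeasure \<mu>' D = emeasure \<mu> D"
        using dm dm' c(1) unfolding is_density_measure_def by simp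
      ultimately show "\<exists>U. open U \<and> x \<in> U \<and> (\<forall>D\<in>sets borel. D \<subseteq> S \<inter> U \<longrightarrow> emeasure \<mu>' D = emeasure \<mu> D)"
        using c(2) by (intro exI[of _ "\<psi> ` W"] conjI)
    qed
    moreover have "emeasure \<mu>' (A - (UNIV - S)) = emeasure \<mu>' A" "emeasure \<mu> (A - (UNIV - S)) = emeasure \<mu> A"
      using n A s by (simp_all add: emeasure_Diff_null_set)
    ultimately show "emeasure \<mu>' A = emeasure \<mu> A" unfolding AS by simp
  qed
  have lm: "liouville_measure \<Lambda> q = \<mu>"
    unfolding liouville_measure_def density_measure_def kk_def[symmetric] S_def[symmetric]
    using dm by (rule the_equality) (rule uniq)
  \<comment> \<open>The tube measure was characterised on nonnegative functions; f times the bracket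
    has no sign, so it is split into positive and negative parts.\<close>
  define \<phi>p where "\<phi>p y = max 0 (\<phi> y)" for y
  define \<phi>n where "\<phi>n y = max 0 (- \<phi> y)" for y
  have cpn: "continuous_on UNIV \<phi>p" "continuous_on UNIV \<phi>n" unfolding \<phi>p_def \<phi>n_def using \<phi> by (intro continuous_intros; simp)+
  have pn0: "\<phi>p y \<ge> 0" "\<phi>n y \<ge> 0" for y unfolding \<phi>p_def \<phi>n_def by simp_all
  have pn: "\<phi> y = \<phi>p y - \<phi>n y" for y unfolding \<phi>p_def \<phi>n_def by simp
  from m[OF cpn(1) pn0(1)] obtain Lp where Lp: "0 \<le> Lp" "(\<lambda>k. \<integral>y. tube_integrand k \<phi>p y \<partial>lborel) \<longlonglongrightarrow> Lp"
     "(\<integral>\<^sup>+y. ennreal (\<phi>p y) \<partial>m) = ennreal Lp" by (elim exE conjE)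
  from m[OF cpn(2) pn0(2)] obtain Ln where Ln: "0 \<le> Ln" "(\<lambda>k. \<integral>y. tube_integrand k \<phi>n y \<partial>lborel) \<longlonglongrightarrow> Ln"
     "(\<integral>\<^sup>+y. ennreal (\<phi>n y) \<partial>m) = ennreal Ln" by (elim exE conjE)
  have bm: "h \<in> borel_measurable m" if "continuous_on UNIV h" for h :: "real^('n bit0) \<Rightarrow> real"
    using borel_measurable_continuous_onI[OF that] sets_m by (simp cong: measurable_cong_sets)
  have int: "integrable m h \<and> (\<integral>y. h y \<partial>m) = L"
    if "continuous_on UNIV h" "\<And>y. h y \<ge> 0" "(\<integral>\<^sup>+y. ennreal (h y) \<partial>m) = ennreal L" "L \<ge> 0" for h L
  proof
    show "integrable m h" by (rule integrableI_nonneg[OF bm[OF that(1)]]) (use that in simp_all)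
    show "(\<integral>y. h y \<partial>m) = L" using integral_eq_nn_integral[OF bm[OF that(1)]] that by simp
  qed
  have ip: "integrable m \<phi>p" "(\<integral>y. \<phi>p y \<partial>m) = Lp" using int[OF cpn(1) pn0(1) Lp(3,1)] by simp_all
  have i_n: "integrable m \<phi>n" "(\<integral>y. \<phi>n y \<partial>m) = Ln" using int[OF cpn(2) pn0(2) Ln(3,1)] by simp_all
  have "(\<integral>y. \<phi> y \<partial>m) = (\<integral>y. \<phi>p y - \<phi>n y \<partial>m)" using pn by simp
  also have "\<dots> = Lp - Ln" using Bochner_Integration.integral_diff[OF ip(1) i_n(1)] ip(2) i_n(2) by simp
  finally have I\<phi>: "(\<integral>y. \<phi> y \<partial>m) = Lp - Ln" .
  have lim: "(\<lambda>k. \<integral>y. tube_integrand k \<phi> y \<partial>lborel) \<longlonglongrightarrow> Lp - Ln"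
  proof (rule Lim_transform_eventually[OF tendsto_diff[OF Lp(2) Ln(2)] eventually_sequentiallyI[of 5]])
    fix k :: nat assume k: "5 \<le> k"
    have "tube_integrand k \<phi> = (\<lambda>y. tube_integrand k \<phi>p y - tube_integrand k \<phi>n y)"
      unfolding tube_integrand_def[abs_def] by (rule ext) (simp add: pn algebra_simps)
    then show "(\<integral>y. tube_integrand k \<phi>p y \<partial>lborel) - (\<integral>y. tube_integrand k \<phi>n y \<partial>lborel) = (\<integral>y. tube_integrand k \<phi> y \<partial>lborel)"
      using Bochner_Integration.integral_diff[OF integrable_tube_integrand[OF cpn(1) k] integrable_tube_integrand[OF cpn(2) k]] by simp
  qed
  define F' where "F' \<rho> = indicator S \<rho> *\<^sub>R complex_of_real (\<phi> (inv g \<rho>))" for \<rho>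
  have FF': "indicator S \<rho> *\<^sub>R F \<rho> = F' \<rho>" for \<rho>
  proof (cases "\<rho> \<in> S")
    case True
    then obtain y where "y \<in> Z" "\<rho> = g y" unfolding g_S_Z(2) by (rule imageE)
    then show ?thesis unfolding F'_def using F[of y] inv_g_g[of y] by simp
  qed (simp add: F'_def)
  have mF': "F' \<in> borel_measurable borel"
    unfolding F'_def
  proof (rule borel_measurable_continuous_on_indicator[OF Sb])
    have "continuous_on S (inv g)" by (rule continuous_on_subset[OF continuous_inv_g S_subset])
    from continuous_on_compose2[OF \<phi> this] have "continuous_on S (\<lambda>\<rho>. \<phi> (inv g \<rho>))" by simp
    then show "continuous_on S (\<lambda>\<rho>. complex_of_real (\<phi> (inv g \<rho>)))" by (rule continuous_on_of_real)
  qed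
  have "(LINT \<rho>:S|\<mu>. F \<rho>) = (\<integral>\<rho>. F' \<rho> \<partial>\<mu>)" unfolding set_lebesgue_integral_def FF' ..
  also have "\<dots> = (\<integral>y. F' (g y) \<partial>m)" unfolding \<mu>_def by (rule integral_distr[OF mg mF'])
  also have "\<dots> = (\<integral>y. complex_of_real (\<phi> y) \<partial>m)"
  proof (rule integral_cong_AE)
    show "(\<lambda>y. F' (g y)) \<in> borel_measurable m" by (rule measurable_compose[OF mg mF'])
    show "(\<lambda>y. complex_of_real (\<phi> y)) \<in> borel_measurable m" using bm[OF \<phi>] by measurable
    have "- Z \<in> null_sets m" unfolding null_sets_def using null sets_m Z_closed by simp
    then have "AE y in m. y \<notin> - Z" by (rule AE_not_in)
    then show "AE y in m. F' (g y) = complex_of_real (\<phi> y)"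
    proof eventually_elim
      case (elim y)
      then have "g y \<in> S" unfolding g_S_Z(2) by simp
      then show ?case unfolding F'_def inv_g_g by simp
    qed
  qed
  also have "\<dots> = complex_of_real (Lp - Ln)" unfolding I\<phi>[symmetric] by (rule integral_complex_of_real)
  finally show ?thesis unfolding lm using lim by (intro exI[of _ "Lp - Ln"] conjI)
qed

section \<open>Positivity of the Liouville integral\<close>

lemma has_derivative_P: "(P has_derivative frechet_derivative P (at y)) (at y)"
  and has_derivative_Q: "(Q has_derivative frechet_derivative Q (at y)) (at y)"
  using Ck_has_derivative[OF spec[OF Cinf_P, of "Suc 0"], of y] Ck_has_derivative[OF spec[OF Cinf_Q, of "Suc 0"], of y] by simp_all

text \<open>Every segment \<open>y + t *\<^sub>R u\<close> starting near \<open>y1\<close> crosses the level \<open>P = 0\<close>, and along it the integral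
  of \<open>bump k (P _) * \<partial>\<^sub>u P\<close> is 1; averaging over the starting points gives the lower bound.\<close>

lemma slab_lower_bound:
  assumes y1: "P y1 = 0" and u: "frechet_derivative P (at y1) u = 1" and U: "open U" "y1 \<in> U"
  shows "\<exists>c>0. \<exists>k0. \<forall>k\<ge>k0. ennreal c \<le> (\<integral>\<^sup>+z. indicator U z * ennreal (bump k (P z)) \<partial>lborel)"
proof -
  define D where "D y = frechet_derivative P (at y) u" for y
  have cD: "continuous_on UNIV D" unfolding D_def[abs_def]
    by (rule Ck_continuous_on[OF Ck_frechet[OF spec[OF Cinf_P, of "Suc 0"]]])
  \<comment> \<open>The lower bound 1/2 makes P move steadily along u; the upper bound 2 lets D *
    bump be estimated by 2 * bump.\<close>
  define U1 where "U1 = U \<inter> ({y. 1/2 < D y} \<inter> {y. D y < 2})"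
  have "open U1" unfolding U1_def
    by (intro open_Int U(1) open_Collect_less continuous_on_const cD)
  moreover have "y1 \<in> U1" unfolding U1_def D_def using U(2) u by simp
  ultimately obtain \<rho> where \<rho>: "\<rho> > 0" "ball y1 \<rho> \<subseteq> U1" by (rule openE)
  \<comment> \<open>The half-length of the segments: T times the norm of u is at most \<rho>/2, so
    segments that start within \<rho>/2 of y1 remain in the \<rho>-ball.\<close>
  define T where "T = \<rho> / (2 * (norm u + 1))"
  have nu: "norm u + 1 > 0" using norm_ge_zero[of u] by linarith
  have T: "T > 0" unfolding T_def using \<rho>(1) nu by simp
  have Tu: "T * norm u \<le> \<rho> / 2"
  proof -
    have "T * norm u \<le> T * (norm u + 1)" using T by (intro mult_left_mono) simp_all
    also have "\<dots> = \<rho> / 2"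
    proof -
      have "\<rho> / (2 * a) * a = \<rho> / 2" if "a > 0" for a :: real using that by simp
      from this[OF nu] show ?thesis unfolding T_def .
    qed
    finally show ?thesis .
  qed
  \<comment> \<open>Over a distance T the function P changes by at least T/2, so starting between
    -T/4 and T/4 it ends beyond these bounds on both sides.\<close>
  define U2 where "U2 = ball y1 (\<rho>/2) \<inter> ({y. - (T/4) < P y} \<inter> {y. P y < T/4})"
  have "open U2" unfolding U2_def
    by (intro open_Int open_ball open_Collect_less continuous_on_const cont_PQvol)
  moreover have "y1 \<in> U2" unfolding U2_def using y1 \<rho>(1) T by simp
  ultimately obtain r1 where r1: "r1 > 0" "ball y1 r1 \<subseteq> U2" by (rule openE)
  let ?B = "ball y1 r1"
  have inb: "y + t *\<^sub>R u \<in> U1" if y: "y \<in> ?B" and t: "\<bar>t\<bar> \<le> T" for y t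
  proof -
    have "y \<in> ball y1 (\<rho>/2)" using subsetD[OF r1(2) y] unfolding U2_def by simp
    then have 1: "dist y1 y < \<rho>/2" by simp
    have "dist y (y + t *\<^sub>R u) = \<bar>t\<bar> * norm u" by (simp add: dist_norm)
    also have "\<dots> \<le> T * norm u" using t by (intro mult_right_mono) simp_all
    finally have 2: "dist y (y + t *\<^sub>R u) \<le> \<rho>/2" using Tu by simp
    have "dist y1 (y + t *\<^sub>R u) < \<rho>" using dist_triangle[of y1 "y + t *\<^sub>R u" y] 1 2 by linarith
    then show ?thesis using \<rho>(2) by auto
  qed
  have D12: "1/2 < D (y + t *\<^sub>R u)" "D (y + t *\<^sub>R u) < 2" if "y \<in> ?B" "\<bar>t\<bar> \<le> T" for y t
    using inb[OF that] unfolding U1_def by simp_all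
  have der: "((\<lambda>t. P (y + t *\<^sub>R u)) has_real_derivative D (y + t *\<^sub>R u)) (at t)" for y t
  proof -
    have "((\<lambda>t. y + t *\<^sub>R u) has_derivative (\<lambda>s. s *\<^sub>R u)) (at t)" by (auto intro!: derivative_eq_intros)
    from diff_chain_at[OF this has_derivative_P]
    have "((\<lambda>t. P (y + t *\<^sub>R u)) has_derivative (\<lambda>s. frechet_derivative P (at (y + t *\<^sub>R u)) (s *\<^sub>R u))) (at t)"
      by (simp add: o_def)
    moreover have "(\<lambda>s. frechet_derivative P (at (y + t *\<^sub>R u)) (s *\<^sub>R u)) = (\<lambda>s. D (y + t *\<^sub>R u) * s)"
      by (rule ext) (simp add: D_def linear_cmul[OF has_derivative_linear[OF has_derivative_P]])
    ultimately show ?thesis by (simp add: has_field_derivative_def)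
  qed
  have up: "P (y + T *\<^sub>R u) \<ge> T/4" and dn: "P (y + (- T) *\<^sub>R u) \<le> - (T/4)" if y: "y \<in> ?B" for y
  proof -
    have Py: "- (T/4) < P y" "P y < T/4" using subsetD[OF r1(2) y] unfolding U2_def by simp_all
    from MVT2[OF T der[of y]] obtain z where z: "0 < z" "z < T"
      "P (y + T *\<^sub>R u) - P (y + 0 *\<^sub>R u) = (T - 0) * D (y + z *\<^sub>R u)" by auto
    have "T * (1/2) \<le> T * D (y + z *\<^sub>R u)" using D12(1)[OF y, of z] z(1,2) T by (intro mult_left_mono) simp_all
    moreover have "P (y + T *\<^sub>R u) = P y + T * D (y + z *\<^sub>R u)" using z(3) by simp
    ultimately show "P (y + T *\<^sub>R u) \<ge> T/4" using Py by linarith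
    have "- T < 0" using T by simp
    from MVT2[OF this der[of y]] obtain z' where z': "- T < z'" "z' < 0"
      "P (y + 0 *\<^sub>R u) - P (y + (- T) *\<^sub>R u) = (0 - (- T)) * D (y + z' *\<^sub>R u)" by auto
    have "T * (1/2) \<le> T * D (y + z' *\<^sub>R u)" using D12(1)[OF y, of z'] z'(1,2) T by (intro mult_left_mono) simp_all
    moreover have "P (y + (- T) *\<^sub>R u) = P y - T * D (y + z' *\<^sub>R u)" using z'(3) by simp
    ultimately show "P (y + (- T) *\<^sub>R u) \<le> - (T/4)" using Py by linarith
  qed
  define b where "b = measure lborel ?B"
  have b: "b > 0" unfolding b_def using content_ball_pos[OF r1(1)] by simp
  have eb: "emeasure lborel ?B = ennreal b" unfolding b_def
    using emeasure_lborel_ball_finite[of y1 r1] by (intro emeasure_eq_ennreal_measure) simp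
  \<comment> \<open>From k0 on (k + 1) T/4 is at least 3/2, so at the ends of each segment the
    primitive of the spline has reached its constant values -1/2 and 1/2.\<close>
  obtain k0 :: nat where k0: "6 / T \<le> real k0" using real_arch_simple[of "6 / T"] by (rule exE)
  have main: "ennreal (b / (4 * T)) \<le> (\<integral>\<^sup>+z. indicator U z * ennreal (bump k (P z)) \<partial>lborel)" if k: "k \<ge> k0" for k
  proof -
    let ?J = "\<integral>\<^sup>+z. indicator U z * ennreal (bump k (P z)) \<partial>lborel"
    have kT: "3/2 \<le> real (Suc k) * (T/4)"
    proof -
      have "6 / T \<le> real (Suc k)" using k0 k by linarith
      then show ?thesis using T by (simp add: divide_le_eq field_simps)
    qed
    have mP[measurable]: "P \<in> borel_measurable borel" by (rule borel_measurable_continuous_onI[OF cont_PQvol(1)])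
    have mD[measurable]: "D \<in> borel_measurable borel" by (rule borel_measurable_continuous_onI[OF cD])
    have mb[measurable]: "bump k \<in> borel_measurable borel" by (rule borel_measurable_continuous_onI[OF continuous_bump])
    have mU[measurable]: "U \<in> sets borel" using U(1) by simp
    define h where "h y t = ennreal (2 * bump k (P (y + t *\<^sub>R u))) * indicator {-T..T} t" for y and t :: real
    have line: "1 \<le> (\<integral>\<^sup>+t. h y t \<partial>lborel)" if y: "y \<in> ?B" for y
    proof -
      define f where "f t = D (y + t *\<^sub>R u) * bump k (P (y + t *\<^sub>R u))" for t
      define F where "F t = bspline_int (real (Suc k) * P (y + t *\<^sub>R u))" for t
      have dF: "(F has_real_derivative f t) (at t)" for t
        unfolding F_def f_def bump_def
        using DERIV_chain2[OF DERIV_bspline_int DERIV_cmult[OF der]] by (simp only: mult_ac)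
      have tT: "\<bar>t\<bar> \<le> T" if "t \<in> {-T..T}" for t using that by auto
      have "(\<integral>\<^sup>+t. ennreal (f t) * indicator {-T..T} t \<partial>lborel) = ennreal (F T - F (-T))"
      proof (rule nn_integral_FTC_Icc)
        show "f \<in> borel_measurable borel" unfolding f_def by measurable
        fix t assume t: "t \<in> {-T..T}"
        show "(F has_real_derivative f t) (at t)" by (rule dF)
        show "0 \<le> f t" unfolding f_def
          using D12(1)[OF y tT[OF t]] bump_nonneg[of k] by (intro mult_nonneg_nonneg) simp_all
      next
        show "- T \<le> T" using T by simp
      qed
      moreover have "F T = 1/2" unfolding F_def
      proof (rule bspline_int_ge)
        have "real (Suc k) * (T/4) \<le> real (Suc k) * P (y + T *\<^sub>R u)" using up[OF y] by (intro mult_left_mono) simp_all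
        then show "3/2 \<le> real (Suc k) * P (y + T *\<^sub>R u)" using kT by linarith
      qed
      moreover have "F (-T) = -1/2" unfolding F_def
      proof (rule bspline_int_le)
        have "real (Suc k) * P (y + (- T) *\<^sub>R u) \<le> real (Suc k) * (- (T/4))" using dn[OF y] by (intro mult_left_mono) simp_all
        then show "real (Suc k) * P (y + (- T) *\<^sub>R u) \<le> -3/2" using kT by linarith
      qed
      ultimately have 1: "(\<integral>\<^sup>+t. ennreal (f t) * indicator {-T..T} t \<partial>lborel) = 1" by simp
      have "(\<integral>\<^sup>+t. ennreal (f t) * indicator {-T..T} t \<partial>lborel) \<le> (\<integral>\<^sup>+t. h y t \<partial>lborel)"
      proof (rule nn_integral_mono)
        fix t
        show "ennreal (f t) * indicator {-T..T} t \<le> h y t"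
        proof (cases "t \<in> {-T..T}")
          case True
          have "f t \<le> 2 * bump k (P (y + t *\<^sub>R u))" unfolding f_def
            using D12(2)[OF y tT[OF True]] bump_nonneg[of k] by (intro mult_right_mono) simp_all
          then show ?thesis unfolding h_def by (intro mult_right_mono ennreal_leI) simp_all
        qed (simp add: h_def)
      qed
      then show ?thesis unfolding 1 .
    qed
    let ?G = "\<lambda>y t. indicator ?B y * h y t"
    have mG: "(\<lambda>(y, t). ?G y t) \<in> borel_measurable (lborel \<Otimes>\<^sub>M lborel)"
    proof -
      have c: "continuous_on UNIV (\<lambda>p :: (real^('n bit0)) \<times> real. P (fst p + snd p *\<^sub>R u))"
        by (rule continuous_on_compose2[OF cont_PQvol(1)[of UNIV]]) (auto intro!: continuous_intros)
      have m: "(\<lambda>p :: (real^('n bit0)) \<times> real. ennreal (2 * bump k (P (fst p + snd p *\<^sub>R u)))) \<in> borel_measurable borel"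
        using measurable_compose[OF borel_measurable_continuous_onI[OF c] mb] by measurable
      have s: "?B \<times> {-T..T} \<in> sets borel" by (rule borel_Times) simp_all
      have eq: "(\<lambda>(y, t). ?G y t) = (\<lambda>p. indicator (?B \<times> {-T..T}) p * ennreal (2 * bump k (P (fst p + snd p *\<^sub>R u))))"
        unfolding h_def by (auto simp: fun_eq_iff indicator_def)
      show ?thesis unfolding lborel_prod eq measurable_lborel2
        by (rule borel_measurable_times_ennreal[OF borel_measurable_indicator[OF s] m])
    qed
    \<comment> \<open>Each starting point in the ball contributes at least 1. After exchanging the
      integrals, each t contributes at most 2 J by translation invariance, so b \<le> 2 J * 2 T,
      which is the bound b/(4 T).\<close>
    have "ennreal b = (\<integral>\<^sup>+y. indicator ?B y \<partial>lborel)" using eb by simp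
    also have "\<dots> \<le> (\<integral>\<^sup>+y. \<integral>\<^sup>+t. ?G y t \<partial>lborel \<partial>lborel)"
    proof (rule nn_integral_mono)
      fix y
      show "indicator ?B y \<le> (\<integral>\<^sup>+t. ?G y t \<partial>lborel)" using line[of y] by (cases "y \<in> ?B") simp_all
    qed
    also have "\<dots> = (\<integral>\<^sup>+t. \<integral>\<^sup>+y. ?G y t \<partial>lborel \<partial>lborel)" by (rule lborel_pair.Fubini'[OF mG, symmetric])
    also have "\<dots> \<le> (\<integral>\<^sup>+t. (2 * ?J) * indicator {-T..T} t \<partial>lborel)"
    proof (rule nn_integral_mono)
      fix t :: real
      show "(\<integral>\<^sup>+y. ?G y t \<partial>lborel) \<le> (2 * ?J) * indicator {-T..T} t"
      proof (cases "t \<in> {-T..T}")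
        case True
        then have tT: "\<bar>t\<bar> \<le> T" by auto
        let ?H = "\<lambda>z. indicator U z * ennreal (2 * bump k (P z))"
        have mH: "?H \<in> borel_measurable borel" by measurable
        have "(\<integral>\<^sup>+y. ?G y t \<partial>lborel) \<le> (\<integral>\<^sup>+y. ?H (t *\<^sub>R u + y) \<partial>lborel)"
        proof (rule nn_integral_mono)
          fix y
          show "?G y t \<le> ?H (t *\<^sub>R u + y)"
          proof (cases "y \<in> ?B")
            case yB: True
            have "y + t *\<^sub>R u \<in> U" using inb[OF yB tT] unfolding U1_def by simp
            then show ?thesis unfolding h_def using True yB by (simp add: add.commute)
          qed simp
        qed
        also have "\<dots> = (\<integral>\<^sup>+z. ?H z \<partial>distr lborel borel ((+) (t *\<^sub>R u)))"
          by (rule nn_integral_distr[symmetric]) (use mH in simp_all)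
        also have "\<dots> = (\<integral>\<^sup>+z. ?H z \<partial>lborel)" by (simp only: lborel_distr_plus)
        also have "\<dots> = (\<integral>\<^sup>+z. 2 * (indicator U z * ennreal (bump k (P z))) \<partial>lborel)"
          by (rule nn_integral_cong) (simp add: ennreal_mult bump_nonneg mult_ac)
        also have "\<dots> = 2 * ?J" by (rule nn_integral_cmult) measurable
        finally show ?thesis using True by simp
      qed (simp add: h_def)
    qed
    also have "\<dots> = (2 * ?J) * ennreal (2 * T)"
      using T by (subst nn_integral_cmult_indicator) simp_all
    finally have fin: "ennreal b \<le> (2 * ?J) * ennreal (2 * T)" .
    show ?thesis
    proof (cases ?J)
      case (real j)
      have "(2 * ?J) * ennreal (2 * T) = ennreal (2 * j * (2 * T))"
      proof -
        have "ennreal (2 * j * (2 * T)) = ennreal (2 * j) * ennreal (2 * T)" by (rule ennreal_mult) (use real(1) T in simp_all)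
        also have "ennreal (2 * j) = ennreal 2 * ennreal j" by (rule ennreal_mult) (use real(1) in simp_all)
        finally show ?thesis unfolding real(2) by simp
      qed
      then have "b \<le> 2 * j * (2 * T)" using fin real(1) T by (simp add: ennreal_le_iff)
      then have "b / (4 * T) \<le> j" using T by (simp add: divide_le_eq mult_ac)
      then show ?thesis unfolding real(2) by (rule ennreal_leI)
    next
      case top
      then show ?thesis by simp
    qed
  qed
  have "b / (4 * T) > 0" using b T by simp
  then show ?thesis using main by (intro exI[of _ "b / (4 * T)"] conjI exI[of _ k0] allI impI)
qed

text \<open>\<open>vol\<close> has no zeros on a connected space. The tube density contains
  \<bar>vol\<bar> while \<open>integral_ham_zero\<close> is about \<open>vol\<close>; a constant
  sign reconciles them.\<close>

lemma vol_sign: "(\<forall>y. \<bar>vol y\<bar> = vol y) \<or> (\<forall>y. \<bar>vol y\<bar> = - vol y)"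
proof (rule ccontr)
  assume "\<not> ?thesis"
  then obtain a b where "\<bar>vol a\<bar> \<noteq> vol a" "\<bar>vol b\<bar> \<noteq> - vol b" by auto
  then have ab: "vol a \<le> 0" "0 \<le> vol b" by linarith+
  have "connected (range vol)" by (rule connected_continuous_image[OF cont_PQvol(3) connected_UNIV])
  from connectedD_interval[OF this rangeI rangeI ab] obtain y where "0 = vol y" by (rule imageE)
  then show False using vol_nonzero[of y] by simp
qed

lemma ham_self: "frechet_derivative P (at y) (ham P y) = 0"
proof -
  have "om y (ham P y) (ham P y) = 0" unfolding om_def sigma_def by (simp add: sum_subtractf)
  then show ?thesis using om_ham[OF has_derivative_P] by simp
qed

text \<open>For every k \<ge> 5 the tube integral equals the integral of the nonnegative function
  \<open>H k\<close>. A bound from below that does not depend on k, obtained near the single point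
  y1, therefore passes to L.\<close>

lemma limit_positive:
  assumes ff: "Cinf UNIV ff" and Qff: "\<And>y. Q y = frechet_derivative ff (at y) (ham P y)"
    and y1: "P y1 = 0" "Q y1 \<noteq> 0" "frechet_derivative P (at y1) u \<noteq> 0"
    and lim: "(\<lambda>k. \<integral>y. tube_integrand k (\<lambda>y. ff y * - frechet_derivative Q (at y) (ham P y)) y \<partial>lborel) \<longlonglongrightarrow> L"
  shows "L > 0"
proof -
  define \<phi> where "\<phi> y = ff y * - frechet_derivative Q (at y) (ham P y)" for y
  have C1: "Ck (Suc 0) UNIV ff" "Ck (Suc 0) UNIV P" "Ck (Suc 0) UNIV Q" using spec[OF ff, of "Suc 0"] spec[OF Cinf_P, of "Suc 0"] spec[OF Cinf_Q, of "Suc 0"] .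
  have dff: "(ff has_derivative frechet_derivative ff (at y)) (at y)" for y
    by (rule Ck_has_derivative[OF C1(1) UNIV_I])
  define w where "w k y = bspline_int (real (Suc k) * Q y)" for k y
  define test where "test k y = bump k (P y) * (ff y * w k y)" for k y
  have Cw: "Ck (Suc 0) UNIV (w k)" for k unfolding w_def[abs_def]
    by (rule Ck_compose[OF open_UNIV open_UNIV Ck_Suc_imp[OF Ck_bspline_int] Ck_mult[OF open_UNIV Ck_const C1(3)] UNIV_I])
  have Cb: "Ck (Suc 0) UNIV (\<lambda>y. bump k (P y))" for k
    by (rule Ck_compose[OF open_UNIV open_UNIV Ck_bump C1(2) UNIV_I])
  have Ctest: "Ck (Suc 0) UNIV (test k)" for k unfolding test_def[abs_def]
    by (rule Ck_mult[OF open_UNIV Cb Ck_mult[OF open_UNIV C1(1) Cw]])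
  have dw: "(w k has_derivative (\<lambda>v. (real (Suc k) * frechet_derivative Q (at y) v) * bspline (real (Suc k) * Q y))) (at y)" for k y
    unfolding w_def[abs_def]
    by (rule DERIV_compose_FDERIV[OF DERIV_bspline_int has_derivative_mult_right[OF has_derivative_Q]])
  \<comment> \<open>P is constant along its own Hamilton field, so the factor
    \<open>bump k (P y)\<close> is not differentiated in effect.\<close>
  have db: "\<exists>b'. ((\<lambda>y. bump k (P y)) has_derivative b') (at y) \<and> b' (ham P y) = 0" for k y
  proof -
    have B: "(bump k has_derivative frechet_derivative (bump k) (at (P y))) (at (P y))"
      by (rule Ck_has_derivative[OF Ck_bump UNIV_I])
    from diff_chain_at[OF has_derivative_P B]
    have "((\<lambda>y. bump k (P y)) has_derivative (\<lambda>v. frechet_derivative (bump k) (at (P y)) (frechet_derivative P (at y) v))) (at y)"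
      by (simp add: o_def)
    moreover have "frechet_derivative (bump k) (at (P y)) (frechet_derivative P (at y) (ham P y)) = 0"
      unfolding ham_self by (rule linear_0[OF has_derivative_linear[OF B]])
    ultimately show ?thesis by (intro exI conjI)
  qed
  \<comment> \<open>Of the product rule two terms remain: the derivative of ff along the field is Q,
    and the derivative of w yields \<open>bump k (Q y)\<close> times that of Q. The second is the
    tube integrand up to sign and volume.\<close>
  have dtest: "frechet_derivative (test k) (at y) (ham P y) =
      bump k (P y) * (Q y * w k y) - bump k (P y) * bump k (Q y) * \<phi> y" for k y
  proof -
    obtain b' where b': "((\<lambda>y. bump k (P y)) has_derivative b') (at y)" "b' (ham P y) = 0" using db[of k y] by (elim exE conjE)
    from has_derivative_mult[OF b'(1) has_derivative_mult[OF dff dw]]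
    have "(test k has_derivative (\<lambda>v. bump k (P y) * (ff y * ((real (Suc k) * frechet_derivative Q (at y) v) * bspline (real (Suc k) * Q y))
       + frechet_derivative ff (at y) v * w k y) + b' v * (ff y * w k y))) (at y)" unfolding test_def[abs_def] .
    from frechet_derivative_at[OF this, symmetric]
    show ?thesis unfolding \<phi>_def bump_def[of k "Q y"] by (simp add: b'(2) Qff[symmetric] algebra_simps)
  qed
  have c\<phi>: "continuous_on UNIV \<phi>"
  proof -
    have cc: "continuous_on UNIV (\<lambda>y. frechet_derivative Q (at y) v)" for v
      by (rule Ck_continuous_on[OF Ck_frechet[OF C1(3)]])
    have ch: "continuous_on UNIV (ham P)" by (rule Ck_continuous_on[OF Ck_ham[OF C1(2)]])
    have "frechet_derivative Q (at y) (ham P y) = (\<Sum>a\<in>UNIV. ham P y $ a * frechet_derivative Q (at y) (axis a 1))" for y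
      by (subst vec_expand[of "ham P y"])
        (simp add: linear_sum[OF has_derivative_linear[OF has_derivative_Q]] linear_cmul[OF has_derivative_linear[OF has_derivative_Q]])
    then show ?thesis unfolding \<phi>_def[abs_def]
      by (simp only:) (intro continuous_intros cc ch Ck_continuous_on[OF C1(1)])
  qed
  define H where "H k y = \<bar>vol y\<bar> * (bump k (P y) * (Q y * w k y))" for k y
  have Hn: "H k y \<ge> 0" for k y
  proof -
    have "real (Suc k) * (Q y * w k y) \<ge> 0" using bspline_int_sign[of "real (Suc k) * Q y"] unfolding w_def by (simp only: mult.assoc)
    then have "Q y * w k y \<ge> 0" by (simp add: zero_le_mult_iff)
    then show ?thesis unfolding H_def using bump_nonneg[of k "P y"] by simp
  qed
  have Pz: "bump k (P y) = 0" if "k \<ge> 5" "y \<notin> {y. \<bar>P y\<bar> \<le> 1/2}" for k y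
  proof (rule bump_0)
    have "3 / real (Suc k) \<le> 1/2" using that(1) by (simp add: field_simps)
    moreover have "1/2 \<le> \<bar>P y\<bar>" using that(2) by simp
    ultimately show "3 / real (Suc k) \<le> \<bar>P y\<bar>" by (rule order_trans)
  qed
  have iH: "integrable lborel (H k)" if k: "k \<ge> 5" for k
  proof (rule integrable_compact_support[OF _ compact_P])
    show "continuous_on UNIV (H k)" unfolding H_def[abs_def]
      by (intro continuous_on_mult continuous_on_rabs cont_PQvol Ck_continuous_on[OF Cb] Ck_continuous_on[OF Cw])
    show "H k y = 0" if "y \<notin> {y. \<bar>P y\<bar> \<le> 1/2}" for y unfolding H_def Pz[OF k that] by simp
  qed
  have tubeH: "(\<integral>y. tube_integrand k \<phi> y \<partial>lborel) = (\<integral>y. H k y \<partial>lborel)" if k: "k \<ge> 5" for k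
  proof -
    have z: "(\<integral>y. vol y * frechet_derivative (test k) (at y) (ham P y) \<partial>lborel) = 0"
      by (rule integral_ham_zero[OF spec[OF Cinf_P] Ctest compact_P]) (simp add: test_def Pz[OF k])
    have "(\<integral>y. \<bar>vol y\<bar> * frechet_derivative (test k) (at y) (ham P y) \<partial>lborel) = 0"
      using vol_sign
    proof
      assume "\<forall>y. \<bar>vol y\<bar> = vol y"
      then show ?thesis using z by simp
    next
      assume "\<forall>y. \<bar>vol y\<bar> = - vol y"
      then show ?thesis using z by simp
    qed
    moreover have "(\<lambda>y. \<bar>vol y\<bar> * frechet_derivative (test k) (at y) (ham P y)) = (\<lambda>y. H k y - tube_integrand k \<phi> y)"
      by (rule ext) (simp add: dtest H_def tube_integrand_def algebra_simps)
    ultimately show ?thesis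
      using Bochner_Integration.integral_diff[OF iH[OF k] integrable_tube_integrand[OF c\<phi> k]] by simp
  qed
  \<comment> \<open>Half of the values at y1, so that the strict bounds hold on an open
    neighbourhood U.\<close>
  define c0 where "c0 = \<bar>Q y1\<bar> / 2"
  define v0 where "v0 = \<bar>vol y1\<bar> / 2"
  have c0: "c0 > 0" and v0: "v0 > 0" unfolding c0_def v0_def using y1(2) vol_nonzero[of y1] by simp_all
  define U where "U = {y. c0 < \<bar>Q y\<bar>} \<inter> {y. v0 < \<bar>vol y\<bar>}"
  have U: "open U" "y1 \<in> U"
  proof -
    show "open U" unfolding U_def by (intro open_Int open_Collect_less continuous_on_const continuous_on_rabs cont_PQvol)
    show "y1 \<in> U" unfolding U_def using c0 v0 unfolding c0_def v0_def by simp
  qed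
  let ?u = "inverse (frechet_derivative P (at y1) u) *\<^sub>R u"
  have u1: "frechet_derivative P (at y1) ?u = 1"
    using y1(3) by (simp add: linear_cmul[OF has_derivative_linear[OF has_derivative_P]])
  from slab_lower_bound[OF y1(1) u1 U] obtain c k0 where c: "c > 0"
    "\<forall>k\<ge>k0. ennreal c \<le> (\<integral>\<^sup>+z. indicator U z * ennreal (bump k (P z)) \<partial>lborel)" by (elim exE conjE)
  \<comment> \<open>From k1 on (k + 1) c0 is at least 3/2, hence on U the primitive w is 1/2 times
    the sign of Q, and Q w = \<bar>Q\<bar>/2.\<close>
  obtain k1 :: nat where k1: "3 / (2 * c0) \<le> real k1" using real_arch_simple[of "3 / (2 * c0)"] by (rule exE)
  have mP[measurable]: "P \<in> borel_measurable borel" by (rule borel_measurable_continuous_onI[OF cont_PQvol(1)])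
  have mU[measurable]: "U \<in> sets borel" using U(1) by simp
  have low: "v0 * (c0 / 2) * c \<le> (\<integral>y. tube_integrand k \<phi> y \<partial>lborel)" if k: "k \<ge> max (max 5 k0) k1" for k
  proof -
    have k5: "k \<ge> 5" "k \<ge> k0" "k \<ge> k1" using k by simp_all
    have mb[measurable]: "bump k \<in> borel_measurable borel" by (rule borel_measurable_continuous_onI[OF continuous_bump])
    have pt: "v0 * (c0 / 2) * bump k (P y) \<le> H k y" if y: "y \<in> U" for y
    proof -
      have Qy: "c0 < \<bar>Q y\<bar>" and vy: "v0 < \<bar>vol y\<bar>" using y unfolding U_def by simp_all
      have "3 / (2 * c0) \<le> real (Suc k)" using k1 k5(3) by linarith
      then have "3/2 \<le> real (Suc k) * c0" using c0 by (simp add: divide_le_eq mult_ac)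
      also have "\<dots> \<le> real (Suc k) * \<bar>Q y\<bar>" using Qy by (intro mult_left_mono) simp_all
      finally have kQ: "3/2 \<le> real (Suc k) * \<bar>Q y\<bar>" .
      have "Q y * w k y = \<bar>Q y\<bar> / 2"
      proof (cases "Q y \<ge> 0")
        case True
        then have "w k y = 1/2" unfolding w_def using kQ by (intro bspline_int_ge) simp
        then show ?thesis using True by simp
      next
        case False
        then have "w k y = -1/2" unfolding w_def using kQ by (intro bspline_int_le) simp
        then show ?thesis using False by simp
      qed
      then have "c0 / 2 \<le> Q y * w k y" using Qy by simp
      then have "v0 * (bump k (P y) * (c0 / 2)) \<le> H k y" unfolding H_def
        using vy v0 c0 bump_nonneg[of k "P y"] by (intro mult_mono) simp_all
      then show ?thesis by (simp add: mult_ac)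
    qed
    have "ennreal (v0 * (c0 / 2) * c) = ennreal (v0 * (c0 / 2)) * ennreal c"
      by (rule ennreal_mult) (use v0 c0 c(1) in simp_all)
    also have "\<dots> \<le> ennreal (v0 * (c0 / 2)) * (\<integral>\<^sup>+z. indicator U z * ennreal (bump k (P z)) \<partial>lborel)"
      using c(2) k5(2) by (intro mult_left_mono) simp_all
    also have "\<dots> = (\<integral>\<^sup>+z. ennreal (v0 * (c0 / 2)) * (indicator U z * ennreal (bump k (P z))) \<partial>lborel)"
      by (rule nn_integral_cmult[symmetric]) measurable
    also have "\<dots> \<le> (\<integral>\<^sup>+z. ennreal (H k z) \<partial>lborel)"
    proof (rule nn_integral_mono)
      fix z
      show "ennreal (v0 * (c0 / 2)) * (indicator U z * ennreal (bump k (P z))) \<le> ennreal (H k z)"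
      proof (cases "z \<in> U")
        case True
        have "ennreal (v0 * (c0 / 2)) * (indicator U z * ennreal (bump k (P z))) = ennreal (v0 * (c0 / 2) * bump k (P z))"
          using ennreal_mult[of "v0 * (c0 / 2)" "bump k (P z)"] True v0 c0 bump_nonneg[of k "P z"] by simp
        then show ?thesis using ennreal_leI[OF pt[OF True]] by simp
      qed simp
    qed
    also have "\<dots> = ennreal (\<integral>z. H k z \<partial>lborel)" by (rule nn_integral_eq_integral[OF iH[OF k5(1)]]) (simp add: Hn)
    finally have "v0 * (c0 / 2) * c \<le> (\<integral>z. H k z \<partial>lborel)"
      by (rule iffD1[OF ennreal_le_iff, rotated]) (rule Bochner_Integration.integral_nonneg[OF Hn])
    then show ?thesis unfolding tubeH[OF k5(1)] .
  qed
  have "v0 * (c0 / 2) * c \<le> L"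
  proof (rule LIMSEQ_le_const[OF lim])
    show "\<exists>N. \<forall>k\<ge>N. v0 * (c0 / 2) * c \<le> (\<integral>y. tube_integrand k (\<lambda>y. ff y * - frechet_derivative Q (at y) (ham P y)) y \<partial>lborel)"
      by (intro exI[of _ "max (max 5 k0) k1"] allI impI) (rule low[unfolded \<phi>_def[abs_def]])
  qed
  moreover have "0 < v0 * (c0 / 2) * c" using v0 c0 c(1) by simp
  ultimately show ?thesis by linarith
qed

end

section \<open>From the hypotheses of the theorem to the two locales\<close>

lemma param_manifold_exists:
  fixes \<Lambda> :: "'n::finite phase set"
  assumes IR: "IR_manifold \<Lambda>" and dif: "diffeomorphic_to_R2n \<Lambda>"
  shows "\<exists>g. param_manifold \<Lambda> g"
proof -
  obtain g0 :: "(real^'n) \<times> (real^'n) \<Rightarrow> 'n phase" where g0: "smooth_on UNIV g0" "inj g0" "range g0 = \<Lambda>"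
    "smooth_function_on_subset \<Lambda> (inv g0)" using dif unfolding diffeomorphic_to_R2n_def by (elim exE conjE)
  \<comment> \<open>The given diffeomorphism starts from a product of two copies of
    \<open>real^'n\<close>; a linear isomorphism moves it to \<open>real^('n bit0)\<close>.\<close>
  have dim: "DIM(real^('n bit0)) = DIM((real^'n) \<times> (real^'n))" by simp
  obtain L :: "real^('n bit0) \<Rightarrow> (real^'n) \<times> (real^'n)" and L'
    where L: "linear L \<and> linear L' \<and> (\<forall>x. L' (L x) = x) \<and> (\<forall>x. L (L' x) = x)"
    using euclidean_isomorphism[OF dim] by (elim exE)
  then have bL: "bounded_linear L" "bounded_linear L'" by (simp_all add: linear_conv_bounded_linear)
  have LL: "L' (L x) = x" "L (L' z) = z" for x z using L by (elim conjE, elim spec)+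
  define g where "g y = g0 (L y)" for y
  have ig: "inj g" unfolding g_def
  proof (rule injI)
    fix x y assume "g0 (L x) = g0 (L y)"
    then have "L x = L y" by (rule injD[OF g0(2)])
    then have "L' (L x) = L' (L y)" by (rule arg_cong)
    then show "x = y" unfolding LL .
  qed
  have rg: "range g = \<Lambda>"
  proof
    show "range g \<subseteq> \<Lambda>" unfolding g_def g0(3)[symmetric] by auto
    show "\<Lambda> \<subseteq> range g"
    proof
      fix \<rho> assume "\<rho> \<in> \<Lambda>"
      then obtain x where "\<rho> = g0 x" unfolding g0(3)[symmetric] by (rule imageE)
      then have "\<rho> = g (L' x)" unfolding g_def LL(2) .
      then show "\<rho> \<in> range g" by (rule image_eqI) simp
    qed
  qed
  have invg: "inv g z = L' (inv g0 z)" if z: "z \<in> \<Lambda>" for z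
  proof -
    obtain x where x: "z = g0 x" using z unfolding g0(3)[symmetric] by (rule imageE)
    have "z = g (L' x)" unfolding g_def LL(2) by (rule x)
    then show ?thesis using inv_f_f[OF ig, of "L' x"] inv_f_f[OF g0(2), of x] x by simp
  qed
  have "param_manifold \<Lambda> g"
  proof
    show "smooth_on UNIV g" using smooth_on_affine[OF g0(1) bL(1), of UNIV 0] unfolding g_def[abs_def] by simp
    show "inj g" "range g = \<Lambda>" by (rule ig, rule rg)
    show "\<exists>U G. open U \<and> \<rho> \<in> U \<and> Cinf U G \<and> (\<forall>z\<in>\<Lambda> \<inter> U. G z = inv g z)" if \<rho>: "\<rho> \<in> \<Lambda>" for \<rho>
    proof -
      from bspec[OF g0(4)[unfolded smooth_function_on_subset_def] \<rho>] obtain U F where UF: "open U" "\<rho> \<in> U" "smooth_on U F"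
        "\<forall>z\<in>\<Lambda> \<inter> U. F z = inv g0 z" by (elim exE conjE)
      have "Cinf U (\<lambda>z. L' (F z))"
        by (rule allI) (rule Ck_bounded_linear[OF UF(1) bL(2) smooth_on_imp_Ck[OF UF(3)]])
      moreover have "\<forall>z\<in>\<Lambda> \<inter> U. L' (F z) = inv g z" using UF(4) invg by simp
      ultimately show ?thesis using UF(1,2) by (intro exI[of _ U] exI[of _ "\<lambda>z. L' (F z)"] conjI)
    qed
    show "sigma s t \<in> \<real>" if "\<rho> \<in> \<Lambda>" "s \<in> tangent_space \<Lambda> \<rho>" "t \<in> tangent_space \<Lambda> \<rho>" for \<rho> s t
      using IR that unfolding IR_manifold_def by simp
    show "s = 0" if "\<rho> \<in> \<Lambda>" "s \<in> tangent_space \<Lambda> \<rho>" "\<And>t. t \<in> tangent_space \<Lambda> \<rho> \<Longrightarrow> sigma s t = 0" for \<rho> s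
    proof -
      have "\<forall>\<rho>\<in>\<Lambda>. \<forall>s\<in>tangent_space \<Lambda> \<rho>. (\<forall>t\<in>tangent_space \<Lambda> \<rho>. sigma s t = 0) \<longrightarrow> s = 0"
        using IR unfolding IR_manifold_def by simp
      from mp[OF bspec[OF bspec[OF this that(1)] that(2)]] show ?thesis using that(3) by simp
    qed
  qed
  then show ?thesis by (rule exI[of _ g])
qed

text \<open>Used by contradiction: were Hf zero on all of M, its differential along M would vanish,
  against the assumption at zeros of Hf.\<close>

lemma differential_on_zero:
  fixes h :: "'a::euclidean_space \<Rightarrow> real"
  assumes h: "\<And>\<rho>. \<rho> \<in> M \<Longrightarrow> h \<rho> = 0" and v: "v \<in> tangent_space M \<rho>"
  shows "differential_on M h \<rho> v = 0"
proof -
  have 0: "((\<lambda>t. h (\<gamma> t)) has_vector_derivative 0) (at 0)" if \<gamma>: "curve_through M \<rho> v \<gamma>" for \<gamma>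
  proof -
    obtain \<epsilon> where \<epsilon>: "\<epsilon> > 0" "\<gamma> ` {-\<epsilon><..<\<epsilon>} \<subseteq> M" using \<gamma> unfolding curve_through_def by (elim exE conjE)
    show ?thesis
    proof (rule has_vector_derivative_transform_within_open[OF has_vector_derivative_const open_greaterThanLessThan])
      show "0 \<in> {-\<epsilon><..<\<epsilon>}" using \<epsilon>(1) by simp
      show "0 = h (\<gamma> t)" if "t \<in> {-\<epsilon><..<\<epsilon>}" for t
        using h[OF subsetD[OF \<epsilon>(2) imageI[OF that]]] by simp
    qed
  qed
  obtain \<gamma>0 where \<gamma>0: "curve_through M \<rho> v \<gamma>0" using v unfolding tangent_space_def by blast
  show ?thesis unfolding differential_on_def
  proof (rule the_equality)
    show "\<forall>\<gamma>. curve_through M \<rho> v \<gamma> \<longrightarrow> ((\<lambda>t. h (\<gamma> t)) has_vector_derivative 0) (at 0)" using 0 by simp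
    fix w assume "\<forall>\<gamma>. curve_through M \<rho> v \<gamma> \<longrightarrow> ((\<lambda>t. h (\<gamma> t)) has_vector_derivative w) (at 0)"
    then have "((\<lambda>t. h (\<gamma>0 t)) has_vector_derivative w) (at 0)" using \<gamma>0 by simp
    from vector_derivative_unique_at[OF this 0[OF \<gamma>0]] show "w = 0" .
  qed
qed

context param_manifold
begin

lemma Cinf_pullback:
  assumes "smooth_function_on_subset \<Lambda> f"
  shows "Cinf UNIV (\<lambda>y. f (g y))"
proof (rule allI, rule Ck_local)
  fix k y
  from bspec[OF assms[unfolded smooth_function_on_subset_def] g_in[of y]] obtain U F where UF: "open U" "g y \<in> U" "smooth_on U F"
    "\<forall>z\<in>\<Lambda> \<inter> U. F z = f z" by (elim exE conjE)
  have V: "open (g -` U)" using continuous_g UF(1) by (simp add: open_vimage)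
  have "Ck k (g -` U) (\<lambda>y. F (g y))"
    by (rule Ck_compose[OF V UF(1) smooth_on_imp_Ck[OF UF(3)] Ck_subset[OF Ck_g subset_UNIV]]) simp
  then have "Ck k (g -` U) (\<lambda>y. f (g y))" by (rule Ck_cong[OF V]) (use UF(4) in simp)
  then show "\<exists>V. open V \<and> y \<in> V \<and> Ck k V (\<lambda>y. f (g y))" using V UF(2) by (intro exI[of _ "g -` U"] conjI) simp_all
qed

text \<open>Expanding the Hamilton field in coordinates leaves derivatives of F in constant
  directions, where \<open>Ck_frechet\<close> applies.\<close>

lemma Cinf_ham_derivative:
  fixes F :: "real^('n bit0) \<Rightarrow> real"
  assumes P: "Cinf UNIV P" and F: "Cinf UNIV F"
  shows "Cinf UNIV (\<lambda>y. frechet_derivative F (at y) (ham P y))"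
proof
  fix k
  have lin: "linear (frechet_derivative F (at y))" for y
    by (rule has_derivative_linear[OF Ck_has_derivative[OF spec[OF F, of "Suc 0"] UNIV_I]])
  have "frechet_derivative F (at y) (ham P y) = (\<Sum>a\<in>UNIV. ham P y $ a * frechet_derivative F (at y) (axis a 1))" for y
    by (subst vec_expand[of "ham P y"]) (simp add: linear_sum[OF lin] linear_cmul[OF lin])
  moreover have "Ck k UNIV (\<lambda>y. \<Sum>a\<in>UNIV. ham P y $ a * frechet_derivative F (at y) (axis a 1))"
    by (rule Ck_sum[OF open_UNIV Ck_mult[OF open_UNIV Ck_vec_nth[OF open_UNIV Ck_ham[OF spec[OF P]]] Ck_frechet[OF spec[OF F]]]])
  ultimately show "Ck k UNIV (\<lambda>y. frechet_derivative F (at y) (ham P y))" by simp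
qed

lemma om_antisym: "om y u w = - om y w u"
  unfolding om_def sigma_def by (simp add: sum_subtractf mult.commute)

end

context level_set
begin

text \<open>For q = P - iQ bilinearity and antisymmetry give {q, cnj q} = 2i {P, Q}, and i/2 times
  this is - {P, Q}, minus the derivative of Q along the Hamilton field of P.\<close>

lemma poisson_bracket_eq:
  "\<i> / 2 * poisson_bracket \<Lambda> q (\<lambda>\<rho>. cnj (q \<rho>)) (g y) = complex_of_real (- frechet_derivative Q (at y) (ham P y))"
proof -
  let ?P' = "frechet_derivative P (at y)" and ?Q' = "frechet_derivative Q (at y)"
  let ?k' = "\<lambda>u. complex_of_real (?P' u) + \<i> * complex_of_real (?Q' u)"
  have k: "((\<lambda>y. cnj (q (g y))) has_derivative ?k') (at y)"
  proof -
    have "(\<lambda>y. cnj (q (g y))) = (\<lambda>y. complex_of_real (P y) + \<i> * complex_of_real (Q y))" by (rule ext) (simp add: q_g)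
    then show ?thesis
      by (simp only:) (intro has_derivative_add has_derivative_of_real has_derivative_mult_right has_derivative_P has_derivative_Q)
  qed
  have R: "(\<lambda>y. Re (q (g y))) = P" and I: "(\<lambda>y. Im (q (g y))) = (\<lambda>y. - Q y)" by (rule ext, simp add: q_g)+
  have dQ: "((\<lambda>y. - Q y) has_derivative (\<lambda>u. - ?Q' u)) (at y)" by (rule has_derivative_minus[OF has_derivative_Q])
  have 1: "hamilton_derivative \<Lambda> (\<lambda>z. Re (q z)) (\<lambda>\<rho>. cnj (q \<rho>)) (g y) = ?k' (ham P y)"
    using hamilton_derivative_eq[of "\<lambda>z. Re (q z)" ?P' y "\<lambda>\<rho>. cnj (q \<rho>)" ?k'] k has_derivative_P unfolding R by simp
  have 2: "hamilton_derivative \<Lambda> (\<lambda>z. Im (q z)) (\<lambda>\<rho>. cnj (q \<rho>)) (g y) = ?k' (ham (\<lambda>y. - Q y) y)"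
    using hamilton_derivative_eq[of "\<lambda>z. Im (q z)" "\<lambda>u. - ?Q' u" y "\<lambda>\<rho>. cnj (q \<rho>)" ?k'] k dQ unfolding I by simp
  let ?K = "ham (\<lambda>y. - Q y) y"
  have "?Q' ?K = 0" using om_ham[OF dQ, of ?K] om_antisym[of y ?K ?K] by simp
  moreover have "?P' ?K = ?Q' (ham P y)"
    using om_ham[OF dQ, of "ham P y"] om_ham[OF has_derivative_P, of y ?K] om_antisym[of y ?K "ham P y"] by simp
  ultimately show ?thesis unfolding poisson_bracket_def 1 2 ham_self by (simp add: algebra_simps)
qed

end

theorem proposition9p4:
  fixes \<Phi>\<^sub>0 :: "complex^'n::finite \<Rightarrow> real"
    and W Wt \<Lambda>\<^sub>0 M \<Sigma>\<^sub>0 :: "'n phase set"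
    and p pt :: "'n phase \<Rightarrow> complex"
    and p\<^sub>0 f Hf :: "'n phase \<Rightarrow> real"
  assumes Phi0: "real_quadratic_form \<Phi>\<^sub>0" "strictly_psh \<Phi>\<^sub>0"
    and W: "bounded_open_nbhd \<Phi>\<^sub>0 W" "bounded_open_nbhd \<Phi>\<^sub>0 Wt" "closure Wt \<subseteq> W"
    and p: "admissible_symbol \<Phi>\<^sub>0 W p"
    and Lambda0: "admissible_IR_manifold \<Phi>\<^sub>0 Wt \<Lambda>\<^sub>0"
    and p0: "\<forall>\<rho>\<in>\<Lambda>\<^sub>0. p \<rho> = complex_of_real (p\<^sub>0 \<rho>)"
    and M_def: "M = {\<rho> \<in> \<Lambda>\<^sub>0. p\<^sub>0 \<rho> = 0}"
    and dp0: "\<forall>\<rho>\<in>M. \<exists>v\<in>tangent_space \<Lambda>\<^sub>0 \<rho>. differential_on \<Lambda>\<^sub>0 p\<^sub>0 \<rho> v \<noteq> 0"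
    and M_nonempty: "M \<noteq> {}"
    and f: "Cb_infinity_IR \<Phi>\<^sub>0 \<Lambda>\<^sub>0 f"
    and Hf_def: "Hf = hamilton_derivative \<Lambda>\<^sub>0 p\<^sub>0 f"
    and dHf: "\<forall>\<rho>\<in>M. Hf \<rho> = 0 \<longrightarrow> (\<exists>v\<in>tangent_space M \<rho>. differential_on M Hf \<rho> v \<noteq> 0)"
    and pt_def: "pt = (\<lambda>\<rho>. complex_of_real (p\<^sub>0 \<rho>) - \<i> * complex_of_real (Hf \<rho>))"
    and Sigma0_def: "\<Sigma>\<^sub>0 = {\<rho> \<in> \<Lambda>\<^sub>0. p\<^sub>0 \<rho> = 0 \<and> Hf \<rho> = 0}"
    and rho0: "\<exists>\<rho>\<^sub>0\<in>\<Sigma>\<^sub>0. \<i> / 2 * poisson_bracket \<Lambda>\<^sub>0 pt (\<lambda>\<rho>. cnj (pt \<rho>)) \<rho>\<^sub>0 \<noteq> 0"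
  shows "\<exists>r::real. r > 0 \<and>
    2 * complex_of_real pi *
      (LINT \<rho>:\<Sigma>\<^sub>0|liouville_measure \<Lambda>\<^sub>0 pt.
         complex_of_real (f \<rho>) * (\<i> / 2 * poisson_bracket \<Lambda>\<^sub>0 pt (\<lambda>\<rho>. cnj (pt \<rho>)) \<rho>))
    = complex_of_real r"
proof -
  have IR: "IR_manifold \<Lambda>\<^sub>0" and sub: "\<Lambda>\<^sub>0 \<subseteq> tube \<Phi>\<^sub>0 Wt" and cl: "closed \<Lambda>\<^sub>0" and dif: "diffeomorphic_to_R2n \<Lambda>\<^sub>0"
    using Lambda0 unfolding admissible_IR_manifold_def by simp_all
  obtain g where "param_manifold \<Lambda>\<^sub>0 g" using param_manifold_exists[OF IR dif] by (rule exE)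
  then interpret param_manifold \<Lambda>\<^sub>0 g .
  have "Wt \<subseteq> W" by (rule subset_trans[OF closure_subset W(3)])
  then have "tube \<Phi>\<^sub>0 Wt \<subseteq> tube \<Phi>\<^sub>0 W" unfolding tube_def by blast
  then have g_tube: "g y \<in> tube \<Phi>\<^sub>0 W" for y using sub g_in[of y] by blast
  have openin: "openin (top_of_set (Lambda \<Phi>\<^sub>0)) W" using W(1) unfolding bounded_open_nbhd_def by simp
  \<comment> \<open>Openness lets the holomorphic p be differentiated to any order at the points of
    the manifold; this is where the smoothness of P comes from.\<close>
  have oT: "open (tube \<Phi>\<^sub>0 W)" by (rule open_tube[OF Phi0 openin])
  have hol: "phase_holomorphic_on p (tube \<Phi>\<^sub>0 W)"
    and dec: "\<exists>m::real. m < - 2 * real CARD('n) \<and> (\<exists>C. \<forall>\<rho>\<in>tube \<Phi>\<^sub>0 W. norm (p \<rho> - 1) \<le> C * sqrt (1 + (norm \<rho>)\<^sup>2) powr m)"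
    using p unfolding admissible_symbol_def by simp_all
  define P where "P y = p\<^sub>0 (g y)" for y
  define Q where "Q y = Hf (g y)" for y
  define ff where "ff y = f (g y)" for y
  have pP: "p (g y) = complex_of_real (P y)" for y unfolding P_def using bspec[OF p0 g_in] .
  have CP: "Cinf UNIV P"
  proof
    fix k
    have "Ck k UNIV (\<lambda>y. p (g y))"
      by (rule Ck_compose[OF open_UNIV oT phase_holomorphic_Ck[OF oT hol] Ck_g g_tube])
    from Ck_bounded_linear[OF open_UNIV bounded_linear_Re this] show "Ck k UNIV P" unfolding pP by simp
  qed
  have Cff: "Cinf UNIV ff" unfolding ff_def[abs_def]
    by (rule Cinf_pullback) (use f in \<open>simp add: Cb_infinity_IR_def\<close>)
  have dP: "(P has_derivative frechet_derivative P (at y)) (at y)" for y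
    by (rule Ck_has_derivative[OF spec[OF CP, of "Suc 0"] UNIV_I])
  have dff: "(ff has_derivative frechet_derivative ff (at y)) (at y)" for y
    by (rule Ck_has_derivative[OF spec[OF Cff, of "Suc 0"] UNIV_I])
  have Qff: "Q y = frechet_derivative ff (at y) (ham P y)" for y
    unfolding Q_def Hf_def
    using hamilton_derivative_eq[of p\<^sub>0 "frechet_derivative P (at y)" y f "frechet_derivative ff (at y)"] dP[of y] dff[of y]
    unfolding P_def[abs_def] ff_def[abs_def] by simp
  have CQ: "Cinf UNIV Q" using Cinf_ham_derivative[OF CP Cff] unfolding Qff[symmetric] .
  have dQ: "(Q has_derivative frechet_derivative Q (at y)) (at y)" for y
    by (rule Ck_has_derivative[OF spec[OF CQ, of "Suc 0"] UNIV_I])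
  have linP: "linear (frechet_derivative P (at y))" and linQ: "linear (frechet_derivative Q (at y))" for y
    by (rule has_derivative_linear[OF dP], rule has_derivative_linear[OF dQ])
  have gM: "g y \<in> M \<longleftrightarrow> P y = 0" for y unfolding M_def P_def by simp
  have dP_nonzero: "\<exists>u. frechet_derivative P (at y) u \<noteq> 0" if y: "P y = 0" for y
  proof -
    obtain v where v: "v \<in> tangent_space \<Lambda>\<^sub>0 (g y)" "differential_on \<Lambda>\<^sub>0 p\<^sub>0 (g y) v \<noteq> 0"
      using bspec[OF dp0 iffD2[OF gM y]] by (elim bexE)
    obtain u where u: "v = Dg y u" using v(1) unfolding tangent_space_eq by (rule imageE)
    have "differential_on \<Lambda>\<^sub>0 p\<^sub>0 (g y) (Dg y u) = frechet_derivative P (at y) u"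
      by (rule differential_on_eq) (use dP[of y] in \<open>simp add: P_def[abs_def]\<close>)
    then show ?thesis using v(2) u by auto
  qed
  interpret level_set \<Lambda>\<^sub>0 g pt P Q
  proof
    show "pt (g y) = complex_of_real (P y) - \<i> * complex_of_real (Q y)" for y unfolding pt_def P_def Q_def ..
    show "Cinf UNIV P" "Cinf UNIV Q" by (rule CP, rule CQ)
    show "\<exists>a b. frechet_derivative P (at y) a = 1 \<and> frechet_derivative Q (at y) a = 0 \<and>
       frechet_derivative P (at y) b = 0 \<and> frechet_derivative Q (at y) b = 1" if y: "P y = 0" "Q y = 0" for y
    proof -
      let ?P' = "frechet_derivative P (at y)" and ?Q' = "frechet_derivative Q (at y)"
      obtain u1 where u1: "?P' u1 \<noteq> 0" using dP_nonzero[OF y(1)] by (rule exE)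
      have Hf0: "Hf (g y) = 0" using y(2) unfolding Q_def .
      obtain v where v: "v \<in> tangent_space M (g y)" "differential_on M Hf (g y) v \<noteq> 0"
        using mp[OF bspec[OF dHf iffD2[OF gM y(1)]] Hf0] by (elim bexE)
      obtain u2 where u2: "?P' u2 = 0" "differential_on M Hf (g y) v = ?Q' u2"
        by (rule tangent_sub_level[OF M_def v(1) dP[of y, unfolded P_def[abs_def]] dQ[of y, unfolded Q_def[abs_def]],
          folded P_def[abs_def] Q_def[abs_def]])
      have u2': "?Q' u2 \<noteq> 0" using v(2) unfolding u2(2) .
      show ?thesis
      proof (intro exI conjI)
        \<comment> \<open>The vector u2 is tangent to M with Q' u2 \<noteq> 0. Subtracting a
          multiple of it from u1 removes the Q-component without changing P', and scaling gives the
          dual pair.\<close>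
        let ?a = "(1 / ?P' u1) *\<^sub>R (u1 - (?Q' u1 / ?Q' u2) *\<^sub>R u2)" and ?b = "(1 / ?Q' u2) *\<^sub>R u2"
        show "?P' ?a = 1" "?Q' ?a = 0" "?P' ?b = 0" "?Q' ?b = 1"
          using u1 u2(1) u2' by (simp_all add: linear_cmul[OF linP] linear_cmul[OF linQ] linear_diff[OF linP] linear_diff[OF linQ])
      qed
    qed
    show "compact {y. \<bar>P y\<bar> \<le> 1/2}"
    proof -
      obtain m C where m: "m < - 2 * real CARD('n)"
        and C: "\<forall>\<rho>\<in>tube \<Phi>\<^sub>0 W. norm (p \<rho> - 1) \<le> C * sqrt (1 + (norm \<rho>)\<^sup>2) powr m" using dec by (elim exE conjE)
      \<comment> \<open>As n is at least 1, the decay may be weakened to the power -1, an inequality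
        that can be solved for the norm.\<close>
      have m1: "m \<le> -1"
      proof -
        have "real CARD('n) \<ge> 1" using zero_less_card_finite[where 'a='n] by linarith
        then show ?thesis using m by linarith
      qed
      \<comment> \<open>If \<bar>P\<bar> \<le> 1/2 then \<bar>p - 1\<bar> is at least 1/2, which the
        decay of p - 1 permits only within distance 2 \<bar>C\<bar> of the origin.\<close>
      have bd: "norm (g y) \<le> 2 * \<bar>C\<bar>" if y: "\<bar>P y\<bar> \<le> 1/2" for y
      proof -
        let ?s = "sqrt (1 + (norm (g y))\<^sup>2)"
        have s1: "?s \<ge> 1" by simp
        have "complex_of_real (P y) - 1 = complex_of_real (P y - 1)" by simp
        then have "norm (p (g y) - 1) = \<bar>P y - 1\<bar>" unfolding pP by (simp only: norm_of_real)
        then have "1/2 \<le> norm (p (g y) - 1)" using y by linarith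
        also have "\<dots> \<le> C * ?s powr m" by (rule bspec[OF C g_tube])
        also have "\<dots> \<le> \<bar>C\<bar> * ?s powr (-1)" by (intro mult_mono powr_mono m1 s1) simp_all
        also have "?s powr (-1) = 1 / ?s"
        proof -
          have "?s > 0" using s1 by linarith
          then show ?thesis by (simp add: powr_minus_divide)
        qed
        finally have "1/2 \<le> \<bar>C\<bar> * (1 / ?s)" .
        moreover have "?s > 0" using s1 by linarith
        ultimately have "?s \<le> 2 * \<bar>C\<bar>" by (simp add: field_simps del: real_sqrt_gt_0_iff)
        moreover have "norm (g y) \<le> ?s" by (rule real_le_rsqrt) simp
        ultimately show ?thesis by linarith
      qed
      let ?K = "inv g ` (\<Lambda>\<^sub>0 \<inter> cball 0 (2 * \<bar>C\<bar>))"
      have K: "compact ?K"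
        by (rule compact_continuous_image[OF continuous_on_subset[OF continuous_inv_g Int_lower1] closed_Int_compact[OF cl compact_cball]])
      have "{y. \<bar>P y\<bar> \<le> 1/2} \<subseteq> ?K"
      proof
        fix y assume "y \<in> {y. \<bar>P y\<bar> \<le> 1/2}"
        then have "g y \<in> \<Lambda>\<^sub>0 \<inter> cball 0 (2 * \<bar>C\<bar>)" using bd[of y] by simp
        then have "inv g (g y) \<in> ?K" by (rule imageI)
        then show "y \<in> ?K" by simp
      qed
      moreover have "closed {y. \<bar>P y\<bar> \<le> 1/2}"
        by (rule closed_Collect_le[OF continuous_on_rabs[OF Ck_continuous_on[OF spec[OF CP, of 0]]] continuous_on_const])
      ultimately show ?thesis using compact_Int_closed[OF K, of "{y. \<bar>P y\<bar> \<le> 1/2}"] by (simp add: Int_absorb1)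
    qed
  qed
  have S_Sigma: "S = \<Sigma>\<^sub>0" unfolding S_def Sigma0_def by (simp add: pt_def complex_eq_iff)
  \<comment> \<open>A point of M off the zeros of Hf, where the strict positivity
    originates.\<close>
  obtain y1 where y1: "P y1 = 0" "Q y1 \<noteq> 0"
  proof -
    have "\<exists>\<rho>\<in>M. Hf \<rho> \<noteq> 0"
    proof (rule ccontr)
      assume "\<not> (\<exists>\<rho>\<in>M. Hf \<rho> \<noteq> 0)"
      then have H0: "Hf \<rho> = 0" if "\<rho> \<in> M" for \<rho> using that by simp
      obtain \<rho> where \<rho>: "\<rho> \<in> M" using M_nonempty by auto
      obtain v where v: "v \<in> tangent_space M \<rho>" "differential_on M Hf \<rho> v \<noteq> 0"
        using mp[OF bspec[OF dHf \<rho>] H0[OF \<rho>]] by (elim bexE)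
      show False using differential_on_zero[where h=Hf, OF H0 v(1)] v(2) by simp
    qed
    then obtain \<rho> where \<rho>: "\<rho> \<in> M" "Hf \<rho> \<noteq> 0" by (elim bexE)
    then have "\<rho> \<in> \<Lambda>\<^sub>0" unfolding M_def by simp
    then have g\<rho>: "g (inv g \<rho>) = \<rho>" by (rule g_inv_g)
    show ?thesis
    proof (rule that[of "inv g \<rho>"])
      show "P (inv g \<rho>) = 0" using \<rho>(1) unfolding P_def g\<rho> M_def by simp
      show "Q (inv g \<rho>) \<noteq> 0" using \<rho>(2) unfolding Q_def g\<rho> .
    qed
  qed
  obtain u where u: "frechet_derivative P (at y1) u \<noteq> 0" using dP_nonzero[OF y1(1)] by (rule exE)
  define \<phi> where "\<phi> y = ff y * - frechet_derivative Q (at y) (ham P y)" for y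
  have c\<phi>: "continuous_on UNIV \<phi>" unfolding \<phi>_def[abs_def]
    by (intro continuous_on_mult continuous_on_minus Ck_continuous_on[OF spec[OF Cff, of 0]]
      Ck_continuous_on[OF spec[OF Cinf_ham_derivative[OF CP CQ], of 0]])
  let ?F = "\<lambda>\<rho>. complex_of_real (f \<rho>) * (\<i> / 2 * poisson_bracket \<Lambda>\<^sub>0 pt (\<lambda>\<rho>. cnj (pt \<rho>)) \<rho>)"
  have F: "?F (g y) = complex_of_real (\<phi> y)" for y
    unfolding poisson_bracket_eq \<phi>_def ff_def by simp
  obtain L where L: "(\<lambda>k. \<integral>y. tube_integrand k \<phi> y \<partial>lborel) \<longlonglongrightarrow> L"
    "(LINT \<rho>:S|liouville_measure \<Lambda>\<^sub>0 pt. ?F \<rho>) = complex_of_real L"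
    using liouville_measure_limit[OF c\<phi>, of ?F, OF F] by (elim exE conjE)
  have "L > 0" by (rule limit_positive[OF Cff Qff y1 u L(1)[unfolded \<phi>_def[abs_def]]])
  then have "2 * pi * L > 0" by simp
  moreover have "2 * complex_of_real pi * (LINT \<rho>:\<Sigma>\<^sub>0|liouville_measure \<Lambda>\<^sub>0 pt. ?F \<rho>) = complex_of_real (2 * pi * L)"
    using L(2) unfolding S_Sigma by simp
  ultimately show ?thesis by (intro exI[of _ "2 * pi * L"] conjI)
qed

end
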